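(* Suppose that $f,g\in C^2[0,1)$ are positive, increasing and strictly convex with $\lim_{v\to1^-}f(v)=\lim_{u\to1^-}g(u)=+\infty$, and that $u_0,v_0\in C^2(\bar\Omega)$ satisfy $0\le u_0,v_0<1$ in $\bar\Omega$ and $u_0=v_0=0$ on $\partial\Omega$. Then for any $\lambda>0$, $\mu>0$ there exists $T>0$ such that problem (P) has a unique solution $(u,v)$ on $[0,T)$. Moreover $(u,v)\in C^1((0,T),C^2(\Omega,\mathbb{R}^2))$.
   Context: $\Omega\subset\mathbb{R}^N$ is a smooth bounded domain; $\alpha,\beta$ are nonnegative, nontrivial (not identically zero), Hölder continuous functions on $\bar\Omega$. Problem (P) is $$u_t-\Delta u=\lambda\alpha(x)f(v),\quad v_t-\Delta v=\mu\beta(x)g(u)\quad\text{in }\Omega\times(0,T),$$ $$u=v=0\ \text{ on }\partial\Omega\times(0,T),\qquad u(x,0)=u_0(x),\ v(x,0)=v_0(x)\ \text{ in }\Omega.$$ Solutions are classical, with values in $[0,1)$. *)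

theory Defs
  imports "HOL-Analysis.Analysis"
begin

text \<open>Derivatives on \<open>\<real>\<^sup>N\<close>, rendered by an arbitrary Euclidean space; a list of basis
  vectors plays the role of a multi-index. The values are meaningful only where the functions
  involved are differentiable, so the regularity classes below ask for differentiability.\<close>

definition partial :: "'a::euclidean_space \<Rightarrow> ('a \<Rightarrow> 'b::real_normed_vector) \<Rightarrow> 'a \<Rightarrow> 'b" where
  "partial i w x = frechet_derivative w (at x) i"

definition partials :: "'a::euclidean_space list \<Rightarrow> ('a \<Rightarrow> 'b::real_normed_vector) \<Rightarrow> 'a \<Rightarrow> 'b" where
  "partials is w = foldr partial is w"

definition laplacian :: "('a::euclidean_space \<Rightarrow> real) \<Rightarrow> 'a \<Rightarrow> real" where
  "laplacian w x = (\<Sum>i\<in>Basis. partials [i, i] w x)"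

definition multi_indices :: "nat \<Rightarrow> 'a::euclidean_space list set" where
  "multi_indices k = {is. set is \<subseteq> Basis \<and> length is \<le> k}"

text \<open>\<open>C\<^sup>k(S)\<close>, meant for open \<open>S\<close>.\<close>

definition Ck_on :: "nat \<Rightarrow> 'a::euclidean_space set \<Rightarrow> ('a \<Rightarrow> 'b::real_normed_vector) \<Rightarrow> bool" where
  "Ck_on k S w \<longleftrightarrow>
     (\<forall>is\<in>multi_indices k. continuous_on S (partials is w) \<and>
        (length is < k \<longrightarrow> (\<forall>x\<in>S. partials is w differentiable (at x))))"

text \<open>\<open>C\<^sup>k\<close> on the closure of the open set \<open>S\<close>: all derivatives of order at most \<open>k\<close> extend
  continuously from \<open>S\<close> to the closure. The values of \<open>w\<close> itself on the boundary are those of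
  the continuous extension.\<close>

definition Ck_closure :: "nat \<Rightarrow> 'a::euclidean_space set \<Rightarrow> ('a \<Rightarrow> 'b::real_normed_vector) \<Rightarrow> bool" where
  "Ck_closure k S w \<longleftrightarrow> Ck_on k S w \<and> continuous_on (closure S) w \<and>
     (\<forall>is\<in>multi_indices k. \<exists>G. continuous_on (closure S) G \<and> (\<forall>x\<in>S. G x = partials is w x))"

text \<open>Near each boundary point the domain is the set lying above the graph of a smooth function,
  in a direction \<open>e\<close>. The graph function lives on the hyperplane orthogonal to \<open>e\<close> and is
  extended constantly along \<open>e\<close>.\<close>

definition smooth_boundary :: "'a::euclidean_space set \<Rightarrow> bool" where
  "smooth_boundary \<Omega> \<longleftrightarrow>
     (\<forall>p\<in>frontier \<Omega>. \<exists>r>0. \<exists>e. \<exists>\<gamma> :: 'a \<Rightarrow> real. norm e = 1 \<and> (\<forall>k. Ck_on k UNIV \<gamma>) \<and>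
        \<Omega> \<inter> ball p r = {x \<in> ball p r. \<gamma> (x - (x \<bullet> e) *\<^sub>R e) < x \<bullet> e})"

definition smooth_bounded_domain :: "'a::euclidean_space set \<Rightarrow> bool" where
  "smooth_bounded_domain \<Omega> \<longleftrightarrow>
     open \<Omega> \<and> connected \<Omega> \<and> \<Omega> \<noteq> {} \<and> bounded \<Omega> \<and> smooth_boundary \<Omega>"

definition holder_continuous_on :: "'a::metric_space set \<Rightarrow> ('a \<Rightarrow> real) \<Rightarrow> bool" where
  "holder_continuous_on S a \<longleftrightarrow>
     (\<exists>\<theta> C. 0 < \<theta> \<and> \<theta> \<le> 1 \<and> (\<forall>x\<in>S. \<forall>y\<in>S. \<bar>a x - a y\<bar> \<le> C * dist x y powr \<theta>))"

text \<open>\<open>C\<^sup>2\<close> on an interval, with one-sided derivatives at endpoints belonging to it.\<close>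

definition C2_interval :: "real set \<Rightarrow> (real \<Rightarrow> real) \<Rightarrow> bool" where
  "C2_interval I f \<longleftrightarrow>
     (\<exists>f' f''. (\<forall>s\<in>I. (f has_real_derivative f' s) (at s within I) \<and>
                      (f' has_real_derivative f'' s) (at s within I)) \<and>
               continuous_on I f'')"

definition strictly_convex_on :: "'a::real_vector set \<Rightarrow> ('a \<Rightarrow> real) \<Rightarrow> bool" where
  "strictly_convex_on S f \<longleftrightarrow> convex S \<and>
     (\<forall>x\<in>S. \<forall>y\<in>S. \<forall>t. x \<noteq> y \<longrightarrow> 0 < t \<longrightarrow> t < 1 \<longrightarrow>
        f ((1 - t) *\<^sub>R x + t *\<^sub>R y) < (1 - t) * f x + t * f y)"

text \<open>The parabolic class \<open>C\<^sup>2\<^sup>,\<^sup>1\<close>: two space derivatives and one time derivative, all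
  jointly continuous on \<open>\<Omega> \<times> (0, T)\<close>.\<close>

definition C21_on :: "'a::euclidean_space set \<Rightarrow> real \<Rightarrow> ('a \<Rightarrow> real \<Rightarrow> real) \<Rightarrow> bool" where
  "C21_on \<Omega> T u \<longleftrightarrow>
     (\<forall>t\<in>{0<..<T}. Ck_on 2 \<Omega> (\<lambda>x. u x t)) \<and>
     (\<forall>is\<in>multi_indices 2.
        continuous_on (\<Omega> \<times> {0<..<T}) (\<lambda>(x, t). partials is (\<lambda>y. u y t) x)) \<and>
     (\<forall>x\<in>\<Omega>. \<forall>t\<in>{0<..<T}. (\<lambda>s. u x s) field_differentiable (at t)) \<and>
     continuous_on (\<Omega> \<times> {0<..<T}) (\<lambda>(x, t). deriv (\<lambda>s. u x s) t)"

text \<open>Classical solutions on \<open>[0, T)\<close>: of class \<open>C\<^sup>2\<^sup>,\<^sup>1\<close> inside, continuous up to the lateral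
  boundary and the initial time, and with values in \<open>[0, 1)\<close>.\<close>

definition classical_solution ::
  "'a::euclidean_space set \<Rightarrow> ('a \<Rightarrow> real) \<Rightarrow> ('a \<Rightarrow> real) \<Rightarrow> (real \<Rightarrow> real) \<Rightarrow> (real \<Rightarrow> real) \<Rightarrow>
   real \<Rightarrow> real \<Rightarrow> ('a \<Rightarrow> real) \<Rightarrow> ('a \<Rightarrow> real) \<Rightarrow> real \<Rightarrow>
   ('a \<Rightarrow> real \<Rightarrow> real) \<Rightarrow> ('a \<Rightarrow> real \<Rightarrow> real) \<Rightarrow> bool" where
  "classical_solution \<Omega> \<alpha> \<beta> f g lam \<mu> u0 v0 T u v \<longleftrightarrow>
     C21_on \<Omega> T u \<and> C21_on \<Omega> T v \<and>
     continuous_on (closure \<Omega> \<times> {0..<T}) (\<lambda>(x, t). u x t) \<and>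
     continuous_on (closure \<Omega> \<times> {0..<T}) (\<lambda>(x, t). v x t) \<and>
     (\<forall>x\<in>closure \<Omega>. \<forall>t\<in>{0..<T}. u x t \<in> {0..<1} \<and> v x t \<in> {0..<1}) \<and>
     (\<forall>x\<in>\<Omega>. \<forall>t\<in>{0<..<T}.
        deriv (\<lambda>s. u x s) t - laplacian (\<lambda>y. u y t) x = lam * \<alpha> x * f (v x t) \<and>
        deriv (\<lambda>s. v x s) t - laplacian (\<lambda>y. v y t) x = \<mu> * \<beta> x * g (u x t)) \<and>
     (\<forall>x\<in>frontier \<Omega>. \<forall>t\<in>{0<..<T}. u x t = 0 \<and> v x t = 0) \<and>
     (\<forall>x\<in>\<Omega>. u x 0 = u0 x \<and> v x 0 = v0 x)"

text \<open>Convergence in \<open>C\<^sup>k(S)\<close> with its usual topology, for open \<open>S\<close>: derivatives of order at most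
  \<open>k\<close> converge uniformly on compact subsets of \<open>S\<close>.\<close>

definition Ck_tendsto ::
  "nat \<Rightarrow> 'a::euclidean_space set \<Rightarrow> ('c \<Rightarrow> 'a \<Rightarrow> 'b::real_normed_vector) \<Rightarrow> ('a \<Rightarrow> 'b) \<Rightarrow> 'c filter \<Rightarrow> bool" where
  "Ck_tendsto k S W w F \<longleftrightarrow>
     (\<forall>K. compact K \<longrightarrow> K \<subseteq> S \<longrightarrow>
        (\<forall>is\<in>multi_indices k. uniform_limit K (\<lambda>s. partials is (W s)) (partials is w) F))"

text \<open>\<open>C\<^sup>1(I, C\<^sup>k(S))\<close>: a curve in the topological vector space \<open>C\<^sup>k(S)\<close> that has a derivative \<open>W'\<close>
  there, as the limit of difference quotients, depending continuously on the parameter.\<close>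

definition C1_curve_in_Ck ::
  "real set \<Rightarrow> nat \<Rightarrow> 'a::euclidean_space set \<Rightarrow> (real \<Rightarrow> 'a \<Rightarrow> 'b::real_normed_vector) \<Rightarrow> bool" where
  "C1_curve_in_Ck I k S W \<longleftrightarrow>
     (\<forall>t\<in>I. Ck_on k S (W t)) \<and>
     (\<exists>W'. \<forall>t\<in>I. Ck_on k S (W' t) \<and>
        Ck_tendsto k S (\<lambda>s x. (W s x - W t x) /\<^sub>R (s - t)) (W' t) (at t within I) \<and>
        Ck_tendsto k S W' (W' t) (at t within I))"

end

theory Submission imports Defs "HOL-Probability.Distributions" begin

text \<open>
  Extend the data to the whole space and replace the Dirichlet condition by a penalty
  \<open>- n min(1, dist(x, \<Omega>)) u\<close>, with the nonlinearities truncated to bounded Lipschitz monotone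
  functions. The penalised Cauchy problem has a mild solution by Banach's fixed point theorem and the heat
  kernel, and by comparison it decreases in \<open>n\<close>. Barriers of the form linear plus quadratic, built from an
  exterior paraboloid at each boundary point, show that the limit vanishes continuously on the boundary.

  Interior regularity rests on a representation that survives the limit. If \<open>a\<close> is a cut-off near \<open>0\<close> and
  \<open>\<Gamma>\<close> the heat kernel, then a solution of \<open>w\<^sub>t - \<Delta>w = H\<close> satisfies
  \<open>w = (a \<Gamma>) * H + \<kappa> * w\<close> and \<open>((\<partial>\<^sub>t - \<Delta>) \<kappa>) * w = \<kappa> * H\<close>, where
  \<open>\<kappa> = (\<partial>\<^sub>t - \<Delta>) ((1 - a) \<Gamma>)\<close> is smooth with compact support. These identities
  give Lipschitz bounds for bounded \<open>H\<close> and second derivatives for Hoelder continuous \<open>H\<close>. They can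
  moreover be differentiated in time, so that \<open>w\<^sub>t\<close> is again twice differentiable in space. For a short time
  the truncation is not active; uniqueness is the maximum principle for the cooperative system.
\<close>

text \<open>Posing the approximate problems on the whole space keeps every solution operator an
  explicit Gaussian convolution; the domain enters only through the penalty and through barriers.
  The price is that the limit is known only as a bounded pointwise limit. The identities tolerate
  this: they contain no derivative of \<open>w\<close>, so dominated convergence carries them over,
  and inside \<Omega> the penalty drops out because their kernels have small support. Their roles
  differ: the first gives regularity, the second excludes a spurious source and so gives the
  equation. Differentiating the system in space is blocked by the merely Hoelder continuous
  coefficients; these do not depend on time, so the time derivative solves a problem of the same
  kind, which is what \<open>C^1\<close> in time with values in \<open>C^2\<close> asks for.
  Existence is worked out on the fixed window \<open>[0, 1)\<close>, since the heat kernel is cut at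
  time 1 to be integrable over space-time; \<open>T\<close> then comes from the bound
  \<open>mm + M * M * t\<close>, which must not exceed a level \<open>c < 1\<close> up to which
  truncated and original nonlinearities agree.\<close>

section \<open>The heat operator at a point and the parabolic maximum principle\<close>

text \<open>Only coordinate lines are involved, with first derivatives near the point and second
  derivatives at it. Barriers, potentials and classical solutions all supply this, and it is what
  the second derivative test at a maximum consumes.\<close>

definition heat_at :: "('a::euclidean_space \<Rightarrow> real \<Rightarrow> real) \<Rightarrow> 'a \<Rightarrow> real \<Rightarrow> real \<Rightarrow> bool" where
  "heat_at w x t c \<longleftrightarrow> (\<exists>d a w'. ((\<lambda>s. w x s) has_real_derivative d) (at t) \<and>
     (\<forall>i\<in>Basis. (\<forall>\<^sub>F s in nhds 0. ((\<lambda>r. w (x + r *\<^sub>R i) t) has_real_derivative w' i s) (at s)) \<and>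
        (w' i has_real_derivative a i) (at 0)) \<and> c = d - (\<Sum>i\<in>Basis. a i))"

lemma norm_add_scaleR_Basis_sq:
  assumes "i \<in> Basis"
  shows "(norm (x + r *\<^sub>R i))\<^sup>2 = (norm x)\<^sup>2 + 2 * r * (x \<bullet> i) + r\<^sup>2"
  using assms unfolding power2_norm_eq_inner
  by (simp add: inner_add_left inner_add_right inner_commute power2_eq_square algebra_simps)

lemma norm_sq_eq_sum: "(norm (x::'a::euclidean_space))\<^sup>2 = (\<Sum>i\<in>Basis. (x \<bullet> i)\<^sup>2)"
  unfolding power2_norm_eq_inner by (subst euclidean_inner) (simp add: power2_eq_square)

lemma heat_at_lincomb:
  assumes "heat_at w x t c" "heat_at v x t e"
  shows "heat_at (\<lambda>x t. k * w x t + l * v x t) x t (k * c + l * e)"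
proof -
  from assms(1) obtain d a w' where 1: "((\<lambda>s. w x s) has_real_derivative d) (at t)"
    "\<And>i. i\<in>Basis \<Longrightarrow> \<forall>\<^sub>F s in nhds 0. ((\<lambda>r. w (x + r *\<^sub>R i) t) has_real_derivative w' i s) (at s)"
    "\<And>i. i\<in>Basis \<Longrightarrow> (w' i has_real_derivative a i) (at 0)" "c = d - (\<Sum>i\<in>Basis. a i)"
    unfolding heat_at_def by blast
  from assms(2) obtain d2 a2 w2' where 2: "((\<lambda>s. v x s) has_real_derivative d2) (at t)"
    "\<And>i. i\<in>Basis \<Longrightarrow> \<forall>\<^sub>F s in nhds 0. ((\<lambda>r. v (x + r *\<^sub>R i) t) has_real_derivative w2' i s) (at s)"
    "\<And>i. i\<in>Basis \<Longrightarrow> (w2' i has_real_derivative a2 i) (at 0)" "e = d2 - (\<Sum>i\<in>Basis. a2 i)"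
    unfolding heat_at_def by blast
  show ?thesis
    unfolding heat_at_def
  proof (rule exI[of _ "k * d + l * d2"], rule exI[of _ "\<lambda>i. k * a i + l * a2 i"], rule exI[of _ "\<lambda>i s. k * w' i s + l * w2' i s"], intro conjI ballI)
    show "((\<lambda>s. k * w x s + l * v x s) has_real_derivative k * d + l * d2) (at t)"
      by (intro DERIV_add DERIV_cmult 1 2)
    fix i :: 'a assume i: "i \<in> Basis"
    show "\<forall>\<^sub>F s in nhds 0. ((\<lambda>r. k * w (x + r *\<^sub>R i) t + l * v (x + r *\<^sub>R i) t) has_real_derivative k * w' i s + l * w2' i s) (at s)"
      using 1(2)[OF i] 2(2)[OF i] by eventually_elim (intro DERIV_add DERIV_cmult)
    show "((\<lambda>s. k * w' i s + l * w2' i s) has_real_derivative k * a i + l * a2 i) (at 0)"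
      by (intro DERIV_add DERIV_cmult 1 2 i)
  qed (use 1(4) 2(4) in \<open>simp add: sum.distrib sum_distrib_left right_diff_distrib\<close>)
qed

lemma heat_at_add: "heat_at w x t c \<Longrightarrow> heat_at v x t e \<Longrightarrow> heat_at (\<lambda>x t. w x t + v x t) x t (c + e)"
  using heat_at_lincomb[of w x t c v e 1 1] by simp

lemma heat_at_cmult: "heat_at w x t c \<Longrightarrow> heat_at (\<lambda>x t. k * w x t) x t (k * c)"
  using heat_at_lincomb[of w x t c w c k 0] by simp

lemma heat_at_diff: "heat_at w x t c \<Longrightarrow> heat_at v x t e \<Longrightarrow> heat_at (\<lambda>x t. w x t - v x t) x t (c - e)"
  using heat_at_lincomb[of w x t c v e 1 "-1"] by simp

lemma heat_at_affine: "heat_at (\<lambda>x t. k + m * t) x t m"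
  unfolding heat_at_def
  by (rule exI[of _ m], rule exI[of _ "\<lambda>i. 0"], rule exI[of _ "\<lambda>i s. 0"])
     (auto intro!: derivative_eq_intros always_eventually)

lemma heat_at_norm_sq: "heat_at (\<lambda>x t. (norm (x - p))\<^sup>2) (x::'a::euclidean_space) t (- 2 * real DIM('a))"
  unfolding heat_at_def
proof (rule exI[of _ 0], rule exI[of _ "\<lambda>i. 2"], rule exI[of _ "\<lambda>i s. 2 * ((x - p) \<bullet> i) + 2 * s"], intro conjI ballI)
  fix i :: 'a assume i: "i \<in> Basis"
  have "(norm (x + r *\<^sub>R i - p))\<^sup>2 = (norm (x - p))\<^sup>2 + 2 * r * ((x - p) \<bullet> i) + r\<^sup>2" for r
    using norm_add_scaleR_Basis_sq[OF i, of "x - p" r] by (simp add: algebra_simps)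
  then show "\<forall>\<^sub>F s in nhds 0. ((\<lambda>r. (norm (x + r *\<^sub>R i - p))\<^sup>2) has_real_derivative 2 * ((x - p) \<bullet> i) + 2 * s) (at s)"
    by (auto intro!: derivative_eq_intros always_eventually)
  show "((\<lambda>s. 2 * ((x - p) \<bullet> i) + 2 * s) has_real_derivative 2) (at 0)"
    by (auto intro!: derivative_eq_intros)
qed auto

lemma heat_at_linear: "heat_at (\<lambda>x t. (x - p) \<bullet> \<nu>) x t 0"
  unfolding heat_at_def
  by (rule exI[of _ 0], rule exI[of _ "\<lambda>i. 0"], rule exI[of _ "\<lambda>i s. i \<bullet> \<nu>"])
     (auto intro!: derivative_eq_intros always_eventually simp: inner_add_left inner_diff_left)

lemma heat_at_linear_sq: "heat_at (\<lambda>x t. ((x - p) \<bullet> \<nu>)\<^sup>2) x t (- 2 * (norm \<nu>)\<^sup>2)"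
  unfolding heat_at_def
proof (rule exI[of _ 0], rule exI[of _ "\<lambda>i. 2 * (\<nu> \<bullet> i)\<^sup>2"],
    rule exI[of _ "\<lambda>i s. 2 * ((x - p) \<bullet> \<nu> + s * (i \<bullet> \<nu>)) * (i \<bullet> \<nu>)"], intro conjI ballI)
  fix i :: 'a assume i: "i \<in> Basis"
  have "(x + r *\<^sub>R i - p) \<bullet> \<nu> = (x - p) \<bullet> \<nu> + r * (i \<bullet> \<nu>)" for r
    by (simp add: inner_add_left inner_diff_left)
  then show "\<forall>\<^sub>F s in nhds 0. ((\<lambda>r. ((x + r *\<^sub>R i - p) \<bullet> \<nu>)\<^sup>2) has_real_derivative
      2 * ((x - p) \<bullet> \<nu> + s * (i \<bullet> \<nu>)) * (i \<bullet> \<nu>)) (at s)"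
    by (auto intro!: derivative_eq_intros always_eventually)
  show "((\<lambda>s. 2 * ((x - p) \<bullet> \<nu> + s * (i \<bullet> \<nu>)) * (i \<bullet> \<nu>)) has_real_derivative 2 * (\<nu> \<bullet> i)\<^sup>2) (at 0)"
    by (auto intro!: derivative_eq_intros simp: power2_eq_square inner_commute)
next
  show "- 2 * (norm \<nu>)\<^sup>2 = 0 - (\<Sum>i\<in>Basis. 2 * (\<nu> \<bullet> i)\<^sup>2)"
    by (simp add: sum_distrib_left norm_sq_eq_sum sum_negf)
qed auto

text \<open>With \<open>q = |x|^2\<close> each coordinate contributes
  \<open>2 F_q + 4 x_i^2 F_qq\<close> to the Laplacian. Radial kernels can therefore be handled in
  the two real variables \<open>q\<close> and \<open>s\<close>.\<close>

lemma heat_at_radial: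
  fixes x :: "'a::euclidean_space"
  assumes t: "((\<lambda>s. F ((norm x)\<^sup>2) s) has_real_derivative Ft) (at t)"
    and q: "\<And>q. ((\<lambda>q. F q t) has_real_derivative Fq q) (at q)"
    and qq: "(Fq has_real_derivative Fqq) (at ((norm x)\<^sup>2))"
  shows "heat_at (\<lambda>x t. F ((norm x)\<^sup>2) t) x t (Ft - 2 * real DIM('a) * Fq ((norm x)\<^sup>2) - 4 * (norm x)\<^sup>2 * Fqq)"
  unfolding heat_at_def
proof (rule exI[of _ Ft], rule exI[of _ "\<lambda>i. 2 * Fq ((norm x)\<^sup>2) + 4 * (x \<bullet> i)\<^sup>2 * Fqq"],
    rule exI[of _ "\<lambda>i s. Fq ((norm x)\<^sup>2 + 2 * s * (x \<bullet> i) + s\<^sup>2) * (2 * (x \<bullet> i) + 2 * s)"], intro conjI ballI)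
  fix i :: 'a assume i: "i \<in> Basis"
  have eq: "(norm (x + r *\<^sub>R i))\<^sup>2 = (norm x)\<^sup>2 + 2 * r * (x \<bullet> i) + r\<^sup>2" for r
    by (rule norm_add_scaleR_Basis_sq[OF i])
  have dq: "((\<lambda>r. (norm x)\<^sup>2 + 2 * r * (x \<bullet> i) + r\<^sup>2) has_real_derivative (2 * (x \<bullet> i) + 2 * s)) (at s)" for s
    by (auto intro!: derivative_eq_intros)
  show "\<forall>\<^sub>F s in nhds 0. ((\<lambda>r. F ((norm (x + r *\<^sub>R i))\<^sup>2) t) has_real_derivative
      Fq ((norm x)\<^sup>2 + 2 * s * (x \<bullet> i) + s\<^sup>2) * (2 * (x \<bullet> i) + 2 * s)) (at s)"
    unfolding eq by (intro always_eventually allI DERIV_chain'[OF dq] q)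
  have d2: "((\<lambda>s. Fq ((norm x)\<^sup>2 + 2 * s * (x \<bullet> i) + s\<^sup>2)) has_real_derivative Fqq * (2 * (x \<bullet> i) + 2 * 0)) (at 0)"
    by (rule DERIV_chain'[OF dq]) (use qq in simp)
  show "((\<lambda>s. Fq ((norm x)\<^sup>2 + 2 * s * (x \<bullet> i) + s\<^sup>2) * (2 * (x \<bullet> i) + 2 * s)) has_real_derivative
      2 * Fq ((norm x)\<^sup>2) + 4 * (x \<bullet> i)\<^sup>2 * Fqq) (at 0)"
    by (rule derivative_eq_intros d2 refl)+ (simp add: power2_eq_square)
next
  show "Ft - 2 * real DIM('a) * Fq ((norm x)\<^sup>2) - 4 * (norm x)\<^sup>2 * Fqq =
      Ft - (\<Sum>i\<in>(Basis::'a set). 2 * Fq ((norm x)\<^sup>2) + 4 * (x \<bullet> i)\<^sup>2 * Fqq)"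
    by (simp add: norm_sq_eq_sum[of x] sum.distrib sum_distrib_left sum_distrib_right)
qed (use t in auto)

text \<open>A positive \<open>a\<close> would make \<open>h'\<close> positive just to the right of
  its zero at 0, and the mean value theorem would push \<open>h\<close> above
  \<open>h 0\<close>.\<close>

lemma second_derivative_local_max:
  fixes h :: "real \<Rightarrow> real"
  assumes "\<forall>\<^sub>F s in nhds 0. (h has_real_derivative h' s) (at s)"
    and "(h' has_real_derivative a) (at 0)" and "\<forall>\<^sub>F s in nhds 0. h s \<le> h 0"
  shows "a \<le> 0"
proof (rule ccontr)
  assume "\<not> a \<le> 0"
  then obtain d1 where d1: "d1 > 0" "\<And>s. 0 < s \<Longrightarrow> s < d1 \<Longrightarrow> h' 0 < h' s"
    using DERIV_pos_inc_right[OF assms(2)] by auto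
  have "\<forall>\<^sub>F s in nhds 0. (h has_real_derivative h' s) (at s) \<and> h s \<le> h 0"
    using assms(1,3) by eventually_elim simp
  then obtain d2 where d2: "d2 > 0" "\<And>s. dist s 0 < d2 \<Longrightarrow> (h has_real_derivative h' s) (at s) \<and> h s \<le> h 0"
    unfolding eventually_nhds_metric by blast
  have h0: "h' 0 = 0"
    using DERIV_local_max[of h "h' 0" 0 d2] d2 by (auto simp: dist_real_def abs_minus_commute)
  define s where "s = min d1 d2 / 2"
  have s: "0 < s" "s < d1" "s < d2" using d1(1) d2(1) by (auto simp: s_def)
  obtain z where z: "0 < z" "z < s" "h s - h 0 = (s - 0) * h' z"
    using MVT2[of 0 s h h'] s d2(2) by (auto simp: dist_real_def)
  have "h' z > 0" using d1(2)[of z] z s h0 by auto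
  then have "h s - h 0 > 0" unfolding z(3) using s by simp
  then show False using d2(2)[of s] s by (auto simp: dist_real_def)
qed

text \<open>Two components are treated at once: at a positive maximum over both, the maximal
  component dominates the other, so the differential inequality is asked only under that premise.
  This is the form a cooperative system provides. \<open>D\<close> may be unbounded: the subtrahend
  \<open>\<epsilon> * (1 + |x|^2)\<close> together with the upper bound \<open>B\<close> confines
  the maximum to a ball.\<close>

lemma parabolic_maximum_principle:
  fixes w :: "bool \<Rightarrow> 'a::euclidean_space \<Rightarrow> real \<Rightarrow> real"
  assumes D: "open D"
    and cont: "\<And>b. continuous_on (closure D \<times> {0..<T}) (\<lambda>(x, t). w b x t)"
    and bdd: "\<And>b x t. x \<in> closure D \<Longrightarrow> t \<in> {0..<T} \<Longrightarrow> w b x t \<le> B"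
    and init: "\<And>b x. x \<in> closure D \<Longrightarrow> w b x 0 \<le> 0"
    and lat: "\<And>b x t. x \<in> frontier D \<Longrightarrow> t \<in> {0..<T} \<Longrightarrow> w b x t \<le> 0"
    and heat: "\<And>b x t. x \<in> D \<Longrightarrow> t \<in> {0<..<T} \<Longrightarrow> w b x t > 0 \<Longrightarrow> w (\<not> b) x t \<le> w b x t \<Longrightarrow>
      \<exists>c. heat_at (w b) x t c \<and> c \<le> L * w b x t"
    and x0: "x0 \<in> closure D" "t0 \<in> {0..<T}"
  shows "w b0 x0 t0 \<le> 0"
proof (rule ccontr)
  assume neg: "\<not> w b0 x0 t0 \<le> 0"
  let ?N = "real DIM('a)"
  \<comment> \<open>\<open>2 * ?N\<close> pays for the Laplacian of the quadratic subtrahend, and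
    the final 1 makes the contradiction strict.\<close>
  define K where "K = \<bar>L\<bar> + 2 * ?N + 1"
  define \<epsilon> where "\<epsilon> = exp (- K * t0) * w b0 x0 t0 / (2 * (1 + (norm x0)\<^sup>2))"
  have K0: "K > 0" unfolding K_def by (simp add: add_nonneg_pos)
  have eps: "\<epsilon> > 0" unfolding \<epsilon>_def using neg by (auto intro!: divide_pos_pos simp: add_pos_nonneg)
  define z where "z b x t = exp (- K * t) * w b x t - \<epsilon> * (1 + (norm x)\<^sup>2)" for b x t
  have "1 + (norm x0)\<^sup>2 > 0" by (simp add: add_pos_nonneg)
  then have "\<epsilon> * (1 + (norm x0)\<^sup>2) = exp (- K * t0) * w b0 x0 t0 / 2"
    unfolding \<epsilon>_def by (auto simp: divide_simps)
  moreover have "exp (- K * t0) * w b0 x0 t0 > 0" using neg by simp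
  ultimately have z0: "z b0 x0 t0 > 0" unfolding z_def by linarith
  \<comment> \<open>From radius \<open>R\<close> on the subtrahend is at least
    \<open>\<bar>B\<bar>\<close>, so the perturbed function \<open>z\<close> is nonpositive
    there.\<close>
  define R where "R = sqrt (\<bar>B\<bar> / \<epsilon>) + norm x0 + 1"
  have "sqrt (\<bar>B\<bar> / \<epsilon>) \<ge> 0" using eps by simp
  then have R: "R\<^sup>2 \<ge> \<bar>B\<bar> / \<epsilon>" "R > 0" "norm x0 < R"
  proof -
    have "\<bar>B\<bar> / \<epsilon> = (sqrt (\<bar>B\<bar> / \<epsilon>))\<^sup>2" using eps by simp
    also have "\<dots> \<le> R\<^sup>2" unfolding R_def using eps by (intro power_mono) auto
    finally show "R\<^sup>2 \<ge> \<bar>B\<bar> / \<epsilon>" .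
  qed (auto simp: R_def add_nonneg_pos)
  have zneg: "z b x t \<le> 0" if "x \<in> closure D" "t \<in> {0..t0}" "w b x t \<le> 0 \<or> norm x \<ge> R" for b x t
  proof (cases "w b x t \<le> 0")
    case True
    have "exp (- K * t) * w b x t \<le> 0" using True by (simp add: mult_nonneg_nonpos)
    moreover have "\<epsilon> * (1 + (norm x)\<^sup>2) \<ge> 0" using eps by simp
    ultimately show ?thesis unfolding z_def by linarith
  next
    case False
    then have "norm x \<ge> R" using that by auto
    then have "(norm x)\<^sup>2 \<ge> R\<^sup>2" using R(2) by (intro power_mono) auto
    then have "\<epsilon> * (1 + (norm x)\<^sup>2) \<ge> \<epsilon> * (\<bar>B\<bar> / \<epsilon>)" using R(1) eps by (intro mult_left_mono) auto
    then have 1: "\<epsilon> * (1 + (norm x)\<^sup>2) \<ge> \<bar>B\<bar>" using eps by simp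
    have "exp (- K * t) * w b x t \<le> 1 * w b x t"
      using False that K0 by (intro mult_right_mono) auto
    also have "\<dots> \<le> \<bar>B\<bar>" using bdd[of x t b] that x0(2) by auto
    finally show ?thesis unfolding z_def using 1 by linarith
  qed
  define S where "S = (closure D \<inter> cball 0 R) \<times> {0..t0}"
  have cS: "compact S" unfolding S_def by (intro compact_Times compact_Icc closed_Int_compact) auto
  have x0S: "(x0, t0) \<in> S" using x0 R unfolding S_def by auto
  have sub: "S \<subseteq> closure D \<times> {0..<T}" using x0(2) unfolding S_def by auto
  have "continuous_on S (\<lambda>p. max (z True (fst p) (snd p)) (z False (fst p) (snd p)))"
    unfolding z_def
    using continuous_on_subset[OF cont[of True] sub] continuous_on_subset[OF cont[of False] sub]
    by (intro continuous_intros) (auto simp: case_prod_unfold)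
  then obtain p where p: "p \<in> S" "\<And>y. y \<in> S \<Longrightarrow> max (z True (fst y) (snd y)) (z False (fst y) (snd y))
      \<le> max (z True (fst p) (snd p)) (z False (fst p) (snd p))"
    using continuous_attains_sup[OF cS] x0S by blast
  obtain x t where pxt: "p = (x, t)" by (cases p)
  \<comment> \<open>\<open>b\<close> is the larger component at the maximum point; this yields the
    premise \<open>w (\<not> b) x t \<le> w b x t\<close> of \<open>heat\<close>.\<close>
  obtain b where b: "max (z True x t) (z False x t) = z b x t" "z (\<not> b) x t \<le> z b x t"
    by (cases "z False x t \<le> z True x t") (force simp: max_def)+
  have zpos: "z b x t > 0"
  proof -
    have "z b0 x0 t0 \<le> max (z True x0 t0) (z False x0 t0)" by (cases b0) auto
    then show ?thesis using p(2)[OF x0S] b z0 pxt by auto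
  qed
  have xt: "x \<in> closure D" "t \<in> {0..t0}" using p pxt unfolding S_def by auto
  have wpos: "w b x t > 0" and xR: "norm x < R" using zneg[OF xt, of b] zpos by force+
  have tpos: "0 < t" using init[OF xt(1), of b] wpos xt(2) by (cases "t = 0") auto
  have xD: "x \<in> D" using lat[of x t b] wpos xt x0(2) D
    by (auto simp: frontier_def interior_open)
  have zmax: "z b y s \<le> z b x t" if "y \<in> closure D" "s \<in> {0..t0}" for y s
  proof (cases "norm y \<ge> R")
    case True then show ?thesis using zneg[of y s b] that zpos by auto
  next
    case False
    then have "(y, s) \<in> S" using that unfolding S_def by auto
    then have "max (z True y s) (z False y s) \<le> z b x t" using p(2) pxt b(1) by force
    then show ?thesis by (cases b) auto
  qed
  have "w (\<not> b) x t \<le> w b x t" using b(2) unfolding z_def by simp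
  then obtain c where c: "heat_at (w b) x t c" "c \<le> L * w b x t"
    using heat[OF xD _ wpos] tpos xt x0(2) by auto
  obtain d a w' where h: "((\<lambda>s. w b x s) has_real_derivative d) (at t)"
    "\<And>i. i\<in>Basis \<Longrightarrow> \<forall>\<^sub>F s in nhds 0. ((\<lambda>r. w b (x + r *\<^sub>R i) t) has_real_derivative w' i s) (at s)"
    "\<And>i. i\<in>Basis \<Longrightarrow> (w' i has_real_derivative a i) (at 0)" "c = d - (\<Sum>i\<in>Basis. a i)"
    using c(1) unfolding heat_at_def by blast
  have "((\<lambda>s. z b x s) has_real_derivative exp (- K * t) * (d - K * w b x t)) (at t)"
    unfolding z_def by (rule derivative_eq_intros h(1) refl)+ (simp add: algebra_simps)
  \<comment> \<open>The maximum may sit at the final time \<open>t0\<close>, so only earlier times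
    are compared and the time derivative is bounded from one side.\<close>
  have dK: "d \<ge> K * w b x t"
  proof (rule ccontr)
    assume "\<not> ?thesis"
    then have "exp (- K * t) * (d - K * w b x t) < 0" by (simp add: mult_pos_neg)
    then obtain \<delta> where \<delta>: "\<delta> > 0" "\<And>h. 0 < h \<Longrightarrow> h < \<delta> \<Longrightarrow> z b x t < z b x (t - h)"
      using DERIV_neg_dec_left[OF \<open>((\<lambda>s. z b x s) has_real_derivative _) (at t)\<close>] by auto
    define k where "k = min (\<delta>/2) t"
    have k: "0 < k" "k < \<delta>" "k \<le> t" unfolding k_def using \<delta>(1) tpos by auto
    then have "z b x t < z b x (t - k)" by (intro \<delta>(2)) auto
    then show False using zmax[OF xt(1), of "t - k"] xt(2) k by auto
  qed
  have ee: "exp (- K * t) * exp (K * t) = 1" by (simp flip: exp_add)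
  define E where "E = \<epsilon> * exp (K * t)"
  have a: "a i \<le> 2 * E" if i: "i \<in> Basis" for i
  proof -
    have eq: "(norm (x + r *\<^sub>R i))\<^sup>2 = (norm x)\<^sup>2 + 2 * r * (x \<bullet> i) + r\<^sup>2" for r
      by (rule norm_add_scaleR_Basis_sq[OF i])
    have "exp (- K * t) * a i - \<epsilon> * 2 \<le> 0"
    proof (rule second_derivative_local_max[where h = "\<lambda>r. z b (x + r *\<^sub>R i) t" and
          h' = "\<lambda>s. exp (- K * t) * w' i s - \<epsilon> * (2 * (x \<bullet> i) + 2 * s)"])
      show "\<forall>\<^sub>F s in nhds 0. ((\<lambda>r. z b (x + r *\<^sub>R i) t) has_real_derivative
          exp (- K * t) * w' i s - \<epsilon> * (2 * (x \<bullet> i) + 2 * s)) (at s)"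
        using h(2)[OF i]
      proof eventually_elim
        case (elim s)
        have "((\<lambda>r. \<epsilon> * (1 + ((norm x)\<^sup>2 + 2 * r * (x \<bullet> i) + r\<^sup>2))) has_real_derivative \<epsilon> * (2 * (x \<bullet> i) + 2 * s)) (at s)"
          by (auto intro!: derivative_eq_intros)
        from DERIV_diff[OF DERIV_cmult[OF elim] this]
        show ?case unfolding z_def eq .
      qed
      show "((\<lambda>s. exp (- K * t) * w' i s - \<epsilon> * (2 * (x \<bullet> i) + 2 * s)) has_real_derivative
        exp (- K * t) * a i - \<epsilon> * 2) (at 0)"
        by (intro DERIV_diff DERIV_cmult h(3)[OF i]) (auto intro!: derivative_eq_intros)
      have "((\<lambda>r. x + r *\<^sub>R i) \<longlongrightarrow> x + 0 *\<^sub>R i) (nhds 0)"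
        by (intro tendsto_intros filterlim_ident)
      then have "\<forall>\<^sub>F r in nhds 0. x + r *\<^sub>R i \<in> D"
        using topological_tendstoD[of _ _ _ D] D xD by simp
      then show "\<forall>\<^sub>F s in nhds 0. z b (x + s *\<^sub>R i) t \<le> z b (x + 0 *\<^sub>R i) t"
      proof eventually_elim
        case (elim s)
        then show ?case using zmax[of "x + s *\<^sub>R i" t] xt closure_subset[of D] by auto
      qed
    qed
    then have "(exp (- K * t) * a i) * exp (K * t) \<le> (\<epsilon> * 2) * exp (K * t)"
      by (intro mult_right_mono) auto
    also have "(exp (- K * t) * a i) * exp (K * t) = (exp (- K * t) * exp (K * t)) * a i"
      by (simp only: ac_simps)
    finally show ?thesis unfolding E_def ee by simp
  qed
  have "(\<Sum>i\<in>Basis. a i) \<le> (\<Sum>i\<in>(Basis::'a set). 2 * E)" by (intro sum_mono a)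
  then have sa: "(\<Sum>i\<in>Basis. a i) \<le> 2 * ?N * E" by (simp add: algebra_simps)
  have "\<epsilon> * (1 + (norm x)\<^sup>2) < exp (- K * t) * w b x t" using zpos unfolding z_def by simp
  moreover have "\<epsilon> * 1 \<le> \<epsilon> * (1 + (norm x)\<^sup>2)" using eps by (intro mult_left_mono) auto
  ultimately have "\<epsilon> < exp (- K * t) * w b x t" by simp
  then have "\<epsilon> * exp (K * t) < (exp (- K * t) * w b x t) * exp (K * t)"
    by (intro mult_strict_right_mono) auto
  also have "(exp (- K * t) * w b x t) * exp (K * t) = (exp (- K * t) * exp (K * t)) * w b x t"
    by (simp only: ac_simps)
  finally have E: "E < w b x t" unfolding E_def ee by simp
  have "2 * ?N * E \<le> 2 * ?N * w b x t" using E by (intro mult_left_mono) auto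
  then have "c \<ge> K * w b x t - 2 * ?N * w b x t" using dK sa h(4) by linarith
  also have "K * w b x t - 2 * ?N * w b x t = \<bar>L\<bar> * w b x t + w b x t"
    unfolding K_def by (simp add: algebra_simps)
  finally have "c > \<bar>L\<bar> * w b x t" using wpos by linarith
  moreover have "\<bar>L\<bar> * w b x t \<ge> L * w b x t" using wpos by (intro mult_right_mono) auto
  ultimately show False using c(2) by linarith
qed

section \<open>Convolutions: continuity, differentiation and associativity\<close>

lemma lborel_distr_reflect: "distr lborel borel (\<lambda>y. x - y) = (lborel :: 'b::euclidean_space measure)"
  using lborel_affine[of "-1" x] by (simp add: density_1)

lemma lborel_distr_translate: "distr lborel borel (\<lambda>y. y + x) = (lborel :: 'b::euclidean_space measure)"
  using lborel_affine[of "1" x] by (simp add: density_1 add.commute)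

lemma integrable_reflect:
  fixes f :: "'b::euclidean_space \<Rightarrow> real"
  assumes "integrable lborel f"
  shows "integrable lborel (\<lambda>y. f (x - y))"
proof -
  have "integrable (distr lborel borel (\<lambda>y. x - y)) f" using assms by (simp add: lborel_distr_reflect)
  then show ?thesis using assms by (subst (asm) integrable_distr_eq) auto
qed

lemma integral_reflect:
  fixes f :: "'b::euclidean_space \<Rightarrow> real"
  assumes [measurable]: "f \<in> borel_measurable borel"
  shows "(\<integral>y. f (x - y) \<partial>lborel) = (\<integral>y. f y \<partial>lborel)"
  by (subst (2) lborel_distr_reflect[of x, symmetric], subst integral_distr) auto

lemma integrable_translate:
  fixes f :: "'b::euclidean_space \<Rightarrow> real"
  assumes "integrable lborel f"
  shows "integrable lborel (\<lambda>y. f (y + x))"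
proof -
  have "integrable (distr lborel borel (\<lambda>y. y + x)) f" using assms by (simp add: lborel_distr_translate)
  then show ?thesis using assms by (subst (asm) integrable_distr_eq) auto
qed

lemma integral_translate:
  fixes f :: "'b::euclidean_space \<Rightarrow> real"
  assumes [measurable]: "f \<in> borel_measurable borel"
  shows "(\<integral>y. f (y + x) \<partial>lborel) = (\<integral>y. f y \<partial>lborel)"
  by (subst (2) lborel_distr_translate[of x, symmetric], subst integral_distr) auto

lemma nn_integral_reflect:
  fixes f :: "'b::euclidean_space \<Rightarrow> ennreal"
  assumes [measurable]: "f \<in> borel_measurable borel"
  shows "(\<integral>\<^sup>+y. f (x - y) \<partial>lborel) = (\<integral>\<^sup>+y. f y \<partial>lborel)"
  by (subst (2) lborel_distr_reflect[of x, symmetric], subst nn_integral_distr) auto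

definition convol :: "('b::euclidean_space \<Rightarrow> real) \<Rightarrow> ('b \<Rightarrow> real) \<Rightarrow> 'b \<Rightarrow> real" where
  "convol k \<phi> x = (\<integral>y. k y * \<phi> (x - y) \<partial>lborel)"

lemma integrable_mult_bounded:
  fixes k \<phi> :: "'b \<Rightarrow> real"
  assumes "integrable M k" "\<phi> \<in> borel_measurable M" "\<And>x. \<bar>\<phi> x\<bar> \<le> B"
  shows "integrable M (\<lambda>y. k y * \<phi> y)"
proof (rule Bochner_Integration.integrable_bound)
  show "integrable M (\<lambda>y. B * k y)" using assms(1) by simp
  show "(\<lambda>y. k y * \<phi> y) \<in> borel_measurable M" using assms by measurable
  have "\<bar>k y * \<phi> y\<bar> \<le> \<bar>B * k y\<bar>" for y
    using mult_left_mono[OF order_trans[OF assms(3) abs_ge_self], of "\<bar>k y\<bar>" y] by (simp add: abs_mult mult.commute)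
  then show "AE y in M. norm (k y * \<phi> y) \<le> norm (B * k y)" by simp
qed

lemma convol_integrable:
  fixes k \<phi> :: "'b::euclidean_space \<Rightarrow> real"
  assumes "integrable lborel k" "\<phi> \<in> borel_measurable borel" "\<And>x. \<bar>\<phi> x\<bar> \<le> B"
  shows "integrable lborel (\<lambda>y. k y * \<phi> (x - y))"
  using assms by (intro integrable_mult_bounded[where B=B]) auto

lemma abs_integral_mult_le:
  fixes k \<phi> :: "'b \<Rightarrow> real"
  assumes "integrable M k" "\<phi> \<in> borel_measurable M" "\<And>x. \<bar>\<phi> x\<bar> \<le> B"
  shows "\<bar>\<integral>y. k y * \<phi> y \<partial>M\<bar> \<le> B * (\<integral>y. \<bar>k y\<bar> \<partial>M)"
proof -
  have "\<bar>\<integral>y. k y * \<phi> y \<partial>M\<bar> \<le> (\<integral>y. \<bar>k y * \<phi> y\<bar> \<partial>M)" using integral_norm_bound[of M "\<lambda>y. k y * \<phi> y"] by simp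
  also have "\<dots> \<le> (\<integral>y. B * \<bar>k y\<bar> \<partial>M)"
  proof (rule integral_mono)
    show "integrable M (\<lambda>y. \<bar>k y * \<phi> y\<bar>)" by (intro integrable_abs integrable_mult_bounded[OF assms])
    show "integrable M (\<lambda>y. B * \<bar>k y\<bar>)" using assms(1) by simp
  qed (auto simp: abs_mult mult.commute intro!: mult_right_mono assms(3))
  finally show ?thesis by simp
qed

lemma convol_bound:
  fixes k \<phi> :: "'b::euclidean_space \<Rightarrow> real"
  assumes "integrable lborel k" "\<phi> \<in> borel_measurable borel" "\<And>x. \<bar>\<phi> x\<bar> \<le> B"
  shows "\<bar>convol k \<phi> x\<bar> \<le> B * (\<integral>y. \<bar>k y\<bar> \<partial>lborel)"
  unfolding convol_def using assms by (intro abs_integral_mult_le) auto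

lemma convol_swap:
  assumes [measurable]: "k \<in> borel_measurable borel" "\<phi> \<in> borel_measurable borel"
  shows "convol k \<phi> x = (\<integral>y. k (x - y) * \<phi> y \<partial>lborel)"
  unfolding convol_def by (subst integral_reflect[of "\<lambda>y. k y * \<phi> (x - y)" x, symmetric]) auto

text \<open>Translation is continuous in \<open>L\<^sup>1\<close> by Scheffe's lemma, since it preserves the norm.\<close>

lemma continuous_on_convol:
  fixes k \<phi> :: "'b::euclidean_space \<Rightarrow> real"
  assumes k: "integrable lborel k" and c: "AE y in lborel. isCont k y"
    and m[measurable]: "\<phi> \<in> borel_measurable borel" and B: "\<And>x. \<bar>\<phi> x\<bar> \<le> B"
  shows "continuous_on S (convol k \<phi>)"
  unfolding continuous_on_sequentially
proof (intro allI ballI impI, elim conjE)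
  fix X :: "nat \<Rightarrow> 'b" and x assume X: "X \<longlonglongrightarrow> x"
  have km[measurable]: "k \<in> borel_measurable borel" using k by auto
  have lim: "(\<lambda>n. \<integral>\<^sup>+ y. norm (k (X n - y) - k (x - y)) \<partial>lborel) \<longlonglongrightarrow> 0"
  proof (rule Scheffe_lemma1)
    have "AE y in distr lborel borel (\<lambda>y. x - y). isCont k y" using c unfolding lborel_distr_reflect .
    then have "AE y in lborel. isCont k (x - y)" by (rule AE_distrD[rotated]) simp
    then show "AE y in lborel. (\<lambda>n. k (X n - y)) \<longlonglongrightarrow> k (x - y)"
      by eventually_elim (rule isCont_tendsto_compose, assumption, intro tendsto_intros X)
    show "limsup (\<lambda>n. \<integral>\<^sup>+ y. norm (k (X n - y)) \<partial>lborel) \<le> (\<integral>\<^sup>+ y. norm (k (x - y)) \<partial>lborel)"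
      using nn_integral_reflect[of "\<lambda>y. norm (k y)"] by (simp add: Limsup_const)
  qed (auto intro: integrable_reflect k)
  have bound: "norm (convol k \<phi> (X n) - convol k \<phi> x) \<le> B * enn2real (\<integral>\<^sup>+ y. norm (k (X n - y) - k (x - y)) \<partial>lborel)" for n
  proof -
    have i: "integrable lborel (\<lambda>y. k (X n - y) - k (x - y))"
      by (intro Bochner_Integration.integrable_diff integrable_reflect k)
    have "convol k \<phi> (X n) - convol k \<phi> x = (\<integral>y. (k (X n - y) - k (x - y)) * \<phi> y \<partial>lborel)"
      unfolding convol_swap[OF km m] left_diff_distrib
      using integrable_mult_bounded[OF integrable_reflect[OF k] _ B] by (subst Bochner_Integration.integral_diff) auto
    also have "\<bar>\<dots>\<bar> \<le> B * (\<integral>y. \<bar>k (X n - y) - k (x - y)\<bar> \<partial>lborel)"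
      by (rule abs_integral_mult_le[OF i _ B]) simp
    also have "(\<integral>y. \<bar>k (X n - y) - k (x - y)\<bar> \<partial>lborel) = enn2real (\<integral>\<^sup>+ y. norm (k (X n - y) - k (x - y)) \<partial>lborel)"
      by (subst integral_eq_nn_integral) auto
    finally show ?thesis by simp
  qed
  have "(\<lambda>n. enn2real (\<integral>\<^sup>+ y. norm (k (X n - y) - k (x - y)) \<partial>lborel)) \<longlonglongrightarrow> 0"
    by (rule tendsto_enn2real) (use lim in simp_all)
  then have "(\<lambda>n. B * enn2real (\<integral>\<^sup>+ y. norm (k (X n - y) - k (x - y)) \<partial>lborel)) \<longlonglongrightarrow> 0"
    using tendsto_mult_right_zero by fastforce
  then have "(\<lambda>n. convol k \<phi> (X n) - convol k \<phi> x) \<longlonglongrightarrow> 0"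
    by (rule Lim_null_comparison[rotated]) (use bound in auto)
  then show "((convol k \<phi>) \<circ> X) \<longlonglongrightarrow> convol k \<phi> x"
    unfolding o_def by (rule LIM_zero_cancel)
qed

lemma integrable_pair_bound:
  fixes f :: "'b::euclidean_space \<Rightarrow> 'c::euclidean_space \<Rightarrow> real"
  assumes m[measurable]: "case_prod f \<in> borel_measurable (borel \<Otimes>\<^sub>M borel)" and i: "\<And>x. integrable lborel (f x)"
    and g: "\<And>x. (\<integral>y. \<bar>f x y\<bar> \<partial>lborel) \<le> g x" "integrable lborel g"
  shows "integrable (lborel \<Otimes>\<^sub>M lborel) (case_prod f)"
proof (rule lborel_pair.Fubini_integrable)
  show "integrable lborel (\<lambda>x. \<integral>y. norm (case (x, y) of (x, y) \<Rightarrow> f x y) \<partial>lborel)"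
  proof (rule Bochner_Integration.integrable_bound[OF g(2)])
    show "AE x in lborel. norm (\<integral>y. norm (case (x, y) of (x, y) \<Rightarrow> f x y) \<partial>lborel) \<le> norm (g x)"
      using g(1) by (auto intro: order_trans[OF _ abs_ge_self])
  qed measurable
qed (use i in \<open>auto intro: m\<close>)

lemma Fubini_bounded_factor:
  fixes f :: "'b::euclidean_space \<Rightarrow> 'c::euclidean_space \<Rightarrow> real"
  assumes m[measurable]: "case_prod f \<in> borel_measurable (borel \<Otimes>\<^sub>M borel)" and i: "\<And>x. integrable lborel (f x)"
    and g: "\<And>x. (\<integral>y. \<bar>f x y\<bar> \<partial>lborel) \<le> g x" "integrable lborel g"
    and \<phi>[measurable]: "\<phi> \<in> borel_measurable borel" and B: "\<And>y. \<bar>\<phi> y\<bar> \<le> B"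
  shows "(\<integral>y. (\<integral>x. f x y * \<phi> y \<partial>lborel) \<partial>lborel) = (\<integral>x. (\<integral>y. f x y * \<phi> y \<partial>lborel) \<partial>lborel)"
proof (rule lborel_pair.Fubini_integral)
  have "integrable (lborel \<Otimes>\<^sub>M lborel) (\<lambda>p. case_prod f p * \<phi> (snd p))"
    by (rule integrable_mult_bounded[OF integrable_pair_bound[OF m i g] _ B]) measurable
  then show "integrable (lborel \<Otimes>\<^sub>M lborel) (\<lambda>(x, y). f x y * \<phi> y)" by (simp add: case_prod_unfold)
qed

text \<open>Meant for increments produced by Fubini's theorem: they exhibit \<open>G\<close> as a
  primitive of \<open>c\<close> up to a constant, so no difference quotient has to be
  dominated.\<close>

lemma DERIV_of_increments:
  fixes G c :: "real \<Rightarrow> real"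
  assumes d: "\<delta> > 0" and c: "continuous_on {t-\<delta>..t+\<delta>} c"
    and G: "\<And>a b. t - \<delta> \<le> a \<Longrightarrow> a \<le> b \<Longrightarrow> b \<le> t + \<delta> \<Longrightarrow> G b - G a = (\<integral>s. indicator {a..b} s * c s \<partial>lborel)"
  shows "(G has_real_derivative c t) (at t)"
proof -
  let ?I = "{t-\<delta>..t+\<delta>}"
  obtain A where A: "\<And>s. s \<in> ?I \<Longrightarrow> (A has_vector_derivative c s) (at s within ?I)"
    using antiderivative_continuous[OF c] by blast
  have GA: "G s = A s + (G (t-\<delta>) - A (t-\<delta>))" if s: "s \<in> ?I" for s
  proof -
    have "(\<integral>r. indicator {t-\<delta>..s} r *\<^sub>R c r \<partial>lborel) = A s - A (t-\<delta>)"
    proof (rule integral_FTC_atLeastAtMost)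
      show "continuous_on {t-\<delta>..s} c" using c by (rule continuous_on_subset) (use s in auto)
      show "(A has_vector_derivative c x) (at x within {t-\<delta>..s})" if "t - \<delta> \<le> x" "x \<le> s" for x
        using A[of x] by (rule has_vector_derivative_within_subset) (use s that in auto)
    qed (use s in auto)
    then show ?thesis using G[of "t-\<delta>" s] s by auto
  qed
  have "(A has_vector_derivative c t) (at t within ?I)" using A d by auto
  then have "(A has_vector_derivative c t) (at t)"
    using d by (subst (asm) at_within_interior) auto
  then have "((\<lambda>s. A s + (G (t-\<delta>) - A (t-\<delta>))) has_real_derivative c t) (at t)"
    unfolding has_real_derivative_iff_has_vector_derivative[symmetric]
    by (auto intro!: derivative_eq_intros)
  moreover have ev: "\<forall>\<^sub>F s in nhds t. A s + (G (t-\<delta>) - A (t-\<delta>)) = G s"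
    unfolding eventually_nhds_metric
  proof (intro exI[of _ \<delta>] conjI allI impI d)
    fix s assume "dist s t < \<delta>"
    then have "s \<in> ?I" by (auto simp: dist_real_def)
    from GA[OF this] show "A s + (G (t-\<delta>) - A (t-\<delta>)) = G s" by (rule sym)
  qed
  ultimately show ?thesis using DERIV_cong_ev[OF refl ev refl, of "c t"] by simp
qed

context
  fixes k k' \<phi> :: "'b::euclidean_space \<Rightarrow> real" and e :: 'b and B :: real
  assumes k: "integrable lborel k" and k': "integrable lborel k'" "continuous_on UNIV k'"
    and d: "\<And>y. ((\<lambda>\<tau>. k (y + \<tau> *\<^sub>R e)) has_real_derivative k' y) (at 0)"
    and m[measurable]: "\<phi> \<in> borel_measurable borel" and B: "\<And>x. \<bar>\<phi> x\<bar> \<le> B"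
begin

text \<open>\<open>k (y + h e) - k y\<close> is the integral of \<open>k'\<close> along the segment,
  and the two integrals are exchanged. All smoothness is taken from the kernel;
  \<open>\<phi>\<close> is only bounded and measurable.\<close>

lemma convol_increment:
  assumes "0 \<le> h"
  shows "convol k \<phi> (x + h *\<^sub>R e) - convol k \<phi> x = (\<integral>\<tau>. indicator {0..h} \<tau> * convol k' \<phi> (x + \<tau> *\<^sub>R e) \<partial>lborel)"
proof -
  have [measurable]: "k \<in> borel_measurable borel" "k' \<in> borel_measurable borel" using k k' by auto
  have dk: "((\<lambda>\<tau>. k (y + \<tau> *\<^sub>R e)) has_real_derivative k' (y + t *\<^sub>R e)) (at t)" for y t
    using DERIV_shift[of "\<lambda>\<tau>. k (y + \<tau> *\<^sub>R e)" "k' (y + t *\<^sub>R e)" 0 t] d[of "y + t *\<^sub>R e"]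
    by (simp add: scaleR_add_left algebra_simps)
  have shift: "(\<integral>y. l (y + \<tau> *\<^sub>R e) * \<phi> (x - y) \<partial>lborel) = convol l \<phi> (x + \<tau> *\<^sub>R e)"
    if [measurable]: "l \<in> borel_measurable borel" for l \<tau>
    unfolding convol_def
    by (subst integral_translate[of "\<lambda>y. l y * \<phi> (x + \<tau> *\<^sub>R e - y)" "\<tau> *\<^sub>R e", symmetric]) (auto simp: algebra_simps)
  have ftc: "(\<integral>\<tau>. indicator {0..h} \<tau> * k' (y + \<tau> *\<^sub>R e) \<partial>lborel) = k (y + h *\<^sub>R e) - k y" for y
  proof -
    have "(\<integral>\<tau>. indicator {0..h} \<tau> *\<^sub>R k' (y + \<tau> *\<^sub>R e) \<partial>lborel) = k (y + h *\<^sub>R e) - k (y + 0 *\<^sub>R e)"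
      using assms
    proof (rule integral_FTC_atLeastAtMost)
      show "continuous_on {0..h} (\<lambda>\<tau>. k' (y + \<tau> *\<^sub>R e))"
        by (intro continuous_on_compose2[OF k'(2)] continuous_intros) auto
      show "((\<lambda>\<tau>. k (y + \<tau> *\<^sub>R e)) has_vector_derivative k' (y + \<tau> *\<^sub>R e)) (at \<tau> within {0..h})" for \<tau>
        using dk[of y \<tau>] unfolding has_real_derivative_iff_has_vector_derivative[symmetric]
        by (rule has_field_derivative_at_within)
    qed
    then show ?thesis by simp
  qed
  have "integrable lborel (\<lambda>y. k (y + h *\<^sub>R e) * \<phi> (x - y))" "integrable lborel (\<lambda>y. k y * \<phi> (x - y))"
    by (auto intro!: integrable_mult_bounded[OF _ _ B] integrable_translate k)
  then have "convol k \<phi> (x + h *\<^sub>R e) - convol k \<phi> x = (\<integral>y. (k (y + h *\<^sub>R e) - k y) * \<phi> (x - y) \<partial>lborel)"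
    unfolding left_diff_distrib by (subst Bochner_Integration.integral_diff) (auto simp: shift, simp add: convol_def)
  also have "\<dots> = (\<integral>y. (\<integral>\<tau>. indicator {0..h} \<tau> * k' (y + \<tau> *\<^sub>R e) * \<phi> (x - y) \<partial>lborel) \<partial>lborel)"
    by (simp add: ftc[symmetric])
  also have "\<dots> = (\<integral>\<tau>. (\<integral>y. indicator {0..h} \<tau> * k' (y + \<tau> *\<^sub>R e) * \<phi> (x - y) \<partial>lborel) \<partial>lborel)"
  proof (rule Fubini_bounded_factor[OF _ _ _ _ _ B])
    show "(\<lambda>(\<tau>, y). indicator {0..h} \<tau> * k' (y + \<tau> *\<^sub>R e)) \<in> borel_measurable (borel \<Otimes>\<^sub>M borel)" by measurable
    show "integrable lborel (\<lambda>y. indicator {0..h} \<tau> * k' (y + \<tau> *\<^sub>R e))" for \<tau>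
      by (intro integrable_mult_right integrable_translate k')
    show "(\<integral>y. \<bar>indicator {0..h} \<tau> * k' (y + \<tau> *\<^sub>R e)\<bar> \<partial>lborel) \<le> indicator {0..h} \<tau> * (\<integral>y. \<bar>k' y\<bar> \<partial>lborel)" for \<tau>
      by (simp add: abs_mult integral_translate[of "\<lambda>y. \<bar>k' y\<bar>"])
    show "integrable lborel (\<lambda>\<tau>. indicator {0..h} \<tau> * (\<integral>y. \<bar>k' y\<bar> \<partial>lborel))"
      by (intro integrable_mult_left integrable_real_indicator) (auto simp: emeasure_lborel_Icc_eq)
  qed measurable
  also have "\<dots> = (\<integral>\<tau>. indicator {0..h} \<tau> * convol k' \<phi> (x + \<tau> *\<^sub>R e) \<partial>lborel)"
    by (simp add: mult.assoc shift)
  finally show ?thesis .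
qed

lemma continuous_on_convol': "continuous_on S (convol k' \<phi>)"
  using k' m B by (intro continuous_on_convol[where B=B]) (auto simp: continuous_on_eq_continuous_at)

lemma DERIV_convol: "((\<lambda>h. convol k \<phi> (x + h *\<^sub>R e)) has_real_derivative convol k' \<phi> (x + t *\<^sub>R e)) (at t)"
proof (rule DERIV_of_increments[where \<delta>=1])
  show "continuous_on {t - 1..t + 1} (\<lambda>t. convol k' \<phi> (x + t *\<^sub>R e))"
    by (intro continuous_on_compose2[OF continuous_on_convol'[of UNIV]] continuous_intros) auto
  fix a b :: real assume "a \<le> b"
  then have "convol k \<phi> (x + b *\<^sub>R e) - convol k \<phi> (x + a *\<^sub>R e) =
      (\<integral>s. indicator {0..b - a} s * convol k' \<phi> (x + (s + a) *\<^sub>R e) \<partial>lborel)"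
    using convol_increment[of "b - a" "x + a *\<^sub>R e"] by (simp add: algebra_simps)
  also have "\<dots> = (\<integral>s. indicator {a..b} (s + a) * convol k' \<phi> (x + (s + a) *\<^sub>R e) \<partial>lborel)"
    by (intro Bochner_Integration.integral_cong) (auto split: split_indicator)
  also have "\<dots> = (\<integral>s. indicator {a..b} s * convol k' \<phi> (x + s *\<^sub>R e) \<partial>lborel)"
  proof (rule integral_translate[where x=a])
    have "(\<lambda>s. convol k' \<phi> (x + s *\<^sub>R e)) \<in> borel_measurable borel"
      by (intro borel_measurable_continuous_onI continuous_on_compose2[OF continuous_on_convol'[of UNIV]] continuous_intros) auto
    then show "(\<lambda>s. indicator {a..b} s * convol k' \<phi> (x + s *\<^sub>R e)) \<in> borel_measurable borel" by measurable
  qed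
  finally show "convol k \<phi> (x + b *\<^sub>R e) - convol k \<phi> (x + a *\<^sub>R e) =
      (\<integral>s. indicator {a..b} s * convol k' \<phi> (x + s *\<^sub>R e) \<partial>lborel)" .
qed simp

text \<open>The direction \<open>e\<close> has arbitrary length, so this is the increment over the
  whole step \<open>e\<close>; its length is hidden in \<open>k'\<close>.\<close>

lemma convol_lipschitz: "\<bar>convol k \<phi> (x + e) - convol k \<phi> x\<bar> \<le> B * (\<integral>y. \<bar>k' y\<bar> \<partial>lborel)"
proof -
  obtain z where "convol k \<phi> (x + 1 *\<^sub>R e) - convol k \<phi> (x + 0 *\<^sub>R e) = (1 - 0) * convol k' \<phi> (x + z *\<^sub>R e)"
    using MVT2[of 0 1 "\<lambda>h. convol k \<phi> (x + h *\<^sub>R e)" "\<lambda>z. convol k' \<phi> (x + z *\<^sub>R e)"] DERIV_convol by force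
  then show ?thesis using convol_bound[OF k'(1) m B] by simp
qed

end

lemma DERIV_integral_dominated:
  fixes f f' :: "real \<Rightarrow> 'c \<Rightarrow> real"
  assumes d: "\<delta> > 0" and f: "\<And>h. \<bar>h\<bar> < \<delta> \<Longrightarrow> integrable M (f h)"
    and f': "\<And>h s. \<bar>h\<bar> < \<delta> \<Longrightarrow> ((\<lambda>h. f h s) has_real_derivative f' h s) (at h)"
    and g: "\<And>h s. \<bar>h\<bar> < \<delta> \<Longrightarrow> \<bar>f' h s\<bar> \<le> g s" "integrable M g"
  shows "((\<lambda>h. \<integral>s. f h s \<partial>M) has_real_derivative (\<integral>s. f' 0 s \<partial>M)) (at 0)"
  unfolding DERIV_def tendsto_at_iff_sequentially
proof (intro allI impI, goal_cases)
  case (1 X)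
  then have X: "X \<longlonglongrightarrow> 0" "\<And>n. X n \<noteq> 0" by auto
  obtain N where N: "\<And>n. n \<ge> N \<Longrightarrow> \<bar>X n\<bar> < \<delta>"
    using LIMSEQ_D[OF X(1) d] by auto
  define Y where "Y n = X (n + N)" for n
  have Y: "Y \<longlonglongrightarrow> 0" "\<And>n. Y n \<noteq> 0" "\<And>n. \<bar>Y n\<bar> < \<delta>"
    unfolding Y_def using X N by (auto simp: LIMSEQ_ignore_initial_segment)
  have q: "(\<lambda>n. (f (Y n) s - f 0 s) / Y n) \<longlonglongrightarrow> f' 0 s" for s
    using f'[of 0 s] d Y unfolding DERIV_def tendsto_at_iff_sequentially by (auto simp: o_def)
  have "(\<lambda>n. \<integral>s. (f (Y n) s - f 0 s) / Y n \<partial>M) \<longlonglongrightarrow> (\<integral>s. f' 0 s \<partial>M)"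
  proof (rule integral_dominated_convergence[where w=g])
    show m: "(\<lambda>s. (f (Y n) s - f 0 s) / Y n) \<in> borel_measurable M" for n
      using f[of "Y n"] f[of 0] d Y by (intro borel_measurable_divide borel_measurable_diff) auto
    show "f' 0 \<in> borel_measurable M" by (rule borel_measurable_LIMSEQ_real[OF q m])
    show "AE s in M. norm ((f (Y n) s - f 0 s) / Y n) \<le> g s" for n
    proof (rule AE_I2)
      fix s
      have "\<bar>f (Y n) s - f 0 s\<bar> \<le> g s * \<bar>Y n - 0\<bar>"
      proof -
        have "norm (f (Y n) s - f 0 s) \<le> g s * norm (Y n - 0)"
          by (rule field_differentiable_bound[where S = "{-\<delta><..<\<delta>}" and f = "\<lambda>h. f h s" and f' = "\<lambda>h. f' h s"])
             (use f' g Y(3)[of n] d in \<open>auto simp: abs_less_iff intro!: DERIV_subset[OF f']\<close>)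
        then show ?thesis by simp
      qed
      then show "norm ((f (Y n) s - f 0 s) / Y n) \<le> g s" using Y(2)[of n] by (simp add: field_simps)
    qed
  qed (use q g in auto)
  moreover have "(\<integral>s. (f (Y n) s - f 0 s) / Y n \<partial>M) = ((\<integral>s. f (Y n) s \<partial>M) - (\<integral>s. f 0 s \<partial>M)) / Y n" for n
    using f[of "Y n"] f[of 0] d Y by simp
  ultimately have "(\<lambda>n. ((\<integral>s. f (Y n) s \<partial>M) - (\<integral>s. f 0 s \<partial>M)) / Y n) \<longlonglongrightarrow> (\<integral>s. f' 0 s \<partial>M)"
    by (simp only:)
  from LIMSEQ_offset[OF this[unfolded Y_def]]
  show ?case by (simp add: o_def)
qed

lemma continuous_on_integral_dominated:
  fixes f :: "'p::metric_space \<Rightarrow> 'c \<Rightarrow> real"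
  assumes c: "\<And>s. continuous_on S (\<lambda>p. f p s)" and m: "\<And>p. p \<in> S \<Longrightarrow> f p \<in> borel_measurable M"
    and g: "\<And>p s. p \<in> S \<Longrightarrow> \<bar>f p s\<bar> \<le> g s" "integrable M g"
  shows "continuous_on S (\<lambda>p. \<integral>s. f p s \<partial>M)"
  unfolding continuous_on_sequentially
proof (intro allI ballI impI, elim conjE)
  fix X x assume X: "x \<in> S" "\<forall>n. X n \<in> S" "X \<longlonglongrightarrow> x"
  show "((\<lambda>p. \<integral>s. f p s \<partial>M) \<circ> X) \<longlonglongrightarrow> (\<integral>s. f x s \<partial>M)"
    unfolding o_def
  proof (rule integral_dominated_convergence[where w=g])
    show "AE s in M. (\<lambda>n. f (X n) s) \<longlonglongrightarrow> f x s"
      using c X unfolding continuous_on_sequentially o_def by blast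
  qed (use X m g in auto)
qed

lemma convol_assoc:
  fixes k l \<phi> :: "'b::euclidean_space \<Rightarrow> real"
  assumes k: "integrable lborel k" and l: "integrable lborel l"
    and m[measurable]: "\<phi> \<in> borel_measurable borel" and B: "\<And>x. \<bar>\<phi> x\<bar> \<le> B"
  shows "convol k (convol l \<phi>) x = convol (convol k l) \<phi> x"
proof -
  have [measurable]: "k \<in> borel_measurable borel" "l \<in> borel_measurable borel" using k l by auto
  have 1: "convol l \<phi> (x - y) = (\<integral>z. l (z - y) * \<phi> (x - z) \<partial>lborel)" for y
    unfolding convol_def
    by (subst integral_translate[of "\<lambda>z. l z * \<phi> (x - y - z)" "- y", symmetric]) (auto simp: algebra_simps)
  have il: "integrable lborel (\<lambda>z. l (z - y))" for y using integrable_translate[OF l, of "-y"] by simp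
  have "convol k (convol l \<phi>) x = (\<integral>y. (\<integral>z. k y * l (z - y) * \<phi> (x - z) \<partial>lborel) \<partial>lborel)"
    unfolding convol_def[of k] 1 by (simp add: mult.assoc)
  also have "\<dots> = (\<integral>z. (\<integral>y. k y * l (z - y) * \<phi> (x - z) \<partial>lborel) \<partial>lborel)"
  proof (rule Fubini_bounded_factor[symmetric, OF _ _ _ _ _ B])
    show "(\<lambda>(y, z). k y * l (z - y)) \<in> borel_measurable (borel \<Otimes>\<^sub>M borel)" by measurable
    show "integrable lborel (\<lambda>z. k y * l (z - y))" for y using il by simp
    show "(\<integral>z. \<bar>k y * l (z - y)\<bar> \<partial>lborel) \<le> \<bar>k y\<bar> * (\<integral>z. \<bar>l z\<bar> \<partial>lborel)" for y
      using integral_translate[of "\<lambda>z. \<bar>l z\<bar>" "-y"] by (simp add: abs_mult)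
  qed (use k in auto)
  also have "\<dots> = convol (convol k l) \<phi> x" unfolding convol_def[of "convol k l"] unfolding convol_def by simp
  finally show ?thesis .
qed

section \<open>Gaussians, their moments, and the heat kernel with its derivatives\<close>

text \<open>The Gaussian factorises over the coordinates, and in one dimension it is a multiple of a
  normal density.\<close>

lemma integrable_exp_neg_norm_sq:
  assumes "a > 0"
  shows "integrable lborel (\<lambda>z::'a::euclidean_space. exp (- a * (norm z)\<^sup>2))"
proof (rule integrableI_bounded)
  define f where "f x = exp (- a * x\<^sup>2)" for x :: real
  have 1: "integrable lborel f"
  proof -
    \<comment> \<open>Chosen so that \<open>x^2 / (2 \<sigma>^2) = a x^2\<close>.\<close>
    define \<sigma> where "\<sigma> = sqrt (1 / (2 * a))"
    have s: "\<sigma> > 0" "\<sigma>\<^sup>2 = 1 / (2 * a)" using assms by (auto simp: \<sigma>_def)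
    have "integrable lborel (normal_density 0 \<sigma>)"
      using normal_moment_even[OF s(1), of 0 0] by (auto dest: integrable.intros)
    then have "integrable lborel (\<lambda>x. sqrt (2 * pi * \<sigma>\<^sup>2) * normal_density 0 \<sigma> x)" by simp
    moreover have "sqrt (2 * pi * \<sigma>\<^sup>2) * normal_density 0 \<sigma> x = f x" for x
      using s assms by (simp add: normal_density_def f_def real_sqrt_mult field_simps)
    ultimately show ?thesis by simp
  qed
  have fin: "(\<integral>\<^sup>+x. f x \<partial>lborel) < \<infinity>"
    using 1 by (simp add: integrable_iff_bounded f_def)
  have "exp (- a * (norm z)\<^sup>2) = (\<Prod>b\<in>Basis. f (z \<bullet> b))" for z :: 'a
    unfolding f_def norm_sq_eq_sum by (simp add: exp_sum[symmetric] sum_distrib_left sum_negf)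
  then have "(\<integral>\<^sup>+z. norm (exp (- a * (norm (z::'a))\<^sup>2)) \<partial>lborel) = (\<integral>\<^sup>+z. (\<Prod>b\<in>Basis. ennreal (f ((z::'a) \<bullet> b))) \<partial>lborel)"
    by (intro nn_integral_cong) (simp add: prod_ennreal f_def abs_prod)
  also have "\<dots> = (\<Prod>b\<in>(Basis::'a set). (\<integral>\<^sup>+x. f x \<partial>lborel))"
    by (intro nn_integral_lborel_prod) (auto simp: f_def)
  also have "\<dots> < \<infinity>"
    using fin by (simp add: power_less_top_ennreal)
  finally show "(\<integral>\<^sup>+z. norm (exp (- a * (norm (z::'a))\<^sup>2)) \<partial>lborel) < \<infinity>" .
qed simp

lemma integrable_gaussian_weight:
  fixes h :: "'a::euclidean_space \<Rightarrow> real"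
  assumes [measurable]: "h \<in> borel_measurable borel" and h: "\<And>z. \<bar>h z\<bar> \<le> 1 + norm z ^ 4"
  shows "integrable lborel (\<lambda>z. h z * exp (- (norm z)\<^sup>2 / 4))"
proof (rule Bochner_Integration.integrable_bound)
  \<comment> \<open>Half of the exponent absorbs the polynomial: \<open>exp y \<ge> y^2 / 2\<close>
    at \<open>y = |z|^2 / 8\<close> gives the factor 128 for the fourth power, and the summand 1 of
    the weight adds one more.\<close>
  show "integrable lborel (\<lambda>z::'a. 129 * exp (- (1/8) * (norm z)\<^sup>2))"
    by (intro integrable_mult_right integrable_exp_neg_norm_sq) simp
  have "\<bar>h z\<bar> * exp (- (norm z)\<^sup>2 / 4) \<le> 129 * exp (- (1/8) * (norm z)\<^sup>2)" for z
  proof -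
    have "1 + (norm z)\<^sup>2/8 + ((norm z)\<^sup>2/8)\<^sup>2 / 2 \<le> exp ((norm z)\<^sup>2/8)"
      by (rule exp_lower_Taylor_quadratic) simp
    moreover have "((norm z)\<^sup>2/8)\<^sup>2 / 2 = norm z ^ 4 / 128" by (simp add: power2_eq_square power4_eq_xxxx)
    moreover have "1 \<le> exp ((norm z)\<^sup>2/8)" by simp
    ultimately have "norm z ^ 4 / 128 \<le> exp ((norm z)\<^sup>2/8)" "1 \<le> exp ((norm z)\<^sup>2/8)"
      using zero_le_power2[of "norm z"] by linarith+
    then have "\<bar>h z\<bar> \<le> 129 * exp ((norm z)\<^sup>2/8)" using h[of z] by linarith
    then have "\<bar>h z\<bar> * exp (- (norm z)\<^sup>2 / 4) \<le> (129 * exp ((norm z)\<^sup>2/8)) * exp (- (norm z)\<^sup>2 / 4)"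
      by (rule mult_right_mono) simp
    also have "\<dots> = 129 * exp (- (1/8) * (norm z)\<^sup>2)" by (simp flip: exp_add)
    finally show ?thesis .
  qed
  then show "AE z in lborel. norm (h z * exp (- (norm z)\<^sup>2 / 4)) \<le> norm (129 * exp (- (1/8) * (norm z)\<^sup>2))"
    by (auto simp: abs_mult)
qed measurable

lemma integral_scale:
  fixes h :: "'a::euclidean_space \<Rightarrow> real"
  assumes c: "c > 0" and h: "integrable lborel h"
  shows "integrable lborel (\<lambda>y. h ((1 / c) *\<^sub>R y))"
    and "(\<integral>y. h ((1 / c) *\<^sub>R y) \<partial>lborel) = c ^ DIM('a) * (\<integral>z. h z \<partial>lborel)"
proof -
  have [measurable]: "h \<in> borel_measurable borel" using h by auto
  have eq: "lborel = density (distr lborel borel (\<lambda>x::'a. c *\<^sub>R x)) (\<lambda>_. ennreal (c ^ DIM('a)))"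
    using lborel_affine[of c 0] c by (simp add: ennreal_power)
  have i: "integrable (density (distr lborel borel (\<lambda>x::'a. c *\<^sub>R x)) (\<lambda>_. ennreal (c ^ DIM('a)))) (\<lambda>y. h ((1 / c) *\<^sub>R y))"
    using c h by (subst integrable_density) (auto simp: integrable_distr_eq)
  then show "integrable lborel (\<lambda>y. h ((1 / c) *\<^sub>R y))" unfolding eq[symmetric] .
  have "(\<integral>y. h ((1 / c) *\<^sub>R y) \<partial>density (distr lborel borel (\<lambda>x::'a. c *\<^sub>R x)) (\<lambda>_. ennreal (c ^ DIM('a)))) = c ^ DIM('a) * (\<integral>z. h z \<partial>lborel)"
    using c by (subst integral_density) (auto simp: integral_distr)
  then show "(\<integral>y. h ((1 / c) *\<^sub>R y) \<partial>lborel) = c ^ DIM('a) * (\<integral>z. h z \<partial>lborel)" unfolding eq[symmetric] .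
qed

text \<open>Here \<open>q\<close> stands for \<open>|y|^2\<close>. Differentiation in either
  variable stays within this family up to polynomial factors in \<open>q\<close> and only shifts
  \<open>m\<close>, so one set of estimates serves the heat kernel and all its derivatives. Away
  from \<open>q = s = 0\<close> on the side \<open>q \<ge> 0\<close> the extension by 0 to
  \<open>s \<le> 0\<close> is smooth.\<close>

definition gsq :: "real \<Rightarrow> real \<Rightarrow> real \<Rightarrow> real" where
  "gsq m q s = (if 0 < s then s powr (- m) * exp (- q / (4 * s)) else 0)"

abbreviation gs :: "real \<Rightarrow> 'a::euclidean_space \<Rightarrow> real \<Rightarrow> real" where
  "gs m y s \<equiv> gsq m ((norm y)\<^sup>2) s"

lemma gsq_nonneg: "0 \<le> gsq m q s" by (simp add: gsq_def)

lemma gsq_deriv_q: "((\<lambda>q. gsq m q s) has_real_derivative - gsq (m + 1) q s / 4) (at q)"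
proof (cases "0 < s")
  case True
  have "s powr (- (m + 1)) = s powr (- m) / s" using True by (simp add: powr_diff powr_minus divide_simps powr_add)
  then show ?thesis using True unfolding gsq_def
    by (auto intro!: derivative_eq_intros simp: field_simps)
qed (simp add: gsq_def)

text \<open>Exponential decay beats every power: with \<open>y = q / (4 s)\<close> and an integer
  \<open>n \<ge> m\<close>, the comparison function is a multiple of
  \<open>y^n / exp y\<close>.\<close>

lemma gsq_tendsto_0:
  assumes "0 < q"
  shows "(gsq m q \<longlongrightarrow> 0) (at 0)"
proof (rule filterlim_split_at)
  show "(gsq m q \<longlongrightarrow> 0) (at_left 0)"
    by (rule tendsto_eventually) (auto simp: eventually_at_filter gsq_def)
  obtain n :: nat where n: "m \<le> real n" using real_arch_simple by blast
  have "filterlim (\<lambda>s. q / 4 * inverse s) at_top (at_right 0)"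
    by (rule filterlim_tendsto_pos_mult_at_top[OF tendsto_const _ filterlim_inverse_at_top_right]) (use assms in simp)
  from tendsto_mult_right_zero[OF filterlim_compose[OF tendsto_power_div_exp_0 this], of "(4 / q) ^ n" n]
  show "(gsq m q \<longlongrightarrow> 0) (at_right 0)"
  proof (rule Lim_null_comparison[rotated])
    have "\<forall>\<^sub>F s in at_right (0::real). s < 1" "\<forall>\<^sub>F s in at_right (0::real). 0 < s"
      by (auto simp: eventually_at_right_field intro!: exI[of _ 1])
    then show "\<forall>\<^sub>F s in at_right 0. norm (gsq m q s) \<le> (4 / q) ^ n * ((q / 4 * inverse s) ^ n / exp (q / 4 * inverse s))"
    proof eventually_elim
      case (elim s)
      have "s powr (- m) \<le> s powr (- real n)" using elim n by (intro powr_mono') auto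
      also have "\<dots> = inverse s ^ n" using elim by (simp add: powr_minus powr_realpow power_inverse)
      finally have "s powr (- m) * exp (- q / (4 * s)) \<le> inverse s ^ n * exp (- q / (4 * s))" by (rule mult_right_mono) simp
      moreover have "inverse s ^ n = (4 / q) ^ n * (q / 4 * inverse s) ^ n" using assms by (simp flip: power_mult_distrib)
      moreover have "exp (- q / (4 * s)) = 1 / exp (q / 4 * inverse s)" by (simp add: exp_minus inverse_eq_divide)
      ultimately show ?case using elim by (simp add: gsq_def divide_right_mono)
    qed
  qed
qed

lemma gsq_deriv_s:
  assumes "0 < q \<or> s \<noteq> 0"
  shows "((\<lambda>s. gsq m q s) has_real_derivative - m * gsq (m + 1) q s + q / 4 * gsq (m + 2) q s) (at s)"
proof -
  consider "0 < s" | "s < 0" | "s = 0" "0 < q" using assms by linarith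
  then show ?thesis
  proof cases
    case 1
    then have p: "s powr (- (m + 1)) = s powr (- m) / s" "s powr (- (m + 2)) = s powr (- m) / s\<^sup>2"
      by (simp_all add: powr_diff powr_minus divide_simps powr_add power2_eq_square)
    have "((\<lambda>s. s powr (- m) * exp (- q / (4 * s))) has_real_derivative
        - m * gsq (m + 1) q s + q / 4 * gsq (m + 2) q s) (at s)"
      using 1 unfolding gsq_def
      by (auto intro!: derivative_eq_intros simp: p powr_diff power2_eq_square) (simp add: field_simps)
    moreover have ev: "\<forall>\<^sub>F s in nhds s. s powr (- m) * exp (- q / (4 * s)) = gsq m q s"
      using eventually_nhds_in_open[of "{0<..}" s] 1 by (auto elim!: eventually_mono simp: gsq_def)
    ultimately show ?thesis using DERIV_cong_ev[OF refl ev refl] by simp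
  next
    case 2
    have ev: "\<forall>\<^sub>F s in nhds s. 0 = gsq m q s"
      using eventually_nhds_in_open[of "{..<0}" s] 2 by (auto elim!: eventually_mono simp: gsq_def)
    show ?thesis using 2 DERIV_cong_ev[OF refl ev refl, of 0] by (simp add: gsq_def[of _ _ s])
  next
    case 3
    \<comment> \<open>At \<open>s = 0\<close> the difference quotient of the member \<open>m\<close>
      of the family is the member \<open>m + 1\<close>, which tends to 0.\<close>
    have eq: "(\<lambda>h. (gsq m q (0 + h) - gsq m q 0) / h) = gsq (m + 1) q"
      by (auto simp: fun_eq_iff gsq_def powr_diff powr_minus powr_add field_simps)
    show ?thesis unfolding 3(1) DERIV_def eq using gsq_tendsto_0[OF 3(2)] by (simp add: gsq_def[of _ _ 0])
  qed
qed

lemma continuous_gsq: "continuous_on {p. 0 < fst p \<or> snd p \<noteq> 0} (\<lambda>p. gsq m (fst p) (snd p))" (is "continuous_on ?U ?f")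
proof (rule continuous_at_imp_continuous_on, rule ballI)
  fix p :: "real \<times> real" assume p: "p \<in> ?U"
  show "isCont ?f p"
  proof (cases "snd p = 0")
    case False
    define S :: "(real \<times> real) set" where "S = UNIV \<times> {0<..} \<union> UNIV \<times> {..<0}"
    have "continuous_on S ?f" unfolding S_def
    proof (rule continuous_on_open_Un)
      show "continuous_on (UNIV \<times> {0<..}) ?f"
        by (rule continuous_on_eq[of _ "\<lambda>p. snd p powr (- m) * exp (- fst p / (4 * snd p))"])
          (auto intro!: continuous_intros simp: gsq_def)
      show "continuous_on (UNIV \<times> {..<0}) ?f" by (rule continuous_on_eq[of _ "\<lambda>_. 0"]) (auto simp: gsq_def)
    qed (auto intro: open_Times)
    moreover have "open S" "p \<in> S" using False by (auto simp: S_def open_Un open_Times mem_Times_iff)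
    ultimately show ?thesis using continuous_on_eq_continuous_at by blast
  next
    case True
    then have q: "0 < fst p" using p by auto
    \<comment> \<open>For first arguments above half of \<open>fst p\<close> the function is
      dominated by its value at that half, so joint continuity at \<open>s = 0\<close> reduces to
      continuity in \<open>s\<close> alone.\<close>
    have "isCont (\<lambda>z. gsq m (fst p / 2) (snd z)) p"
      by (rule isCont_o2[OF _ DERIV_isCont[OF gsq_deriv_s]]) (use q in \<open>auto intro: continuous_intros\<close>)
    then have "((\<lambda>z. gsq m (fst p / 2) (snd z)) \<longlongrightarrow> 0) (at p)"
      using True by (simp add: isCont_def gsq_def[of _ _ 0])
    then have "(?f \<longlongrightarrow> 0) (at p)"
    proof (rule Lim_null_comparison[rotated])
      have "\<forall>\<^sub>F z in nhds p. z \<in> {fst p / 2<..} \<times> UNIV"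
        by (rule eventually_nhds_in_open) (use q in \<open>auto simp: open_Times mem_Times_iff\<close>)
      then show "\<forall>\<^sub>F z in at p. norm (?f z) \<le> gsq m (fst p / 2) (snd z)"
        unfolding eventually_at_filter
      proof eventually_elim
        case (elim z)
        have "- fst z / (4 * snd z) \<le> - (fst p / 2) / (4 * snd z)" if "0 < snd z"
          using elim that by (intro divide_right_mono) auto
        then show ?case by (auto simp: gsq_def mult_left_mono)
      qed
    qed
    then show ?thesis using True by (simp add: isCont_def gsq_def[of _ _ 0])
  qed
qed

lemma norm_sq_line_deriv: "((\<lambda>\<tau>. (norm (y + \<tau> *\<^sub>R e))\<^sup>2) has_real_derivative 2 * (y \<bullet> e)) (at 0)"
proof -
  have "(norm (y + \<tau> *\<^sub>R e))\<^sup>2 = (norm y)\<^sup>2 + 2 * \<tau> * (y \<bullet> e) + \<tau>\<^sup>2 * (norm e)\<^sup>2" for \<tau>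
    unfolding power2_norm_eq_inner
    by (simp add: inner_add_left inner_add_right inner_commute power2_eq_square algebra_simps)
  then show ?thesis by (auto intro!: derivative_eq_intros)
qed

lemma borel_measurable_fst_snd [measurable]:
  "(fst :: 'a::euclidean_space \<times> real \<Rightarrow> 'a) \<in> borel_measurable borel"
  "(snd :: 'a::euclidean_space \<times> real \<Rightarrow> real) \<in> borel_measurable borel"
  by (auto intro!: borel_measurable_continuous_onI continuous_intros)

lemma gs_measurable [measurable]: "(\<lambda>p. gs m (fst p) (snd p)) \<in> borel_measurable borel"
  unfolding gsq_def by measurable

text \<open>Parabolic scaling \<open>y = sqrt s * z\<close>: a weight homogeneous of degree
  \<open>k\<close> contributes \<open>s powr (k / 2)\<close>, the volume element
  \<open>s powr (DIM('a) / 2)\<close>.\<close>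

lemma gs_weight_integral:
  fixes h :: "'a::euclidean_space \<Rightarrow> real"
  assumes [measurable]: "h \<in> borel_measurable borel" and h: "\<And>z. \<bar>h z\<bar> \<le> 1 + norm z ^ 4"
    and hom: "\<And>c z. c > 0 \<Longrightarrow> h (c *\<^sub>R z) = c powr k * h z" and s: "s > 0"
  shows "integrable lborel (\<lambda>y. h y * gs m y s)"
    and "(\<integral>y. h y * gs m y s \<partial>lborel) = s powr (DIM('a) / 2 + k / 2 - m) * (\<integral>z. h z * exp (- (norm z)\<^sup>2 / 4) \<partial>lborel)"
proof -
  let ?h = "\<lambda>z. h z * exp (- (norm z)\<^sup>2 / 4)"
  have i: "integrable lborel ?h" by (rule integrable_gaussian_weight) (use h in auto)
  have c: "sqrt s > 0" using s by simp
  have eq: "h y * gs m y s = s powr (k / 2 - m) * ?h ((1 / sqrt s) *\<^sub>R y)" for y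
  proof -
    have "h y = h (sqrt s *\<^sub>R ((1 / sqrt s) *\<^sub>R y))" using s by simp
    also have "\<dots> = sqrt s powr k * h ((1 / sqrt s) *\<^sub>R y)" by (rule hom[OF c])
    also have "sqrt s powr k = s powr (k / 2)" using s by (simp add: powr_half_sqrt[symmetric] powr_powr)
    finally have 1: "h y = s powr (k / 2) * h ((1 / sqrt s) *\<^sub>R y)" .
    have 2: "- (norm ((1 / sqrt s) *\<^sub>R y))\<^sup>2 / 4 = - (norm y)\<^sup>2 / (4 * s)"
      using s by (simp add: power_divide)
    have 3: "s powr (k / 2 - m) = s powr (k / 2) * s powr (- m)"
      using powr_add[of s "k / 2" "- m"] by simp
    show ?thesis unfolding gsq_def 1 2 3 using s by simp
  qed
  show "integrable lborel (\<lambda>y. h y * gs m y s)"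
    unfolding eq by (intro integrable_mult_right integral_scale(1)[OF c i])
  have "(\<integral>y. h y * gs m y s \<partial>lborel) = s powr (k / 2 - m) * (sqrt s ^ DIM('a) * (\<integral>z. ?h z \<partial>lborel))"
    unfolding eq integral_scale(2)[OF c i, symmetric] by (rule integral_mult_right_zero)
  also have "sqrt s ^ DIM('a) = s powr (DIM('a) / 2)"
    unfolding powr_realpow[OF c, symmetric] using s by (simp add: powr_half_sqrt[symmetric] powr_powr)
  finally have "(\<integral>y. h y * gs m y s \<partial>lborel) = (s powr (k / 2 - m) * s powr (DIM('a) / 2)) * (\<integral>z. ?h z \<partial>lborel)"
    by simp
  also have "s powr (k / 2 - m) * s powr (DIM('a) / 2) = s powr (DIM('a) / 2 + k / 2 - m)"
    unfolding powr_add[symmetric] by (rule arg_cong[where f = "(powr) s"]) simp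
  finally show "(\<integral>y. h y * gs m y s \<partial>lborel) = s powr (DIM('a) / 2 + k / 2 - m) * (\<integral>z. ?h z \<partial>lborel)" .
qed

definition gmom :: "'a::euclidean_space itself \<Rightarrow> real \<Rightarrow> real" where
  "gmom _ \<beta> = (\<integral>(z::'a). norm z powr \<beta> * exp (- (norm z)\<^sup>2 / 4) \<partial>lborel)"

lemma gmom_nonneg: "0 \<le> gmom T \<beta>"
  unfolding gmom_def by (rule integral_nonneg_AE) simp

lemma gs_moment:
  assumes "0 < \<beta>" "\<beta> \<le> 4" "0 < s"
  shows "integrable lborel (\<lambda>y::'a::euclidean_space. norm y powr \<beta> * gs m y s)"
    "(\<integral>(y::'a). norm y powr \<beta> * gs m y s \<partial>lborel) = s powr (DIM('a) / 2 + \<beta> / 2 - m) * gmom TYPE('a) \<beta>"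
proof -
  have b: "norm z powr \<beta> \<le> 1 + norm z ^ 4" for z :: 'a
  proof (cases "norm z \<le> 1")
    case True
    then have "norm z powr \<beta> \<le> 1" using assms powr_le1 by auto
    then show ?thesis by (simp add: add_increasing2)
  next
    case False
    then have "norm z powr \<beta> \<le> norm z powr 4" using assms by (intro powr_mono) auto
    also have "\<dots> = norm z ^ 4" using False by (subst powr_realpow[symmetric]) auto
    finally show ?thesis by simp
  qed
  show "integrable lborel (\<lambda>y::'a. norm y powr \<beta> * gs m y s)"
    "(\<integral>(y::'a). norm y powr \<beta> * gs m y s \<partial>lborel) = s powr (DIM('a) / 2 + \<beta> / 2 - m) * gmom TYPE('a) \<beta>"
    unfolding gmom_def using b assms by (intro gs_weight_integral; auto simp: powr_mult)+
qed

text \<open>The number \<open>(4 pi)^(N/2)\<close>. It is kept as an integral, so that the unit mass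
  of the heat kernel follows from scaling at once.\<close>

definition gmass :: "'a::euclidean_space itself \<Rightarrow> real" where
  "gmass _ = (\<integral>(z::'a). exp (- (norm z)\<^sup>2 / 4) \<partial>lborel)"

lemma gmass_pos [simp]: "gmass TYPE('a::euclidean_space) > 0"
proof -
  let ?f = "\<lambda>z::'a. exp (- (norm z)\<^sup>2 / 4)"
  have i: "integrable lborel ?f" using integrable_exp_neg_norm_sq[of "1/4", where 'a='a] by simp
  have "gmass TYPE('a) \<ge> 0" unfolding gmass_def by (rule integral_nonneg_AE) simp
  moreover have "gmass TYPE('a) \<noteq> 0"
  proof
    assume "gmass TYPE('a) = 0"
    then have "AE z in lborel. ?f z = 0" using integral_nonneg_eq_0_iff_AE[OF i] unfolding gmass_def by simp
    then have "AE z in (lborel::'a measure). False" by simp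
    then show False by (simp add: eventually_False ae_filter_eq_bot_iff)
  qed
  ultimately show ?thesis by linarith
qed

lemma gmass_nonzero [simp]: "gmass TYPE('a::euclidean_space) \<noteq> 0" "0 \<le> gmass TYPE('a)"
  using gmass_pos[where 'a='a] by linarith+

text \<open>The Gauss-Weierstrass kernel, extended by 0 to \<open>s \<le> 0\<close>.
  \<open>hk1\<close> and \<open>hk2\<close> are its first and second directional derivatives in
  \<open>y\<close>, expanded in the \<open>gs\<close> family so that the moment formulas apply to
  them.\<close>

definition hk :: "'a::euclidean_space \<Rightarrow> real \<Rightarrow> real" where
  "hk y s = gs (DIM('a) / 2) y s / gmass TYPE('a)"

definition hk1 :: "'a::euclidean_space \<Rightarrow> 'a \<Rightarrow> real \<Rightarrow> real" where
  "hk1 e y s = - (y \<bullet> e) / 2 * gs (DIM('a) / 2 + 1) y s / gmass TYPE('a)"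

definition hk2 :: "'a::euclidean_space \<Rightarrow> 'a \<Rightarrow> 'a \<Rightarrow> real \<Rightarrow> real" where
  "hk2 e e' y s = (- (e \<bullet> e') / 2 * gs (DIM('a) / 2 + 1) y s
     + (y \<bullet> e) * (y \<bullet> e') / 4 * gs (DIM('a) / 2 + 2) y s) / gmass TYPE('a)"

lemma hk_nonneg: "0 \<le> hk y s"
  by (simp add: hk_def gsq_nonneg)

lemma gs_deriv_dir: "((\<lambda>\<tau>. gs m (y + \<tau> *\<^sub>R e) s) has_real_derivative - (y \<bullet> e) / 2 * gs (m + 1) y s) (at 0)"
  using DERIV_chain'[OF norm_sq_line_deriv[of y e], of "\<lambda>q. gsq m q s", OF gsq_deriv_q] by simp

lemma hk_deriv: "((\<lambda>\<tau>. hk (y + \<tau> *\<^sub>R e) s) has_real_derivative hk1 e y s) (at 0)"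
  unfolding hk_def hk1_def by (intro DERIV_cdivide gs_deriv_dir)

lemma hk1_deriv: "((\<lambda>\<tau>. hk1 e (y + \<tau> *\<^sub>R e') s) has_real_derivative hk2 e e' y s) (at 0)"
proof -
  have "((\<lambda>\<tau>. - ((y + \<tau> *\<^sub>R e') \<bullet> e) / 2) has_real_derivative - (e' \<bullet> e) / 2) (at 0)"
    by (auto intro!: derivative_eq_intros simp: inner_add_left)
  from DERIV_mult[OF this gs_deriv_dir[of "DIM('a)/2 + 1" y e' s]]
  show ?thesis unfolding hk1_def hk2_def
    by (intro DERIV_cdivide) (simp add: inner_commute algebra_simps)
qed

text \<open>The heat equation of the kernel. It holds at \<open>s = 0\<close> as well when
  \<open>y \<noteq> 0\<close>, which lets integrals in time start at 0.\<close>

lemma hk_deriv_time: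
  assumes "y \<noteq> 0 \<or> s \<noteq> 0"
  shows "((\<lambda>s. hk y s) has_real_derivative (\<Sum>i\<in>Basis. hk2 i i y s)) (at s)"
proof -
  have "(\<Sum>i\<in>Basis. hk2 i i y s) = (- (DIM('a) / 2) * gs (DIM('a) / 2 + 1) y s + (norm y)\<^sup>2 / 4 * gs (DIM('a) / 2 + 2) y s) / gmass TYPE('a)"
    unfolding hk2_def sum_divide_distrib[symmetric] sum.distrib sum_distrib_right[symmetric]
    by (simp add: norm_sq_eq_sum[of y] sum_divide_distrib[symmetric] flip: power2_eq_square)
  then show ?thesis unfolding hk_def using DERIV_cdivide[OF gsq_deriv_s[of "(norm y)\<^sup>2" s "DIM('a)/2"], of "gmass TYPE('a)"] assms by simp
qed

lemma hk_measurable [measurable]: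
  "(\<lambda>p. hk (fst p) (snd p)) \<in> borel_measurable borel"
  "(\<lambda>p. hk1 e (fst p) (snd p)) \<in> borel_measurable borel"
  "(\<lambda>p. hk2 e e' (fst p) (snd p)) \<in> borel_measurable borel"
  unfolding hk_def hk1_def hk2_def by measurable

lemma hk_continuous: "continuous_on UNIV (\<lambda>y. hk y s)" "continuous_on UNIV (\<lambda>y. hk1 e y s)"
  "continuous_on UNIV (\<lambda>y. hk2 e e' y s)"
  unfolding hk_def hk1_def hk2_def gsq_def
  by (cases "0 < s"; auto intro!: continuous_intros)+

lemma hk_slice_measurable [measurable]:
  "(\<lambda>y. hk y s) \<in> borel_measurable borel" "(\<lambda>y. hk1 e y s) \<in> borel_measurable borel"
  "(\<lambda>y. hk2 e e' y s) \<in> borel_measurable borel"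
  by (auto intro: borel_measurable_continuous_onI hk_continuous)

lemma continuous_gs: "continuous_on (- {0}) (\<lambda>p. gs m (fst p) (snd p))"
  by (rule continuous_on_compose2[OF continuous_gsq, of _ "\<lambda>p. ((norm (fst p))\<^sup>2, snd p)", simplified])
    (auto intro!: continuous_intros simp: zero_prod_def)

lemma hk_cont: "continuous_on (- {0}) (\<lambda>p. hk (fst p) (snd p))"
   "continuous_on (- {0}) (\<lambda>p. hk2 e e' (fst p) (snd p))"
  unfolding hk_def hk2_def by (auto intro!: continuous_intros continuous_gs)

lemma hk_integral:
  assumes "0 < s"
  shows "integrable lborel (\<lambda>y::'a::euclidean_space. hk y s)" "(\<integral>y. hk (y::'a) s \<partial>lborel) = 1"
proof -
  have *: "integrable lborel (\<lambda>y::'a. 1 * gs (DIM('a) / 2) y s)"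
    "(\<integral>(y::'a). 1 * gs (DIM('a) / 2) y s \<partial>lborel) = s powr (DIM('a) / 2 + 0 / 2 - DIM('a) / 2) * (\<integral>(z::'a). 1 * exp (- (norm z)\<^sup>2 / 4) \<partial>lborel)"
    using assms by (intro gs_weight_integral[where k=0]; simp)+
  show "integrable lborel (\<lambda>y::'a. hk y s)" "(\<integral>y. hk (y::'a) s \<partial>lborel) = 1"
    unfolding hk_def using * assms gmass_nonzero(1)[where 'a='a] by (simp_all add: gmass_def[of "TYPE('a)"])
qed

definition hk1C :: "'a::euclidean_space itself \<Rightarrow> real" where "hk1C T = gmom T 1 / (2 * gmass T)"

text \<open>By scaling, one space derivative costs \<open>s powr (-1/2)\<close>, still integrable at
  0.\<close>

lemma hk1_bound:
  fixes e :: "'a::euclidean_space"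
  assumes s: "0 < s"
  shows "integrable lborel (\<lambda>y. hk1 e y s)" "(\<integral>y. \<bar>hk1 e y s\<bar> \<partial>lborel) \<le> hk1C TYPE('a) * norm e * s powr (-1/2)"
proof -
  let ?m = "DIM('a) / 2 + 1" and ?G = "gmass TYPE('a)"
  have *: "integrable lborel (\<lambda>y::'a. norm y * gs ?m y s)" "(\<integral>(y::'a). norm y * gs ?m y s \<partial>lborel) = s powr (-1/2) * gmom TYPE('a) 1"
    using gs_moment[of 1 s ?m, where 'a='a] s by (simp_all add: diff_divide_distrib)
  have b: "\<bar>hk1 e y s\<bar> \<le> norm e / (2 * ?G) * (norm y * gs ?m y s)" for y
  proof -
    have "\<bar>hk1 e y s\<bar> = \<bar>y \<bullet> e\<bar> * (gs ?m y s / (2 * ?G))" unfolding hk1_def by (simp add: abs_mult gsq_nonneg)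
    also have "\<dots> \<le> (norm y * norm e) * (gs ?m y s / (2 * ?G))"
      by (intro mult_right_mono Cauchy_Schwarz_ineq2) (simp add: gsq_nonneg)
    finally show ?thesis by (simp add: mult_ac)
  qed
  show i: "integrable lborel (\<lambda>y. hk1 e y s)"
    by (rule Bochner_Integration.integrable_bound[OF integrable_mult_right[OF *(1), of "norm e / (2 * ?G)"]], measurable)
      (unfold real_norm_def, intro AE_I2 order_trans[OF b abs_ge_self])
  have "(\<integral>y. \<bar>hk1 e y s\<bar> \<partial>lborel) \<le> (\<integral>(y::'a). norm e / (2 * ?G) * (norm y * gs ?m y s) \<partial>lborel)"
    using i *(1) b by (intro integral_mono integrable_abs integrable_mult_right) auto
  also have "\<dots> = hk1C TYPE('a) * norm e * s powr (-1/2)" using *(2) by (simp add: hk1C_def)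
  finally show "(\<integral>y. \<bar>hk1 e y s\<bar> \<partial>lborel) \<le> hk1C TYPE('a) * norm e * s powr (-1/2)" .
qed

lemma hk2_le:
  fixes i j :: "'a::euclidean_space"
  assumes "i \<in> Basis" "j \<in> Basis"
  shows "\<bar>hk2 i j y s\<bar> \<le> (gs (DIM('a) / 2 + 1) y s + norm y powr 2 * gs (DIM('a) / 2 + 2) y s) / gmass TYPE('a)"
proof -
  let ?m = "DIM('a) / 2"
  have n: "norm y powr 2 = (norm y)\<^sup>2" by (cases "y = 0") (auto simp: powr_numeral)
  have "\<bar>i \<bullet> j\<bar> \<le> 1" using assms by (simp add: inner_Basis)
  then have 1: "\<bar>- (i \<bullet> j) / 2 * gs (?m + 1) y s\<bar> \<le> 1 * gs (?m + 1) y s"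
    unfolding abs_mult by (intro mult_mono) (auto simp: gsq_nonneg)
  have "\<bar>y \<bullet> i\<bar> * \<bar>y \<bullet> j\<bar> \<le> norm y * norm y" using assms by (intro mult_mono Basis_le_norm) auto
  then have "\<bar>y \<bullet> i\<bar> * \<bar>y \<bullet> j\<bar> / 4 \<le> (norm y)\<^sup>2"
    unfolding power2_eq_square using zero_le_square[of "norm y"] by linarith
  then have 2: "\<bar>(y \<bullet> i) * (y \<bullet> j) / 4 * gs (?m + 2) y s\<bar> \<le> (norm y)\<^sup>2 * gs (?m + 2) y s"
    unfolding abs_mult abs_divide by (intro mult_mono) (auto simp: gsq_nonneg)
  show ?thesis
    unfolding hk2_def abs_divide n using 1 2
    by (intro frac_le) (auto intro: order_trans[OF abs_triangle_ineq] simp: gsq_nonneg)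
qed

lemma hk2_integrable:
  assumes s: "0 < s" and ij: "i \<in> Basis" "j \<in> Basis"
  shows "integrable lborel (\<lambda>y. hk2 i j (y::'a::euclidean_space) s)"
proof (rule Bochner_Integration.integrable_bound)
  let ?m = "DIM('a) / 2"
  have "integrable lborel (\<lambda>y::'a. 1 * gs (?m + 1) y s)"
    using s by (intro gs_weight_integral(1)[where k=0]) auto
  then show "integrable lborel (\<lambda>y::'a. (gs (?m + 1) y s + norm y powr 2 * gs (?m + 2) y s) / gmass TYPE('a))"
    using s by (intro Bochner_Integration.integrable_divide Bochner_Integration.integrable_add gs_moment(1)) auto
qed (measurable, unfold real_norm_def, intro AE_I2 order_trans[OF hk2_le[OF ij] abs_ge_self])

definition hk2C :: "'a::euclidean_space itself \<Rightarrow> real \<Rightarrow> real" where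
  "hk2C T \<theta> = (gmom T \<theta> + gmom T (\<theta> + 2)) / gmass T"

text \<open>Unweighted, the scaling would be \<open>1 / s\<close>, which is not integrable at 0; the
  weight \<open>norm y powr \<theta>\<close> gains the factor
  \<open>s powr (\<theta>/2)\<close>.\<close>

lemma hk2_bound:
  fixes i j :: "'a::euclidean_space"
  assumes th: "0 < \<theta>" "\<theta> \<le> 1" and s: "0 < s" and ij: "i \<in> Basis" "j \<in> Basis"
  shows "integrable lborel (\<lambda>y. norm y powr \<theta> * \<bar>hk2 i j y s\<bar>)"
    "(\<integral>y. norm y powr \<theta> * \<bar>hk2 i j y s\<bar> \<partial>lborel) \<le> hk2C TYPE('a) \<theta> * s powr (\<theta>/2 - 1)"
proof -
  let ?m = "DIM('a) / 2" and ?G = "gmass TYPE('a)"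
  let ?g = "\<lambda>y::'a. (norm y powr \<theta> * gs (?m + 1) y s + norm y powr (\<theta> + 2) * gs (?m + 2) y s) / ?G"
  note 1 = gs_moment[of \<theta> s "?m + 1", where 'a='a] and 2 = gs_moment[of "\<theta> + 2" s "?m + 2", where 'a='a]
  have b: "norm y powr \<theta> * \<bar>hk2 i j y s\<bar> \<le> ?g y" for y
    using mult_left_mono[OF hk2_le[OF ij, of y s], of "norm y powr \<theta>"] by (simp add: powr_add algebra_simps)
  have ig: "integrable lborel ?g"
    using th s by (intro Bochner_Integration.integrable_divide Bochner_Integration.integrable_add gs_moment(1)) auto
  show i: "integrable lborel (\<lambda>y. norm y powr \<theta> * \<bar>hk2 i j y s\<bar>)"
    by (rule Bochner_Integration.integrable_bound[OF ig], measurable)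
      (intro AE_I2, unfold real_norm_def, use order_trans[OF b abs_ge_self] in \<open>simp add: abs_mult\<close>)
  have "(\<integral>y. norm y powr \<theta> * \<bar>hk2 i j y s\<bar> \<partial>lborel) \<le> (\<integral>y. ?g y \<partial>lborel)"
    by (rule integral_mono[OF i ig], rule b)
  also have "\<dots> = (s powr (\<theta>/2 - 1) * gmom TYPE('a) \<theta> + s powr (\<theta>/2 - 1) * gmom TYPE('a) (\<theta> + 2)) / ?G"
    using 1 2 th s by (simp add: add_divide_distrib)
  finally show "(\<integral>y. norm y powr \<theta> * \<bar>hk2 i j y s\<bar> \<partial>lborel) \<le> hk2C TYPE('a) \<theta> * s powr (\<theta>/2 - 1)"
    by (simp add: hk2C_def algebra_simps)
qed

text \<open>The convolution of \<open>hk1\<close> with the constant 1 does not depend on the point,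
  and its derivative is the integral in question.\<close>

lemma hk2_integral_zero:
  assumes "0 < s" "i \<in> Basis" "j \<in> Basis"
  shows "(\<integral>y. hk2 i j (y::'a::euclidean_space) s \<partial>lborel) = 0"
proof -
  have "((\<lambda>h. convol (\<lambda>y. hk1 i y s) (\<lambda>_. 1) (0 + h *\<^sub>R j)) has_real_derivative
      convol (\<lambda>y. hk2 i j y s) (\<lambda>_. 1) (0 + 0 *\<^sub>R j)) (at 0)"
    by (rule DERIV_convol[where B=1]) (use hk1_bound(1)[OF assms(1)] hk2_integrable[OF assms] hk_continuous hk1_deriv in auto)
  then have "((\<lambda>h::real. (\<integral>y. hk1 i y s \<partial>lborel)) has_real_derivative (\<integral>y. hk2 i j y s \<partial>lborel)) (at 0)"
    by (simp add: convol_def)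
  then show ?thesis using DERIV_unique[OF _ DERIV_const] by blast
qed

section \<open>Heat potentials of space-time sources and their space derivatives\<close>

lemma set_integrable_powr:
  assumes "a > -1"
  shows "integrable lborel (\<lambda>s::real. indicator {0<..<1} s * s powr a)"
proof (rule integrableI_bounded)
  have i: "(\<lambda>s::real. s powr a) integrable_on {0..1}"
    using integrable_on_powr_from_0[OF assms, of 1] by simp
  have "(\<lambda>s::real. indicator {0..1} s * s powr a) integrable_on UNIV"
  proof -
    have "(\<lambda>s::real. indicator {0..1} s * s powr a) = (\<lambda>s. if s \<in> {0..1} then s powr a else 0)"
      by (auto simp: indicator_def)
    then show ?thesis using i by (simp only: integrable_restrict_UNIV)
  qed
  then obtain I where I: "((\<lambda>s::real. indicator {0..1} s * s powr a) has_integral I) UNIV" by blast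
  have "(\<integral>\<^sup>+ s. ennreal (norm (indicator {0<..<1} s * s powr a)) \<partial>lborel) \<le> (\<integral>\<^sup>+ s. ennreal (indicator {0..1} s * s powr a) \<partial>lborel)"
    by (intro nn_integral_mono) (auto split: split_indicator)
  also have "\<dots> = I" by (rule nn_integral_has_integral_lborel[OF _ _ I]) auto
  finally show "(\<integral>\<^sup>+ s. ennreal (norm (indicator {0<..<1} s * s powr a)) \<partial>lborel) < \<infinity>"
    by (simp add: order_le_less_trans)
qed measurable

lemma integrable_by_slices:
  fixes k :: "'a::euclidean_space \<times> real \<Rightarrow> real"
  assumes m: "k \<in> borel_measurable borel"
    and i: "\<And>s. integrable lborel (\<lambda>y. k (y, s))"
    and g: "\<And>s. (\<integral>y. \<bar>k (y, s)\<bar> \<partial>lborel) \<le> g s" "integrable lborel g"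
  shows "integrable lborel k" "(\<integral>p. k p \<partial>lborel) = (\<integral>s. (\<integral>y. k (y, s) \<partial>lborel) \<partial>lborel)"
    "integrable lborel (\<lambda>s. \<integral>y. k (y, s) \<partial>lborel)"
proof -
  have [measurable]: "k \<in> borel_measurable (borel \<Otimes>\<^sub>M borel)" using m unfolding borel_prod .
  have "integrable (lborel \<Otimes>\<^sub>M lborel) (\<lambda>(s, y). k (y, s))"
    by (rule integrable_pair_bound[OF _ i g]) measurable
  then have I: "integrable (lborel \<Otimes>\<^sub>M lborel) k"
    using lborel_pair.integrable_product_swap_iff[of "\<lambda>(s, y). k (y, s)"] by simp
  then show "integrable lborel k" unfolding lborel_prod .
  have I': "integrable (lborel \<Otimes>\<^sub>M lborel) (case_prod (\<lambda>y s. k (y, s)))" using I by simp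
  show "integrable lborel (\<lambda>s. \<integral>y. k (y, s) \<partial>lborel)" using lborel_pair.integrable_snd[OF I'] .
  show "(\<integral>p. k p \<partial>lborel) = (\<integral>s. (\<integral>y. k (y, s) \<partial>lborel) \<partial>lborel)"
    using lborel_pair.integral_snd[OF I'] unfolding lborel_prod by simp
qed

text \<open>Cutting at time 1 makes the kernel integrable over space-time. For sources that vanish
  at times \<open>t \<le> 0\<close> and evaluation times below 1 the cut is invisible, since lags of
  1 or more hit the source before time 0.\<close>

definition hkE :: "'a::euclidean_space \<times> real \<Rightarrow> real" where
  "hkE q = (if snd q < 1 then hk (fst q) (snd q) else 0)"

lemma hk_nonpos [simp]: "s \<le> 0 \<Longrightarrow> hk y s = 0" "s \<le> 0 \<Longrightarrow> hk1 e y s = 0" "s \<le> 0 \<Longrightarrow> hk2 e e' y s = 0"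
  by (simp_all add: hk_def hk1_def hk2_def gsq_def)

lemma hkE_measurable [measurable]: "hkE \<in> borel_measurable borel"
  unfolding hkE_def by measurable

lemma hkE_nonneg: "0 \<le> hkE q"
  by (simp add: hkE_def hk_nonneg)

lemma integrable_hkE: "integrable lborel (hkE :: 'a::euclidean_space \<times> real \<Rightarrow> real)"
proof (rule integrable_by_slices(1))
  show "integrable lborel (\<lambda>y::'a. hkE (y, s))" for s
    by (cases "0 < s \<and> s < 1") (auto simp: hkE_def hk_integral)
  show "(\<integral>(y::'a). \<bar>hkE (y, s)\<bar> \<partial>lborel) \<le> indicator {0<..<1} s" for s
    by (cases "0 < s"; cases "s < 1") (auto simp: hkE_def hk_integral hk_nonneg)
  show "integrable lborel (indicator {0<..<1} :: real \<Rightarrow> real)"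
    by (intro integrable_real_indicator) auto
qed measurable

lemma AE_snd_neq: "AE q in lborel. snd (q::'a::euclidean_space \<times> real) \<noteq> c"
proof -
  have "negligible {q::'a \<times> real. (0, 1) \<bullet> q = c}" by (rule negligible_hyperplane) (simp add: zero_prod_def)
  moreover have "{q::'a \<times> real. (0, 1) \<bullet> q = c} = {q. snd q = c}" by (auto simp: inner_prod_def)
  ultimately have n: "{q::'a \<times> real. snd q = c} \<in> null_sets lebesgue" by (simp add: negligible_iff_null_sets)
  have "closed {q::'a \<times> real. snd q = c}" by (intro closed_Collect_eq continuous_intros)
  then have "{q::'a \<times> real. snd q = c} \<in> null_sets lborel"
    using n by (subst (asm) null_sets_completion_iff) auto
  then show ?thesis by (rule AE_I') auto
qed

lemma hkE_isCont: "AE q in lborel. isCont (hkE :: 'a::euclidean_space \<times> real \<Rightarrow> real) q"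
  using AE_snd_neq[of 0] AE_snd_neq[of 1]
proof eventually_elim
  case (elim q)
  have *: "isCont hkE q" if "open S" "q \<in> S" "continuous_on S hkE" for S :: "('a \<times> real) set"
    using that continuous_on_eq_continuous_at by blast
  consider "snd q < 0" | "0 < snd q" "snd q < 1" | "1 < snd q" using elim by linarith
  then show ?case
  proof cases
    case 1
    then show ?thesis
      by (intro *[of "UNIV \<times> {..<0}", OF _ _ continuous_on_eq[of _ "\<lambda>_. 0"]]) (auto simp: hkE_def mem_Times_iff intro!: open_Times)
  next
    case 2
    then show ?thesis
      by (intro *[of "UNIV \<times> {0<..<1}", OF _ _ continuous_on_eq[OF continuous_on_subset[OF hk_cont(1)]]]) (auto simp: hkE_def mem_Times_iff intro!: open_Times)
  next
    case 3
    then show ?thesis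
      by (intro *[of "UNIV \<times> {1<..}", OF _ _ continuous_on_eq[of _ "\<lambda>_. 0"]]) (auto simp: hkE_def mem_Times_iff intro!: open_Times)
  qed
qed

lemma abs_mult_le_bound:
  fixes a b B :: real
  assumes "\<bar>b\<bar> \<le> B"
  shows "\<bar>a * b\<bar> \<le> B * \<bar>a\<bar>"
  using mult_right_mono[OF assms, of "\<bar>a\<bar>"] by (simp add: abs_mult mult.commute)

lemma integrable_powr_weight:
  assumes "a > -1"
  shows "integrable lborel (\<lambda>s::real. indicator {0<..<1} s * (c * s powr a))"
  using integrable_mult_right[OF set_integrable_powr[OF assms], of c] by (simp add: mult_ac)

text \<open>The contribution of the time lag \<open>s\<close> to a space-time convolution. Treating
  the lags one by one also admits kernels such as \<open>hk2\<close>, which are integrable in space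
  for each lag but not over space-time.\<close>

definition slice_pot :: "('a::euclidean_space \<Rightarrow> real \<Rightarrow> real) \<Rightarrow> ('a \<times> real \<Rightarrow> real) \<Rightarrow> real \<Rightarrow> 'a \<times> real \<Rightarrow> real" where
  "slice_pot k H s p = indicator {0<..<1} s * convol (\<lambda>y. k y s) (\<lambda>z. H (z, snd p - s)) (fst p)"

context
  fixes H :: "'a::euclidean_space \<times> real \<Rightarrow> real" and B :: real
  assumes Hm[measurable]: "H \<in> borel_measurable borel" and HB: "\<And>p. \<bar>H p\<bar> \<le> B"
begin

lemma H_slice_measurable [measurable]: "(\<lambda>z. H (z, s)) \<in> borel_measurable borel"
proof -
  have "(\<lambda>z::'a. (z, s)) \<in> borel_measurable borel"
    by (intro borel_measurable_continuous_onI continuous_intros)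
  from measurable_compose[OF this Hm] show ?thesis .
qed

lemma slice_pot_integrable:
  fixes k :: "'a \<Rightarrow> real \<Rightarrow> real"
  assumes [measurable]: "(\<lambda>p. k (fst p) (snd p)) \<in> borel_measurable borel"
    and k: "\<And>s. 0 < s \<Longrightarrow> integrable lborel (\<lambda>y. k y s)"
    and g: "\<And>s. 0 < s \<Longrightarrow> (\<integral>y. \<bar>k y s\<bar> \<partial>lborel) \<le> g s" "integrable lborel (\<lambda>s. indicator {0<..<1} s * g s)"
  shows "integrable lborel (\<lambda>s. slice_pot k H s p)" (is ?th1)
    "convol (\<lambda>q. indicator {0<..<1} (snd q) * k (fst q) (snd q)) H p = (\<integral>s. slice_pot k H s p \<partial>lborel)" (is ?th2)
    "\<And>s. \<bar>slice_pot k H s p\<bar> \<le> indicator {0<..<1} s * (B * g s)" 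
proof -
  define K where "K q = (indicator {0<..<1} (snd q) * k (fst q) (snd q)) * H (p - q)" for q
  have B0: "0 \<le> B" using HB[of undefined] by linarith
  have Km: "K \<in> borel_measurable borel" unfolding K_def by measurable
  have bnd: "\<bar>convol (\<lambda>y. k y s) (\<lambda>z. H (z, snd p - s)) (fst p)\<bar> \<le> B * (\<integral>y. \<bar>k y s\<bar> \<partial>lborel)" if "0 < s" for s
    using k[OF that] by (rule convol_bound) (auto intro: HB)
  show 3: "\<bar>slice_pot k H s p\<bar> \<le> indicator {0<..<1} s * (B * g s)" for s
    using bnd[of s] g(1)[of s] mult_left_mono[OF g(1)[of s] B0] unfolding slice_pot_def
    by (auto split: split_indicator)
  have eq: "(\<integral>y. K (y, s) \<partial>lborel) = slice_pot k H s p" for s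
    unfolding K_def slice_pot_def convol_def by (cases p) (simp add: mult.assoc)
  have i: "integrable lborel (\<lambda>y. K (y, s))" for s
  proof (cases "0 < s \<and> s < 1")
    case True
    then have "integrable lborel (\<lambda>y. k y s * H (fst p - y, snd p - s))"
      by (intro integrable_mult_bounded[OF k _ HB]) auto
    then show ?thesis unfolding K_def using True by (cases p) simp
  qed (auto simp: K_def)
  have b: "(\<integral>y. \<bar>K (y, s)\<bar> \<partial>lborel) \<le> B * (indicator {0<..<1} s * g s)" for s
  proof (cases "0 < s \<and> s < 1")
    case True
    have "(\<integral>y. \<bar>K (y, s)\<bar> \<partial>lborel) \<le> (\<integral>y. B * \<bar>k y s\<bar> \<partial>lborel)"
    proof (rule integral_mono)
      show "integrable lborel (\<lambda>y. \<bar>K (y, s)\<bar>)" by (rule integrable_abs[OF i])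
      show "integrable lborel (\<lambda>y. B * \<bar>k y s\<bar>)" using k[of s] True by simp
      show "\<bar>K (y, s)\<bar> \<le> B * \<bar>k y s\<bar>" for y
        using abs_mult_le_bound[OF HB, of "k y s" "p - (y, s)"] True by (simp add: K_def)
    qed
    also have "\<dots> \<le> B * g s" using mult_left_mono[OF g(1)[of s] B0] True by simp
    finally show ?thesis using True by simp
  qed (auto simp: K_def)
  have "integrable lborel (\<lambda>s. B * (indicator {0<..<1} s * g s))" using g(2) by simp
  from integrable_by_slices(2,3)[OF Km i b this]
  show ?th1 ?th2 unfolding eq by (simp_all add: convol_def K_def)
qed

lemma hkE_slice: 
  "integrable lborel (\<lambda>s. slice_pot hk H s p)"
  "convol hkE H p = (\<integral>s. slice_pot hk H s p \<partial>lborel)"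
proof -
  have 1: "integrable lborel (\<lambda>s::real. indicator {0<..<1} s * (1::real))" 
    by (simp add: integrable_real_indicator)
  have e: "hkE = (\<lambda>q::'a \<times> real. indicator {0<..<1} (snd q) * hk (fst q) (snd q))"
    by (auto simp: hkE_def fun_eq_iff split: split_indicator)
  show "integrable lborel (\<lambda>s. slice_pot hk H s p)"
    by (rule slice_pot_integrable(1)[where g="\<lambda>_. 1"]) (use 1 in \<open>auto simp: hk_integral hk_nonneg\<close>)
  show "convol hkE H p = (\<integral>s. slice_pot hk H s p \<partial>lborel)" unfolding e
    by (rule slice_pot_integrable(2)[where g="\<lambda>_. 1"]) (use 1 in \<open>auto simp: hk_integral hk_nonneg\<close>)
qed

lemma continuous_heat_potential: "continuous_on S (convol hkE H)"
  by (rule continuous_on_convol[OF integrable_hkE hkE_isCont Hm HB])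

lemma heat_potential_bound: "\<bar>convol hkE H p\<bar> \<le> B * (\<integral>q. \<bar>hkE (q::'a \<times> real)\<bar> \<partial>lborel)"
  by (rule convol_bound[OF integrable_hkE Hm HB])

text \<open>No regularity of \<open>H\<close> enters: the contribution of the lag \<open>s\<close>
  is Lipschitz in space with a constant of order \<open>s powr (-1/2)\<close>, and these constants
  are integrable over the lags.\<close>

lemma heat_potential_lipschitz:
  "\<exists>C\<ge>0. \<forall>x x' t. \<bar>convol hkE H (x, t) - convol hkE H (x', t)\<bar> \<le> C * norm (x - x')"
proof -
  let ?C = "hk1C TYPE('a)"
  have B0: "0 \<le> B" using HB[of undefined] by linarith
  define I where "I = (\<integral>(s::real). indicator {0<..<1} s * s powr (-1/2) \<partial>lborel)"
  have i: "integrable lborel (\<lambda>s::real. indicator {0<..<1} s * s powr (-1/2))" by (rule set_integrable_powr) simp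
  have I0: "I \<ge> 0" unfolding I_def by (rule integral_nonneg_AE) simp
  show ?thesis
  proof (rule exI[of _ "B * ?C * I"], intro conjI allI)
    show "B * ?C * I \<ge> 0" using B0 I0 by (simp add: hk1C_def gmom_nonneg)
    fix x x' :: 'a and t
    define e where "e = x - x'"
    have sl: "\<bar>slice_pot hk H s (x, t) - slice_pot hk H s (x', t)\<bar> \<le> (B * ?C * norm e) * (indicator {0<..<1} s * s powr (-1/2))" for s
    proof (cases "0 < s \<and> s < 1")
      case True
      have "\<bar>convol (\<lambda>y. hk y s) (\<lambda>z. H (z, t - s)) (x' + e) - convol (\<lambda>y. hk y s) (\<lambda>z. H (z, t - s)) x'\<bar> \<le> B * (\<integral>y. \<bar>hk1 e y s\<bar> \<partial>lborel)"
        by (rule convol_lipschitz) (use True in \<open>auto intro: hk_integral hk1_bound(1) hk_continuous hk_deriv HB\<close>)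
      also have "\<dots> \<le> B * (?C * norm e * s powr (-1/2))" using True by (intro mult_left_mono hk1_bound(2) B0) auto
      finally show ?thesis using True by (simp add: slice_pot_def e_def mult_ac)
    qed (auto simp: slice_pot_def)
    have "\<bar>convol hkE H (x, t) - convol hkE H (x', t)\<bar> = \<bar>\<integral>s. slice_pot hk H s (x, t) - slice_pot hk H s (x', t) \<partial>lborel\<bar>"
      unfolding hkE_slice(2) by (subst Bochner_Integration.integral_diff) (auto intro: hkE_slice)
    also have "\<dots> \<le> (\<integral>s. \<bar>slice_pot hk H s (x, t) - slice_pot hk H s (x', t)\<bar> \<partial>lborel)"
      using integral_norm_bound[of lborel "\<lambda>s. slice_pot hk H s (x, t) - slice_pot hk H s (x', t)"] by simp
    also have "\<dots> \<le> (\<integral>s. (B * ?C * norm e) * (indicator {0<..<1} s * s powr (-1/2)) \<partial>lborel)"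
      by (intro integral_mono integrable_abs Bochner_Integration.integrable_diff hkE_slice integrable_mult_right i sl)
    also have "\<dots> = B * ?C * I * norm (x - x')" unfolding I_def e_def by simp
    finally show "\<bar>convol hkE H (x, t) - convol hkE H (x', t)\<bar> \<le> B * ?C * I * norm (x - x')" .
  qed
qed

lemma hk1_slice:
  shows "integrable lborel (\<lambda>s. slice_pot (hk1 i) H s p)"
    "\<bar>slice_pot (hk1 i) H s p\<bar> \<le> indicator {0<..<1} s * (B * (hk1C TYPE('a) * norm i * s powr (-1/2)))"
proof -
  have i: "integrable lborel (\<lambda>s::real. indicator {0<..<1} s * (hk1C TYPE('a) * norm i * s powr (-1/2)))"
    by (rule integrable_powr_weight) simp
  have m: "(\<lambda>p::'a \<times> real. hk1 i (fst p) (snd p)) \<in> borel_measurable borel" by measurable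
  show "integrable lborel (\<lambda>s. slice_pot (hk1 i) H s p)"
    "\<bar>slice_pot (hk1 i) H s p\<bar> \<le> indicator {0<..<1} s * (B * (hk1C TYPE('a) * norm i * s powr (-1/2)))"
    by (rule slice_pot_integrable(1,3)[OF m hk1_bound i]; assumption)+
qed

end

definition pot1 :: "('a::euclidean_space \<times> real \<Rightarrow> real) \<Rightarrow> 'a \<Rightarrow> 'a \<times> real \<Rightarrow> real" where
  "pot1 H i p = (\<integral>s. slice_pot (hk1 i) H s p \<partial>lborel)"

text \<open>An iterated integral on purpose: the integral in space comes first, because the
  cancellation in it is what makes the integral over the lags converge.\<close>

definition pot2 :: "('a::euclidean_space \<times> real \<Rightarrow> real) \<Rightarrow> 'a \<Rightarrow> 'a \<Rightarrow> 'a \<times> real \<Rightarrow> real" where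
  "pot2 H i j p = (\<integral>s. slice_pot (hk2 i j) H s p \<partial>lborel)"

context
  fixes H :: "'a::euclidean_space \<times> real \<Rightarrow> real" and A B \<theta> :: real
  assumes Hc: "continuous_on UNIV H" and HB: "\<And>p. \<bar>H p\<bar> \<le> B"
    and th: "0 < \<theta>" "\<theta> \<le> 1" and holder: "\<And>x x' t. \<bar>H (x, t) - H (x', t)\<bar> \<le> A * norm (x - x') powr \<theta>"
begin

lemma H_borel: "H \<in> borel_measurable borel"
  using Hc by (rule borel_measurable_continuous_onI)

lemma A_nonneg: "A \<ge> 0"
proof -
  obtain b :: 'a where "b \<in> Basis" using nonempty_Basis by blast
  then have "\<bar>H (b, 0) - H (0, 0)\<bar> \<le> A" using holder[of b 0 0] by simp
  then show ?thesis by linarith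
qed

lemma continuous_slice_pot:
  assumes k: "\<And>s. 0 < s \<Longrightarrow> integrable lborel (\<lambda>y. k y s)"
  shows "continuous_on S (slice_pot k H s)"
proof (cases "0 < s \<and> s < 1")
  case True
  then have i: "integrable lborel (\<lambda>y. k y s)" using k by simp
  then have [measurable]: "(\<lambda>y. k y s) \<in> borel_measurable borel" by simp
  have "continuous_on S (\<lambda>p. \<integral>y. k y s * H (fst p - y, snd p - s) \<partial>lborel)"
  proof (rule continuous_on_integral_dominated[where g = "\<lambda>y. B * \<bar>k y s\<bar>"])
    show "continuous_on S (\<lambda>p. k y s * H (fst p - y, snd p - s))" for y
      by (intro continuous_intros continuous_on_compose2[OF Hc]) auto
    have [measurable]: "(\<lambda>y. H (fst p - y, snd p - s)) \<in> borel_measurable borel" for p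
      by (intro borel_measurable_continuous_onI continuous_on_compose2[OF Hc] continuous_intros) auto
    show "(\<lambda>y. k y s * H (fst p - y, snd p - s)) \<in> borel_measurable lborel" for p by measurable
    show "\<bar>k y s * H (fst p - y, snd p - s)\<bar> \<le> B * \<bar>k y s\<bar>" for p y
      by (rule abs_mult_le_bound[OF HB])
    show "integrable lborel (\<lambda>y. B * \<bar>k y s\<bar>)" using i by simp
  qed
  then show ?thesis using True by (simp add: slice_pot_def convol_def)
qed (auto simp: slice_pot_def)

lemma pot_continuous:
  assumes "\<And>s. 0 < s \<Longrightarrow> integrable lborel (\<lambda>y. k y s)" "\<And>p. integrable lborel (\<lambda>s. slice_pot k H s p)"
    and "\<And>p s. \<bar>slice_pot k H s p\<bar> \<le> g s" "integrable lborel g"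
  shows "continuous_on S (\<lambda>p. \<integral>s. slice_pot k H s p \<partial>lborel)"
  by (rule continuous_on_integral_dominated[where g=g]) (use assms continuous_slice_pot[of k] in auto)

lemma slice_pot_DERIV:
  assumes "\<And>s. 0 < s \<Longrightarrow> integrable lborel (\<lambda>y. k y s)" "\<And>s. 0 < s \<Longrightarrow> integrable lborel (\<lambda>y. k' y s)"
    and "\<And>s. continuous_on UNIV (\<lambda>y. k' y s)"
    and "\<And>y s. 0 < s \<Longrightarrow> ((\<lambda>\<tau>. k (y + \<tau> *\<^sub>R e) s) has_real_derivative k' y s) (at 0)"
  shows "((\<lambda>h. slice_pot k H s (x + h *\<^sub>R e, t)) has_real_derivative slice_pot k' H s (x + h *\<^sub>R e, t)) (at h)"
proof (cases "0 < s \<and> s < 1")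
  case True
  have "((\<lambda>h. convol (\<lambda>y. k y s) (\<lambda>z. H (z, t - s)) (x + h *\<^sub>R e)) has_real_derivative
      convol (\<lambda>y. k' y s) (\<lambda>z. H (z, t - s)) (x + h *\<^sub>R e)) (at h)"
    by (rule DERIV_convol[where B=B]) (use True assms HB H_slice_measurable[OF H_borel HB] in auto)
  then show ?thesis using True by (simp add: slice_pot_def)
qed (auto simp: slice_pot_def)

lemma pot_DERIV:
  assumes k: "\<And>s. 0 < s \<Longrightarrow> integrable lborel (\<lambda>y. k y s)" "\<And>s. 0 < s \<Longrightarrow> integrable lborel (\<lambda>y. k' y s)"
    and "\<And>s. continuous_on UNIV (\<lambda>y. k' y s)"
    and "\<And>y s. 0 < s \<Longrightarrow> ((\<lambda>\<tau>. k (y + \<tau> *\<^sub>R e) s) has_real_derivative k' y s) (at 0)"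
    and "\<And>p. integrable lborel (\<lambda>s. slice_pot k H s p)" "\<And>p s. \<bar>slice_pot k' H s p\<bar> \<le> g s" "integrable lborel g"
  shows "((\<lambda>h. \<integral>s. slice_pot k H s (x + h *\<^sub>R e, t) \<partial>lborel) has_real_derivative (\<integral>s. slice_pot k' H s (x, t) \<partial>lborel)) (at 0)"
proof -
  have "((\<lambda>h. \<integral>s. slice_pot k H s (x + h *\<^sub>R e, t) \<partial>lborel) has_real_derivative (\<integral>s. slice_pot k' H s (x + 0 *\<^sub>R e, t) \<partial>lborel)) (at 0)"
    by (rule DERIV_integral_dominated[OF zero_less_one _ _ assms(6,7)]) (rule assms slice_pot_DERIV | assumption)+
  then show ?thesis by simp
qed

text \<open>The second derivatives of the kernel are not integrable up to time \<open>0\<close>. Their integral over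
  space vanishes, so the value of the density at the evaluation point may be subtracted, and Hoelder
  continuity restores integrability.\<close>

lemma convol_hk2_diff:
  assumes s: "0 < s" and ij: "i \<in> Basis" "j \<in> Basis"
  shows "integrable lborel (\<lambda>y. hk2 i j y s * (H (x - y, \<tau>) - H (x, \<tau>)))"
    "convol (\<lambda>y. hk2 i j y s) (\<lambda>z. H (z, \<tau>)) x = (\<integral>y. hk2 i j y s * (H (x - y, \<tau>) - H (x, \<tau>)) \<partial>lborel)"
proof -
  note i1 = convol_integrable[OF hk2_integrable[OF assms] H_slice_measurable[OF H_borel HB] HB, of x \<tau>]
  have i2: "integrable lborel (\<lambda>y. hk2 i j y s * H (x, \<tau>))"
    by (intro integrable_mult_left hk2_integrable assms)
  show "integrable lborel (\<lambda>y. hk2 i j y s * (H (x - y, \<tau>) - H (x, \<tau>)))"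
    unfolding right_diff_distrib by (intro Bochner_Integration.integrable_diff i1 i2)
  show "convol (\<lambda>y. hk2 i j y s) (\<lambda>z. H (z, \<tau>)) x = (\<integral>y. hk2 i j y s * (H (x - y, \<tau>) - H (x, \<tau>)) \<partial>lborel)"
    unfolding right_diff_distrib using i1 i2 hk2_integral_zero[OF assms]
    by (subst Bochner_Integration.integral_diff) (auto simp: convol_def)
qed

lemma hk2_diff_bound:
  assumes s: "0 < s" and ij: "i \<in> Basis" "j \<in> Basis"
  shows "(\<integral>y. \<bar>hk2 i j y s * (H (x - y, \<tau>) - H (x, \<tau>))\<bar> \<partial>lborel) \<le> A * hk2C TYPE('a) \<theta> * s powr (\<theta>/2 - 1)"
proof -
  have "(\<integral>y. \<bar>hk2 i j y s * (H (x - y, \<tau>) - H (x, \<tau>))\<bar> \<partial>lborel) \<le> (\<integral>y. A * (norm y powr \<theta> * \<bar>hk2 i j y s\<bar>) \<partial>lborel)"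
  proof (rule integral_mono[OF integrable_abs[OF convol_hk2_diff(1)[OF assms]] integrable_mult_right[OF hk2_bound(1)[OF th assms]]])
    fix y :: 'a
    have "\<bar>hk2 i j y s\<bar> * \<bar>H (x - y, \<tau>) - H (x, \<tau>)\<bar> \<le> \<bar>hk2 i j y s\<bar> * (A * norm y powr \<theta>)"
      using holder[of "x - y" \<tau> x] by (intro mult_left_mono) auto
    then show "\<bar>hk2 i j y s * (H (x - y, \<tau>) - H (x, \<tau>))\<bar> \<le> A * (norm y powr \<theta> * \<bar>hk2 i j y s\<bar>)"
      by (simp add: abs_mult mult_ac)
  qed
  also have "\<dots> \<le> A * (hk2C TYPE('a) \<theta> * s powr (\<theta>/2 - 1))"
    unfolding integral_mult_right_zero by (intro mult_left_mono hk2_bound(2)[OF th assms] A_nonneg)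
  finally show ?thesis by (simp add: mult.assoc)
qed

lemma hk2_slice:
  assumes ij: "i \<in> Basis" "j \<in> Basis"
  shows "0 < s \<Longrightarrow> \<bar>convol (\<lambda>y. hk2 i j y s) (\<lambda>z. H (z, \<tau>)) x\<bar> \<le> A * hk2C TYPE('a) \<theta> * s powr (\<theta>/2 - 1)"
    "\<bar>slice_pot (hk2 i j) H s p\<bar> \<le> indicator {0<..<1} s * (A * hk2C TYPE('a) \<theta> * s powr (\<theta>/2 - 1))"
    "integrable lborel (\<lambda>s. slice_pot (hk2 i j) H s p)"
proof -
  show *: "\<bar>convol (\<lambda>y. hk2 i j y s) (\<lambda>z. H (z, \<tau>)) x\<bar> \<le> A * hk2C TYPE('a) \<theta> * s powr (\<theta>/2 - 1)" if "0 < s" for s \<tau> x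
    unfolding convol_hk2_diff(2)[OF that ij] by (rule order_trans[OF integral_abs_bound hk2_diff_bound[OF that ij]])
  show "\<bar>slice_pot (hk2 i j) H s p\<bar> \<le> indicator {0<..<1} s * (A * hk2C TYPE('a) \<theta> * s powr (\<theta>/2 - 1))"
    using * by (auto simp: slice_pot_def split: split_indicator)
  \<comment> \<open>Subtracting \<open>H\<close> at the fixed space point makes the integrand
    jointly integrable without changing its space integrals; Fubini's theorem then gives
    measurability and integrability of the slices in \<open>s\<close>.\<close>
  define K where "K q = indicator {0<..<1} (snd q) * hk2 i j (fst q) (snd q) * (H (p - q) - H (fst p, snd p - snd q))" for q
  note [measurable] = H_borel
  have [measurable]: "(\<lambda>q. H (fst p, snd p - snd q)) \<in> borel_measurable (borel :: ('a \<times> real) measure)"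
    by (intro borel_measurable_continuous_onI continuous_on_compose2[OF Hc] continuous_intros) auto
  have eq: "(\<integral>y. K (y, s) \<partial>lborel) = slice_pot (hk2 i j) H s p" for s
    unfolding K_def slice_pot_def by (cases p; cases "0 < s") (auto simp: convol_hk2_diff(2) ij mult.assoc)
  have "integrable lborel (\<lambda>s. \<integral>y. K (y, s) \<partial>lborel)"
  proof (rule integrable_by_slices(3))
    show "K \<in> borel_measurable borel" unfolding K_def by measurable
    show "integrable lborel (\<lambda>y. K (y, s))" for s
      using convol_hk2_diff(1)[of s i j "fst p" "snd p - s"] ij
      by (cases p; cases "0 < s \<and> s < 1") (auto simp: K_def)
    show "(\<integral>y. \<bar>K (y, s)\<bar> \<partial>lborel) \<le> indicator {0<..<1} s * (A * hk2C TYPE('a) \<theta> * s powr (\<theta>/2 - 1))" for s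
      using hk2_diff_bound[of s i j "fst p" "snd p - s"] ij
      by (cases p; cases "0 < s \<and> s < 1") (auto simp: K_def)
  qed (use th in \<open>intro integrable_powr_weight, auto\<close>)
  then show "integrable lborel (\<lambda>s. slice_pot (hk2 i j) H s p)" unfolding eq .
qed

lemma hk1_weight: "integrable lborel (\<lambda>s::real. indicator {0<..<1} s * (B * (hk1C TYPE('a) * norm i * s powr (-1/2))))"
  using integrable_powr_weight[of "-1/2" "B * (hk1C TYPE('a) * norm i)"] by (simp add: mult.assoc)

lemma pot_DERIV1: "((\<lambda>h. convol hkE H (x + h *\<^sub>R i, t)) has_real_derivative pot1 H i (x, t)) (at 0)"
  unfolding hkE_slice(2)[OF H_borel HB] pot1_def
  by (rule pot_DERIV[OF _ hk1_bound(1) _ hk_deriv hkE_slice(1)[OF H_borel HB] hk1_slice(2)[OF H_borel HB] hk1_weight])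
    (auto intro: hk_integral hk_continuous)

lemma pot_DERIV2:
  assumes ij: "i \<in> Basis" "j \<in> Basis"
  shows "((\<lambda>h. pot1 H i (x + h *\<^sub>R j, t)) has_real_derivative pot2 H i j (x, t)) (at 0)"
  unfolding pot1_def pot2_def
  by (rule pot_DERIV[OF hk1_bound(1) hk2_integrable[OF _ ij] _ hk1_deriv hk1_slice(1)[OF H_borel HB] hk2_slice(2)[OF ij] integrable_powr_weight])
    (use th in \<open>auto intro: hk_continuous\<close>)

lemma continuous_pot1: "continuous_on S (pot1 H i)"
  unfolding pot1_def[abs_def]
  by (rule pot_continuous[OF hk1_bound(1) hk1_slice[OF H_borel HB] hk1_weight]) auto

lemma continuous_pot2:
  assumes ij: "i \<in> Basis" "j \<in> Basis"
  shows "continuous_on S (pot2 H i j)"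
  unfolding pot2_def[abs_def]
  by (rule pot_continuous[OF hk2_integrable[OF _ ij] hk2_slice(3)[OF ij] hk2_slice(2)[OF ij] integrable_powr_weight]) (use th in auto)

end

section \<open>The time derivative of a heat potential\<close>

lemma hk_measurable_raw [measurable (raw)]:
  assumes [measurable]: "f \<in> borel_measurable M" "g \<in> borel_measurable M"
  shows "(\<lambda>z. hk (f z) (g z)) \<in> borel_measurable M" "(\<lambda>z. hk2 e e' (f z) (g z)) \<in> borel_measurable M"
  using measurable_compose[OF borel_measurable_Pair[OF assms] hk_measurable(1)]
    measurable_compose[OF borel_measurable_Pair[OF assms] hk_measurable(3)[of e e']] by simp_all

lemma integrable_product_bound:
  fixes f :: "real \<times> real \<Rightarrow> real"
  assumes [measurable]: "f \<in> borel_measurable (lborel \<Otimes>\<^sub>M lborel)"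
    and g: "integrable lborel g" and f: "\<And>r s. \<bar>f (r, s)\<bar> \<le> g r * indicator {a..b} s"
  shows "integrable (lborel \<Otimes>\<^sub>M lborel) f"
proof (rule Bochner_Integration.integrable_bound)
  have i: "integrable lborel (indicator {a..b} :: real \<Rightarrow> real)"
    by (intro integrable_real_indicator) (auto simp: emeasure_lborel_Icc_eq)
  have [measurable]: "g \<in> borel_measurable borel" using g by simp
  show "integrable (lborel \<Otimes>\<^sub>M lborel) (\<lambda>(r, s). g r * indicator {a..b} s)"
  proof (rule lborel_pair.Fubini_integrable)
    show "(\<lambda>(r, s). g r * indicator {a..b} s) \<in> borel_measurable (lborel \<Otimes>\<^sub>M lborel)" by measurable
    show "AE r in lborel. integrable lborel (\<lambda>s. case (r, s) of (r, s) \<Rightarrow> g r * indicator {a..b} s)"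
      using i by simp
    show "integrable lborel (\<lambda>r. \<integral>s. norm (case (r, s) of (r, s) \<Rightarrow> g r * indicator {a..b} s) \<partial>lborel)"
      using g by (simp add: abs_mult)
  qed
  show "AE p in lborel \<Otimes>\<^sub>M lborel. norm (f p) \<le> norm (case p of (r, s) \<Rightarrow> g r * indicator {a..b} s)"
    by (intro AE_I2) (auto simp: real_norm_def simp del: abs_mult intro!: order_trans[OF f abs_ge_self])
qed fact

context
  fixes H :: "'a::euclidean_space \<times> real \<Rightarrow> real" and A B \<theta> :: real
  assumes Hc: "continuous_on UNIV H" and HB: "\<And>p. \<bar>H p\<bar> \<le> B"
    and th: "0 < \<theta>" "\<theta> \<le> 1" and holder: "\<And>x x' t. \<bar>H (x, t) - H (x', t)\<bar> \<le> A * norm (x - x') powr \<theta>"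
begin

lemmas Hm = H_borel[OF Hc HB th holder]

text \<open>The Laplacian at \<open>x\<close> of the heat semigroup at time \<open>s\<close> applied
  to the time slice of \<open>H\<close> at \<tau>.\<close>

definition lap_slice :: "real \<Rightarrow> 'a \<Rightarrow> real \<Rightarrow> real" where
  "lap_slice s x \<tau> = (\<Sum>i\<in>Basis. convol (\<lambda>y. hk2 i i y s) (\<lambda>z. H (z, \<tau>)) x)"

lemma H_measurable_raw [measurable (raw)]:
  assumes "f \<in> borel_measurable M" "g \<in> borel_measurable M"
  shows "(\<lambda>z. H (f z, g z)) \<in> borel_measurable M"
  using measurable_compose[OF borel_measurable_Pair[OF assms] Hm] .

lemma lap_slice_measurable [measurable (raw)]:
  assumes [measurable]: "f \<in> borel_measurable M" "g \<in> borel_measurable M"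
  shows "(\<lambda>z. lap_slice (f z) x (g z)) \<in> borel_measurable M"
  unfolding lap_slice_def convol_def by measurable

lemma lap_slice_bound:
  assumes s: "0 < s"
  shows "\<bar>lap_slice s x \<tau>\<bar> \<le> DIM('a) * (A * hk2C TYPE('a) \<theta> * s powr (\<theta>/2 - 1))"
proof -
  have "\<bar>lap_slice s x \<tau>\<bar> \<le> (\<Sum>i\<in>(Basis::'a set). A * hk2C TYPE('a) \<theta> * s powr (\<theta>/2 - 1))"
    unfolding lap_slice_def by (intro order_trans[OF sum_abs] sum_mono hk2_slice(1)[OF Hc HB th holder] s)
  then show ?thesis by simp
qed

lemma lap_weight: "integrable lborel (\<lambda>s. indicator {0<..<1} s * (DIM('a) * (A * hk2C TYPE('a) \<theta> * s powr (\<theta>/2 - 1))))"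
  using integrable_powr_weight[of "\<theta>/2 - 1" "DIM('a) * (A * hk2C TYPE('a) \<theta>)"] th by (simp add: mult.assoc)

text \<open>The semigroup identity \<open>exp (\<sigma> \<Delta>) H = H + \<integral> \<Delta> exp
  (s \<Delta>) H ds\<close>. It is the fundamental theorem in time for the kernel, tested against
  \<open>H (x - y, \<tau>) - H (x, \<tau>)\<close>; this difference vanishes at the singular point
  \<open>y = 0\<close> and makes the double integral absolutely convergent.\<close>

lemma convol_hk_eq:
  assumes s: "0 < \<sigma>" "\<sigma> < 1"
  shows "convol (\<lambda>y. hk y \<sigma>) (\<lambda>z. H (z, \<tau>)) x = H (x, \<tau>) + (\<integral>s. indicator {0<..\<sigma>} s * lap_slice s x \<tau> \<partial>lborel)"
proof -
  define d where "d y = H (x - y, \<tau>) - H (x, \<tau>)" for y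
  define K where "K s y = indicator {0<..\<sigma>} s * (\<Sum>i\<in>Basis. hk2 i i y s * d y)" for s y
  note hk2 = convol_hk2_diff[OF Hc HB th holder, where x=x and \<tau>=\<tau>, folded d_def] hk2_diff_bound[OF Hc HB th holder, where x=x and \<tau>=\<tau>, folded d_def]
  have [measurable]: "d \<in> borel_measurable borel" unfolding d_def by measurable
  have Km: "case_prod K \<in> borel_measurable (borel \<Otimes>\<^sub>M borel)" unfolding K_def by measurable
  have K1: "integrable lborel (K s)" for s
    unfolding K_def by (cases "0 < s") (auto intro!: Bochner_Integration.integrable_sum hk2)
  have K2: "(\<integral>y. K s y \<partial>lborel) = indicator {0<..\<sigma>} s * lap_slice s x \<tau>" for s
    by (cases "0 < s") (auto simp: K_def lap_slice_def hk2 Bochner_Integration.integral_sum)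
  have K3: "(\<integral>y. \<bar>K s y\<bar> \<partial>lborel) \<le> indicator {0<..<1} s * (DIM('a) * (A * hk2C TYPE('a) \<theta> * s powr (\<theta>/2 - 1)))" for s
  proof (cases "s \<in> {0<..\<sigma>}")
    case True
    have "(\<integral>y. \<bar>K s y\<bar> \<partial>lborel) \<le> (\<integral>y. (\<Sum>i\<in>Basis. \<bar>hk2 i i y s * d y\<bar>) \<partial>lborel)"
      using True by (intro integral_mono integrable_abs K1 Bochner_Integration.integrable_sum hk2) (auto simp: K_def)
    also have "\<dots> = (\<Sum>i\<in>Basis. (\<integral>y. \<bar>hk2 i i y s * d y\<bar> \<partial>lborel))"
      using True by (intro Bochner_Integration.integral_sum integrable_abs hk2) auto
    also have "\<dots> \<le> (\<Sum>i\<in>(Basis::'a set). A * hk2C TYPE('a) \<theta> * s powr (\<theta>/2 - 1))"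
      using True by (intro sum_mono hk2) auto
    finally show ?thesis using True s by simp
  next
    case False
    have "0 \<le> A * hk2C TYPE('a) \<theta>" by (simp add: hk2C_def gmom_nonneg A_nonneg[OF Hc HB th holder])
    then show ?thesis using False by (auto simp: K_def)
  qed
  have K4: "(\<integral>s. K s y \<partial>lborel) = hk y \<sigma> * d y" for y
  proof (cases "y = 0")
    case False
    have "(\<integral>s. indicator {0..\<sigma>} s *\<^sub>R (\<Sum>i\<in>Basis. hk2 i i y s) \<partial>lborel) = hk y \<sigma> - hk y 0"
    proof (rule integral_FTC_atLeastAtMost)
      show "(hk y has_vector_derivative (\<Sum>i\<in>Basis. hk2 i i y s)) (at s within {0..\<sigma>})" for s
        using hk_deriv_time[of y s] False unfolding has_real_derivative_iff_has_vector_derivative[symmetric]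
        by (auto intro: has_field_derivative_at_within)
      show "continuous_on {0..\<sigma>} (\<lambda>s. \<Sum>i\<in>Basis. hk2 i i y s)"
        by (intro continuous_on_sum continuous_on_compose2[OF hk_cont(2), of _ "\<lambda>s. (y, s)", simplified] continuous_intros)
          (use False in \<open>auto simp: zero_prod_def\<close>)
    qed (use s in simp)
    moreover have "K s y = indicator {0..\<sigma>} s *\<^sub>R (\<Sum>i\<in>Basis. hk2 i i y s) * d y" for s
      by (cases "s = 0") (auto simp: K_def sum_distrib_right split: split_indicator)
    ultimately show ?thesis by simp
  qed (simp add: K_def d_def)
  have "(\<integral>y. hk y \<sigma> * d y \<partial>lborel) = (\<integral>s. indicator {0<..\<sigma>} s * lap_slice s x \<tau> \<partial>lborel)"
    unfolding K2[symmetric] K4[symmetric] by (rule lborel_pair.Fubini_integral[OF integrable_pair_bound[OF Km K1 K3 lap_weight]])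
  moreover have "(\<integral>y. hk y \<sigma> * d y \<partial>lborel) = convol (\<lambda>y. hk y \<sigma>) (\<lambda>z. H (z, \<tau>)) x - H (x, \<tau>)"
    unfolding d_def right_diff_distrib convol_def using hk_integral[OF s(1), where 'a='a]
    by (subst Bochner_Integration.integral_diff) (auto intro!: integrable_mult_bounded[OF _ _ HB])
  ultimately show ?thesis by simp
qed

lemma sum_pot2: "(\<Sum>i\<in>Basis. pot2 H i i (x, t)) = (\<integral>s. indicator {0<..<1} s * lap_slice s x (t - s) \<partial>lborel)"
proof -
  have i: "integrable lborel (\<lambda>s. slice_pot (hk2 i i) H s (x, t))" if "i \<in> Basis" for i
    by (rule hk2_slice(3)[OF Hc HB th holder that that])
  have "(\<Sum>i\<in>Basis. pot2 H i i (x, t)) = (\<integral>s. (\<Sum>i\<in>Basis. slice_pot (hk2 i i) H s (x, t)) \<partial>lborel)"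
    unfolding pot2_def by (rule Bochner_Integration.integral_sum[symmetric]) (rule i)
  then show ?thesis by (simp add: slice_pot_def lap_slice_def sum_distrib_left)
qed

text \<open>The integrand is too singular for differentiation under the integral. Instead
  \<open>convol_hk_eq\<close> is inserted and the order of integration changed, which shows the
  potential to be a primitive of the continuous function \<open>c\<close>.\<close>

lemma pot_DERIV_time:
  assumes H0: "\<And>x t. t \<le> 0 \<or> 1 \<le> t \<Longrightarrow> H (x, t) = 0" and t: "0 < t" "t < 1"
  shows "((\<lambda>t. convol hkE H (x, t)) has_real_derivative H (x, t) + (\<Sum>i\<in>Basis. pot2 H i i (x, t))) (at t)"
proof -
  define c where "c r = H (x, r) + (\<Sum>i\<in>Basis. pot2 H i i (x, r))" for r
  have cc: "continuous_on S c" for S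
    unfolding c_def
    by (intro continuous_intros continuous_on_sum continuous_on_compose2[OF Hc]
        continuous_on_compose2[OF continuous_pot2[OF Hc HB th holder, of _ _ UNIV]]) auto
  have lap0: "lap_slice s x \<tau> = 0" if "\<tau> \<le> 0 \<or> 1 \<le> \<tau>" for s \<tau>
    using H0[OF that] by (simp add: lap_slice_def convol_def)
  have W: "convol hkE H (x, t) = (\<integral>r. indicator {0..t} r * c r \<partial>lborel)" if t: "0 \<le> t" "t \<le> 1" for t
  proof -
    \<comment> \<open>In \<open>F\<close>, \<open>s\<close> is the lag and \<open>r \<le> s\<close>
      the kernel time. Reflecting \<open>s\<close> at \<open>t + r\<close> turns \<open>F\<close>
      into \<open>G\<close>, where \<open>s\<close> is the time at which the Laplacian of the
      potential is evaluated, as in \<open>sum_pot2\<close>.\<close>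
    define F where "F s r = indicator {0<..<1} s * (indicator {0<..s} r * lap_slice r x (t - s))" for s r :: real
    define G where "G r s = indicator {0<..<1} r * (indicator {0..t} s * lap_slice r x (s - r))" for s r :: real
    have [measurable]: "(\<lambda>p::real\<times>real. indicator {0<..fst p} (snd p) :: real) \<in> borel_measurable (borel \<Otimes>\<^sub>M borel)"
    proof -
      have "(\<lambda>p::real\<times>real. indicator {0<..fst p} (snd p) :: real) = (\<lambda>p. if 0 < snd p \<and> snd p \<le> fst p then 1 else 0)"
        by (auto simp: indicator_def fun_eq_iff)
      also have "\<dots> \<in> borel_measurable (borel \<Otimes>\<^sub>M borel)" by measurable
      finally show ?thesis .
    qed
    have Gi: "integrable (lborel \<Otimes>\<^sub>M lborel) (case_prod G)"
    proof (rule integrable_product_bound[OF _ lap_weight, where a=0 and b=t])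
      show "case_prod G \<in> borel_measurable (lborel \<Otimes>\<^sub>M lborel)" unfolding G_def by measurable
      show "\<bar>case (r, s) of (r, s) \<Rightarrow> G r s\<bar> \<le> indicator {0<..<1} r * (DIM('a) * (A * hk2C TYPE('a) \<theta> * r powr (\<theta>/2 - 1))) * indicator {0..t} s" for r s
        using lap_slice_bound[of r x "s - r"] by (auto simp: G_def split: split_indicator)
    qed
    have Fi: "integrable (lborel \<Otimes>\<^sub>M lborel) (\<lambda>(r, s). F s r)"
    proof (rule integrable_product_bound[OF _ lap_weight, where a=0 and b=1])
      show "(\<lambda>(r, s). F s r) \<in> borel_measurable (lborel \<Otimes>\<^sub>M lborel)"
      proof -
        have "(\<lambda>(r, s). F s r) = (\<lambda>p. indicator {0<..<1} (snd p) * ((\<lambda>q. indicator {0<..fst q} (snd q) :: real) (snd p, fst p) * lap_slice (fst p) x (t - snd p)))"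
          by (auto simp: F_def fun_eq_iff)
        also have "\<dots> \<in> borel_measurable (lborel \<Otimes>\<^sub>M lborel)" by measurable
        finally show ?thesis .
      qed
      show "\<bar>case (r, s) of (r, s) \<Rightarrow> F s r\<bar> \<le> indicator {0<..<1} r * (DIM('a) * (A * hk2C TYPE('a) \<theta> * r powr (\<theta>/2 - 1))) * indicator {0..1} s" for r s
        using lap_slice_bound[of r x "t - s"] by (auto simp: F_def split: split_indicator)
    qed
    \<comment> \<open>For \<open>r \<le> 0\<close> the indicators vanish; for \<open>s - r\<close>
      outside \<open>(0, 1)\<close> the source vanishes.\<close>
    have FG: "F (t + r - s) r = G r s" for r s
    proof (cases "0 < r \<and> 0 < s - r \<and> s - r < 1")
      case True
      then show ?thesis using t by (auto simp: F_def G_def split: split_indicator)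
    next
      case False
      then show ?thesis using lap0[of "s - r" r] by (auto simp: F_def G_def split: split_indicator)
    qed
    have iF: "integrable lborel (\<lambda>s. \<integral>r. F s r \<partial>lborel)"
      using lborel_pair.integrable_snd[OF Fi] .
    have [measurable]: "(\<lambda>s. H (x, s)) \<in> borel_measurable borel" by measurable
    have iH: "integrable lborel (\<lambda>s. indicator {0<..<1} s * H (x, t - s))"
      by (intro integrable_mult_bounded[OF _ _ HB] integrable_real_indicator) auto
    have "convol hkE H (x, t) = (\<integral>s. indicator {0<..<1} s * H (x, t - s) + (\<integral>r. F s r \<partial>lborel) \<partial>lborel)"
      unfolding hkE_slice(2)[OF Hm HB]
      by (intro Bochner_Integration.integral_cong) (auto simp: slice_pot_def convol_hk_eq F_def split: split_indicator)
    also have "\<dots> = (\<integral>s. indicator {0<..<1} s * H (x, t - s) \<partial>lborel) + (\<integral>s. (\<integral>r. F s r \<partial>lborel) \<partial>lborel)"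
      by (rule Bochner_Integration.integral_add[OF iH iF])
    also have "(\<integral>s. indicator {0<..<1} s * H (x, t - s) \<partial>lborel) = (\<integral>s. indicator {0<..<1} (t - s) * H (x, s) \<partial>lborel)"
      by (subst integral_reflect[of "\<lambda>s. indicator {0<..<1} s * H (x, t - s)" t, symmetric]) auto
    also have "\<dots> = (\<integral>s. indicator {0..t} s * H (x, s) \<partial>lborel)"
    proof (rule integral_cong_AE)
      have "indicator {0<..<1} (t - s) * H (x, s) = indicator {0..t} s * H (x, s)" if "s \<noteq> t" for s
      proof (cases "s \<le> 0 \<or> 1 \<le> s")
        case True
        from H0[OF this, of x] show ?thesis by simp
      next
        case False
        then have "t - s \<in> {0<..<1} \<longleftrightarrow> s \<in> {0..t}" using t that by auto
        then show ?thesis by (simp add: indicator_def)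
      qed
      then show "AE s in lborel. indicator {0<..<1} (t - s) * H (x, s) = indicator {0..t} s * H (x, s)"
        using AE_lborel_singleton[of t] by (auto elim: eventually_mono)
    qed measurable
    also have "(\<integral>s. (\<integral>r. F s r \<partial>lborel) \<partial>lborel) = (\<integral>r. (\<integral>s. F s r \<partial>lborel) \<partial>lborel)"
      by (rule lborel_pair.Fubini_integral[OF Fi])
    also have "\<dots> = (\<integral>r. (\<integral>s. G r s \<partial>lborel) \<partial>lborel)"
    proof (rule Bochner_Integration.integral_cong[OF refl])
      fix r
      have "(\<lambda>s. F s r) \<in> borel_measurable borel"
      proof -
        have "(\<lambda>s. F s r) = (\<lambda>s. (\<lambda>(r, s). F s r) (r, s))" by simp
        also have "\<dots> \<in> borel_measurable borel" using borel_measurable_integrable[OF Fi] by measurable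
        finally show ?thesis .
      qed
      from integral_reflect[OF this, of "t + r"]
      show "(\<integral>s. F s r \<partial>lborel) = (\<integral>s. G r s \<partial>lborel)" unfolding FG by simp
    qed
    also have "\<dots> = (\<integral>s. (\<integral>r. G r s \<partial>lborel) \<partial>lborel)"
      by (rule lborel_pair.Fubini_integral[OF Gi, symmetric])
    also have "\<dots> = (\<integral>s. indicator {0..t} s * (\<Sum>i\<in>Basis. pot2 H i i (x, s)) \<partial>lborel)"
      unfolding sum_pot2 G_def
      by (intro Bochner_Integration.integral_cong refl) (auto split: split_indicator)
    also have "(\<integral>s. indicator {0..t} s * H (x, s) \<partial>lborel) + \<dots> = (\<integral>r. indicator {0..t} r * c r \<partial>lborel)"
      unfolding c_def ring_distribs
    proof (rule Bochner_Integration.integral_add[symmetric])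
      have *: "integrable lborel (\<lambda>s. indicator {0..t} s * f s)" if "continuous_on {0..t} f" for f :: "real \<Rightarrow> real"
        using borel_integrable_atLeastAtMost'[OF that] by (simp add: set_integrable_def)
      show "integrable lborel (\<lambda>s. indicator {0..t} s * H (x, s))"
        by (intro * continuous_on_compose2[OF Hc] continuous_intros) auto
      show "integrable lborel (\<lambda>s. indicator {0..t} s * (\<Sum>i\<in>Basis. pot2 H i i (x, s)))"
        by (intro * continuous_on_sum continuous_intros
            continuous_on_compose2[OF continuous_pot2[OF Hc HB th holder, of _ _ UNIV]]) auto
    qed
    finally show ?thesis .
  qed
  have W': "convol hkE H (x, t) = integral {0..t} c" if t: "0 \<le> t" "t \<le> 1" for t
  proof -
    have "set_integrable lborel {0..t} c" by (rule borel_integrable_atLeastAtMost'[OF cc])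
    from set_borel_integral_eq_integral(2)[OF this] W[OF t] show ?thesis
      by (simp add: set_lebesgue_integral_def)
  qed
  have "((\<lambda>t. integral {0..t} c) has_real_derivative c t) (at t within {0..1})"
    by (rule integral_has_real_derivative[OF cc]) (use t in auto)
  then have "((\<lambda>t. integral {0..t} c) has_real_derivative c t) (at t)"
    using t by (subst (asm) at_within_interior) auto
  moreover have ev: "\<forall>\<^sub>F t in nhds t. integral {0..t} c = convol hkE H (x, t)"
    using eventually_nhds_in_open[of "{0<..<1}" t] t W' by (auto elim!: eventually_mono)
  ultimately show ?thesis unfolding c_def[symmetric] using DERIV_cong_ev[OF refl ev refl, of "c t"] by simp
qed

end

section \<open>Cut-offs of finite smoothness and compactly supported radial kernels\<close>

definition pow_pos :: "nat \<Rightarrow> real \<Rightarrow> real" where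
  "pow_pos k x = max 0 x ^ k"

text \<open>The kink at 0 is what excludes the exponent 1. The exponent 0 gives the constant 1, also
  for negative arguments.\<close>

lemma pow_pos_deriv:
  assumes "k \<noteq> 1"
  shows "(pow_pos k has_real_derivative real k * pow_pos (k - 1) x) (at x)"
proof (cases "k = 0")
  case False
  then obtain n where k: "k = Suc (Suc n)" using assms by (metis One_nat_def not0_implies_Suc)
  consider "x < 0" | "x = 0" | "0 < x" by linarith
  then show ?thesis
  proof cases
    case 1
    have ev: "\<forall>\<^sub>F y in nhds x. 0 = pow_pos k y"
      using eventually_nhds_in_open[of "{..<0}" x] 1 by (auto elim!: eventually_mono simp: pow_pos_def k)
    have "(pow_pos k has_real_derivative 0) (at x)" using DERIV_cong_ev[OF refl ev refl, of 0] by simp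
    moreover have "pow_pos (k - 1) x = 0" using 1 by (simp add: pow_pos_def k)
    ultimately show ?thesis by simp
  next
    case 3
    have ev: "\<forall>\<^sub>F y in nhds x. y ^ k = pow_pos k y"
      using eventually_nhds_in_open[of "{0<..}" x] 3 by (auto elim!: eventually_mono simp: pow_pos_def k)
    have "((\<lambda>y. y ^ k) has_real_derivative real k * x ^ (k - 1)) (at x)"
      by (auto intro!: derivative_eq_intros)
    moreover have "pow_pos (k - 1) x = x ^ (k - 1)" using 3 by (simp add: pow_pos_def)
    ultimately show ?thesis using DERIV_cong_ev[OF refl ev refl] by simp
  next
    case 2
    have "((\<lambda>h. (pow_pos k (0 + h) - pow_pos k 0) / h) \<longlongrightarrow> 0) (at 0)"
    proof (rule Lim_null_comparison)
      show "\<forall>\<^sub>F h in at 0. norm ((pow_pos k (0 + h) - pow_pos k 0) / h) \<le> \<bar>h\<bar> ^ Suc n"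
        by (intro always_eventually) (auto simp: pow_pos_def k max_def power_abs intro: mult_nonpos_nonneg)
      show "((\<lambda>h::real. \<bar>h\<bar> ^ Suc n) \<longlongrightarrow> 0) (at 0)"
        by (rule tendsto_eq_intros refl | simp)+
    qed
    then show ?thesis using 2 by (simp add: DERIV_def pow_pos_def k)
  qed
qed (simp add: pow_pos_def[abs_def])

text \<open>A family closed under differentiation. The member \<open>k = 6\<close>,
  \<open>l = 0\<close> is the cut-off: 1 up to \<open>r\<close> and 0 from \<open>2 * r\<close> on.
  The exponent 6 leaves five derivatives: two for \<open>kap\<close>, two more for
  \<open>kap'\<close>, and one for the Lipschitz bound of \<open>kap'\<close>.\<close>

definition bump_pow :: "nat \<Rightarrow> nat \<Rightarrow> real \<Rightarrow> real \<Rightarrow> real" where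
  "bump_pow k l r x = pow_pos k (1 - pow_pos 6 (x / r - 1)) * pow_pos l (x / r - 1)"

lemma bump_pow_deriv:
  assumes "k \<noteq> 1" "l \<noteq> 1" "0 < r"
  shows "(bump_pow k l r has_real_derivative l / r * bump_pow k (l - 1) r x - 6 * k / r * bump_pow (k - 1) (l + 5) r x) (at x)"
proof -
  have 1: "((\<lambda>x. pow_pos l (x / r - 1)) has_real_derivative real l * pow_pos (l - 1) (x / r - 1) * (1 / r)) (at x)" if "l \<noteq> 1" for l
    by (rule DERIV_chain'[where g = "pow_pos l", OF _ pow_pos_deriv[OF that]]) (use assms in \<open>auto intro!: derivative_eq_intros\<close>)
  have "((\<lambda>x. 1 - pow_pos 6 (x / r - 1)) has_real_derivative - (6 * pow_pos 5 (x / r - 1) * (1 / r))) (at x)"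
    using DERIV_diff[OF DERIV_const 1[of 6]] by simp
  from DERIV_mult[OF DERIV_chain'[OF this pow_pos_deriv[OF assms(1)]] 1[OF assms(2)]]
  show ?thesis unfolding bump_pow_def[abs_def]
    by (rule DERIV_cong) (simp add: pow_pos_def power_add algebra_simps)
qed

lemma continuous_bump_pow: "0 < r \<Longrightarrow> continuous_on S (bump_pow k l r)"
  unfolding bump_pow_def[abs_def] pow_pos_def by (intro continuous_intros) auto

lemma bump_pow_support:
  assumes "0 < r"
  shows "2 * r \<le> x \<Longrightarrow> 1 \<le> k \<Longrightarrow> bump_pow k l r x = 0" "x \<le> r \<Longrightarrow> 1 \<le> l \<Longrightarrow> bump_pow k l r x = 0"
    "x \<le> r \<Longrightarrow> bump_pow k 0 r x = 1"
proof -
  assume "2 * r \<le> x" "1 \<le> k"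
  then have "1 \<le> max 0 (x / r - 1)" using assms by (simp add: field_simps)
  then have "1 \<le> pow_pos 6 (x / r - 1)" unfolding pow_pos_def by (rule one_le_power)
  then show "bump_pow k l r x = 0" using \<open>1 \<le> k\<close> by (simp add: bump_pow_def pow_pos_def[of k] max_def)
qed (use assms in \<open>auto simp: bump_pow_def pow_pos_def divide_le_eq\<close>)

definition cut0 :: "real \<Rightarrow> real \<Rightarrow> real" where "cut0 = bump_pow 6 0"

definition cut1 :: "real \<Rightarrow> real \<Rightarrow> real" where "cut1 r x = - 36 / r * bump_pow 5 5 r x"

definition cut2 :: "real \<Rightarrow> real \<Rightarrow> real" where
  "cut2 r x = 1080 / r\<^sup>2 * bump_pow 4 10 r x - 180 / r\<^sup>2 * bump_pow 5 4 r x"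

lemma cut_deriv:
  assumes "0 < r"
  shows "(cut0 r has_real_derivative cut1 r x) (at x)" "(cut1 r has_real_derivative cut2 r x) (at x)"
  using bump_pow_deriv[of 6 0 r x] DERIV_cmult[OF bump_pow_deriv[of 5 5 r x], of "- 36 / r"] assms
  by (simp_all add: cut0_def cut1_def[abs_def] cut2_def power2_eq_square algebra_simps)

lemma continuous_cut: "0 < r \<Longrightarrow> continuous_on S (cut0 r)" "0 < r \<Longrightarrow> continuous_on S (cut1 r)"
  unfolding cut0_def cut1_def[abs_def] by (auto intro!: continuous_intros continuous_bump_pow)

lemma cut_support:
  assumes "0 < r"
  shows "2 * r \<le> x \<Longrightarrow> cut0 r x = 0" "x \<le> r \<Longrightarrow> cut0 r x = 1" "x \<le> r \<Longrightarrow> cut1 r x = 0"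
  using bump_pow_support[OF assms] by (simp_all add: cut0_def cut1_def)

lemma cut0_bounds: "0 \<le> cut0 r x" "cut0 r x \<le> 1"
  by (auto simp: cut0_def bump_pow_def pow_pos_def intro: power_le_one)

text \<open>The cut-off factor vanishes near the singularity \<open>(0, 0)\<close> of the Gaussian, so these products are
  as smooth as the cut-off.\<close>

definition cutg :: "(real \<Rightarrow> real) \<Rightarrow> real \<Rightarrow> real \<Rightarrow> real \<Rightarrow> real" where
  "cutg A m q s = A (q + s) * gsq m q s"

context
  fixes A :: "real \<Rightarrow> real" and r :: real
  assumes r: "0 < r" and A0: "\<And>x. x \<le> r \<Longrightarrow> A x = 0" and Ac: "continuous_on UNIV A"
begin

lemma continuous_cutg: "continuous_on UNIV (\<lambda>p. cutg A m (fst p) (snd p))" (is "continuous_on _ ?f")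
proof -
  have "continuous_on ({p. fst p + snd p < r} \<union> {p. 0 < fst p \<or> snd p \<noteq> 0}) ?f"
  proof (rule continuous_on_open_Un)
    show "continuous_on {p. fst p + snd p < r} ?f" by (rule continuous_on_eq[of _ "\<lambda>_. 0"]) (auto simp: cutg_def A0)
    show "continuous_on {p. 0 < fst p \<or> snd p \<noteq> 0} ?f"
      unfolding cutg_def by (intro continuous_intros continuous_gsq continuous_on_compose2[OF Ac]) auto
  qed (intro open_Collect_less open_Collect_disj open_Collect_neq continuous_intros)+
  moreover have "{p. fst p + snd p < r} \<union> {p. 0 < fst p \<or> snd p \<noteq> 0} = UNIV" using r by force
  ultimately show ?thesis by simp
qed

context
  fixes A' :: "real \<Rightarrow> real"
  assumes dA: "\<And>x. (A has_real_derivative A' x) (at x)"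
begin

lemma cutg_deriv_q:
  "((\<lambda>q. cutg A m q s) has_real_derivative cutg A' m q s - cutg A (m + 1) q s / 4) (at q)"
proof -
  have "((\<lambda>q. A (q + s)) has_real_derivative A' (q + s)) (at q)"
    using dA[of "q + s"] by (simp add: DERIV_shift)
  from DERIV_mult[OF this gsq_deriv_q] show ?thesis unfolding cutg_def by (simp add: mult_ac)
qed

lemma cutg_deriv_s:
  "((\<lambda>s. cutg A m q s) has_real_derivative cutg A' m q s - m * cutg A (m + 1) q s + q / 4 * cutg A (m + 2) q s) (at s)"
proof -
  have dA': "((\<lambda>s. A (q + s)) has_real_derivative A' (q + s)) (at s)"
    using dA[of "q + s"] by (simp add: DERIV_shift[of A, symmetric] add.commute)
  show ?thesis
  proof (cases "0 < q \<or> s \<noteq> 0")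
    case True
    from DERIV_mult[OF dA' gsq_deriv_s[OF True, of m]] show ?thesis unfolding cutg_def by (simp add: algebra_simps)
  next
    case False
    have ev: "\<forall>\<^sub>F s in nhds s. 0 = cutg A m q s"
      using eventually_nhds_in_open[of "{..<r - q}" s] False r by (auto elim!: eventually_mono simp: cutg_def A0)
    have z: "cutg X n q s = 0" for X n using False by (simp add: cutg_def gsq_def)
    show ?thesis using DERIV_cong_ev[OF refl ev refl, of 0] by (simp add: z)
  qed
qed

end

end

text \<open>Bookkeeping of smoothness: \<open>n\<close> counts the derivatives already spent, so
  both exponents are at least \<open>6 - n\<close>, and keeping them at least 1 preserves continuity
  and support. Multiplication by \<open>q\<close> is included because the Laplacian of a radial
  function produces this factor.\<close>

inductive_set rad :: "real \<Rightarrow> nat \<Rightarrow> (real \<Rightarrow> real \<Rightarrow> real) set" for r n where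
  rad_base: "1 \<le> k \<Longrightarrow> 1 \<le> l \<Longrightarrow> 6 \<le> k + n \<Longrightarrow> 6 \<le> l + n \<Longrightarrow> cutg (bump_pow k l r) m \<in> rad r n"
| rad_add: "k \<in> rad r n \<Longrightarrow> l \<in> rad r n \<Longrightarrow> (\<lambda>q s. k q s + l q s) \<in> rad r n"
| rad_cmult: "k \<in> rad r n \<Longrightarrow> (\<lambda>q s. c * k q s) \<in> rad r n"
| rad_qmult: "k \<in> rad r n \<Longrightarrow> (\<lambda>q s. q * k q s) \<in> rad r n"

lemma rad_diff: "k \<in> rad r n \<Longrightarrow> l \<in> rad r n \<Longrightarrow> (\<lambda>q s. k q s - l q s) \<in> rad r n"
  using rad_add[OF _ rad_cmult[of l r n "-1"], of k] by simp

lemma rad_mono: "k \<in> rad r n \<Longrightarrow> n \<le> n' \<Longrightarrow> k \<in> rad r n'"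
  by (induction rule: rad.induct) (auto intro: rad.intros)

lemma rad_support: "k \<in> rad r n \<Longrightarrow> 0 < r \<Longrightarrow> s \<le> 0 \<or> 2 * r \<le> q + s \<Longrightarrow> k q s = 0"
  by (induction rule: rad.induct) (auto simp: cutg_def gsq_def bump_pow_support)

lemma continuous_rad: "k \<in> rad r n \<Longrightarrow> 0 < r \<Longrightarrow> continuous_on UNIV (\<lambda>p. k (fst p) (snd p))"
proof (induction rule: rad.induct)
  case (rad_base k l m)
  then show ?case by (intro continuous_cutg[of r] continuous_bump_pow) (auto intro: bump_pow_support)
qed (auto intro!: continuous_intros)

definition dq :: "(real \<Rightarrow> real \<Rightarrow> real) \<Rightarrow> real \<Rightarrow> real \<Rightarrow> real" where
  "dq k q s = deriv (\<lambda>q. k q s) q"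

definition ds :: "(real \<Rightarrow> real \<Rightarrow> real) \<Rightarrow> real \<Rightarrow> real \<Rightarrow> real" where
  "ds k q s = deriv (k q) s"

text \<open>For \<open>n < 5\<close> both exponents are at least 2, so the kink of
  \<open>pow_pos\<close> never appears; each differentiation lowers an exponent by at most
  one.\<close>

lemma rad_deriv_ex:
  assumes "k \<in> rad r n" "0 < r" "n < 5"
  shows "\<exists>kq\<in>rad r (Suc n). \<exists>ks\<in>rad r (Suc n). \<forall>q s. ((\<lambda>q. k q s) has_real_derivative kq q s) (at q) \<and>
    ((\<lambda>s. k q s) has_real_derivative ks q s) (at s)"
  using assms
proof (induction rule: rad.induct)
  case (rad_base k l m)
  let ?A = "bump_pow k l r" and ?A1 = "bump_pow k (l - 1) r" and ?A2 = "bump_pow (k - 1) (l + 5) r"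
  let ?A' = "\<lambda>x. l / r * ?A1 x - 6 * k / r * ?A2 x"
  have A: "\<And>x. x \<le> r \<Longrightarrow> ?A x = 0" "continuous_on UNIV ?A" "\<And>x. (?A has_real_derivative ?A' x) (at x)"
    using rad_base bump_pow_deriv[of k l r] by (auto intro: bump_pow_support continuous_bump_pow)
  have m: "cutg ?A1 m' \<in> rad r (Suc n)" "cutg ?A2 m' \<in> rad r (Suc n)" "cutg ?A m' \<in> rad r (Suc n)" for m'
    using rad_base by (auto intro!: rad.rad_base)
  have c: "cutg ?A' m q s = l / r * cutg ?A1 m q s - 6 * k / r * cutg ?A2 m q s" for q s by (simp add: cutg_def algebra_simps)
  show ?case
  proof (intro bexI allI conjI)
    show "((\<lambda>q. cutg ?A m q s) has_real_derivative (l / r * cutg ?A1 m q s - 6 * k / r * cutg ?A2 m q s) - (1/4) * cutg ?A (m + 1) q s) (at q)" for q s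
      using cutg_deriv_q[OF rad_base(5) A, of m s q, unfolded c] by simp
    show "((\<lambda>s. cutg ?A m q s) has_real_derivative (l / r * cutg ?A1 m q s - 6 * k / r * cutg ?A2 m q s - m * cutg ?A (m + 1) q s) + q * ((1/4) * cutg ?A (m + 2) q s)) (at s)" for q s
      using cutg_deriv_s[OF rad_base(5) A, of m q s, unfolded c] by simp
  qed (intro rad.rad_add rad_diff rad.rad_cmult rad.rad_qmult m)+
next
  case (rad_add k l)
  then obtain kq ks lq ls where k: "kq\<in>rad r (Suc n)" "ks\<in>rad r (Suc n)" "\<And>q s. ((\<lambda>q. k q s) has_real_derivative kq q s) (at q)"
    "\<And>q s. ((\<lambda>s. k q s) has_real_derivative ks q s) (at s)" and l: "lq\<in>rad r (Suc n)" "ls\<in>rad r (Suc n)" "\<And>q s. ((\<lambda>q. l q s) has_real_derivative lq q s) (at q)"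
    "\<And>q s. ((\<lambda>s. l q s) has_real_derivative ls q s) (at s)" by blast
  show ?case
    by (rule bexI[OF bexI[OF _ rad.rad_add[OF k(2) l(2)]] rad.rad_add[OF k(1) l(1)]]) (auto intro: DERIV_add k l)
next
  case (rad_cmult k c)
  then obtain kq ks where k: "kq\<in>rad r (Suc n)" "ks\<in>rad r (Suc n)" "\<And>q s. ((\<lambda>q. k q s) has_real_derivative kq q s) (at q)"
    "\<And>q s. ((\<lambda>s. k q s) has_real_derivative ks q s) (at s)" by blast
  show ?case
    by (rule bexI[OF bexI[OF _ rad.rad_cmult[OF k(2), of c]] rad.rad_cmult[OF k(1), of c]]) (auto intro: DERIV_cmult k)
next
  case (rad_qmult k)
  then obtain kq ks where k: "kq\<in>rad r (Suc n)" "ks\<in>rad r (Suc n)" "\<And>q s. ((\<lambda>q. k q s) has_real_derivative kq q s) (at q)"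
    "\<And>q s. ((\<lambda>s. k q s) has_real_derivative ks q s) (at s)" by blast
  have k': "k \<in> rad r (Suc n)" using rad_mono[OF rad_qmult(1)] by simp
  have "((\<lambda>q. q * k q s) has_real_derivative k q s + q * kq q s) (at q)" for q s
    using DERIV_mult[OF DERIV_ident k(3)] by (simp add: mult.commute)
  then show ?case
    by (intro bexI[OF bexI[OF _ rad.rad_qmult[OF k(2)]] rad.rad_add[OF k' rad.rad_qmult[OF k(1)]]]) (auto intro: DERIV_cmult k)
qed

lemma rad_deriv:
  assumes "k \<in> rad r n" "0 < r" "n < 5"
  shows "dq k \<in> rad r (Suc n)" "ds k \<in> rad r (Suc n)" "((\<lambda>q. k q s) has_real_derivative dq k q s) (at q)"
    "((\<lambda>s. k q s) has_real_derivative ds k q s) (at s)"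
proof -
  obtain kq ks where k: "kq\<in>rad r (Suc n)" "ks\<in>rad r (Suc n)" "\<And>q s. ((\<lambda>q. k q s) has_real_derivative kq q s) (at q)"
    "\<And>q s. ((\<lambda>s. k q s) has_real_derivative ks q s) (at s)" using rad_deriv_ex[OF assms] by blast
  have "dq k = kq" "ds k = ks" using DERIV_imp_deriv[OF k(3)] DERIV_imp_deriv[OF k(4)] by (auto simp: dq_def ds_def fun_eq_iff)
  with k show "dq k \<in> rad r (Suc n)" "ds k \<in> rad r (Suc n)" "((\<lambda>q. k q s) has_real_derivative dq k q s) (at q)"
    "((\<lambda>s. k q s) has_real_derivative ds k q s) (at s)" by auto
qed

text \<open>The operator \<open>\<partial>\<^sub>s - \<Delta>\<close> on radial functions in
  dimension \<open>N\<close>, written in the variables \<open>q = |x|^2\<close> and \<open>s\<close>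
  as in \<open>heat_at_radial\<close>.\<close>

definition heatq :: "real \<Rightarrow> (real \<Rightarrow> real \<Rightarrow> real) \<Rightarrow> real \<Rightarrow> real \<Rightarrow> real" where
  "heatq N k q s = ds k q s - 2 * N * dq k q s - 4 * (q * dq (dq k) q s)"

lemma rad_heatq:
  assumes "k \<in> rad r n" "0 < r" "n < 4"
  shows "heatq N k \<in> rad r (Suc (Suc n))"
  unfolding heatq_def[abs_def] using assms rad_deriv[of k r n] rad_deriv(1)[of "dq k" r "Suc n"]
  by (intro rad_diff rad_cmult rad_qmult) (auto intro: rad_mono[of _ _ "Suc n"])

definition lift :: "(real \<Rightarrow> real \<Rightarrow> real) \<Rightarrow> 'a::euclidean_space \<times> real \<Rightarrow> real" where
  "lift k p = k ((norm (fst p))\<^sup>2) (snd p)"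

text \<open>A compact box containing the support of every lifted member of \<open>rad r n\<close>:
  these vanish for \<open>s \<le> 0\<close> and for \<open>|y|^2 + s \<ge> 2 * r\<close>. It shrinks
  to the origin with \<open>r\<close>.\<close>

definition cap :: "real \<Rightarrow> ('a::euclidean_space \<times> real) set" where
  "cap r = cball 0 (sqrt (2 * r)) \<times> {0..2 * r}"

lemma compact_cap: "compact (cap r)"
  unfolding cap_def by (intro compact_Times compact_cball compact_Icc)

lemma not_in_cap:
  assumes "p \<notin> cap r"
  shows "snd p \<le> 0 \<or> 2 * r \<le> (norm (fst p))\<^sup>2 + snd p"
proof (rule ccontr)
  assume "\<not> ?thesis"
  then have 1: "0 < snd p" "(norm (fst p))\<^sup>2 + snd p < 2 * r" by auto
  then have "(norm (fst p))\<^sup>2 \<le> 2 * r" "snd p \<le> 2 * r" using zero_le_power2[of "norm (fst p)"] by linarith+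
  then have "norm (fst p) \<le> sqrt (2 * r)" by (simp add: real_le_rsqrt)
  then show False using assms 1 \<open>snd p \<le> 2 * r\<close> by (cases p) (auto simp: cap_def)
qed

lemma lift_support:
  assumes "k \<in> rad r n" "0 < r" "p \<notin> cap r"
  shows "lift k p = 0"
  unfolding lift_def by (rule rad_support[OF assms(1,2) not_in_cap[OF assms(3)]])

lemma continuous_lift:
  assumes "k \<in> rad r n" "0 < r"
  shows "continuous_on UNIV (lift k)"
proof -
  have "continuous_on UNIV (\<lambda>p::'a \<times> real. ((norm (fst p))\<^sup>2, snd p))" by (intro continuous_intros)
  from continuous_on_compose2[OF continuous_rad[OF assms] this] show ?thesis
    unfolding lift_def[abs_def] by simp
qed

lemma integrable_compact_support:
  fixes f :: "'b::euclidean_space \<Rightarrow> real"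
  assumes "continuous_on UNIV f" "compact S" "\<And>p. p \<notin> S \<Longrightarrow> f p = 0"
  shows "integrable lborel f"
proof -
  have "integrable lborel (\<lambda>x. indicator S x *\<^sub>R f x)"
    by (rule borel_integrable_compact[OF assms(2) continuous_on_subset[OF assms(1)]]) simp
  moreover have "(\<lambda>x. indicator S x *\<^sub>R f x) = f" using assms(3) by (auto simp: fun_eq_iff split: split_indicator)
  ultimately show ?thesis by simp
qed

lemma integrable_lift: "k \<in> rad r n \<Longrightarrow> 0 < r \<Longrightarrow> integrable lborel (lift k)"
  by (rule integrable_compact_support[OF continuous_lift compact_cap lift_support])

lemma bounded_compact_support:
  fixes f :: "'b::euclidean_space \<Rightarrow> real"
  assumes "continuous_on UNIV f" "compact S" "\<And>p. p \<notin> S \<Longrightarrow> f p = 0"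
  obtains B where "\<And>p. \<bar>f p\<bar> \<le> B"
proof -
  have "bounded (f ` S)" by (intro compact_imp_bounded compact_continuous_image continuous_on_subset[OF assms(1)] assms(2)) simp
  then obtain B where B: "\<And>p. p \<in> S \<Longrightarrow> \<bar>f p\<bar> \<le> B" unfolding bounded_real by blast
  show ?thesis
  proof (rule that[of "max B 0"])
    show "\<bar>f p\<bar> \<le> max B 0" for p using B[of p] assms(3)[of p] by (cases "p \<in> S") auto
  qed
qed

lemma lift_deriv_x:
  assumes "k \<in> rad r n" "0 < r" "n < 5"
  shows "((\<lambda>\<tau>. lift k (p + \<tau> *\<^sub>R (e, 0))) has_real_derivative 2 * (fst p \<bullet> e) * lift (dq k) p) (at 0)"
proof -
  from DERIV_chain'[OF norm_sq_line_deriv[of "fst p" e] rad_deriv(3)[OF assms]] show ?thesis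
    by (cases p) (simp add: lift_def mult.commute)
qed

lemma lift_deriv_xx:
  assumes "k \<in> rad r n" "0 < r" "n < 4"
  shows "((\<lambda>\<tau>. 2 * (fst (p + \<tau> *\<^sub>R (e', 0)) \<bullet> e) * lift (dq k) (p + \<tau> *\<^sub>R (e', 0))) has_real_derivative
    2 * (e \<bullet> e') * lift (dq k) p + 4 * (fst p \<bullet> e) * (fst p \<bullet> e') * lift (dq (dq k)) p) (at 0)"
proof -
  have 1: "((\<lambda>\<tau>. 2 * (fst (p + \<tau> *\<^sub>R (e', 0::real)) \<bullet> e)) has_real_derivative 2 * (e \<bullet> e')) (at 0)"
    by (cases p) (auto intro!: derivative_eq_intros simp: inner_add_left inner_add_right inner_commute)
  have "dq k \<in> rad r (Suc n)" using rad_deriv(1)[OF assms(1,2)] assms(3) by simp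
  from DERIV_mult[OF 1 lift_deriv_x[OF this assms(2), of p e']] assms(3)
  show ?thesis by (simp add: algebra_simps zero_prod_def[symmetric])
qed

lemma lift_deriv_t:
  assumes "k \<in> rad r n" "0 < r" "n < 5"
  shows "((\<lambda>\<tau>. lift k (p + \<tau> *\<^sub>R (0, 1))) has_real_derivative lift (ds k) p) (at 0)"
proof -
  have "((\<lambda>\<tau>. snd p + \<tau>) has_real_derivative 1) (at 0)" by (auto intro!: derivative_eq_intros)
  from DERIV_chain'[OF this, of "k ((norm (fst p))\<^sup>2)"] rad_deriv(4)[OF assms] show ?thesis
    by (cases p) (simp add: lift_def)
qed

section \<open>Parabolic smoothness classes with explicit derivatives\<close>

definition par_C2 :: "('a::euclidean_space \<times> real) set \<Rightarrow> ('a \<times> real \<Rightarrow> real) \<Rightarrow>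
    ('a \<Rightarrow> 'a \<times> real \<Rightarrow> real) \<Rightarrow> ('a \<Rightarrow> 'a \<Rightarrow> 'a \<times> real \<Rightarrow> real) \<Rightarrow> bool" where
  "par_C2 G w D1 D2 \<longleftrightarrow> continuous_on G w \<and> (\<forall>i\<in>Basis. continuous_on G (D1 i) \<and>
     (\<forall>x t. (x, t) \<in> G \<longrightarrow> ((\<lambda>h. w (x + h *\<^sub>R i, t)) has_real_derivative D1 i (x, t)) (at 0)) \<and>
     (\<forall>j\<in>Basis. continuous_on G (D2 i j) \<and>
       (\<forall>x t. (x, t) \<in> G \<longrightarrow> ((\<lambda>h. D1 i (x + h *\<^sub>R j, t)) has_real_derivative D2 i j (x, t)) (at 0))))"

definition time_C1 :: "('a::euclidean_space \<times> real) set \<Rightarrow> ('a \<times> real \<Rightarrow> real) \<Rightarrow> ('a \<times> real \<Rightarrow> real) \<Rightarrow> bool" where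
  "time_C1 G w Dt \<longleftrightarrow> continuous_on G Dt \<and> (\<forall>x t. (x, t) \<in> G \<longrightarrow> ((\<lambda>s. w (x, s)) has_real_derivative Dt (x, t)) (at t))"

lemma par_C2_add:
  assumes "par_C2 G w D1 D2" "par_C2 G v E1 E2"
  shows "par_C2 G (\<lambda>p. w p + v p) (\<lambda>i p. D1 i p + E1 i p) (\<lambda>i j p. D2 i j p + E2 i j p)"
  using assms unfolding par_C2_def by (auto intro!: continuous_intros DERIV_add)

lemma time_C1_add:
  assumes "time_C1 G w D" "time_C1 G v E"
  shows "time_C1 G (\<lambda>p. w p + v p) (\<lambda>p. D p + E p)"
  using assms unfolding time_C1_def by (auto intro!: continuous_intros DERIV_add)

lemma eventually_line_in_open:
  fixes G :: "('a::euclidean_space \<times> real) set"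
  assumes "open G" "(x, t) \<in> G"
  shows "\<forall>\<^sub>F h in nhds 0. (x + h *\<^sub>R i, t) \<in> G" "\<forall>\<^sub>F s in nhds t. (x, s) \<in> G"
proof -
  have "((\<lambda>h. (x + h *\<^sub>R i, t)) \<longlongrightarrow> (x + 0 *\<^sub>R i, t)) (nhds 0)"
    by (intro tendsto_intros filterlim_ident)
  then show "\<forall>\<^sub>F h in nhds 0. (x + h *\<^sub>R i, t) \<in> G"
    using topological_tendstoD[of _ _ _ G] assms by simp
  have "((\<lambda>s. (x, s)) \<longlongrightarrow> (x, t)) (nhds t)"
    by (intro tendsto_intros filterlim_ident)
  then show "\<forall>\<^sub>F s in nhds t. (x, s) \<in> G"
    using topological_tendstoD[of _ _ _ G] assms by simp
qed

lemma par_C2_cong: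
  assumes "par_C2 G w D1 D2" "open G" "\<And>p. p \<in> G \<Longrightarrow> w p = v p"
  shows "par_C2 G v D1 D2"
proof -
  have "((\<lambda>h. v (x + h *\<^sub>R i, t)) has_real_derivative D1 i (x, t)) (at 0)"
    if "i \<in> Basis" "(x, t) \<in> G" for i x t
  proof -
    have ev: "\<forall>\<^sub>F h in nhds 0. w (x + h *\<^sub>R i, t) = v (x + h *\<^sub>R i, t)"
      using eventually_line_in_open(1)[OF assms(2) that(2)] by eventually_elim (rule assms(3))
    show ?thesis using assms(1) that DERIV_cong_ev[OF refl ev refl, of "D1 i (x, t)"] unfolding par_C2_def by auto
  qed
  moreover have "continuous_on G v" using assms(1,3) continuous_on_cong[of G G w v] unfolding par_C2_def by auto
  ultimately show ?thesis using assms(1) unfolding par_C2_def by auto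
qed

lemma time_C1_cong:
  assumes "time_C1 G w D" "open G" "\<And>p. p \<in> G \<Longrightarrow> w p = v p"
  shows "time_C1 G v D"
proof -
  have "((\<lambda>s. v (x, s)) has_real_derivative D (x, t)) (at t)" if "(x, t) \<in> G" for x t
  proof -
    have ev: "\<forall>\<^sub>F s in nhds t. w (x, s) = v (x, s)"
      using eventually_line_in_open(2)[OF assms(2) that] by eventually_elim (rule assms(3))
    show ?thesis using assms(1) that DERIV_cong_ev[OF refl ev refl, of "D (x, t)"] unfolding time_C1_def by auto
  qed
  then show ?thesis using assms(1) unfolding time_C1_def by auto
qed

lemma par_C2_subset: "par_C2 G w D1 D2 \<Longrightarrow> G' \<subseteq> G \<Longrightarrow> par_C2 G' w D1 D2"
  unfolding par_C2_def by (blast intro: continuous_on_subset)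

lemma time_C1_subset: "time_C1 G w D \<Longrightarrow> G' \<subseteq> G \<Longrightarrow> time_C1 G' w D"
  unfolding time_C1_def by (auto intro: continuous_on_subset)

lemma par_C2_heat_at:
  assumes w: "par_C2 G w D1 D2" "((\<lambda>s. w (x, s)) has_real_derivative d) (at t)" and G: "open G" "(x, t) \<in> G"
  shows "heat_at (\<lambda>x t. w (x, t)) x t (d - (\<Sum>i\<in>Basis. D2 i i (x, t)))"
  unfolding heat_at_def
proof (rule exI[of _ d], rule exI[of _ "\<lambda>i. D2 i i (x, t)"], rule exI[of _ "\<lambda>i s. D1 i (x + s *\<^sub>R i, t)"], intro conjI ballI)
  fix i :: 'a assume i: "i \<in> Basis"
  show "\<forall>\<^sub>F s in nhds 0. ((\<lambda>r. w (x + r *\<^sub>R i, t)) has_real_derivative D1 i (x + s *\<^sub>R i, t)) (at s)"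
    using eventually_line_in_open(1)[OF G, of i]
  proof eventually_elim
    case (elim s)
    then have "((\<lambda>h. w ((x + s *\<^sub>R i) + h *\<^sub>R i, t)) has_real_derivative D1 i (x + s *\<^sub>R i, t)) (at 0)"
      using w(1) i unfolding par_C2_def by blast
    then show ?case using DERIV_shift[of "\<lambda>r. w (x + r *\<^sub>R i, t)" _ 0 s] by (simp add: scaleR_add_left algebra_simps)
  qed
  show "((\<lambda>s. D1 i (x + s *\<^sub>R i, t)) has_real_derivative D2 i i (x, t)) (at 0)"
    using w(1) i G unfolding par_C2_def by blast
qed (use w in auto)

lemma heat_potential_par_C2:
  assumes "continuous_on UNIV H" "\<And>p. \<bar>H p\<bar> \<le> B" "0 < \<theta>" "\<theta> \<le> 1"
    and "\<And>x x' t. \<bar>H (x, t) - H (x', t)\<bar> \<le> A * norm (x - x') powr \<theta>"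
  shows "par_C2 UNIV (convol hkE H) (pot1 H) (pot2 H)"
  unfolding par_C2_def
  using continuous_heat_potential[OF Hm[OF assms] assms(2)] continuous_pot1[OF assms] continuous_pot2[OF assms]
    pot_DERIV1[OF assms] pot_DERIV2[OF assms] by blast

context
  fixes z :: "'a::euclidean_space \<times> real \<Rightarrow> real" and B r :: real and k and n :: nat
  assumes zm: "z \<in> borel_measurable borel" and zB: "\<And>p. \<bar>z p\<bar> \<le> B"
    and k: "k \<in> rad r n" "0 < r" "n < 4"
begin

text \<open>All derivatives fall on the compactly supported kernel, so a bounded measurable
  \<open>z\<close> is smoothed, and the heat operator of the convolution is convolution with the
  kernel \<open>heatq\<close> of \<open>k\<close>.\<close>

lemma convol_lift_par_C2:
  "par_C2 UNIV (convol (lift k) z) (\<lambda>i. convol (\<lambda>p. 2 * (fst p \<bullet> i) * lift (dq k) p) z)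
    (\<lambda>i j. convol (\<lambda>p. 2 * (i \<bullet> j) * lift (dq k) p + 4 * (fst p \<bullet> i) * (fst p \<bullet> j) * lift (dq (dq k)) p) z)"
  and convol_lift_time_C1: "time_C1 UNIV (convol (lift k) z) (convol (lift (ds k)) z)"
  and convol_lift_heat: "convol (lift (ds k)) z p - (\<Sum>i\<in>Basis. convol (\<lambda>p. 2 * (i \<bullet> i) * lift (dq k) p + 4 * (fst p \<bullet> i) * (fst p \<bullet> i) * lift (dq (dq k)) p) z p)
    = convol (lift (heatq DIM('a) k)) z p"
proof -
  have q: "dq k \<in> rad r (Suc n)" "ds k \<in> rad r (Suc n)" "dq (dq k) \<in> rad r (Suc (Suc n))"
    using rad_deriv(1,2)[OF k(1,2)] rad_deriv(1)[of "dq k" r "Suc n"] k by auto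
  note c = continuous_lift[OF k(1,2), where 'a='a] continuous_lift[OF q(1) k(2), where 'a='a] continuous_lift[OF q(2) k(2), where 'a='a] continuous_lift[OF q(3) k(2), where 'a='a]
  note s = lift_support[OF k(1,2), where 'a='a] lift_support[OF q(1) k(2), where 'a='a] lift_support[OF q(2) k(2), where 'a='a] lift_support[OF q(3) k(2), where 'a='a]
  define D1 where "D1 i p = 2 * (fst p \<bullet> i) * lift (dq k) p" for i :: 'a and p
  define D2 where "D2 i j p = 2 * (i \<bullet> j) * lift (dq k) p + 4 * (fst p \<bullet> i) * (fst p \<bullet> j) * lift (dq (dq k)) p" for i j :: 'a and p
  have c1: "continuous_on UNIV (D1 i)" and c2: "continuous_on UNIV (D2 i j)" for i j
    unfolding D1_def D2_def by (auto intro!: continuous_intros c)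
  have i0: "integrable lborel (lift k :: 'a \<times> real \<Rightarrow> real)" by (rule integrable_lift[OF k(1,2)])
  have it: "integrable lborel (lift (ds k) :: 'a \<times> real \<Rightarrow> real)" by (rule integrable_lift[OF q(2) k(2)])
  have i1: "integrable lborel (D1 i)" for i
    by (rule integrable_compact_support[OF c1 compact_cap[of r]]) (use s in \<open>auto simp: D1_def\<close>)
  have i2: "integrable lborel (D2 i j)" for i j
    by (rule integrable_compact_support[OF c2 compact_cap[of r]]) (use s in \<open>auto simp: D2_def\<close>)
  have cc: "continuous_on UNIV (convol l z)" if "continuous_on UNIV l" "integrable lborel l" for l
  proof (rule continuous_on_convol[OF that(2) AE_I2 zm zB])
    show "isCont l y" for y using that(1) continuous_on_eq_continuous_at[OF open_UNIV] by blast
  qed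
  have d1: "((\<lambda>h. convol (lift k) z (x + h *\<^sub>R i, t)) has_real_derivative convol (D1 i) z (x, t)) (at 0)" for i x t
    using DERIV_convol[OF i0 i1 c1 _ zm zB, of "(i, 0)" i "(x, t)" 0] lift_deriv_x[OF k(1,2), of _ i] k(3)
    by (simp add: D1_def)
  have d2: "((\<lambda>h. convol (D1 i) z (x + h *\<^sub>R j, t)) has_real_derivative convol (D2 i j) z (x, t)) (at 0)" for i j x t
    using DERIV_convol[OF i1[of i] i2 c2 _ zm zB, of "(j, 0)" i j "(x, t)" 0] lift_deriv_xx[OF k, of _ j i]
    by (simp add: D1_def D2_def)
  show "par_C2 UNIV (convol (lift k) z) (\<lambda>i. convol (\<lambda>p. 2 * (fst p \<bullet> i) * lift (dq k) p) z)
    (\<lambda>i j. convol (\<lambda>p. 2 * (i \<bullet> j) * lift (dq k) p + 4 * (fst p \<bullet> i) * (fst p \<bullet> j) * lift (dq (dq k)) p) z)"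
    unfolding D1_def[symmetric] D2_def[symmetric] par_C2_def using cc[OF c(1) i0] cc[OF c1 i1] cc[OF c2 i2] d1 d2 by blast
  have dt: "((\<lambda>h. convol (lift k) z ((x, 0) + h *\<^sub>R (0, 1))) has_real_derivative convol (lift (ds k)) z ((x, 0) + t *\<^sub>R (0, 1))) (at t)" for x t
    by (rule DERIV_convol[OF i0 it c(3) _ zm zB]) (use lift_deriv_t[OF k(1,2)] k(3) in auto)
  then show "time_C1 UNIV (convol (lift k) z) (convol (lift (ds k)) z)"
    unfolding time_C1_def using cc[OF c(3) it] by simp
  have zi: "integrable lborel (\<lambda>q. l q * z (p - q))" if "integrable lborel l" for l
    by (rule convol_integrable[OF that zm zB])
  have h: "lift (heatq DIM('a) k) q = lift (ds k) q - (\<Sum>i\<in>Basis. D2 i i q)" for q :: "'a \<times> real"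
  proof -
    have "(\<Sum>i\<in>Basis. D2 i i q) = 2 * DIM('a) * lift (dq k) q + 4 * (norm (fst q))\<^sup>2 * lift (dq (dq k)) q"
      unfolding D2_def norm_sq_eq_sum by (simp add: sum.distrib sum_distrib_left sum_distrib_right power2_eq_square mult_ac)
    then show ?thesis by (simp add: lift_def heatq_def)
  qed
  have "convol (lift (heatq DIM('a) k)) z p = (\<integral>q. lift (ds k) q * z (p - q) - (\<Sum>i\<in>Basis. D2 i i q * z (p - q)) \<partial>lborel)"
    unfolding convol_def h by (simp add: left_diff_distrib sum_distrib_right)
  also have "\<dots> = convol (lift (ds k)) z p - (\<Sum>i\<in>Basis. convol (D2 i i) z p)"
    unfolding convol_def using zi[OF it] zi[OF i2]
    by (subst Bochner_Integration.integral_diff) (auto intro!: Bochner_Integration.integrable_sum)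
  finally show "convol (lift (ds k)) z p - (\<Sum>i\<in>Basis. convol (\<lambda>p. 2 * (i \<bullet> i) * lift (dq k) p + 4 * (fst p \<bullet> i) * (fst p \<bullet> i) * lift (dq (dq k)) p) z p)
    = convol (lift (heatq DIM('a) k)) z p" unfolding D2_def by simp
qed

end

section \<open>Uniqueness of heat potentials and the kernel identities\<close>

lemma heat_potential_zero:
  assumes H0: "\<And>x t. t \<le> 0 \<Longrightarrow> H (x, t) = 0" and t: "t \<le> 0"
  shows "convol hkE H (x, t) = 0"
proof -
  have z: "hkE q * H ((x, t) - q) = 0" for q
  proof (cases "snd q \<le> 0")
    case False
    then show ?thesis using H0[of "t - snd q" "x - fst q"] t by (cases q) auto
  qed (simp add: hkE_def)
  show ?thesis unfolding convol_def z by simp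
qed

text \<open>Turns an identity between kernels into the verification of a heat equation: the
  potential and \<psi> have the same source, start from 0 and are bounded, so the maximum principle
  on the whole space applies to their difference with both signs.\<close>

lemma heat_potential_unique:
  fixes H \<psi> :: "'a::euclidean_space \<times> real \<Rightarrow> real"
  assumes H: "continuous_on UNIV H" "\<And>p. \<bar>H p\<bar> \<le> B" "0 < \<theta>" "\<theta> \<le> 1"
      "\<And>x x' t. \<bar>H (x, t) - H (x', t)\<bar> \<le> A * norm (x - x') powr \<theta>"
    and H0: "\<And>x t. t \<le> 0 \<or> 1 \<le> t \<Longrightarrow> H (x, t) = 0"
    and \<psi>: "continuous_on (UNIV \<times> {0..<1}) \<psi>" "\<And>x t. 0 \<le> t \<Longrightarrow> t < 1 \<Longrightarrow> \<bar>\<psi> (x, t)\<bar> \<le> C"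
      "\<And>x. \<psi> (x, 0) = 0" "\<And>x t. 0 < t \<Longrightarrow> t < 1 \<Longrightarrow> heat_at (\<lambda>x t. \<psi> (x, t)) x t (H (x, t))"
    and t: "0 \<le> t" "t < 1"
  shows "convol hkE H (x, t) = \<psi> (x, t)"
proof -
  let ?W = "convol hkE H"
  note Hm = Hm[OF H]
  have W: "heat_at (\<lambda>x t. ?W (x, t)) x t (H (x, t))" if "0 < t" "t < 1" for x t
    using par_C2_heat_at[OF heat_potential_par_C2[OF H] pot_DERIV_time[OF H H0 that], of x] by simp
  have c: "continuous_on (UNIV \<times> {0..<1}) ?W" by (rule continuous_heat_potential[OF Hm H(2)])
  define I where "I = (\<integral>q. \<bar>hkE (q::'a \<times> real)\<bar> \<partial>lborel)"
  have b: "\<bar>?W p\<bar> \<le> B * I" for p unfolding I_def by (rule heat_potential_bound[OF Hm H(2)])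
  define w where "w b x t = (if b then 1 else - 1) * (?W (x, t) - \<psi> (x, t))" for b :: bool and x t
  have w0: "w b x t \<le> 0" for b
  proof (rule parabolic_maximum_principle[where w=w and D=UNIV and T=1 and B="B * I + C" and L=0])
    fix b
    show "continuous_on (closure UNIV \<times> {0..<1}) (\<lambda>(x, t). w b x t)"
      unfolding w_def using c \<psi>(1) by (auto intro!: continuous_intros simp: case_prod_unfold)
    show "w b x t \<le> B * I + C" if "t \<in> {0..<1}" for x t
      using b[of "(x, t)"] \<psi>(2)[of t x] that unfolding w_def by (cases b) auto
    show "w b x 0 \<le> 0" for x
      unfolding w_def using \<psi>(3) heat_potential_zero[of H 0 x] H0 by auto
    show "\<exists>c. heat_at (w b) x t c \<and> c \<le> 0 * w b x t" if "t \<in> {0<..<1}" for x t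
    proof (rule exI[of _ 0], rule conjI)
      show "heat_at (w b) x t 0"
      proof -
        have "heat_at (\<lambda>x t. ?W (x, t) - \<psi> (x, t)) x t (H (x, t) - H (x, t))"
          by (rule heat_at_diff[OF W \<psi>(4)]) (use that in auto)
        from heat_at_cmult[OF this, of "if b then 1 else -1"] show ?thesis unfolding w_def[abs_def] by simp
      qed
    qed simp
  qed (use t in auto)
  from w0[of True] w0[of False] show ?thesis by (simp add: w_def)
qed

lemma lift_holder:
  assumes "k \<in> rad r n" "0 < r" "n < 5"
  obtains A where "\<And>(x::'a::euclidean_space) x' t. \<bar>lift k (x, t) - lift k (x', t)\<bar> \<le> A * norm (x - x') powr 1"
proof -
  have q: "dq k \<in> rad r (Suc n)" using rad_deriv(1)[OF assms] .
  obtain C where C: "\<And>p::'a \<times> real. \<bar>norm (fst p) * lift (dq k) p\<bar> \<le> C"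
  proof (rule bounded_compact_support[OF _ compact_cap[of r]])
    show "continuous_on UNIV (\<lambda>p::'a \<times> real. norm (fst p) * lift (dq k) p)"
      by (intro continuous_intros continuous_lift[OF q assms(2)])
  qed (use lift_support[OF q assms(2)] in auto)
  show ?thesis
  proof (rule that[of "2 * C"])
    fix x x' :: 'a and t
    define e where "e = x - x'"
    have d: "((\<lambda>\<tau>. lift k (x' + \<tau> *\<^sub>R e, t)) has_real_derivative 2 * ((x' + \<tau> *\<^sub>R e) \<bullet> e) * lift (dq k) (x' + \<tau> *\<^sub>R e, t)) (at \<tau>)" for \<tau>
      using lift_deriv_x[OF assms, of "(x' + \<tau> *\<^sub>R e, t)" e] DERIV_shift[of "\<lambda>\<tau>. lift k (x' + \<tau> *\<^sub>R e, t)" _ 0 \<tau>]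
      by (simp add: scaleR_add_left algebra_simps)
    obtain \<tau> where \<tau>: "lift k (x' + 1 *\<^sub>R e, t) - lift k (x' + 0 *\<^sub>R e, t) = (1 - 0) * (2 * ((x' + \<tau> *\<^sub>R e) \<bullet> e) * lift (dq k) (x' + \<tau> *\<^sub>R e, t))"
      using MVT2[of 0 1 "\<lambda>\<tau>. lift k (x' + \<tau> *\<^sub>R e, t)"] d by force
    define y where "y = x' + \<tau> *\<^sub>R e"
    have "\<bar>lift k (x, t) - lift k (x', t)\<bar> = 2 * \<bar>y \<bullet> e\<bar> * \<bar>lift (dq k) (y, t)\<bar>"
      using \<tau> by (simp add: e_def y_def abs_mult)
    also have "\<dots> \<le> 2 * (norm y * norm e) * \<bar>lift (dq k) (y, t)\<bar>"
      by (intro mult_right_mono mult_left_mono Cauchy_Schwarz_ineq2) auto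
    also have "\<dots> = 2 * \<bar>norm (fst (y, t)) * lift (dq k) (y, t)\<bar> * norm e" by (simp add: abs_mult)
    also have "\<dots> \<le> 2 * C * norm e" by (intro mult_right_mono mult_left_mono C) auto
    finally show "\<bar>lift k (x, t) - lift k (x', t)\<bar> \<le> 2 * C * norm (x - x') powr 1" by (simp add: e_def)
  qed
qed

text \<open>With \<open>a\<close> the cut-off \<open>cut0 r\<close> evaluated at \<open>|y|\<^sup>2 + s\<close> and \<open>\<Gamma>\<close> the heat kernel, \<open>kap r\<close> is
  \<open>(\<partial>\<^sub>s - \<Delta>) ((1 - a) \<Gamma>)\<close> and \<open>kap' r\<close> is \<open>(\<partial>\<^sub>s - \<Delta>) (kap r)\<close>.\<close>

definition kapq :: "'a::euclidean_space itself \<Rightarrow> real \<Rightarrow> real \<Rightarrow> real \<Rightarrow> real" where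
  "kapq T r q s = 1 / gmass T * ((2 * real DIM('a) - 1) * cutg (cut1 r) (DIM('a) / 2) q s
     + 4 * (q * cutg (cut2 r) (DIM('a) / 2) q s) - 2 * (q * cutg (cut1 r) (DIM('a) / 2 + 1) q s))"

definition kap :: "real \<Rightarrow> 'a::euclidean_space \<times> real \<Rightarrow> real" where
  "kap r = lift (kapq TYPE('a) r)"

definition kap' :: "real \<Rightarrow> 'a::euclidean_space \<times> real \<Rightarrow> real" where
  "kap' r = lift (heatq DIM('a) (kapq TYPE('a) r))"

text \<open>The local part \<open>a \<Gamma>\<close> of the heat kernel. It keeps the singularity at
  the origin; the complement \<open>(1 - a) \<Gamma>\<close> is as smooth as the cut-off.\<close>

definition kerP :: "real \<Rightarrow> 'a::euclidean_space \<times> real \<Rightarrow> real" where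
  "kerP r p = cut0 r ((norm (fst p))\<^sup>2 + snd p) * hk (fst p) (snd p)"

lemma kapq_rad: "kapq TYPE('a::euclidean_space) r \<in> rad r 2"
proof -
  have 1: "cutg (cut1 r) m q s = - 36 / r * cutg (bump_pow 5 5 r) m q s" for m q s by (simp add: cutg_def cut1_def)
  have 2: "cutg (cut2 r) m q s = 1080 / r\<^sup>2 * cutg (bump_pow 4 10 r) m q s - 180 / r\<^sup>2 * cutg (bump_pow 5 4 r) m q s" for m q s
    by (simp add: cutg_def cut2_def algebra_simps)
  show ?thesis unfolding kapq_def[abs_def] 1 2 by (intro rad_cmult rad_diff rad_add rad_qmult rad_base) auto
qed

lemma kapq'_rad: "0 < r \<Longrightarrow> heatq N (kapq TYPE('a::euclidean_space) r) \<in> rad r 4"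
  using rad_heatq[OF kapq_rad, of r N] by (simp add: numeral_eq_Suc)

lemma rad_support_time:
  assumes "k \<in> rad r n" "0 < r" "2 * r \<le> 1" "t \<le> 0 \<or> 1 \<le> t"
  shows "lift k (x, t) = 0"
proof -
  have "t \<le> 0 \<or> 2 * r \<le> (norm x)\<^sup>2 + t" using assms(3,4) zero_le_power2[of "norm x"] by linarith
  then show ?thesis unfolding lift_def by (auto intro: rad_support[OF assms(1,2)])
qed

lemma lift_bounded:
  assumes "k \<in> rad r n" "0 < r"
  obtains B where "\<And>p::'a::euclidean_space \<times> real. \<bar>lift k p\<bar> \<le> B"
  using bounded_compact_support[OF continuous_lift[OF assms] compact_cap[of r] lift_support[OF assms]] by blast

text \<open>The right-hand side is \<open>(1 - a) \<Gamma>\<close>: bounded, zero at time 0, and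
  with source \<open>kap r\<close>. By uniqueness it is the potential of
  \<open>kap r\<close>.\<close>

lemma psi_eq:
  assumes r: "0 < r" "2 * r \<le> 1" and t: "t < 1"
  shows "convol hkE (kap r) (x, t) = hk x t - kerP r (x::'a::euclidean_space, t)"
proof (cases "0 < t")
  case False
  have "convol hkE (kap r) (x, t) = 0"
    by (rule heat_potential_zero) (use rad_support_time[OF kapq_rad r] False in \<open>auto simp: kap_def\<close>)
  then show ?thesis using False by (simp add: kerP_def)
next
  case True
  let ?m = "DIM('a) / 2" and ?G = "gmass TYPE('a)" and ?N = "real DIM('a)"
  define a where "a x = 1 - cut0 r x" for x
  define a1 where "a1 x = - cut1 r x" for x
  define a2 where "a2 x = - cut2 r x" for x
  have a: "\<And>x. x \<le> r \<Longrightarrow> a x = 0" "continuous_on UNIV a" "\<And>x. (a has_real_derivative a1 x) (at x)"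
    using r DERIV_diff[OF DERIV_const cut_deriv(1)[of r]] unfolding a_def[abs_def] a1_def
    by (auto intro!: continuous_intros continuous_cut simp: cut_support)
  have a1: "\<And>x. x \<le> r \<Longrightarrow> a1 x = 0" "continuous_on UNIV a1" "\<And>x. (a1 has_real_derivative a2 x) (at x)"
    using r DERIV_minus[OF cut_deriv(2)[of r]] unfolding a1_def[abs_def] a2_def
    by (auto intro!: continuous_intros continuous_cut simp: cut_support)
  define F where "F q s = cutg a ?m q s / ?G" for q s
  define \<psi> where "\<psi> p = F ((norm (fst p))\<^sup>2) (snd p)" for p :: "'a \<times> real"
  have \<psi>eq: "\<psi> p = hk (fst p) (snd p) - kerP r p" for p :: "'a \<times> real"
    unfolding \<psi>_def F_def kerP_def cutg_def a_def hk_def by (simp add: field_simps)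
  have "convol hkE (kap r) (x, t) = \<psi> (x, t)"
  proof -
    obtain B where B: "\<And>p::'a \<times> real. \<bar>kap r p\<bar> \<le> B" unfolding kap_def using lift_bounded[OF kapq_rad r(1)] by blast
    obtain A where A: "\<And>(x::'a) x' t. \<bar>kap r (x, t) - kap r (x', t)\<bar> \<le> A * norm (x - x') powr 1"
      unfolding kap_def using lift_holder[OF kapq_rad r(1)] by auto
    have "bounded ((\<lambda>s. gsq ?m (r / 2) s) ` {0..1})"
      by (intro compact_imp_bounded compact_continuous_image continuous_at_imp_continuous_on ballI DERIV_isCont[OF gsq_deriv_s]) (use r in auto)
    then obtain K where K: "\<And>s. s \<in> {0..1} \<Longrightarrow> \<bar>gsq ?m (r / 2) s\<bar> \<le> K" unfolding bounded_real by blast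
    then have K0: "0 \<le> K" using order_trans[OF abs_ge_zero, of _ K] by force
    have a01: "\<bar>a x\<bar> \<le> 1" for x using cut0_bounds[of r x] by (simp add: a_def)
    show ?thesis
    proof (rule heat_potential_unique[where B=B and A=A and \<theta>=1 and C="max K ((r/2) powr (- ?m)) / ?G"])
      show "continuous_on UNIV (kap r :: 'a \<times> real \<Rightarrow> real)" unfolding kap_def by (rule continuous_lift[OF kapq_rad r(1)])
      show "kap r (x, t) = 0" if "t \<le> 0 \<or> 1 \<le> t" for x :: 'a and t
        unfolding kap_def by (rule rad_support_time[OF kapq_rad r that])
      have "continuous_on UNIV (\<lambda>p. cutg a ?m (fst p) (snd p))"
        by (rule continuous_cutg[OF r(1) a(1,2)])
      moreover have "continuous_on UNIV (\<lambda>p::'a \<times> real. ((norm (fst p))\<^sup>2, snd p))" by (intro continuous_intros)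
      ultimately have "continuous_on UNIV (\<lambda>p::'a \<times> real. cutg a ?m ((norm (fst p))\<^sup>2) (snd p))"
        using continuous_on_compose2[of UNIV "\<lambda>p. cutg a ?m (fst p) (snd p)" UNIV "\<lambda>p::'a \<times> real. ((norm (fst p))\<^sup>2, snd p)"] by simp
      then have "continuous_on UNIV \<psi>"
        unfolding \<psi>_def[abs_def] F_def by (intro continuous_on_divide continuous_on_const) auto
      then show "continuous_on (UNIV \<times> {0..<1}) \<psi>" by (rule continuous_on_subset) simp
      show "\<psi> (x, 0) = 0" for x by (simp add: \<psi>_def F_def cutg_def gsq_def)
      show "\<bar>\<psi> (x, t)\<bar> \<le> max K ((r/2) powr (- ?m)) / ?G" if t: "0 \<le> t" "t < 1" for x t
      proof -
        define q where "q = (norm x)\<^sup>2"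
        have q0: "q \<ge> 0" by (simp add: q_def)
        have "\<bar>cutg a ?m q t\<bar> \<le> max K ((r/2) powr (- ?m))"
        proof -
          \<comment> \<open>Where the factor does not vanish, \<open>q\<close> or \<open>t\<close>
            is at least \<open>r / 2\<close>, and either alone bounds the Gaussian.\<close>
          consider "q + t < r" | "r / 2 \<le> q" | "r / 2 \<le> t" by linarith
          then show ?thesis
          proof cases
            case 1
            then show ?thesis using a(1)[of "q + t"] K0 by (simp add: cutg_def le_max_iff_disj)
          next
            case 2
            have "- q / (4 * t) \<le> - (r / 2) / (4 * t)" using 2 t by (intro divide_right_mono) auto
            then have "\<bar>gsq ?m q t\<bar> \<le> gsq ?m (r / 2) t" by (simp add: gsq_def mult_left_mono)
            also have "\<dots> \<le> K" using K[of t] t by simp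
            finally have le: "\<bar>gsq ?m q t\<bar> \<le> K" .
            then have "\<bar>a (q + t)\<bar> * \<bar>gsq ?m q t\<bar> \<le> 1 * K" by (intro mult_mono a01 le) auto
            then show ?thesis by (simp add: cutg_def abs_mult)
          next
            case 3
            then have t0: "0 < t" using r by linarith
            have "gsq ?m q t \<le> t powr (- ?m) * 1"
              unfolding gsq_def using t0 q0 by (auto intro!: mult_left_mono)
            also have "\<dots> \<le> (r/2) powr (- ?m)" using 3 r by (auto intro!: powr_mono2')
            finally have "\<bar>gsq ?m q t\<bar> \<le> (r/2) powr (- ?m)" by (simp add: gsq_def)
            then have "\<bar>a (q + t)\<bar> * \<bar>gsq ?m q t\<bar> \<le> 1 * (r/2) powr (- ?m)" by (intro mult_mono a01) auto
            then show ?thesis by (simp add: cutg_def abs_mult)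
          qed
        qed
        then show ?thesis using gmass_pos[where 'a='a] by (simp add: \<psi>_def F_def q_def divide_right_mono)
      qed
      fix x :: 'a and t :: real assume t: "0 < t" "t < 1"
      have h1: "((\<lambda>s. F ((norm x)\<^sup>2) s) has_real_derivative (cutg a1 ?m ((norm x)\<^sup>2) t - ?m * cutg a (?m + 1) ((norm x)\<^sup>2) t
          + (norm x)\<^sup>2 / 4 * cutg a (?m + 2) ((norm x)\<^sup>2) t) / ?G) (at t)"
        unfolding F_def by (intro DERIV_cdivide cutg_deriv_s[OF r(1) a])
      have h2: "((\<lambda>q. F q t) has_real_derivative (cutg a1 ?m q t - cutg a (?m + 1) q t / 4) / ?G) (at q)" for q
        unfolding F_def by (intro DERIV_cdivide cutg_deriv_q[OF r(1) a])
      have h3: "((\<lambda>q. (cutg a1 ?m q t - cutg a (?m + 1) q t / 4) / ?G) has_real_derivative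
          ((cutg a2 ?m q t - cutg a1 (?m + 1) q t / 4) - (cutg a1 (?m + 1) q t - cutg a (?m + 1 + 1) q t / 4) / 4) / ?G) (at q)" for q
        by (intro DERIV_cdivide DERIV_diff cutg_deriv_q[OF r(1) a] cutg_deriv_q[OF r(1) a1])
      \<comment> \<open>The terms free of derivatives of the cut-off cancel, because the Gaussian
        solves the heat equation; the remaining ones are \<open>kapq\<close>.\<close>
      have e: "((cutg a1 ?m ((norm x)\<^sup>2) t - ?m * cutg a (?m + 1) ((norm x)\<^sup>2) t + (norm x)\<^sup>2 / 4 * cutg a (?m + 2) ((norm x)\<^sup>2) t) / ?G
         - 2 * ?N * ((cutg a1 ?m ((norm x)\<^sup>2) t - cutg a (?m + 1) ((norm x)\<^sup>2) t / 4) / ?G)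
         - 4 * (norm x)\<^sup>2 * (((cutg a2 ?m ((norm x)\<^sup>2) t - cutg a1 (?m + 1) ((norm x)\<^sup>2) t / 4)
            - (cutg a1 (?m + 1) ((norm x)\<^sup>2) t - cutg a (?m + 1 + 1) ((norm x)\<^sup>2) t / 4) / 4) / ?G))
         = kap r (x, t)"
      proof -
        have m: "?m + 1 + 1 = ?m + 2" by simp
        have c: "cutg a1 m q s = - cutg (cut1 r) m q s" "cutg a2 m q s = - cutg (cut2 r) m q s" for m q s
          by (simp_all add: cutg_def a1_def a2_def)
        show ?thesis unfolding kap_def lift_def kapq_def c m
          by (simp add: divide_simps) (simp add: algebra_simps)
      qed
      show "heat_at (\<lambda>x t. \<psi> (x, t)) x t (kap r (x, t))"
        using heat_at_radial[where F=F, OF h1 h2 h3] unfolding e by (simp add: \<psi>_def)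
    qed (use A B True t in auto)
  qed
  then show ?thesis by (simp add: \<psi>eq)
qed

text \<open>The argument of \<open>psi_eq\<close> one level up: \<open>kap r\<close> is itself a
  bounded function vanishing at time 0, with source \<open>kap' r\<close>.\<close>

lemma kap'_eq:
  assumes r: "0 < r" "2 * r \<le> 1" and t: "t < 1"
  shows "convol hkE (kap' r) (x, t) = kap r (x::'a::euclidean_space, t)"
proof (cases "0 < t")
  case False
  have "convol hkE (kap' r) (x, t) = 0"
    by (rule heat_potential_zero) (use rad_support_time[OF kapq'_rad r] r False in \<open>auto simp: kap'_def\<close>)
  then show ?thesis using False rad_support_time[OF kapq_rad[where 'a='a] r, of t x] by (simp add: kap_def)
next
  case True
  note R = kapq'_rad[OF r(1), of "real DIM('a)", where 'a='a]
  obtain B where B: "\<And>p::'a \<times> real. \<bar>kap' r p\<bar> \<le> B" unfolding kap'_def using lift_bounded[OF R r(1)] by blast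
  obtain A where A: "\<And>(x::'a) x' t. \<bar>kap' r (x, t) - kap' r (x', t)\<bar> \<le> A * norm (x - x') powr 1"
    unfolding kap'_def using lift_holder[OF R r(1)] by auto
  obtain C where C: "\<And>p::'a \<times> real. \<bar>kap r p\<bar> \<le> C" unfolding kap_def using lift_bounded[OF kapq_rad r(1)] by blast
  have q: "dq (kapq TYPE('a) r) \<in> rad r 3"
    using rad_deriv(1)[OF kapq_rad r(1)] by simp
  show ?thesis
  proof (rule heat_potential_unique[where B=B and A=A and \<theta>=1 and C=C])
    show "continuous_on UNIV (kap' r :: 'a \<times> real \<Rightarrow> real)" unfolding kap'_def by (rule continuous_lift[OF R r(1)])
    show "kap' r (x, t) = 0" if "t \<le> 0 \<or> 1 \<le> t" for x :: 'a and t
      unfolding kap'_def by (rule rad_support_time[OF R r that])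
    show "continuous_on (UNIV \<times> {0..<1}) (kap r :: 'a \<times> real \<Rightarrow> real)" unfolding kap_def
      by (rule continuous_on_subset[OF continuous_lift[OF kapq_rad r(1)]]) simp
    show "kap r (x, 0) = 0" for x :: 'a
      unfolding kap_def by (rule rad_support_time[OF kapq_rad r]) simp
    show "heat_at (\<lambda>x t. kap r (x, t)) x t (kap' r (x, t))" for x :: 'a and t
      using heat_at_radial[of "kapq TYPE('a) r" x _ t, OF rad_deriv(4)[OF kapq_rad r(1)] rad_deriv(3)[OF kapq_rad r(1)] rad_deriv(3)[OF q r(1)]]
      by (simp add: kap_def kap'_def lift_def heatq_def mult.assoc)
  qed (use A B C True t in auto)
qed

lemma convol_commute:
  assumes "k \<in> borel_measurable borel" "l \<in> borel_measurable borel"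
  shows "convol k l x = convol l k x"
  unfolding convol_swap[OF assms] by (simp add: convol_def mult.commute)

lemma kap_measurable [measurable]: "0 < r \<Longrightarrow> kap r \<in> borel_measurable borel" "0 < r \<Longrightarrow> kap' r \<in> borel_measurable borel"
  unfolding kap_def kap'_def
  by (auto intro!: borel_measurable_continuous_onI continuous_lift[OF kapq_rad] continuous_lift[OF kapq'_rad])

lemma kap_integrable: "0 < r \<Longrightarrow> integrable lborel (kap r)" "0 < r \<Longrightarrow> integrable lborel (kap' r)"
  unfolding kap_def kap'_def by (auto intro: integrable_lift[OF kapq_rad] integrable_lift[OF kapq'_rad])

lemma kap_support: "0 < r \<Longrightarrow> p \<notin> cap r \<Longrightarrow> kap r p = 0" "0 < r \<Longrightarrow> p \<notin> cap r \<Longrightarrow> kap' r p = 0"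
  unfolding kap_def kap'_def by (auto intro: lift_support[OF kapq_rad] lift_support[OF kapq'_rad])

lemma kerP_support:
  assumes "0 < r" "p \<notin> cap r"
  shows "kerP r p = 0"
  using not_in_cap[OF assms(2)] cut_support(1)[OF assms(1)] by (auto simp: kerP_def)

lemma kerP_measurable [measurable]: "0 < r \<Longrightarrow> kerP r \<in> borel_measurable borel"
proof -
  assume r: "0 < r"
  have [measurable]: "cut0 r \<in> borel_measurable borel"
    by (intro borel_measurable_continuous_onI continuous_cut r)
  show ?thesis unfolding kerP_def[abs_def] by measurable
qed

lemma kerP_bounds:
  assumes "0 < r" "2 * r \<le> 1"
  shows "0 \<le> kerP r p" "kerP r p \<le> hkE p"
proof -
  show "0 \<le> kerP r p" by (simp add: kerP_def cut0_bounds hk_nonneg)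
  show "kerP r p \<le> hkE p"
  proof (cases "snd p < 1")
    case True
    then show ?thesis using mult_right_mono[OF cut0_bounds(2) hk_nonneg] by (simp add: kerP_def hkE_def)
  next
    case False
    then have "2 * r \<le> (norm (fst p))\<^sup>2 + snd p" using assms zero_le_power2[of "norm (fst p)"] by linarith
    then show ?thesis using False cut_support(1)[OF assms(1)] by (simp add: kerP_def hkE_def)
  qed
qed

lemma kerP_integrable: "0 < r \<Longrightarrow> 2 * r \<le> 1 \<Longrightarrow> integrable lborel (kerP r)"
proof (rule Bochner_Integration.integrable_bound[OF integrable_hkE])
  assume r: "0 < r" "2 * r \<le> 1"
  show "AE p in lborel. norm (kerP r p) \<le> norm (hkE p)"
    by (rule AE_I2) (simp add: kerP_bounds[OF r] hkE_nonneg)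
qed simp

text \<open>Associativity moves \<open>kap r\<close> and \<open>kap' r\<close> onto the heat kernel,
  where \<open>psi_eq\<close> and \<open>kap'_eq\<close> evaluate the product. These hold for lags
  below 1; for larger lags \<open>f\<close> vanishes.\<close>

lemma heat_potential_identities:
  fixes f :: "'a::euclidean_space \<times> real \<Rightarrow> real"
  assumes r: "0 < r" "2 * r \<le> 1" and t: "t < 1"
    and f: "f \<in> borel_measurable borel" "\<And>p. \<bar>f p\<bar> \<le> B" "\<And>x t. t \<le> 0 \<Longrightarrow> f (x, t) = 0"
  shows "convol hkE f (x, t) = convol (kerP r) f (x, t) + convol (kap r) (convol hkE f) (x, t)"
    and "convol (kap' r) (convol hkE f) (x, t) = convol (kap r) f (x, t)"
proof -
  have f0: "f ((x, t) - q) = 0" if "1 \<le> snd q" for q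
    using f(3)[of "t - snd q" "x - fst q"] that t by (cases q) auto
  have eq: "k * f ((x, t) - q) = k' * f ((x, t) - q)" if "snd q < 1 \<Longrightarrow> k = k'" for k k' q
    using that f0[of q] by (cases "snd q < 1") auto
  have "convol (kap r) (convol hkE f) (x, t) = convol (convol (kap r) hkE) f (x, t)"
    by (rule convol_assoc[OF kap_integrable(1)[OF r(1)] integrable_hkE f(1,2)])
  also have "\<dots> = (\<integral>q. hkE q * f ((x, t) - q) - kerP r q * f ((x, t) - q) \<partial>lborel)"
    unfolding convol_def[of "convol (kap r) hkE"] left_diff_distrib[symmetric]
    by (intro Bochner_Integration.integral_cong refl eq)
       (use psi_eq[OF r] r in \<open>auto simp: convol_commute[of "kap r" hkE] hkE_def\<close>)
  also have "\<dots> = convol hkE f (x, t) - convol (kerP r) f (x, t)"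
    unfolding convol_def
    by (intro Bochner_Integration.integral_diff convol_integrable[OF integrable_hkE f(1,2)] convol_integrable[OF kerP_integrable[OF r] f(1,2)])
  finally show "convol hkE f (x, t) = convol (kerP r) f (x, t) + convol (kap r) (convol hkE f) (x, t)" by simp
  have "convol (kap' r) (convol hkE f) (x, t) = convol (convol (kap' r) hkE) f (x, t)"
    by (rule convol_assoc[OF kap_integrable(2)[OF r(1)] integrable_hkE f(1,2)])
  also have "\<dots> = convol (kap r) f (x, t)"
    unfolding convol_def[of "convol (kap' r) hkE"] convol_def[of "kap r"]
    by (intro Bochner_Integration.integral_cong refl eq)
       (use kap'_eq[OF r] r in \<open>auto simp: convol_commute[of "kap' r" hkE]\<close>)
  finally show "convol (kap' r) (convol hkE f) (x, t) = convol (kap r) f (x, t)" .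
qed

section \<open>The heat flow of initial data\<close>

text \<open>The substitution \<open>y = sqrt t * z\<close> freezes the kernel at time 1, so
  continuity down to \<open>t = 0\<close> is plain dominated convergence. Negative times get the
  initial value.\<close>

definition heat_flow :: "('a::euclidean_space \<Rightarrow> real) \<Rightarrow> 'a \<times> real \<Rightarrow> real" where
  "heat_flow g p = (\<integral>z. hk z 1 * g (fst p - sqrt (max 0 (snd p)) *\<^sub>R z) \<partial>lborel)"

context
  fixes g :: "'a::euclidean_space \<Rightarrow> real" and B :: real
  assumes gc: "continuous_on UNIV g" and gB: "\<And>x. \<bar>g x\<bar> \<le> B"
begin

lemma g_measurable [measurable]: "g \<in> borel_measurable borel"
  by (rule borel_measurable_continuous_onI[OF gc])

lemma continuous_heat_flow: "continuous_on UNIV (heat_flow g)"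
  unfolding heat_flow_def[abs_def]
proof (rule continuous_on_integral_dominated[where g = "\<lambda>z. B * \<bar>hk z 1\<bar>"])
  show "continuous_on UNIV (\<lambda>p. hk z 1 * g (fst p - sqrt (max 0 (snd p)) *\<^sub>R z))" for z
    by (intro continuous_intros continuous_on_compose2[OF gc]) auto
  show "\<bar>hk z 1 * g (fst p - sqrt (max 0 (snd p)) *\<^sub>R z)\<bar> \<le> B * \<bar>hk z 1\<bar>" for p z
    by (rule abs_mult_le_bound[OF gB])
  show "integrable lborel (\<lambda>z::'a. B * \<bar>hk z 1\<bar>)" using hk_integral(1)[of 1, where 'a='a] by simp
qed measurable

lemma heat_flow_bound: "\<bar>heat_flow g p\<bar> \<le> B"
proof -
  have "\<bar>heat_flow g p\<bar> \<le> (\<integral>(z::'a). B * \<bar>hk z 1\<bar> \<partial>lborel)"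
    unfolding heat_flow_def using hk_integral(1)[of 1, where 'a='a]
    by (intro order_trans[OF integral_abs_bound integral_mono] integrable_abs integrable_mult_bounded[OF _ _ gB] abs_mult_le_bound[OF gB]) auto
  also have "\<dots> = B" using hk_integral(2)[of 1, where 'a='a] by (simp add: hk_nonneg)
  finally show ?thesis .
qed

lemma heat_flow_initial: "t \<le> 0 \<Longrightarrow> heat_flow g (x, t) = g x"
  using hk_integral(2)[of 1, where 'a='a] by (simp add: heat_flow_def max_absorb1)

lemma heat_flow_eq:
  assumes t: "0 < t"
  shows "heat_flow g (x, t) = (\<integral>y. hk y t * g (x - y) \<partial>lborel)"
proof -
  have c: "0 < sqrt t" using t by simp
  define h where "h z = hk z 1 * g (x - sqrt t *\<^sub>R z)" for z
  have i: "integrable lborel h" unfolding h_def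
    by (intro integrable_mult_bounded[OF _ _ gB]) (auto intro: hk_integral)
  have "sqrt t ^ DIM('a) = sqrt t powr DIM('a)" using c by (simp add: powr_realpow)
  also have "\<dots> = t powr (DIM('a) / 2)" using t by (simp add: powr_half_sqrt[symmetric] powr_powr)
  finally have p: "sqrt t ^ DIM('a) = t powr (DIM('a) / 2)" .
  have e: "hk y t * g (x - y) = t powr (- (DIM('a) / 2)) * h ((1 / sqrt t) *\<^sub>R y)" for y
    using t by (simp add: h_def hk_def gsq_def power_divide)
  have "(\<integral>y. hk y t * g (x - y) \<partial>lborel) = t powr (- (DIM('a) / 2)) * (t powr (DIM('a) / 2) * (\<integral>z. h z \<partial>lborel))"
    unfolding e p[symmetric] integral_scale(2)[OF c i, symmetric] by (rule integral_mult_right_zero)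
  also have "\<dots> = (\<integral>z. h z \<partial>lborel)" using t by (simp add: powr_minus)
  finally show ?thesis using t by (simp add: heat_flow_def h_def)
qed

text \<open>Fubini's theorem moves \<open>k\<close> onto the kernel at the fixed time
  \<open>t\<close>. The condition \<open>2 * r < t\<close> keeps every lag in the support of
  \<open>k\<close> below \<open>t\<close>, so the flow is only used at positive times.\<close>

lemma convol_heat_flow:
  fixes k :: "'a \<times> real \<Rightarrow> real"
  assumes k: "integrable lborel k" "\<And>q. q \<notin> cap r \<Longrightarrow> k q = 0" "\<And>q. snd q \<le> 0 \<Longrightarrow> k q = 0" and t: "2 * r < t" "t < 1"
  shows "convol k (heat_flow g) (x, t) = (\<integral>\<eta>. convol k hkE (\<eta>, t) * g (x - \<eta>) \<partial>lborel)"
proof -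
  have [measurable]: "k \<in> borel_measurable borel" using k by auto
  have k': "k q = 0 \<or> (0 < t - snd q \<and> t - snd q < 1)" for q
  proof (cases "k q = 0")
    case False
    then have "q \<in> cap r" "\<not> snd q \<le> 0" using k(2,3)[of q] by auto
    then show ?thesis using t by (auto simp: cap_def)
  qed simp
  have fl: "k q * heat_flow g ((x, t) - q) = (\<integral>\<eta>. k q * hkE ((\<eta>, t) - q) * g (x - \<eta>) \<partial>lborel)" for q
  proof (cases "k q = 0")
    case False
    then have s: "0 < t - snd q" "t - snd q < 1" using k'[of q] by auto
    have "heat_flow g ((x, t) - q) = (\<integral>y. hk y (t - snd q) * g (x - fst q - y) \<partial>lborel)"
      using heat_flow_eq[OF s(1)] by (cases q) simp
    also have "\<dots> = (\<integral>\<eta>. hk (\<eta> - fst q) (t - snd q) * g (x - \<eta>) \<partial>lborel)"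
      by (subst integral_translate[of "\<lambda>y. hk y (t - snd q) * g (x - fst q - y)" "- fst q", symmetric]) (auto simp: algebra_simps)
    also have "\<dots> = (\<integral>\<eta>. hkE ((\<eta>, t) - q) * g (x - \<eta>) \<partial>lborel)"
      using s by (cases q) (simp add: hkE_def)
    finally show ?thesis by (simp add: mult.assoc)
  qed simp
  have "convol k (heat_flow g) (x, t) = (\<integral>q. (\<integral>\<eta>. k q * hkE ((\<eta>, t) - q) * g (x - \<eta>) \<partial>lborel) \<partial>lborel)"
    unfolding convol_def fl ..
  also have "\<dots> = (\<integral>\<eta>. (\<integral>q. k q * hkE ((\<eta>, t) - q) * g (x - \<eta>) \<partial>lborel) \<partial>lborel)"
  proof (rule Fubini_bounded_factor[symmetric, where g="\<lambda>q. \<bar>k q\<bar>"])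
    have pm: "(\<lambda>z::('a \<times> real) \<times> 'a. (snd z, t) - fst z) \<in> borel_measurable (borel \<Otimes>\<^sub>M borel)" by measurable
    have [measurable]: "(\<lambda>z::('a \<times> real) \<times> 'a. hkE ((snd z, t) - fst z)) \<in> borel_measurable (borel \<Otimes>\<^sub>M borel)"
      by (rule measurable_compose[OF pm hkE_measurable])
    show "(\<lambda>(q, \<eta>). k q * hkE ((\<eta>, t) - q)) \<in> borel_measurable (borel \<Otimes>\<^sub>M borel)"
      unfolding case_prod_unfold by measurable
    have hi: "integrable lborel (\<lambda>\<eta>. hkE ((\<eta>, t) - q))" "(\<integral>\<eta>. hkE ((\<eta>, t) - q) \<partial>lborel) = 1" if "k q \<noteq> 0" for q
    proof -
      have s: "0 < t - snd q" "t - snd q < 1" using k'[of q] that by auto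
      have e: "hkE ((\<eta>, t) - q) = hk (\<eta> + (- fst q)) (t - snd q)" for \<eta> using s by (cases q) (simp add: hkE_def)
      show "integrable lborel (\<lambda>\<eta>. hkE ((\<eta>, t) - q))" unfolding e by (rule integrable_translate[OF hk_integral(1)[OF s(1)]])
      show "(\<integral>\<eta>. hkE ((\<eta>, t) - q) \<partial>lborel) = 1"
        unfolding e using hk_integral(2)[OF s(1), where 'a='a]
        by (subst integral_translate[of "\<lambda>y. hk y (t - snd q)"]) auto
    qed
    show "integrable lborel (\<lambda>\<eta>. k q * hkE ((\<eta>, t) - q))" for q using hi(1)[of q] by auto
    show "(\<integral>\<eta>. \<bar>k q * hkE ((\<eta>, t) - q)\<bar> \<partial>lborel) \<le> \<bar>k q\<bar>" for q
      using hi(2)[of q] by (cases "k q = 0") (auto simp: abs_mult hkE_nonneg)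
  qed (use k(1) gB in auto)
  also have "\<dots> = (\<integral>\<eta>. convol k hkE (\<eta>, t) * g (x - \<eta>) \<partial>lborel)" unfolding convol_def by simp
  finally show ?thesis .
qed

text \<open>The kernel identities with source 0. At times beyond \<open>2 * r\<close> the cut-off
  vanishes, so convolving the kernel with \<open>kap r\<close> reproduces it and convolving it with
  \<open>kap' r\<close> gives 0.\<close>

lemma heat_flow_identities:
  assumes r: "0 < r" "2 * r \<le> 1" and t: "2 * r < t" "t < 1"
  shows "heat_flow g (x, t) = convol (kap r) (heat_flow g) (x, t)"
    and "convol (kap' r) (heat_flow g) (x, t) = 0"
proof -
  have n: "kap r q = 0" "kap' r q = 0" if "snd q \<le> 0" for q :: "'a \<times> real"
    using rad_support_time[OF kapq_rad r, of "snd q" "fst q"] rad_support_time[OF kapq'_rad r, of "snd q" _ "fst q"] that r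
    by (auto simp: kap_def kap'_def)
  have c: "2 * r \<le> (norm \<eta>)\<^sup>2 + t" for \<eta> :: 'a using t zero_le_power2[of "norm \<eta>"] by linarith
  have k: "convol (kap r) hkE (\<eta>, t) = hk \<eta> t" for \<eta> :: 'a
    using psi_eq[OF r t(2), of \<eta>] cut_support(1)[OF r(1) c] r by (simp add: convol_commute[of "kap r" hkE] kerP_def)
  have k': "convol (kap' r) hkE (\<eta>, t) = 0" for \<eta> :: 'a
    using kap'_eq[OF r t(2), of \<eta>] r rad_support[OF kapq_rad[where 'a='a] r(1), of t "(norm \<eta>)\<^sup>2"] c
    by (simp add: convol_commute[of "kap' r" hkE] kap_def lift_def)
  show "heat_flow g (x, t) = convol (kap r) (heat_flow g) (x, t)"
    using convol_heat_flow[OF kap_integrable(1)[OF r(1)] kap_support(1)[OF r(1)] n(1) t] heat_flow_eq[of t x] r t by (simp add: k)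
  show "convol (kap' r) (heat_flow g) (x, t) = 0"
    using convol_heat_flow[OF kap_integrable(2)[OF r(1)] kap_support(2)[OF r(1)] n(2) t] by (simp add: k')
qed

end

section \<open>Local solutions defined by the kernel identities, and their regularity\<close>

text \<open>The first identity carries the regularity of \<open>w\<close>. The second is what makes
  the additional source \<open>convol (kap' r) z\<close> vanish in \<open>local_decomp\<close>, and
  so it carries the equation.\<close>

abbreviation kernel_id :: "real \<Rightarrow> ('a::euclidean_space \<times> real \<Rightarrow> real) \<Rightarrow> ('a \<times> real \<Rightarrow> real) \<Rightarrow> 'a \<times> real \<Rightarrow> bool" where
  "kernel_id r w H p \<equiv> w p = convol (kerP r) H p + convol (kap r) w p \<and> convol (kap' r) w p = convol (kap r) H p"

text \<open>A formulation of \<open>w\<^sub>t - \<Delta>w = H\<close> in \<open>G\<close> that is stable under bounded pointwise limits.\<close>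

definition local_sol :: "('a::euclidean_space \<times> real) set \<Rightarrow> ('a \<times> real \<Rightarrow> real) \<Rightarrow> ('a \<times> real \<Rightarrow> real) \<Rightarrow> bool" where
  "local_sol G w H \<longleftrightarrow> (\<forall>p\<in>G. \<exists>\<rho>>0. \<forall>r p'. 0 < r \<longrightarrow> r < \<rho> \<longrightarrow> p' \<in> ball p \<rho> \<longrightarrow> kernel_id r w H p')"

definition loc_bdd :: "('a::metric_space) set \<Rightarrow> ('a \<Rightarrow> real) \<Rightarrow> bool" where
  "loc_bdd G w \<longleftrightarrow> (\<forall>p\<in>G. \<exists>\<rho>>0. \<exists>B. \<forall>q\<in>ball p \<rho>. \<bar>w q\<bar> \<le> B)"

definition loc_holder :: "real \<Rightarrow> ('a::euclidean_space \<times> real) set \<Rightarrow> ('a \<times> real \<Rightarrow> real) \<Rightarrow> bool" where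
  "loc_holder \<theta> G w \<longleftrightarrow> (\<forall>p\<in>G. \<exists>\<rho>>0. \<exists>A. \<forall>x x' t. (x, t) \<in> ball p \<rho> \<longrightarrow> (x', t) \<in> ball p \<rho> \<longrightarrow>
     \<bar>w (x, t) - w (x', t)\<bar> \<le> A * norm (x - x') powr \<theta>)"

lemma loc_bdd_continuous:
  assumes "open G" "continuous_on G w"
  shows "loc_bdd G w"
  unfolding loc_bdd_def
proof
  fix p assume p: "p \<in> G"
  then have "isCont w p" using assms continuous_on_eq_continuous_at by blast
  then obtain \<rho> where \<rho>: "\<rho> > 0" "\<And>q. dist q p < \<rho> \<Longrightarrow> dist (w q) (w p) < 1"
    unfolding continuous_at_eps_delta by (metis zero_less_one)
  have "\<bar>w q\<bar> \<le> \<bar>w p\<bar> + 1" if "q \<in> ball p \<rho>" for q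
    using \<rho>(2)[of q] that by (auto simp: dist_commute dist_real_def)
  then show "\<exists>\<rho>>0. \<exists>B. \<forall>q\<in>ball p \<rho>. \<bar>w q\<bar> \<le> B" using \<rho>(1) by blast
qed

lemma cap_small:
  assumes "0 < \<rho>"
  obtains r0 where "0 < r0" "\<And>r. 0 < r \<Longrightarrow> r < r0 \<Longrightarrow> 2 * r \<le> 1"
    "\<And>r q. 0 < r \<Longrightarrow> r < r0 \<Longrightarrow> (q::'a::euclidean_space \<times> real) \<in> cap r \<Longrightarrow> norm q < \<rho>"
\<comment> \<open>\<open>\<rho>\<^sup>2/8\<close> bounds the space part \<open>sqrt (2 * r)\<close>
  by \<open>\<rho>/2\<close>, \<open>\<rho>/4\<close> bounds the time part \<open>2 * r\<close> by
  \<open>\<rho>/2\<close>, and 1/2 gives \<open>2 * r \<le> 1\<close>.\<close>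
proof (rule that[of "min (1/2) (min (\<rho>/4) (\<rho>\<^sup>2/8))"])
  show "0 < min (1/2) (min (\<rho>/4) (\<rho>\<^sup>2/8))" using assms by auto
  fix r assume r: "0 < r" "r < min (1/2) (min (\<rho>/4) (\<rho>\<^sup>2/8))"
  then show "2 * r \<le> 1" by auto
  fix q :: "'a \<times> real" assume q: "q \<in> cap r"
  have "2 * r < (\<rho>/2)\<^sup>2" using r by (simp add: power2_eq_square)
  then have "sqrt (2 * r) < sqrt ((\<rho>/2)\<^sup>2)" by (rule real_sqrt_less_mono)
  then have "sqrt (2 * r) < \<rho>/2" using assms by simp
  moreover have "norm (fst q) \<le> sqrt (2 * r)" "norm (snd q) \<le> 2 * r" using q by (auto simp: cap_def)
  moreover have "norm q \<le> norm (fst q) + norm (snd q)"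
    using norm_Pair_le[of "fst q" "snd q"] by simp
  ultimately show "norm q < \<rho>" using r by auto
qed

lemma convol_cong:
  assumes "\<And>q. q \<notin> S \<Longrightarrow> k q = 0" "\<And>q. q \<in> S \<Longrightarrow> f (p - q) = g (p - q)"
  shows "convol k f p = convol k g p"
  unfolding convol_def using assms by (intro Bochner_Integration.integral_cong refl) (metis mult_zero_left)

lemma convol_diff_right:
  assumes "integrable lborel k" "f \<in> borel_measurable borel" "g \<in> borel_measurable borel" "\<And>x. \<bar>f x\<bar> \<le> B" "\<And>x. \<bar>g x\<bar> \<le> C"
  shows "convol k (\<lambda>q. f q - g q) p = convol k f p - convol k g p"
  unfolding convol_def right_diff_distrib
  by (intro Bochner_Integration.integral_diff convol_integrable[OF assms(1,2,4)] convol_integrable[OF assms(1,3,5)])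

text \<open>Equal to 1 within distance \<open>2 * \<rho>\<close> and 0 from distance
  \<open>3 * \<rho>\<close> on. It only multiplies sources, where Lipschitz continuity preserves
  Hoelder continuity.\<close>

definition cutoff :: "'a::metric_space \<Rightarrow> real \<Rightarrow> 'a \<Rightarrow> real" where
  "cutoff p0 \<rho> q = max 0 (min 1 (3 - dist q p0 / \<rho>))"

lemma cutoff_props:
  assumes "0 < \<rho>"
  shows "0 \<le> cutoff p0 \<rho> q" "cutoff p0 \<rho> q \<le> 1" "dist q p0 \<le> 2 * \<rho> \<Longrightarrow> cutoff p0 \<rho> q = 1"
    "3 * \<rho> \<le> dist q p0 \<Longrightarrow> cutoff p0 \<rho> q = 0" "continuous_on S (cutoff p0 \<rho>)"
    "\<bar>cutoff p0 \<rho> q - cutoff p0 \<rho> q'\<bar> \<le> dist q q' / \<rho>"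
proof -
  show "dist q p0 \<le> 2 * \<rho> \<Longrightarrow> cutoff p0 \<rho> q = 1" "3 * \<rho> \<le> dist q p0 \<Longrightarrow> cutoff p0 \<rho> q = 0"
    using assms by (auto simp: cutoff_def divide_simps min_def max_def)
  show "continuous_on S (cutoff p0 \<rho>)" unfolding cutoff_def[abs_def] using assms by (intro continuous_intros) auto
  have "\<bar>dist q p0 - dist q' p0\<bar> \<le> dist q q'" using dist_triangle[of q p0 q'] dist_triangle[of q' p0 q] by (simp add: dist_commute)
  then have "\<bar>dist q p0 - dist q' p0\<bar> / \<rho> \<le> dist q q' / \<rho>" using assms by (intro divide_right_mono) auto
  then have "\<bar>dist q p0 / \<rho> - dist q' p0 / \<rho>\<bar> \<le> dist q q' / \<rho>" using assms by (simp add: diff_divide_distrib[symmetric])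
  then show "\<bar>cutoff p0 \<rho> q - cutoff p0 \<rho> q'\<bar> \<le> dist q q' / \<rho>" unfolding cutoff_def by linarith
qed (auto simp: cutoff_def)

lemma abs_cutoff: "0 < \<rho> \<Longrightarrow> \<bar>cutoff p0 \<rho> q\<bar> \<le> 1"
  using cutoff_props(1,2)[of \<rho> p0 q] by simp

lemma cutoff_mult_bound:
  assumes "0 < \<rho>" "\<And>p. p \<in> ball p0 (4 * \<rho>) \<Longrightarrow> \<bar>H p\<bar> \<le> B"
  shows "\<bar>H q * cutoff p0 \<rho> q\<bar> \<le> B"
proof (cases "dist q p0 < 3 * \<rho>")
  case True
  then have "\<bar>H q\<bar> \<le> B" using assms by (auto simp: dist_commute)
  then have "\<bar>H q\<bar> * \<bar>cutoff p0 \<rho> q\<bar> \<le> B * 1" by (intro mult_mono abs_cutoff[OF assms(1)]) auto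
  then show ?thesis by (simp add: abs_mult)
next
  case False
  then show ?thesis using cutoff_props(4)[OF assms(1), of q p0] assms order_trans[OF abs_ge_zero assms(2)[of p0]] by simp
qed

context
  fixes G :: "('a::euclidean_space \<times> real) set" and w H :: "'a \<times> real \<Rightarrow> real"
  assumes G: "open G" "G \<subseteq> UNIV \<times> {0<..<1}" and LS: "local_sol G w H"
    and m[measurable]: "w \<in> borel_measurable borel" "H \<in> borel_measurable borel"
    and bd: "loc_bdd G w" "loc_bdd G H"
begin

text \<open>The potential \<open>W\<close> of the localised source satisfies the same two identities
  as \<open>w\<close>. Subtracting, \<open>w - W\<close> is reproduced by \<open>kap r\<close> and
  annihilated by \<open>kap' r\<close>. Hence near \<open>p0\<close> the function is a genuine heat
  potential plus a smooth convolution with zero heat source.\<close>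

lemma local_decomp:
  assumes p0: "p0 \<in> G" and \<rho>0: "0 < \<rho>0"
  obtains \<rho> r B z where "0 < \<rho>" "\<rho> \<le> \<rho>0" "ball p0 (4 * \<rho>) \<subseteq> G" "0 < r" "z \<in> borel_measurable borel"
    "\<And>p. \<bar>z p\<bar> \<le> B" "\<And>p. p \<in> ball p0 (4 * \<rho>) \<Longrightarrow> \<bar>H p\<bar> \<le> B"
    "\<And>p. p \<in> ball p0 \<rho> \<Longrightarrow> w p = convol hkE (\<lambda>q. H q * cutoff p0 \<rho> q) p + convol (kap r) z p"
    "\<And>p. p \<in> ball p0 \<rho> \<Longrightarrow> convol (kap' r) z p = 0"
proof -
  obtain \<rho>1 where \<rho>1: "\<rho>1 > 0" "\<And>r p'. 0 < r \<Longrightarrow> r < \<rho>1 \<Longrightarrow> p' \<in> ball p0 \<rho>1 \<Longrightarrow> kernel_id r w H p'"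
    using LS p0 unfolding local_sol_def by blast
  obtain \<rho>2 B1 where \<rho>2: "\<rho>2 > 0" "\<And>q. q \<in> ball p0 \<rho>2 \<Longrightarrow> \<bar>w q\<bar> \<le> B1" using bd(1) p0 unfolding loc_bdd_def by blast
  obtain \<rho>3 B2 where \<rho>3: "\<rho>3 > 0" "\<And>q. q \<in> ball p0 \<rho>3 \<Longrightarrow> \<bar>H q\<bar> \<le> B2" using bd(2) p0 unfolding loc_bdd_def by blast
  obtain \<rho>4 where \<rho>4: "\<rho>4 > 0" "ball p0 \<rho>4 \<subseteq> G" using G(1) p0 open_contains_ball by blast
  \<comment> \<open>A quarter of all radii: a point within \<rho>, shifted by a lag of norm below
    \<rho>, stays within \<open>2 * \<rho>\<close>, where the cut-off is 1; the support of the
    cut-off lies within \<open>3 * \<rho>\<close>, inside the ball of radius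
    \<open>4 * \<rho>\<close>.\<close>
  define \<rho> where "\<rho> = min (min \<rho>0 \<rho>1) (min \<rho>2 (min \<rho>3 \<rho>4)) / 4"
  have \<rho>: "0 < \<rho>" "\<rho> \<le> \<rho>0" "4 * \<rho> \<le> \<rho>1" "4 * \<rho> \<le> \<rho>2" "4 * \<rho> \<le> \<rho>3" "4 * \<rho> \<le> \<rho>4"
    unfolding \<rho>_def using \<rho>0 \<rho>1(1) \<rho>2(1) \<rho>3(1) \<rho>4(1) by auto
  have sub: "ball p0 (4 * \<rho>) \<subseteq> G" using subset_ball[OF \<rho>(6)] \<rho>4(2) by blast
  obtain r0 where r0: "0 < r0" "\<And>r. 0 < r \<Longrightarrow> r < r0 \<Longrightarrow> 2 * r \<le> 1"
    "\<And>r q. 0 < r \<Longrightarrow> r < r0 \<Longrightarrow> (q::'a \<times> real) \<in> cap r \<Longrightarrow> norm q < \<rho>"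
    using cap_small[OF \<rho>(1), where 'a='a] by metis
  define r where "r = min r0 \<rho>1 / 2"
  have r: "0 < r" "r < r0" "r < \<rho>1" unfolding r_def using r0(1) \<rho>1(1) by auto
  have r1: "2 * r \<le> 1" using r0(2) r by blast
  define f where "f q = H q * cutoff p0 \<rho> q" for q
  have [measurable]: "cutoff p0 \<rho> \<in> borel_measurable borel"
    by (rule borel_measurable_continuous_onI[OF cutoff_props(5)[OF \<rho>(1)]])
  have fm[measurable]: "f \<in> borel_measurable borel" unfolding f_def[abs_def] by measurable
  have B10: "\<bar>w p0\<bar> \<le> B1" using \<rho>2 by simp
  have HB: "\<bar>H q\<bar> \<le> B2" if "q \<in> ball p0 (4 * \<rho>)" for q using \<rho>3(2)[of q] that \<rho> by auto
  note fB = cutoff_mult_bound[of \<rho> p0 H B2, OF \<rho>(1) HB, folded f_def]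
  have f0: "f (x, t) = 0" if "t \<le> 0" for x t
  proof (cases "dist (x, t) p0 < 3 * \<rho>")
    case True
    then have "(x, t) \<in> G" using sub \<rho>(1) by (auto simp: dist_commute)
    then show ?thesis using G(2) that by auto
  qed (simp add: f_def cutoff_props(4)[OF \<rho>(1)])
  define W where "W = convol hkE f"
  have Wm[measurable]: "W \<in> borel_measurable borel"
    unfolding W_def by (rule borel_measurable_continuous_onI[OF continuous_heat_potential[OF fm fB]])
  define I where "I = (\<integral>q. \<bar>hkE (q::'a \<times> real)\<bar> \<partial>lborel)"
  have WB: "\<bar>W p\<bar> \<le> B2 * I" for p unfolding W_def I_def by (rule heat_potential_bound[OF fm fB])
  have WB0: "0 \<le> B2 * I" using WB[of p0] by linarith
  define i where "i = (indicator (ball p0 (2 * \<rho>)) :: 'a \<times> real \<Rightarrow> real)"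
  have im[measurable]: "i \<in> borel_measurable borel" unfolding i_def by (rule borel_measurable_indicator) simp
  \<comment> \<open>The truncated \<open>w - W\<close>. Kernels supported in \<open>cap r\<close> do
    not see the truncation when evaluated within distance \<rho> of \<open>p0\<close>, and it makes
    \<open>z\<close> globally bounded.\<close>
  define z where "z q = i q * w q - i q * W q" for q
  have iw: "\<bar>i q * w q\<bar> \<le> B1" for q
    using \<rho>2(2)[of q] \<rho> B10 by (auto simp: i_def split: split_indicator)
  have iW: "\<bar>i q * W q\<bar> \<le> B2 * I" for q
    using WB[of q] WB0 by (auto simp: i_def split: split_indicator)
  have near: "p - q \<in> ball p0 (2 * \<rho>)" if "p \<in> ball p0 \<rho>" "q \<in> cap r" for p q
  proof -
    have "dist p0 (p - q) \<le> dist p0 p + dist p (p - q)" by (rule dist_triangle)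
    also have "dist p (p - q) = norm q" by (simp add: dist_norm)
    finally show ?thesis using that r0(3)[OF r(1,2) that(2)] by auto
  qed
  have i1: "i (p - q) = 1" if "p \<in> ball p0 \<rho>" "q \<in> cap r" for p q
    unfolding i_def by (rule indicator_eq_1_iff[THEN iffD2, OF near[OF that]])
  have cz: "convol k z p = convol k w p - convol k W p"
    if "integrable lborel k" "\<And>q. q \<notin> cap r \<Longrightarrow> k q = 0" "p \<in> ball p0 \<rho>" for k p
  proof -
    have "convol k z p = convol k (\<lambda>q. i q * w q) p - convol k (\<lambda>q. i q * W q) p"
      unfolding z_def[abs_def] by (rule convol_diff_right[OF that(1) _ _ iw iW]) measurable
    moreover have "convol k (\<lambda>q. i q * g q) p = convol k g p" for g
    proof (rule convol_cong[OF that(2)])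
      fix q :: "'a \<times> real" assume "q \<in> cap r"
      from i1[OF that(3) this] show "i (p - q) * g (p - q) = g (p - q)" by simp
    qed simp
    ultimately show ?thesis by simp
  qed
  have cf: "convol k H p = convol k f p" if "\<And>q. q \<notin> cap r \<Longrightarrow> k q = 0" "p \<in> ball p0 \<rho>" for k p
  proof (rule convol_cong[OF that(1)])
    fix q :: "'a \<times> real" assume "q \<in> cap r"
    from near[OF that(2) this] have "dist (p - q) p0 \<le> 2 * \<rho>" by (simp add: dist_commute)
    from cutoff_props(3)[OF \<rho>(1) this] show "H (p - q) = f (p - q)" by (simp add: f_def)
  qed simp
  show ?thesis
  proof (rule that[OF \<rho>(1,2) sub r(1)])
    show "z \<in> borel_measurable borel" unfolding z_def[abs_def] by measurable
    show "\<bar>z p\<bar> \<le> max (B1 + B2 * I) B2" for p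
    proof -
      have "\<bar>z p\<bar> \<le> B1 + B2 * I" using iw[of p] iW[of p] unfolding z_def by linarith
      then show ?thesis by simp
    qed
    show "\<bar>H p\<bar> \<le> max (B1 + B2 * I) B2" if "p \<in> ball p0 (4 * \<rho>)" for p
      using HB[OF that] by (simp add: le_max_iff_disj)
    fix p assume p: "p \<in> ball p0 \<rho>"
    have "p \<in> G" using p sub \<rho>(1) by auto
    then have t: "snd p < 1" using G(2) by auto
    have p1: "p \<in> ball p0 \<rho>1" using p \<rho> by auto
    note e = \<rho>1(2)[OF r(1,3) p1]
    note h = heat_potential_identities[OF r(1) r1 t fm fB f0, of "fst p", unfolded prod.collapse, folded W_def]
    show "convol (kap' r) z p = 0"
      using cz[OF kap_integrable(2)[OF r(1)] kap_support(2)[OF r(1)] p] e h(2) cf[OF kap_support(1)[OF r(1)] p] by simp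
    have "w p = convol (kerP r) f p + convol (kap r) w p"
      using e cf[OF kerP_support[OF r(1)] p] by simp
    then show "w p = convol hkE (\<lambda>q. H q * cutoff p0 \<rho> q) p + convol (kap r) z p"
      using cz[OF kap_integrable(1)[OF r(1)] kap_support(1)[OF r(1)] p] h(1)
      unfolding f_def[symmetric] W_def[symmetric] by simp
  qed
qed

text \<open>Applies with a merely bounded source: the potential is Lipschitz in space by
  \<open>heat_potential_lipschitz\<close>, the other part of the decomposition has a smooth
  kernel.\<close>

lemma local_sol_lipschitz:
  assumes p0: "p0 \<in> G"
  shows "\<exists>\<rho>>0. \<exists>C. continuous_on (ball p0 \<rho>) w \<and> (\<forall>x x' t. (x, t) \<in> ball p0 \<rho> \<longrightarrow> (x', t) \<in> ball p0 \<rho> \<longrightarrow>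
     \<bar>w (x, t) - w (x', t)\<bar> \<le> C * norm (x - x'))"
proof -
  obtain \<rho> r B z where d: "0 < \<rho>" "\<rho> \<le> 1" "ball p0 (4 * \<rho>) \<subseteq> G" "0 < r" "z \<in> borel_measurable borel"
    "\<And>p. \<bar>z p\<bar> \<le> B" "\<And>p. p \<in> ball p0 (4 * \<rho>) \<Longrightarrow> \<bar>H p\<bar> \<le> B"
    "\<And>p. p \<in> ball p0 \<rho> \<Longrightarrow> w p = convol hkE (\<lambda>q. H q * cutoff p0 \<rho> q) p + convol (kap r) z p"
    by (rule local_decomp[OF p0 zero_less_one]) (rule that; assumption)
  define f where "f q = H q * cutoff p0 \<rho> q" for q
  have [measurable]: "cutoff p0 \<rho> \<in> borel_measurable borel"
    by (rule borel_measurable_continuous_onI[OF cutoff_props(5)[OF d(1)]])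
  have fm[measurable]: "f \<in> borel_measurable borel" unfolding f_def[abs_def] by measurable
  have B0: "0 \<le> B" using d(6)[of p0] by linarith
  note fB = cutoff_mult_bound[of \<rho> p0 H B, OF d(1,7), folded f_def]
  obtain C1 where C1: "\<And>x x' t. \<bar>convol hkE f (x, t) - convol hkE f (x', t)\<bar> \<le> C1 * norm (x - x')"
    using heat_potential_lipschitz[OF fm fB] by blast
  note R = kapq_rad[where 'a='a, of r]
  have q: "dq (kapq TYPE('a) r) \<in> rad r 3" using rad_deriv(1)[OF R d(4)] by simp
  define l where "l e p = 2 * (fst p \<bullet> e) * lift (dq (kapq TYPE('a) r)) p" for e :: 'a and p :: "'a \<times> real"
  \<comment> \<open>A bound for the directional derivatives \<open>l e\<close> that depends on
    \<open>e\<close> only through the factor \<open>norm e\<close>; this yields a Lipschitz constant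
    independent of the direction.\<close>
  define n where "n p = 2 * norm (fst p) * \<bar>lift (dq (kapq TYPE('a) r)) p\<bar>" for p :: "'a \<times> real"
  have lc: "continuous_on UNIV (l e)" for e unfolding l_def by (intro continuous_intros continuous_lift[OF q d(4)])
  have nc: "continuous_on UNIV n" unfolding n_def by (intro continuous_intros continuous_lift[OF q d(4)])
  have li: "integrable lborel (l e)" for e
    by (rule integrable_compact_support[OF lc compact_cap[of r]]) (simp add: l_def lift_support[OF q d(4)])
  have ni: "integrable lborel n"
    by (rule integrable_compact_support[OF nc compact_cap[of r]]) (simp add: n_def lift_support[OF q d(4)])
  have C2: "\<bar>convol (kap r) z (x, t) - convol (kap r) z (x', t)\<bar> \<le> B * integral\<^sup>L lborel n * norm (x - x')" for x x' t
  proof -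
    define e where "e = x - x'"
    have "\<bar>convol (kap r) z ((x', t) + (e, 0)) - convol (kap r) z (x', t)\<bar> \<le> B * (\<integral>p. \<bar>l e p\<bar> \<partial>lborel)"
    proof (rule convol_lipschitz[OF kap_integrable(1)[OF d(4)] li lc _ d(5,6)])
      show "((\<lambda>\<tau>. kap r (y + \<tau> *\<^sub>R (e, 0))) has_real_derivative l e y) (at 0)" for y
        unfolding kap_def l_def by (rule lift_deriv_x[OF R d(4)]) simp
    qed
    also have "(\<integral>p. \<bar>l e p\<bar> \<partial>lborel) \<le> (\<integral>p. n p * norm e \<partial>lborel)"
    proof (rule integral_mono[OF integrable_abs[OF li] integrable_mult_left])
      show "\<bar>l e p\<bar> \<le> n p * norm e" for p
        using mult_right_mono[OF Cauchy_Schwarz_ineq2[of "fst p" e], of "\<bar>lift (dq (kapq TYPE('a) r)) p\<bar>"]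
        by (simp add: l_def n_def abs_mult mult_ac)
    qed (use ni in simp)
    finally show ?thesis using B0 by (simp add: e_def mult_left_mono mult.assoc)
  qed
  have c: "continuous_on UNIV (convol (kap r) z)"
    using convol_lift_par_C2[OF d(5,6) R d(4)] unfolding par_C2_def kap_def by simp
  show ?thesis
  proof (rule exI[of _ \<rho>], intro conjI exI[of _ "C1 + B * integral\<^sup>L lborel n"] allI impI)
    show "continuous_on (ball p0 \<rho>) w"
    proof (rule continuous_on_eq[of _ "\<lambda>p. convol hkE f p + convol (kap r) z p"])
      show "continuous_on (ball p0 \<rho>) (\<lambda>p. convol hkE f p + convol (kap r) z p)"
        by (intro continuous_intros continuous_heat_potential[OF fm fB] continuous_on_subset[OF c]) auto
    qed (simp add: d(8) f_def[abs_def])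
    fix x x' t assume xx: "(x, t) \<in> ball p0 \<rho>" "(x', t) \<in> ball p0 \<rho>"
    have "\<bar>w (x, t) - w (x', t)\<bar> \<le> C1 * norm (x - x') + B * integral\<^sup>L lborel n * norm (x - x')"
      using C1[of x t x'] C2[of x t x'] unfolding d(8)[OF xx(1)] d(8)[OF xx(2)] f_def[symmetric] by linarith
    then show "\<bar>w (x, t) - w (x', t)\<bar> \<le> (C1 + B * integral\<^sup>L lborel n) * norm (x - x')" by (simp add: ring_distribs)
  qed (rule d(1))
qed

lemma local_sol_continuous: "continuous_on G w"
  unfolding continuous_on_eq_continuous_at[OF G(1)]
proof
  fix p assume "p \<in> G"
  then obtain \<rho> where "\<rho> > 0" "continuous_on (ball p \<rho>) w" using local_sol_lipschitz by blast
  then show "isCont w p" using continuous_on_eq_continuous_at[of "ball p \<rho>" w] by auto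
qed

lemma local_sol_holder:
  assumes th: "0 < \<theta>" "\<theta> \<le> 1"
  shows "loc_holder \<theta> G w"
  unfolding loc_holder_def
proof
  fix p assume "p \<in> G"
  then obtain \<rho> C where \<rho>: "\<rho> > 0" "\<And>x x' t. (x, t) \<in> ball p \<rho> \<Longrightarrow> (x', t) \<in> ball p \<rho> \<Longrightarrow> \<bar>w (x, t) - w (x', t)\<bar> \<le> C * norm (x - x')"
    using local_sol_lipschitz by blast
  show "\<exists>\<rho>>0. \<exists>A. \<forall>x x' t. (x, t) \<in> ball p \<rho> \<longrightarrow> (x', t) \<in> ball p \<rho> \<longrightarrow> \<bar>w (x, t) - w (x', t)\<bar> \<le> A * norm (x - x') powr \<theta>"
  \<comment> \<open>Radius 1/2 keeps points at distance at most 1, where a Lipschitz bound implies a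
    Hoelder bound.\<close>
  proof (rule exI[of _ "min \<rho> (1/2)"], intro conjI exI[of _ "\<bar>C\<bar>"] allI impI)
    show "0 < min \<rho> (1/2)" using \<rho> by simp
    fix x x' t assume xx: "(x, t) \<in> ball p (min \<rho> (1/2))" "(x', t) \<in> ball p (min \<rho> (1/2))"
    have "norm (x - x') = dist (x, t) (x', t)" by (simp add: dist_norm dist_Pair_Pair)
    also have "\<dots> \<le> dist (x, t) p + dist (x', t) p" by (rule dist_triangle2)
    finally have n: "norm (x - x') \<le> 1" using xx by (simp add: dist_commute)
    have "norm (x - x') \<le> norm (x - x') powr \<theta>"
      using n th by (cases "x = x'") (auto intro: order_trans[OF _ powr_mono'[of \<theta> 1]])
    then have "\<bar>C\<bar> * norm (x - x') \<le> \<bar>C\<bar> * norm (x - x') powr \<theta>" by (rule mult_left_mono) simp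
    moreover have "\<bar>w (x, t) - w (x', t)\<bar> \<le> C * norm (x - x')" using \<rho>(2) xx by auto
    moreover have "C * norm (x - x') \<le> \<bar>C\<bar> * norm (x - x')" by (rule mult_right_mono) auto
    ultimately show "\<bar>w (x, t) - w (x', t)\<bar> \<le> \<bar>C\<bar> * norm (x - x') powr \<theta>" by linarith
  qed
qed

text \<open>The localised source is globally Hoelder continuous in space and vanishes outside times
  \<open>(0, 1)\<close>, so the potential theory applies to it. The smooth remainder adds
  \<open>convol (kap' r) z = 0\<close> to the heat operator, which leaves exactly \<open>H\<close>
  where the cut-off is 1.\<close>

lemma local_sol_C2_at:
  assumes th: "0 < \<theta>" "\<theta> \<le> 1" and Hc: "continuous_on G H" and Hh: "loc_holder \<theta> G H" and p0: "p0 \<in> G"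
  shows "\<exists>U D1 D2 Dt. open U \<and> p0 \<in> U \<and> U \<subseteq> G \<and> par_C2 U w D1 D2 \<and> time_C1 U w Dt \<and>
    (\<forall>p\<in>U. Dt p - (\<Sum>i\<in>Basis. D2 i i p) = H p)"
proof -
  obtain \<rho>h A where h: "\<rho>h > 0" "\<And>x x' t. (x, t) \<in> ball p0 \<rho>h \<Longrightarrow> (x', t) \<in> ball p0 \<rho>h \<Longrightarrow>
     \<bar>H (x, t) - H (x', t)\<bar> \<le> A * norm (x - x') powr \<theta>"
    using Hh p0 unfolding loc_holder_def by blast
  have h4: "0 < min (\<rho>h / 4) 1" using h(1) by simp
  obtain \<rho> r B z where d: "0 < \<rho>" "\<rho> \<le> min (\<rho>h / 4) 1" "ball p0 (4 * \<rho>) \<subseteq> G" "0 < r" "z \<in> borel_measurable borel"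
    "\<And>p. \<bar>z p\<bar> \<le> B" "\<And>p. p \<in> ball p0 (4 * \<rho>) \<Longrightarrow> \<bar>H p\<bar> \<le> B"
    "\<And>p. p \<in> ball p0 \<rho> \<Longrightarrow> w p = convol hkE (\<lambda>q. H q * cutoff p0 \<rho> q) p + convol (kap r) z p"
    "\<And>p. p \<in> ball p0 \<rho> \<Longrightarrow> convol (kap' r) z p = 0"
    by (rule local_decomp[OF p0 h4]) (rule that; assumption)
  define f where "f q = H q * cutoff p0 \<rho> q" for q
  have B0: "0 \<le> B" using d(6)[of p0] by linarith
  have fout: "f q = 0" if "3 * \<rho> \<le> dist q p0" for q using cutoff_props(4)[OF d(1) that] by (simp add: f_def)
  note fB = cutoff_mult_bound[of \<rho> p0 H B, OF d(1,7), folded f_def]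
  have fc: "continuous_on UNIV f"
  proof -
    have "continuous_on (ball p0 (4 * \<rho>)) f" unfolding f_def[abs_def]
      by (intro continuous_intros continuous_on_subset[OF Hc d(3)] cutoff_props(5)[OF d(1)])
    then have 1: "isCont f q" if "q \<in> ball p0 (4 * \<rho>)" for q using that continuous_on_eq_continuous_at[of "ball p0 (4 * \<rho>)" f] by auto
    have "continuous_on (- cball p0 (3 * \<rho>)) f"
      by (rule continuous_on_eq[of _ "\<lambda>_. 0"]) (auto simp: fout dist_commute)
    then have 2: "isCont f q" if "q \<in> - cball p0 (3 * \<rho>)" for q
      using that continuous_on_eq_continuous_at[of "- cball p0 (3 * \<rho>)" f] by (auto simp: open_Compl)
    have "isCont f q" for q using 1[of q] 2[of q] d(1) by (cases "dist p0 q < 4 * \<rho>") auto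
    then show ?thesis by (simp add: continuous_on_eq_continuous_at)
  qed
  \<comment> \<open>One summand per source of variation: that of \<open>H\<close> for close points,
    that of the cut-off for close points, and the crude bound \<open>2 * B\<close> for points at
    distance at least \<rho>.\<close>
  define A' where "A' = \<bar>A\<bar> + B / \<rho> + 2 * B / \<rho> powr \<theta>"
  have A'0: "0 \<le> \<bar>A\<bar>" "0 \<le> B / \<rho>" "0 \<le> 2 * B / \<rho> powr \<theta>" using B0 d(1) by auto
  have fh: "\<bar>f (x, t) - f (x', t)\<bar> \<le> A' * norm (x - x') powr \<theta>" for x x' t
  proof -
    let ?n = "norm (x - x')"
    have dn: "dist (x, t) (x', t) = ?n" by (simp add: dist_norm dist_Pair_Pair)
    consider "\<rho> \<le> ?n" | "3 * \<rho> \<le> dist (x, t) p0" "3 * \<rho> \<le> dist (x', t) p0"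
      | "?n < \<rho>" "dist (x, t) p0 < 4 * \<rho>" "dist (x', t) p0 < 4 * \<rho>"
      using dist_triangle[of "(x, t)" p0 "(x', t)"] dist_triangle[of "(x', t)" p0 "(x, t)"] dn by (simp add: dist_commute) linarith
    then show ?thesis
    proof cases
      case 1
      have "\<rho> powr \<theta> \<le> ?n powr \<theta>" using 1 d(1) th by (intro powr_mono2) auto
      then have "2 * B / \<rho> powr \<theta> * \<rho> powr \<theta> \<le> 2 * B / \<rho> powr \<theta> * ?n powr \<theta>" by (intro mult_left_mono A'0)
      then have "2 * B \<le> 2 * B / \<rho> powr \<theta> * ?n powr \<theta>" using d(1) by simp
      also have "\<dots> \<le> A' * ?n powr \<theta>" unfolding A'_def using A'0 by (intro mult_right_mono) auto
      finally show ?thesis using fB[of "(x, t)"] fB[of "(x', t)"] by linarith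
    next
      case 2
      then show ?thesis using fout A'0 by (simp add: A'_def)
    next
      case 3
      have in4: "(x, t) \<in> ball p0 (4 * \<rho>)" "(x', t) \<in> ball p0 (4 * \<rho>)" using 3 by (auto simp: dist_commute)
      then have inh: "(x, t) \<in> ball p0 \<rho>h" "(x', t) \<in> ball p0 \<rho>h" using d(2) by auto
      have n1: "?n \<le> ?n powr \<theta>"
        using 3(1) d(2) th by (cases "x = x'") (auto intro: order_trans[OF _ powr_mono'[of \<theta> 1]])
      have "f (x, t) - f (x', t) = (H (x, t) - H (x', t)) * cutoff p0 \<rho> (x, t) + H (x', t) * (cutoff p0 \<rho> (x, t) - cutoff p0 \<rho> (x', t))"
        by (simp add: f_def algebra_simps)
      also have "\<bar>\<dots>\<bar> \<le> \<bar>H (x, t) - H (x', t)\<bar> * \<bar>cutoff p0 \<rho> (x, t)\<bar> + \<bar>H (x', t)\<bar> * \<bar>cutoff p0 \<rho> (x, t) - cutoff p0 \<rho> (x', t)\<bar>"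
        by (metis abs_triangle_ineq abs_mult)
      also have "\<dots> \<le> (\<bar>A\<bar> * ?n powr \<theta>) * 1 + B * (?n / \<rho>)"
      proof (intro add_mono mult_mono)
        have "A * ?n powr \<theta> \<le> \<bar>A\<bar> * ?n powr \<theta>" by (intro mult_right_mono) auto
        then show "\<bar>H (x, t) - H (x', t)\<bar> \<le> \<bar>A\<bar> * ?n powr \<theta>" using h(2)[OF inh] by linarith
        show "\<bar>cutoff p0 \<rho> (x, t)\<bar> \<le> 1" by (rule abs_cutoff[OF d(1)])
        show "\<bar>cutoff p0 \<rho> (x, t) - cutoff p0 \<rho> (x', t)\<bar> \<le> ?n / \<rho>" using cutoff_props(6)[OF d(1)] dn by metis
      qed (use B0 d(7)[OF in4(2)] in auto)
      also have "B * (?n / \<rho>) \<le> B / \<rho> * ?n powr \<theta>" using mult_left_mono[OF n1 A'0(2)] by simp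
      finally have "\<bar>f (x, t) - f (x', t)\<bar> \<le> (\<bar>A\<bar> + B / \<rho>) * ?n powr \<theta>" by (simp add: ring_distribs)
      also have "\<dots> \<le> A' * ?n powr \<theta>" unfolding A'_def using A'0 by (intro mult_right_mono) auto
      finally show ?thesis .
    qed
  qed
  have f0: "f (x, t) = 0" if "t \<le> 0 \<or> 1 \<le> t" for x t
  proof (cases "dist (x, t) p0 < 3 * \<rho>")
    case True
    then have "(x, t) \<in> G" using d(1,3) by (auto simp: dist_commute)
    then show ?thesis using G(2) that by auto
  qed (simp add: fout)
  let ?U = "ball p0 \<rho>"
  have U: "open ?U" "p0 \<in> ?U" "?U \<subseteq> G" using d(1,3) by (auto intro: subset_ball[THEN subsetD])
  note R = kapq_rad[where 'a='a, of r]
  note hp = heat_potential_par_C2[OF fc fB th fh]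
  have ht: "time_C1 ?U (convol hkE f) (\<lambda>p. f p + (\<Sum>i\<in>Basis. pot2 f i i p))"
    unfolding time_C1_def
  proof (intro conjI allI impI)
    show "continuous_on ?U (\<lambda>p. f p + (\<Sum>i\<in>Basis. pot2 f i i p))"
      by (intro continuous_intros continuous_on_subset[OF fc] continuous_on_sum continuous_pot2[OF fc fB th fh]) auto
    fix x t assume "(x, t) \<in> ?U"
    then have "(x, t) \<in> UNIV \<times> {0<..<1}" using U(3) G(2) by blast
    then have "0 < t" "t < 1" by auto
    then show "((\<lambda>s. convol hkE f (x, s)) has_real_derivative f (x, t) + (\<Sum>i\<in>Basis. pot2 f i i (x, t))) (at t)"
      using pot_DERIV_time[OF fc fB th fh f0, of t x] by simp
  qed
  note kp = convol_lift_par_C2[OF d(5,6) R d(4), simplified, folded kap_def]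
  note kt = convol_lift_time_C1[OF d(5,6) R d(4), simplified, folded kap_def]
  note kh = convol_lift_heat[OF d(5,6) R d(4), simplified, folded kap'_def]
  have weq: "convol hkE f p + convol (kap r) z p = w p" if "p \<in> ?U" for p
    using d(8)[OF that] by (simp add: f_def[abs_def])
  have 1: "par_C2 ?U w (\<lambda>i p. pot1 f i p + convol (\<lambda>p. 2 * (fst p \<bullet> i) * lift (dq (kapq TYPE('a) r)) p) z p)
     (\<lambda>i j p. pot2 f i j p + convol (\<lambda>p. 2 * (i \<bullet> j) * lift (dq (kapq TYPE('a) r)) p + 4 * (fst p \<bullet> i) * (fst p \<bullet> j) * lift (dq (dq (kapq TYPE('a) r))) p) z p)"
    by (rule par_C2_cong[OF par_C2_add[OF par_C2_subset[OF hp] par_C2_subset[OF kp]] U(1) weq]) auto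
  have 2: "time_C1 ?U w (\<lambda>p. (f p + (\<Sum>i\<in>Basis. pot2 f i i p)) + convol (lift (ds (kapq TYPE('a) r))) z p)"
    by (rule time_C1_cong[OF time_C1_add[OF ht time_C1_subset[OF kt]] U(1) weq]) auto
  have 3: "(f p + (\<Sum>i\<in>Basis. pot2 f i i p)) + convol (lift (ds (kapq TYPE('a) r))) z p -
    (\<Sum>i\<in>Basis. pot2 f i i p + convol (\<lambda>p. 2 * (i \<bullet> i) * lift (dq (kapq TYPE('a) r)) p + 4 * (fst p \<bullet> i) * (fst p \<bullet> i) * lift (dq (dq (kapq TYPE('a) r))) p) z p) = H p"
    if p: "p \<in> ?U" for p
  proof -
    have "f p = H p" using p cutoff_props(3)[OF d(1), of p p0] d(1) by (simp add: f_def dist_commute)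
    then show ?thesis using kh[of p] d(9)[OF p] by (simp add: sum.distrib)
  qed
  show ?thesis using U 1 2 3 by blast
qed

end

text \<open>One principle behind products, differences, compositions and congruence: an
  \<open>f\<close> that is locally Lipschitz in terms of \<open>v\<close> and \<open>w\<close>
  inherits their exponent.\<close>

lemma loc_holder_combine:
  assumes "loc_holder \<theta> G v" "loc_holder \<theta> G w"
    and f: "\<And>p. p \<in> G \<Longrightarrow> \<exists>\<rho>>0. \<exists>C\<ge>0. \<forall>q\<in>ball p \<rho>. \<forall>q'\<in>ball p \<rho>. \<bar>f q - f q'\<bar> \<le> C * (\<bar>v q - v q'\<bar> + \<bar>w q - w q'\<bar>)"
  shows "loc_holder \<theta> G f"
  unfolding loc_holder_def
proof
  fix p assume p: "p \<in> G"
  obtain \<rho>1 A1 where 1: "\<rho>1 > 0" "\<And>x x' t. (x, t) \<in> ball p \<rho>1 \<Longrightarrow> (x', t) \<in> ball p \<rho>1 \<Longrightarrow> \<bar>v (x, t) - v (x', t)\<bar> \<le> A1 * norm (x - x') powr \<theta>"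
    using assms(1) p unfolding loc_holder_def by blast
  obtain \<rho>2 A2 where 2: "\<rho>2 > 0" "\<And>x x' t. (x, t) \<in> ball p \<rho>2 \<Longrightarrow> (x', t) \<in> ball p \<rho>2 \<Longrightarrow> \<bar>w (x, t) - w (x', t)\<bar> \<le> A2 * norm (x - x') powr \<theta>"
    using assms(2) p unfolding loc_holder_def by blast
  obtain \<rho>3 C where 3: "\<rho>3 > 0" "C \<ge> 0" "\<And>q q'. q \<in> ball p \<rho>3 \<Longrightarrow> q' \<in> ball p \<rho>3 \<Longrightarrow> \<bar>f q - f q'\<bar> \<le> C * (\<bar>v q - v q'\<bar> + \<bar>w q - w q'\<bar>)"
    using f[OF p] by blast
  have "\<bar>f (x, t) - f (x', t)\<bar> \<le> C * (A1 + A2) * norm (x - x') powr \<theta>"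
    if "(x, t) \<in> ball p (min \<rho>1 (min \<rho>2 \<rho>3))" "(x', t) \<in> ball p (min \<rho>1 (min \<rho>2 \<rho>3))" for x x' t
  proof -
    have "\<bar>f (x, t) - f (x', t)\<bar> \<le> C * (\<bar>v (x, t) - v (x', t)\<bar> + \<bar>w (x, t) - w (x', t)\<bar>)" using that by (intro 3) auto
    also have "\<dots> \<le> C * (A1 * norm (x - x') powr \<theta> + A2 * norm (x - x') powr \<theta>)"
      using that by (intro mult_left_mono add_mono 1 2 3) auto
    finally show ?thesis by (simp add: algebra_simps)
  qed
  then show "\<exists>\<rho>>0. \<exists>A. \<forall>x x' t. (x, t) \<in> ball p \<rho> \<longrightarrow> (x', t) \<in> ball p \<rho> \<longrightarrow> \<bar>f (x, t) - f (x', t)\<bar> \<le> A * norm (x - x') powr \<theta>"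
    using 1(1) 2(1) 3(1) by (meson min_less_iff_conj)
qed

lemma loc_holder_mult:
  assumes "loc_holder \<theta> G v" "loc_holder \<theta> G w" "loc_bdd G v" "loc_bdd G w"
  shows "loc_holder \<theta> G (\<lambda>p. v p * w p)"
proof (rule loc_holder_combine[OF assms(1,2)])
  fix p assume p: "p \<in> G"
  obtain \<rho>1 B1 where 1: "\<rho>1 > 0" "\<And>q. q \<in> ball p \<rho>1 \<Longrightarrow> \<bar>v q\<bar> \<le> B1" using assms(3) p unfolding loc_bdd_def by blast
  obtain \<rho>2 B2 where 2: "\<rho>2 > 0" "\<And>q. q \<in> ball p \<rho>2 \<Longrightarrow> \<bar>w q\<bar> \<le> B2" using assms(4) p unfolding loc_bdd_def by blast
  have B: "0 \<le> B1" "0 \<le> B2" using 1(2)[of p] 2(2)[of p] 1(1) 2(1) by auto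
  have "\<bar>v q * w q - v q' * w q'\<bar> \<le> (B1 + B2) * (\<bar>v q - v q'\<bar> + \<bar>w q - w q'\<bar>)"
    if "q \<in> ball p (min \<rho>1 \<rho>2)" "q' \<in> ball p (min \<rho>1 \<rho>2)" for q q'
  proof -
    have "v q * w q - v q' * w q' = (v q - v q') * w q + v q' * (w q - w q')" by (simp add: algebra_simps)
    also have "\<bar>\<dots>\<bar> \<le> \<bar>v q - v q'\<bar> * \<bar>w q\<bar> + \<bar>v q'\<bar> * \<bar>w q - w q'\<bar>" by (metis abs_triangle_ineq abs_mult)
    also have "\<dots> \<le> \<bar>v q - v q'\<bar> * (B1 + B2) + (B1 + B2) * \<bar>w q - w q'\<bar>"
      using 1(2)[of q'] 2(2)[of q] that B by (intro add_mono mult_mono) auto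
    finally show ?thesis by (simp add: algebra_simps)
  qed
  then show "\<exists>\<rho>>0. \<exists>C\<ge>0. \<forall>q\<in>ball p \<rho>. \<forall>q'\<in>ball p \<rho>. \<bar>v q * w q - v q' * w q'\<bar> \<le> C * (\<bar>v q - v q'\<bar> + \<bar>w q - w q'\<bar>)"
    using 1(1) 2(1) B by (intro exI[of _ "min \<rho>1 \<rho>2"] conjI exI[of _ "B1 + B2"]) auto
qed

lemma loc_holder_diff:
  assumes "loc_holder \<theta> G v" "loc_holder \<theta> G w"
  shows "loc_holder \<theta> G (\<lambda>p. v p - w p)"
  by (rule loc_holder_combine[OF assms]) (auto intro!: exI[of _ 1])

lemma loc_holder_comp:
  assumes w: "loc_holder \<theta> G w" and F: "\<And>p q. p \<in> G \<Longrightarrow> q \<in> G \<Longrightarrow> \<bar>F (w p) - F (w q)\<bar> \<le> L * \<bar>w p - w q\<bar>" and G: "open G" and L: "0 \<le> L"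
  shows "loc_holder \<theta> G (\<lambda>p. F (w p))"
proof (rule loc_holder_combine[OF w w])
  fix p assume "p \<in> G"
  then obtain \<rho> where \<rho>: "\<rho> > 0" "ball p \<rho> \<subseteq> G" using G open_contains_ball by blast
  have "\<bar>F (w q) - F (w q')\<bar> \<le> L * (\<bar>w q - w q'\<bar> + \<bar>w q - w q'\<bar>)" if "q \<in> ball p \<rho>" "q' \<in> ball p \<rho>" for q q'
    by (rule order_trans[OF F mult_left_mono[OF _ L]]) (use that \<rho> in auto)
  then show "\<exists>\<rho>>0. \<exists>C\<ge>0. \<forall>q\<in>ball p \<rho>. \<forall>q'\<in>ball p \<rho>. \<bar>F (w q) - F (w q')\<bar> \<le> C * (\<bar>w q - w q'\<bar> + \<bar>w q - w q'\<bar>)"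
    using \<rho>(1) L by blast
qed

lemma loc_holder_space:
  assumes "\<And>x x'. \<bar>a x - a x'\<bar> \<le> A * norm (x - x') powr \<theta>"
  shows "loc_holder \<theta> G (\<lambda>p. a (fst p))"
  unfolding loc_holder_def using assms by (intro ballI exI[of _ 1] conjI exI[of _ A]) auto

lemma loc_holder_cong:
  assumes "loc_holder \<theta> G v" "open G" "\<And>p. p \<in> G \<Longrightarrow> v p = w p"
  shows "loc_holder \<theta> G w"
proof (rule loc_holder_combine[OF assms(1,1)])
  fix p assume "p \<in> G"
  then obtain \<rho> where "\<rho> > 0" "ball p \<rho> \<subseteq> G" using assms(2) open_contains_ball by blast
  then show "\<exists>\<rho>>0. \<exists>C\<ge>0. \<forall>q\<in>ball p \<rho>. \<forall>q'\<in>ball p \<rho>. \<bar>w q - w q'\<bar> \<le> C * (\<bar>v q - v q'\<bar> + \<bar>v q - v q'\<bar>)"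
    using assms(3) by (intro exI[of _ \<rho>] conjI exI[of _ 1]) (auto simp: subset_iff)
qed

section \<open>The penalised Cauchy problem on the whole space\<close>

text \<open>The index \<open>True\<close> stands for \<open>u\<close> and \<open>False\<close> for
  \<open>v\<close>; the component \<open>b\<close> is driven by the component
  \<open>\<not> b\<close>, so both equations share one form. \<open>pn\<close> is the weight of the
  penalty.\<close>

locale penal =
  fixes al U0 :: "bool \<Rightarrow> 'a::euclidean_space \<Rightarrow> real" and F :: "bool \<Rightarrow> real \<Rightarrow> real" and pn :: "'a \<Rightarrow> real"
    and M A L \<theta> :: real
  assumes th: "0 < \<theta>" "\<theta> \<le> 1"
    and al0: "\<And>b x. 0 \<le> al b x" and alM: "\<And>b x. al b x \<le> M"
    and alh: "\<And>b x x'. \<bar>al b x - al b x'\<bar> \<le> A * norm (x - x') powr \<theta>"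
    and F0: "\<And>b s. 0 \<le> F b s" and FM: "\<And>b s. F b s \<le> M"
    and FL: "\<And>b s s'. \<bar>F b s - F b s'\<bar> \<le> L * \<bar>s - s'\<bar>" and Fmono: "\<And>b s s'. s \<le> s' \<Longrightarrow> F b s \<le> F b s'"
    and U0c: "\<And>b. continuous_on UNIV (U0 b)" and U00: "\<And>b x. 0 \<le> U0 b x" and U01: "\<And>b x. U0 b x \<le> 1"
    and chi0: "\<And>x. 0 \<le> pn x" and chi1: "\<And>x. pn x \<le> 1" and chiL: "\<And>x x'. \<bar>pn x - pn x'\<bar> \<le> norm (x - x')"
begin

lemma M0: "0 \<le> M" using al0 alM order_trans by blast

lemma L0: "0 \<le> L" using FL[of True 0 1] by simp

lemma continuous_al: "continuous_on UNIV (al b)"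
  unfolding continuous_on_eq_continuous_at[OF open_UNIV]
proof
  fix x
  have "((\<lambda>y. al b y - al b x) \<longlongrightarrow> 0) (at x)"
  proof (rule Lim_null_comparison)
    show "\<forall>\<^sub>F y in at x. norm (al b y - al b x) \<le> A * norm (y - x) powr \<theta>" using alh by (intro always_eventually) auto
    have "((\<lambda>y. norm (y - x) powr \<theta>) \<longlongrightarrow> 0) (at x)"
      by (rule tendsto_zero_powrI[where b=\<theta>]) (use th in \<open>auto intro!: tendsto_eq_intros\<close>)
    then show "((\<lambda>y. A * norm (y - x) powr \<theta>) \<longlongrightarrow> 0) (at x)" by (rule tendsto_mult_right_zero)
  qed
  then show "isCont (al b) x" unfolding isCont_def by (rule LIM_zero_cancel)
qed

lemma continuous_F: "continuous_on S (F b)"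
proof -
  have "L-lipschitz_on S (F b)" by (rule lipschitz_onI) (use FL L0 in \<open>auto simp: dist_real_def\<close>)
  then show ?thesis by (rule lipschitz_on_continuous_on)
qed

lemma continuous_chi: "continuous_on S pn"
proof -
  have "1-lipschitz_on S pn" by (rule lipschitz_onI) (use chiL in \<open>auto simp: dist_real_def dist_norm\<close>)
  then show ?thesis by (rule lipschitz_on_continuous_on)
qed

lemma borel_data [measurable]: "al b \<in> borel_measurable borel" "F b \<in> borel_measurable borel" "pn \<in> borel_measurable borel"
  by (auto intro!: borel_measurable_continuous_onI continuous_al continuous_F continuous_chi)

definition src :: "real \<Rightarrow> (bool \<Rightarrow> 'a \<times> real \<Rightarrow> real) \<Rightarrow> bool \<Rightarrow> 'a \<times> real \<Rightarrow> real" where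
  "src n u b p = indicator {0<..<1} (snd p) * (al b (fst p) * F b (u (\<not> b) p) - n * pn (fst p) * u b p)"

text \<open>Banach's theorem for pairs of bounded continuous functions, applied to
  \<open>W = exp (- K t) u\<close>. The exponential weight replaces a smallness condition on the
  time interval, so the solution exists on all of \<open>[0, 1)\<close> for every
  \<open>n\<close>.\<close>

lemma mild_solution:
  assumes n: "0 \<le> n"
  obtains u B where "\<And>b. u b \<in> borel_measurable borel" "\<And>b p. \<bar>u b p\<bar> \<le> B" "\<And>b. continuous_on (UNIV \<times> {0..<1}) (u b)"
    "\<And>b x t. 0 \<le> t \<Longrightarrow> t < 1 \<Longrightarrow> u b (x, t) = heat_flow (U0 b) (x, t) + convol hkE (src n u b) (x, t)"
proof -
  \<comment> \<open>A Lipschitz constant of the source with respect to the pair of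
    components.\<close>
  define q where "q = M * L + n"
  have q0: "0 \<le> q" using M0 L0 n by (simp add: q_def)
  \<comment> \<open>The weighted kernel has mass at most \<open>1 / K\<close>, so each component
    contracts by \<open>q / K \<le> 1/4\<close> and the pair by 1/2; the summand 1 keeps
    \<open>K\<close> positive.\<close>
  define K where "K = 4 * q + 1"
  have K: "0 < K" "q / K \<le> 1/4" using q0 by (auto simp: K_def divide_simps)
  define k where "k p = exp (- K * snd p) * hkE p" for p :: "'a \<times> real"
  have km[measurable]: "k \<in> borel_measurable borel" unfolding k_def by measurable
  have k0: "0 \<le> k p" for p by (simp add: k_def hkE_nonneg)
  have ki: "integrable lborel k"
  proof (rule Bochner_Integration.integrable_bound[OF integrable_hkE])
    show "AE p in lborel. norm (k p) \<le> norm (hkE p)"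
    proof (rule AE_I2)
      fix p :: "'a \<times> real"
      show "norm (k p) \<le> norm (hkE p)"
      proof (cases "0 < snd p")
        case True
        then have "exp (- K * snd p) * hkE p \<le> 1 * hkE p" using K by (intro mult_right_mono hkE_nonneg) auto
        then show ?thesis by (simp add: k_def hkE_nonneg abs_mult)
      qed (simp add: k_def hkE_def)
    qed
  qed simp
  have kmass: "(\<integral>p. \<bar>k p\<bar> \<partial>lborel) \<le> 1 / K"
  proof -
    have i1: "integrable lborel (\<lambda>s::real. indicator {0..1} s * exp (- K * s))"
    proof -
      have c: "continuous_on {0..1} (\<lambda>s. exp (- K * s))" by (intro continuous_intros)
      show ?thesis using borel_integrable_atLeastAtMost'[OF c] by (simp add: set_integrable_def)
    qed
    have sl: "(\<integral>y. k (y, s) \<partial>lborel) = indicator {0<..<1} s * exp (- K * s)" for s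
      by (cases "0 < s \<and> s < 1") (auto simp: k_def hkE_def hk_integral)
    have "(\<integral>p. k p \<partial>lborel) = (\<integral>s. (\<integral>y. k (y, s) \<partial>lborel) \<partial>lborel)"
    proof (rule integrable_by_slices(2)[OF km _ _ i1])
      show "integrable lborel (\<lambda>y. k (y, s))" for s
        by (cases "0 < s \<and> s < 1") (auto simp: k_def hkE_def hk_integral)
      show "(\<integral>y. \<bar>k (y, s)\<bar> \<partial>lborel) \<le> indicator {0..1} s * exp (- K * s)" for s
        using sl[of s] k0 by (auto split: split_indicator)
    qed
    also have "\<dots> \<le> (\<integral>s. indicator {0..1} s * exp (- K * s) \<partial>lborel)"
      unfolding sl
    proof (rule integral_mono[OF _ i1])
      show "integrable lborel (\<lambda>s. indicator {0<..<1} s * exp (- K * s))"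
        by (rule Bochner_Integration.integrable_bound[OF i1]) (auto split: split_indicator)
    qed (auto split: split_indicator)
    also have "\<dots> = (- exp (- K * 1) / K) - (- exp (- K * 0) / K)"
    proof -
      have "(\<integral>s. indicator {0..1} s *\<^sub>R exp (- K * s) \<partial>lborel) = (- exp (- K * 1) / K) - (- exp (- K * 0) / K)"
      proof (rule integral_FTC_atLeastAtMost)
        show "((\<lambda>s. - exp (- K * s) / K) has_vector_derivative exp (- K * s)) (at s within {0..1})" for s
          unfolding has_real_derivative_iff_has_vector_derivative[symmetric]
          using K by (auto intro!: derivative_eq_intros)
      qed (auto intro!: continuous_intros)
      then show ?thesis by simp
    qed
    also have "\<dots> \<le> 1 / K" using K by (simp add: divide_simps)
    finally show ?thesis using k0 by simp
  qed
  have kc: "AE p in lborel. isCont k p"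
    using hkE_isCont by eventually_elim (auto simp: k_def[abs_def] intro!: continuous_intros)
  \<comment> \<open>The source in terms of \<open>W\<close>. It is kept for all positive times, so
    that the fixed point problem lives on the whole of space-time; the decaying exponential keeps it
    bounded there.\<close>
  define h where "h W b p = indicator {0<..} (snd p) * (exp (- K * snd p) * (al b (fst p) * F b (exp (K * snd p) * W (\<not> b) p)) - n * pn (fst p) * W b p)"
    for W :: "bool \<Rightarrow> 'a \<times> real \<Rightarrow> real" and b p
  define sel where "sel W b = apply_bcontfun (if b then fst W else snd W)" for W :: "(('a \<times> real) \<Rightarrow>\<^sub>C real) \<times> (('a \<times> real) \<Rightarrow>\<^sub>C real)" and b
  have selc: "continuous_on S (sel W b)" for S W b
    unfolding sel_def by (intro continuous_on_apply_bcontfun continuous_intros)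
  then have selm[measurable]: "sel W b \<in> borel_measurable borel" for W b by (rule borel_measurable_continuous_onI)
  have seld: "\<bar>sel W b p - sel W' b p\<bar> \<le> dist W W'" for W W' b p
  proof -
    have "\<bar>sel W b p - sel W' b p\<bar> \<le> dist (if b then fst W else snd W) (if b then fst W' else snd W')"
      unfolding sel_def using dist_bounded[of "if b then fst W else snd W" p "if b then fst W' else snd W'"] by (simp add: dist_real_def)
    also have "\<dots> \<le> dist W W'" by (cases b) (auto simp: dist_fst_le dist_snd_le)
    finally show ?thesis .
  qed
  have selb: "\<bar>sel W b p\<bar> \<le> dist W 0" for W b p using seld[of W b p 0] by (cases b) (simp_all add: sel_def zero_bcontfun.rep_eq)
  have hm[measurable]: "h (sel W) b \<in> borel_measurable borel" for W b unfolding h_def by measurable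
  have hb: "\<bar>h (sel W) b p\<bar> \<le> M * M + n * dist W 0" for W b p
  proof (cases "0 < snd p")
    case True
    have "exp (- K * snd p) \<le> 1" using True K by simp
    moreover have "al b (fst p) * F b (exp (K * snd p) * sel W (\<not> b) p) \<le> M * M" by (intro mult_mono al0 alM F0 FM M0)
    ultimately have "exp (- K * snd p) * (al b (fst p) * F b (exp (K * snd p) * sel W (\<not> b) p)) \<le> 1 * (M * M)"
      by (rule mult_mono) (use al0 F0 in auto)
    moreover have "0 \<le> exp (- K * snd p) * (al b (fst p) * F b (exp (K * snd p) * sel W (\<not> b) p))" using al0 F0 by simp
    moreover have "n * pn (fst p) * \<bar>sel W b p\<bar> \<le> n * 1 * dist W 0"
      by (intro mult_mono selb chi1 n chi0) (use n chi0 in auto)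
    then have "\<bar>n * pn (fst p) * sel W b p\<bar> \<le> n * dist W 0" using n chi0 by (simp add: abs_mult)
    ultimately show ?thesis using True unfolding h_def by (simp; linarith)
  qed (use M0 n in \<open>auto simp: h_def\<close>)
  have hd: "\<bar>h (sel W) b p - h (sel W') b p\<bar> \<le> q * dist W W'" for W W' b p
  proof (cases "0 < snd p")
    case True
    let ?e = "exp (K * snd p)"
    have "\<bar>F b (?e * sel W (\<not> b) p) - F b (?e * sel W' (\<not> b) p)\<bar> \<le> L * (?e * dist W W')"
    proof -
      have "\<bar>?e * sel W (\<not> b) p - ?e * sel W' (\<not> b) p\<bar> = ?e * \<bar>sel W (\<not> b) p - sel W' (\<not> b) p\<bar>"
        by (simp add: abs_mult flip: right_diff_distrib)
      also have "\<dots> \<le> ?e * dist W W'" by (intro mult_left_mono seld) simp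
      finally show ?thesis using order_trans[OF FL mult_left_mono[OF _ L0]] by blast
    qed
    then have "al b (fst p) * \<bar>F b (?e * sel W (\<not> b) p) - F b (?e * sel W' (\<not> b) p)\<bar> \<le> M * (L * (?e * dist W W'))"
      by (intro mult_mono alM M0) auto
    then have "exp (- K * snd p) * (al b (fst p) * \<bar>F b (?e * sel W (\<not> b) p) - F b (?e * sel W' (\<not> b) p)\<bar>) \<le> exp (- K * snd p) * (M * (L * (?e * dist W W')))"
      by (intro mult_left_mono) auto
    also have "\<dots> = (exp (- K * snd p) * ?e) * (M * L * dist W W')" by simp
    also have "exp (- K * snd p) * ?e = 1" by (simp flip: exp_add)
    finally have 1: "\<bar>exp (- K * snd p) * (al b (fst p) * F b (?e * sel W (\<not> b) p)) - exp (- K * snd p) * (al b (fst p) * F b (?e * sel W' (\<not> b) p))\<bar> \<le> M * L * dist W W'"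
      using al0[of b "fst p"] by (simp add: abs_mult flip: right_diff_distrib)
    have "n * pn (fst p) * \<bar>sel W b p - sel W' b p\<bar> \<le> n * 1 * dist W W'"
      by (intro mult_mono seld chi1 n chi0) (use n chi0 in auto)
    then have "\<bar>n * pn (fst p) * sel W b p - n * pn (fst p) * sel W' b p\<bar> \<le> n * dist W W'"
      using n chi0[of "fst p"] by (simp add: abs_mult flip: right_diff_distrib)
    with 1 show ?thesis using True unfolding h_def q_def by (simp add: ring_distribs; linarith)
  qed (use q0 in \<open>auto simp: h_def\<close>)
  define \<Phi> where "\<Phi> W b p = exp (- K * max 0 (snd p)) * heat_flow (U0 b) p + convol k (h (sel W) b) p" for W b p
  have U0B: "\<bar>U0 b x\<bar> \<le> 1" for b x using U00 U01 by (simp add: abs_le_iff order_trans[OF _ U00])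
  have \<Phi>c: "continuous_on UNIV (\<Phi> W b)" for W b
    unfolding \<Phi>_def
    by (intro continuous_intros continuous_heat_flow[OF U0c U0B] continuous_on_convol[OF ki kc hm hb])
  have \<Phi>b: "\<bar>\<Phi> W b p\<bar> \<le> 1 + (M * M + n * dist W 0) * (\<integral>p. \<bar>k p\<bar> \<partial>lborel)" for W b p
  proof -
    have "exp (- K * max 0 (snd p)) * \<bar>heat_flow (U0 b) p\<bar> \<le> 1 * 1"
      using K by (intro mult_mono heat_flow_bound[OF U0c U0B]) auto
    then have "\<bar>exp (- K * max 0 (snd p)) * heat_flow (U0 b) p\<bar> \<le> 1" by (simp add: abs_mult)
    moreover have "\<bar>convol k (h (sel W) b) p\<bar> \<le> (M * M + n * dist W 0) * (\<integral>p. \<bar>k p\<bar> \<partial>lborel)" by (rule convol_bound[OF ki hm hb])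
    ultimately show ?thesis unfolding \<Phi>_def by linarith
  qed
  have \<Phi>in: "\<Phi> W b \<in> bcontfun" for W b
    by (rule bcontfun_normI[OF \<Phi>c]) (unfold real_norm_def, rule \<Phi>b)
  define T where "T W = (Bcontfun (\<Phi> W True), Bcontfun (\<Phi> W False))" for W
  have selT: "sel (T W) b = \<Phi> W b" for W b
    unfolding sel_def T_def using \<Phi>in by (cases b) (auto simp: Bcontfun_inverse)
  have \<Phi>d: "\<bar>\<Phi> W b p - \<Phi> W' b p\<bar> \<le> 1/4 * dist W W'" for W W' b p
  proof -
    have "\<Phi> W b p - \<Phi> W' b p = convol k (\<lambda>p. h (sel W) b p - h (sel W') b p) p"
      unfolding \<Phi>_def using convol_diff_right[OF ki hm hm hb hb] by simp
    also have "\<bar>\<dots>\<bar> \<le> q * dist W W' * (\<integral>p. \<bar>k p\<bar> \<partial>lborel)" by (rule convol_bound[OF ki _ hd]) measurable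
    also have "\<dots> \<le> q * dist W W' * (1 / K)" using q0 by (intro mult_left_mono kmass) auto
    also have "\<dots> = q / K * dist W W'" by simp
    also have "\<dots> \<le> 1/4 * dist W W'" by (intro mult_right_mono K) simp
    finally show ?thesis .
  qed
  have Td: "dist (T W) (T W') \<le> 1/2 * dist W W'" for W W'
  proof -
    have d1: "dist (Bcontfun (\<Phi> W b)) (Bcontfun (\<Phi> W' b)) \<le> 1/4 * dist W W'" for b
      by (rule dist_bound) (use \<Phi>d \<Phi>in in \<open>auto simp: Bcontfun_inverse dist_real_def\<close>)
    have "dist (T W) (T W') \<le> dist (Bcontfun (\<Phi> W True)) (Bcontfun (\<Phi> W' True)) + dist (Bcontfun (\<Phi> W False)) (Bcontfun (\<Phi> W' False))"
      unfolding T_def dist_Pair_Pair by (rule sqrt_sum_squares_le_sum) auto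
    with d1[of True] d1[of False] show ?thesis by simp
  qed
  have "\<exists>!W. T W = W"
    by (rule banach_fix_type[where c="1/2"]) (use Td in auto)
  then obtain W where W: "T W = W" by blast
  have Weq: "sel W b p = \<Phi> W b p" for b p using selT[of W b] W by simp
  \<comment> \<open>Undoing the weight. Setting \<open>u\<close> to 0 from time 1 on keeps it
    bounded against the growing exponential.\<close>
  define u where "u b p = (if snd p < 1 then exp (K * snd p) * sel W b p else 0)" for b p
  have um[measurable]: "u b \<in> borel_measurable borel" for b unfolding u_def by measurable
  have ub: "\<bar>u b p\<bar> \<le> exp K * dist W 0" for b p
  proof (cases "snd p < 1")
    case True
    then have "exp (K * snd p) \<le> exp K" using K by simp
    then have "exp (K * snd p) * \<bar>sel W b p\<bar> \<le> exp K * dist W 0" by (intro mult_mono selb) auto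
    then show ?thesis using True by (simp add: u_def abs_mult)
  qed (simp add: u_def)
  show ?thesis
  proof (rule that[of u, OF um ub])
    show "continuous_on (UNIV \<times> {0..<1}) (u b)" for b
    proof (rule continuous_on_eq[of _ "\<lambda>p. exp (K * snd p) * sel W b p"])
      show "continuous_on (UNIV \<times> {0..<1}) (\<lambda>p. exp (K * snd p) * sel W b p)" by (intro continuous_intros selc)
    qed (auto simp: u_def)
    fix b :: bool and x :: 'a and t :: real assume t: "0 \<le> t" "t < 1"
    have e: "exp (K * t) * (k q' * h (sel W) b ((x, t) - q')) = hkE q' * src n u b ((x, t) - q')" for q'
    proof -
      obtain y s where q': "q' = (y, s)" by (cases q')
      consider "s \<le> 0" | "t \<le> s" | "0 < s" "s < t" by linarith
      then show ?thesis
      proof cases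
        case 1 then show ?thesis by (simp add: q' k_def hkE_def)
      next
        case 2 then show ?thesis by (simp add: q' h_def src_def)
      next
        case 3
        have "exp (K * t) * exp (- K * s) = exp (K * (t - s))" by (simp flip: exp_add add: algebra_simps)
        then have "exp (K * t) * (k q' * h (sel W) b ((x, t) - q')) = hkE q' * (exp (K * (t - s)) * h (sel W) b ((x, t) - q'))"
          by (simp add: k_def q' mult_ac)
        also have "exp (K * (t - s)) * h (sel W) b ((x, t) - q') = src n u b ((x, t) - q')"
        proof -
          have "exp (K * (t - s)) * exp (- K * (t - s)) = 1" by (simp flip: exp_add)
          then have "exp (K * (t - s)) * (exp (- K * (t - s)) * z) = z" for z by (metis mult.assoc mult_1)
          then show ?thesis using 3 t by (simp add: h_def src_def q' u_def right_diff_distrib mult.left_commute)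
        qed
        finally show ?thesis .
      qed
    qed
    have "u b (x, t) = exp (K * t) * (exp (- K * t) * heat_flow (U0 b) (x, t)) + exp (K * t) * convol k (h (sel W) b) (x, t)"
      using t by (simp add: u_def Weq \<Phi>_def max_def ring_distribs)
    also have "exp (K * t) * (exp (- K * t) * heat_flow (U0 b) (x, t)) = heat_flow (U0 b) (x, t)"
      by (simp add: mult.assoc[symmetric] flip: exp_add)
    also have "exp (K * t) * convol k (h (sel W) b) (x, t) = convol hkE (src n u b) (x, t)"
      unfolding convol_def by (subst integral_mult_right_zero[symmetric]) (simp only: e)
    finally show "u b (x, t) = heat_flow (U0 b) (x, t) + convol hkE (src n u b) (x, t)" .
  qed
qed

lemma pn_holder: "\<bar>n * pn x - n * pn x'\<bar> \<le> \<bar>n\<bar> * norm (x - x') powr \<theta>"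
proof -
  have "\<bar>pn x - pn x'\<bar> \<le> norm (x - x') powr \<theta>"
  proof (cases "norm (x - x') \<le> 1")
    case True
    then have "norm (x - x') \<le> norm (x - x') powr \<theta>"
      using th by (cases "x = x'") (auto intro: order_trans[OF _ powr_mono'[of \<theta> 1]])
    then show ?thesis using chiL[of x x'] by linarith
  next
    case False
    then have "1 \<le> norm (x - x') powr \<theta>" using th by (intro ge_one_powr_ge_zero) auto
    moreover have "\<bar>pn x - pn x'\<bar> \<le> 1" using chi0[of x] chi0[of x'] chi1[of x] chi1[of x'] by linarith
    ultimately show ?thesis by linarith
  qed
  then have "\<bar>n\<bar> * \<bar>pn x - pn x'\<bar> \<le> \<bar>n\<bar> * norm (x - x') powr \<theta>" by (rule mult_left_mono) simp
  then show ?thesis by (simp add: abs_mult flip: right_diff_distrib)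
qed

definition penal_sol :: "real \<Rightarrow> (bool \<Rightarrow> 'a \<times> real \<Rightarrow> real) \<Rightarrow> bool" where
  "penal_sol n u \<longleftrightarrow> (\<forall>b. u b \<in> borel_measurable borel) \<and> (\<exists>B. \<forall>b p. \<bar>u b p\<bar> \<le> B) \<and>
    (\<forall>b. continuous_on (UNIV \<times> {0..<1}) (u b)) \<and> (\<forall>b x. u b (x, 0) = U0 b x) \<and>
    (\<forall>b x t. 0 < t \<longrightarrow> t < 1 \<longrightarrow> heat_at (\<lambda>x t. u b (x, t)) x t (al b x * F b (u (\<not> b) (x, t)) - n * pn x * u b (x, t))) \<and>
    (\<forall>b r x t. 0 < r \<longrightarrow> 2 * r \<le> 1 \<longrightarrow> 2 * r < t \<longrightarrow> t < 1 \<longrightarrow> kernel_id r (u b) (src n u b) (x, t))"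

text \<open>Bootstrap: the mild equation gives the kernel identities, these make the solution
  locally Hoelder continuous in space, hence also the source, and then the equation holds
  classically. The identities themselves are kept for passing to the limit.\<close>

lemma penal_solution:
  assumes n: "0 \<le> n"
  shows "\<exists>u. penal_sol n u"
proof -
  obtain u B where um[measurable]: "\<And>b. u b \<in> borel_measurable borel" and uB: "\<And>b p. \<bar>u b p\<bar> \<le> B"
    and uc: "\<And>b. continuous_on (UNIV \<times> {0..<1}) (u b)"
    and mild: "\<And>b x t. 0 \<le> t \<Longrightarrow> t < 1 \<Longrightarrow> u b (x, t) = heat_flow (U0 b) (x, t) + convol hkE (src n u b) (x, t)"
    using mild_solution[OF n] by blast
  have U0B: "\<bar>U0 b x\<bar> \<le> 1" for b x using U00 U01 by (simp add: abs_le_iff order_trans[OF _ U00])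
  have B0: "0 \<le> B" using uB[of True undefined] by linarith
  have sm[measurable]: "src n u b \<in> borel_measurable borel" for b unfolding src_def by measurable
  have sB: "\<bar>src n u b p\<bar> \<le> M * M + n * B" for b p
  proof -
    have "al b (fst p) * F b (u (\<not> b) p) \<le> M * M" by (intro mult_mono al0 alM F0 FM M0)
    moreover have "0 \<le> al b (fst p) * F b (u (\<not> b) p)" by (intro mult_nonneg_nonneg al0 F0)
    moreover have "n * pn (fst p) * \<bar>u b p\<bar> \<le> n * 1 * B"
      by (intro mult_mono uB chi1 n chi0) (use n chi0 in auto)
    then have "\<bar>n * pn (fst p) * u b p\<bar> \<le> n * B" using n chi0[of "fst p"] by (simp add: abs_mult)
    moreover have "0 \<le> M * M + n * B" using M0 n B0 by simp
    ultimately show ?thesis unfolding src_def by (auto split: split_indicator; linarith)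
  qed
  have s0: "src n u b (x, t) = 0" if "t \<le> 0" for b x t using that by (simp add: src_def)
  have ident: "kernel_id r (u b) (src n u b) (x, t)"
    if r: "0 < r" "2 * r \<le> 1" and t: "2 * r < t" "t < 1" for b r x t
  proof -
    note P = heat_potential_identities[OF r t(2) sm sB s0, of b x]
    note Fl = heat_flow_identities[OF U0c U0B r t, of b x]
    have flm: "heat_flow (U0 b) \<in> borel_measurable borel"
      by (rule borel_measurable_continuous_onI[OF continuous_heat_flow[OF U0c U0B]])
    have Wm: "convol hkE (src n u b) \<in> borel_measurable borel"
      by (rule borel_measurable_continuous_onI[OF continuous_heat_potential[OF sm sB]])
    have add: "convol k (u b) (x, t) = convol k (heat_flow (U0 b)) (x, t) + convol k (convol hkE (src n u b)) (x, t)"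
      if k: "integrable lborel k" "\<And>q. q \<notin> cap r \<Longrightarrow> k q = 0" "\<And>q. snd q \<le> 0 \<Longrightarrow> k q = 0" for k
    proof -
      have "convol k (u b) (x, t) = convol k (\<lambda>q. heat_flow (U0 b) q + convol hkE (src n u b) q) (x, t)"
      proof (rule convol_cong[where S = "cap r \<inter> {q. 0 < snd q}"])
        show "k q = 0" if "q \<notin> cap r \<inter> {q. 0 < snd q}" for q using k(2)[of q] k(3)[of q] that by (auto simp: not_less)
        fix q :: "'a \<times> real" assume q: "q \<in> cap r \<inter> {q. 0 < snd q}"
        then have "0 \<le> t - snd q" "t - snd q < 1" using t by (auto simp: cap_def)
        from mild[OF this, of b "x - fst q"]
        show "u b ((x, t) - q) = heat_flow (U0 b) ((x, t) - q) + convol hkE (src n u b) ((x, t) - q)" by (cases q) simp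
      qed
      also have "\<dots> = convol k (heat_flow (U0 b)) (x, t) + convol k (convol hkE (src n u b)) (x, t)"
        unfolding convol_def[of k] distrib_left
        by (intro Bochner_Integration.integral_add convol_integrable[OF k(1) flm heat_flow_bound[OF U0c U0B]]
            convol_integrable[OF k(1) Wm heat_potential_bound[OF sm sB]])
      finally show ?thesis .
    qed
    have n0: "kap r q = 0" "kap' r q = 0" if "snd q \<le> 0" for q :: "'a \<times> real"
      using rad_support_time[OF kapq_rad[where 'a='a] r, of "snd q" "fst q"]
        rad_support_time[OF kapq'_rad[OF r(1), where 'a='a] r, of "snd q" "real DIM('a)" "fst q"] that r
      by (auto simp: kap_def kap'_def)
    have m: "u b (x, t) = heat_flow (U0 b) (x, t) + convol hkE (src n u b) (x, t)" using mild t r by simp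
    show ?thesis
      using add[OF kap_integrable(1)[OF r(1)] kap_support(1)[OF r(1)] n0(1)]
        add[OF kap_integrable(2)[OF r(1)] kap_support(2)[OF r(1)] n0(2)] P Fl m by simp
  qed
  let ?G = "UNIV \<times> {0<..<1} :: ('a \<times> real) set"
  have G: "open ?G" "?G \<subseteq> UNIV \<times> {0<..<1}" by (auto intro: open_Times)
  have LS: "local_sol ?G (u b) (src n u b)" for b
    unfolding local_sol_def
  proof
    fix p :: "'a \<times> real" assume p: "p \<in> ?G"
    obtain x0 t0 where p0: "p = (x0, t0)" by (cases p)
    have t0: "0 < t0" "t0 < 1" using p p0 by auto
    \<comment> \<open>The quarter gives \<open>t > 3/4 * t0\<close> and
      \<open>2 * r < t0 / 2\<close>, hence \<open>2 * r < t\<close> and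
      \<open>2 * r \<le> 1\<close>; the bound \<open>1 - t0\<close> gives
      \<open>t < 1\<close>.\<close>
    define \<rho> where "\<rho> = min (t0 / 4) (1 - t0)"
    show "\<exists>\<rho>>0. \<forall>r p'. 0 < r \<longrightarrow> r < \<rho> \<longrightarrow> p' \<in> ball p \<rho> \<longrightarrow> kernel_id r (u b) (src n u b) p'"
    proof (rule exI[of _ \<rho>], intro conjI allI impI)
      show "0 < \<rho>" using t0 by (simp add: \<rho>_def)
      fix r and p' :: "'a \<times> real" assume r: "0 < r" "r < \<rho>" and p': "p' \<in> ball p \<rho>"
      obtain x t where xt: "p' = (x, t)" by (cases p')
      have "\<bar>t0 - t\<bar> \<le> dist p p'" using dist_snd_le[of p p'] by (simp add: p0 xt dist_real_def)
      then have "\<bar>t0 - t\<bar> < \<rho>" using p' by simp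
      then have "t0 - t < \<rho>" "t - t0 < \<rho>" by linarith+
      then have "t0 - t < t0 / 4" "t - t0 < 1 - t0" "r < t0 / 4" using r unfolding \<rho>_def min_less_iff_conj by blast+
      then have "2 * r < t" "t < 1" "2 * r \<le> 1" using t0 by linarith+
      then show "u b p' = convol (kerP r) (src n u b) p' + convol (kap r) (u b) p'"
        "convol (kap' r) (u b) p' = convol (kap r) (src n u b) p'" using ident[OF r(1), of t b x] xt by auto
    qed
  qed
  have bd: "loc_bdd ?G (u b)" "loc_bdd ?G (src n u b)" for b
    unfolding loc_bdd_def using uB sB by (meson zero_less_one)+
  have ucG: "continuous_on ?G (u b)" for b by (rule continuous_on_subset[OF uc]) auto
  have uh: "loc_holder \<theta> ?G (u b)" for b by (rule local_sol_holder[OF G LS um sm bd th])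
  have seq: "al b (fst p) * F b (u (\<not> b) p) - n * pn (fst p) * u b p = src n u b p" if "p \<in> ?G" for b p
    using that by (auto simp: src_def)
  have sc: "continuous_on ?G (src n u b)" for b
  proof (rule continuous_on_eq[OF _ seq])
    show "continuous_on ?G (\<lambda>p. al b (fst p) * F b (u (\<not> b) p) - n * pn (fst p) * u b p)"
      by (intro continuous_intros ucG continuous_on_compose2[OF continuous_al] continuous_on_compose2[OF continuous_F]
          continuous_on_compose2[OF continuous_chi[of UNIV]]) auto
  qed
  have sh: "loc_holder \<theta> ?G (src n u b)" for b
  proof (rule loc_holder_cong[OF _ G(1) seq])
    have 1: "loc_holder \<theta> ?G (\<lambda>p. al b (fst p))" by (rule loc_holder_space[OF alh])
    have 2: "loc_holder \<theta> ?G (\<lambda>p. F b (u (\<not> b) p))" by (rule loc_holder_comp[OF uh FL G(1) L0])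
    have 3: "loc_holder \<theta> ?G (\<lambda>p. n * pn (fst p))" by (rule loc_holder_space[OF pn_holder])
    have "loc_bdd ?G (\<lambda>p. al b (fst p))"
      by (intro loc_bdd_continuous G continuous_on_compose2[OF continuous_al] continuous_intros) auto
    moreover have "loc_bdd ?G (\<lambda>p. F b (u (\<not> b) p))"
      by (intro loc_bdd_continuous G continuous_on_compose2[OF continuous_F[of UNIV]] ucG) auto
    moreover have "loc_bdd ?G (\<lambda>p. n * pn (fst p))"
      by (intro loc_bdd_continuous G continuous_on_compose2[OF continuous_chi[of UNIV]] continuous_intros) auto
    ultimately show "loc_holder \<theta> ?G (\<lambda>p. al b (fst p) * F b (u (\<not> b) p) - n * pn (fst p) * u b p)"
      by (intro loc_holder_diff loc_holder_mult 1 2 3 uh bd)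
  qed
  have heat: "heat_at (\<lambda>x t. u b (x, t)) x t (al b x * F b (u (\<not> b) (x, t)) - n * pn x * u b (x, t))"
    if t: "0 < t" "t < 1" for b x t
  proof -
    have p: "(x, t) \<in> ?G" using t by simp
    obtain U D1 D2 Dt where U: "open U" "(x, t) \<in> U" "par_C2 U (u b) D1 D2" "time_C1 U (u b) Dt"
      "\<forall>p\<in>U. Dt p - (\<Sum>i\<in>Basis. D2 i i p) = src n u b p"
      using local_sol_C2_at[OF G LS[of b] um sm bd th sc sh p] by (elim exE conjE)
    have "((\<lambda>s. u b (x, s)) has_real_derivative Dt (x, t)) (at t)" using U(2,4) unfolding time_C1_def by blast
    from par_C2_heat_at[OF U(3) this U(1,2)] U(2,5) have "heat_at (\<lambda>x t. u b (x, t)) x t (src n u b (x, t))" by simp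
    then show ?thesis using seq[OF p, of b] by simp
  qed
  have init: "u b (x, 0) = U0 b x" for b x
    using mild[of 0 b x] heat_flow_initial[OF U0c U0B, of 0 b x] heat_potential_zero[of "src n u b" 0 x] s0 by simp
  show ?thesis unfolding penal_sol_def using um uB uc init heat ident by (intro exI[of _ u]) blast
qed

end

section \<open>The Dirichlet penalty: bounds, monotonicity in the penalty parameter, and the
  limit\<close>

text \<open>How cooperativity enters comparison: if the other component has not grown, monotonicity
  gives a nonpositive increment; if it has, its growth is at most the growth \<open>d\<close> of the
  maximal component, and the Lipschitz bound applies.\<close>

lemma reaction_increment:
  fixes F :: "real \<Rightarrow> real"
  assumes a: "0 \<le> a" "a \<le> M" and L: "0 \<le> L" and d: "0 < d" "s - s' \<le> d"
    and mono: "s \<le> s' \<Longrightarrow> F s \<le> F s'" and lip: "\<bar>F s - F s'\<bar> \<le> L * \<bar>s - s'\<bar>"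
  shows "a * F s - a * F s' \<le> M * L * d"
proof -
  have "F s - F s' \<le> L * d"
  proof (cases "s \<le> s'")
    case True
    with mono mult_nonneg_nonneg[OF L less_imp_le[OF d(1)]] show ?thesis by linarith
  next
    case False
    then have "L * \<bar>s - s'\<bar> \<le> L * d" using d L by (intro mult_left_mono) auto
    then show ?thesis using lip by linarith
  qed
  then have "a * (F s - F s') \<le> a * (L * d)" using a(1) by (rule mult_left_mono)
  also have "\<dots> \<le> M * (L * d)" using a L d by (intro mult_right_mono) auto
  finally show ?thesis by (simp add: algebra_simps)
qed

text \<open>The penalty weight vanishes exactly on the closure of \<Omega>. \<open>mm\<close> bounds
  the initial data, and \<open>ext\<close> provides an exterior paraboloid at each boundary
  point.\<close>

locale dirichlet = penal al U0 F "\<lambda>x. min 1 (infdist x (closure \<Omega>))" M A L \<theta>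
  for al U0 :: "bool \<Rightarrow> 'a::euclidean_space \<Rightarrow> real" and F M A L \<theta> and \<Omega> :: "'a set" +
  fixes mm :: real
  assumes open\<Omega>: "open \<Omega>" and ne: "\<Omega> \<noteq> {}"
    and U0out: "\<And>b x. x \<notin> \<Omega> \<Longrightarrow> U0 b x = 0" and U0m: "\<And>b x. U0 b x \<le> mm"
    and ext: "\<And>p. p \<in> frontier \<Omega> \<Longrightarrow> \<exists>r>0. \<exists>C>0. \<exists>\<nu>. 1 \<le> norm \<nu> \<and>
       (\<forall>x\<in>closure \<Omega> \<inter> ball p r. - C * (norm (x - p))\<^sup>2 \<le> (x - p) \<bullet> \<nu>)"
begin

abbreviation (input) pn where "pn \<equiv> \<lambda>x. min 1 (infdist x (closure \<Omega>))"

definition un :: "nat \<Rightarrow> bool \<Rightarrow> 'a \<times> real \<Rightarrow> real" where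
  "un n = (SOME u. penal_sol (real n) u)"

lemma un_props:
  shows un_measurable [measurable]: "un n b \<in> borel_measurable borel"
    and un_bounded: "\<exists>B. \<forall>b p. \<bar>un n b p\<bar> \<le> B"
    and un_cont: "continuous_on (UNIV \<times> {0..<1}) (un n b)"
    and un_init: "un n b (x, 0) = U0 b x"
    and un_heat: "0 < t \<Longrightarrow> t < 1 \<Longrightarrow> heat_at (\<lambda>x t. un n b (x, t)) x t (al b x * F b (un n (\<not> b) (x, t)) - real n * pn x * un n b (x, t))"
    and un_ident: "0 < r \<Longrightarrow> 2 * r \<le> 1 \<Longrightarrow> 2 * r < t \<Longrightarrow> t < 1 \<Longrightarrow> kernel_id r (un n b) (src (real n) (un n) b) (x, t)"
proof -
  have "penal_sol (real n) (un n)" unfolding un_def by (rule someI_ex[OF penal_solution]) simp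
  then show "un n b \<in> borel_measurable borel" "\<exists>B. \<forall>b p. \<bar>un n b p\<bar> \<le> B" "continuous_on (UNIV \<times> {0..<1}) (un n b)"
    "un n b (x, 0) = U0 b x" "0 < t \<Longrightarrow> t < 1 \<Longrightarrow> heat_at (\<lambda>x t. un n b (x, t)) x t (al b x * F b (un n (\<not> b) (x, t)) - real n * pn x * un n b (x, t))"
    "0 < r \<Longrightarrow> 2 * r \<le> 1 \<Longrightarrow> 2 * r < t \<Longrightarrow> t < 1 \<Longrightarrow> kernel_id r (un n b) (src (real n) (un n) b) (x, t)"
    unfolding penal_sol_def by blast+
qed

lemma un_cont': "continuous_on (S \<times> {0..<1}) (\<lambda>(x, t). un n b (x, t))"
  using continuous_on_subset[OF un_cont[of n b], of "S \<times> {0..<1}"] by (auto simp: case_prod_unfold)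

lemma alF: "0 \<le> al b x * F b s" "al b x * F b s \<le> M * M"
  by (auto intro!: mult_nonneg_nonneg al0 F0 mult_mono alM FM M0)

text \<open>Where a component is negative the penalty pushes it up, and the reaction is nonnegative
  whatever the other component does.\<close>

lemma un_nonneg:
  assumes "0 \<le> t" "t < 1"
  shows "0 \<le> un n b (x, t)"
proof -
  obtain B where B: "\<And>b p. \<bar>un n b p\<bar> \<le> B" using un_bounded by blast
  have "- un n b (x, t) \<le> 0"
  proof (rule parabolic_maximum_principle[where w = "\<lambda>b x t. - un n b (x, t)" and D=UNIV and T=1 and B=B and L=0])
    show "continuous_on (closure UNIV \<times> {0..<1}) (\<lambda>(x, t). - un n b (x, t))" for b
      using un_cont'[of UNIV n b] by (auto intro!: continuous_intros simp: case_prod_unfold)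
    show "- un n b (x, t) \<le> B" for b x t using B[of b "(x, t)"] by linarith
    show "- un n b (x, 0) \<le> 0" for b x by (simp add: un_init U00)
    show "\<exists>c. heat_at (\<lambda>x t. - un n b (x, t)) x t c \<and> c \<le> 0 * - un n b (x, t)"
      if "t \<in> {0<..<1}" "- un n b (x, t) > 0" for b x t
    proof (intro exI conjI)
      show "heat_at (\<lambda>x t. - un n b (x, t)) x t (-1 * (al b x * F b (un n (\<not> b) (x, t)) - real n * pn x * un n b (x, t)))"
        using heat_at_cmult[OF un_heat[of t n b x], of "-1"] that(1) by simp
      have "real n * pn x * un n b (x, t) \<le> 0"
        using that(2) infdist_nonneg[of x "closure \<Omega>"] by (intro mult_nonneg_nonpos) auto
      then show "-1 * (al b x * F b (un n (\<not> b) (x, t)) - real n * pn x * un n b (x, t)) \<le> 0 * - un n b (x, t)"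
        using alF(1)[of b x "un n (\<not> b) (x, t)"] by simp
    qed
  qed (use assms in auto)
  then show ?thesis by simp
qed

lemma pen_nonneg: "0 \<le> t \<Longrightarrow> t < 1 \<Longrightarrow> 0 \<le> real n * pn x * un n b (x, t)"
  using infdist_nonneg[of x "closure \<Omega>"] by (intro mult_nonneg_nonneg un_nonneg) auto

text \<open>Raising \<open>n\<close> by one subtracts a further \<open>pn x\<close> times a
  nonnegative solution; the coupling is absorbed by \<open>reaction_increment\<close>.\<close>

lemma un_mono:
  assumes "0 \<le> t" "t < 1"
  shows "un (Suc n) b (x, t) \<le> un n b (x, t)"
proof -
  obtain B where B: "\<And>b p. \<bar>un n b p\<bar> \<le> B" using un_bounded by blast
  obtain B' where B': "\<And>b p. \<bar>un (Suc n) b p\<bar> \<le> B'" using un_bounded by blast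
  let ?w = "\<lambda>b x t. un (Suc n) b (x, t) - un n b (x, t)"
  have "?w b x t \<le> 0"
  proof (rule parabolic_maximum_principle[where w = ?w and D=UNIV and T=1 and B="B + B'" and L="M * L"])
    show "continuous_on (closure UNIV \<times> {0..<1}) (\<lambda>(x, t). ?w b x t)" for b
      using un_cont'[of UNIV n b] un_cont'[of UNIV "Suc n" b] by (auto intro!: continuous_intros simp: case_prod_unfold)
    show "?w b x t \<le> B + B'" for b x t using B[of b "(x, t)"] B'[of b "(x, t)"] by linarith
    show "?w b x 0 \<le> 0" for b x by (simp add: un_init)
    show "\<exists>c. heat_at (?w b) x t c \<and> c \<le> M * L * ?w b x t"
      if t: "t \<in> {0<..<1}" and w: "?w b x t > 0" "?w (\<not> b) x t \<le> ?w b x t" for b x t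
    proof (intro exI conjI)
      let ?c1 = "al b x * F b (un (Suc n) (\<not> b) (x, t)) - real (Suc n) * pn x * un (Suc n) b (x, t)"
      let ?c0 = "al b x * F b (un n (\<not> b) (x, t)) - real n * pn x * un n b (x, t)"
      show "heat_at (?w b) x t (?c1 - ?c0)" using t by (intro heat_at_diff un_heat) auto
      have 1: "al b x * F b (un (Suc n) (\<not> b) (x, t)) - al b x * F b (un n (\<not> b) (x, t)) \<le> M * L * ?w b x t"
        by (rule reaction_increment[OF al0 alM L0 w Fmono FL])
      have "real n * pn x * un n b (x, t) \<le> real n * pn x * un (Suc n) b (x, t)"
        using w(1) infdist_nonneg[of x "closure \<Omega>"] by (intro mult_left_mono) auto
      moreover have "0 \<le> pn x * un (Suc n) b (x, t)"
        using un_nonneg[of t "Suc n" b x] t infdist_nonneg[of x "closure \<Omega>"] by (intro mult_nonneg_nonneg) auto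
      moreover have "real (Suc n) * pn x * un (Suc n) b (x, t) = real n * pn x * un (Suc n) b (x, t) + pn x * un (Suc n) b (x, t)"
        by (simp add: algebra_simps)
      ultimately show "?c1 - ?c0 \<le> M * L * ?w b x t" using 1 by linarith
    qed
  qed (use assms in auto)
  then show ?thesis by simp
qed

text \<open>Comparison of a single component with a barrier: the reaction term is at most \<open>M\<^sup>2\<close> and the
  penalty has a sign.\<close>

lemma un_le_barrier:
  assumes D: "open D" and c: "continuous_on (closure D \<times> {0..<1}) (\<lambda>(x, t). E x t)"
    and lo: "\<And>x t. x \<in> closure D \<Longrightarrow> t \<in> {0..<1} \<Longrightarrow> 0 \<le> E x t"
    and init: "\<And>x. x \<in> closure D \<Longrightarrow> U0 b x \<le> E x 0"
    and lat: "\<And>x t. x \<in> frontier D \<Longrightarrow> t \<in> {0..<1} \<Longrightarrow> un n b (x, t) \<le> E x t"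
    and heat: "\<And>x t. x \<in> D \<Longrightarrow> t \<in> {0<..<1} \<Longrightarrow> E x t < un n b (x, t) \<Longrightarrow> \<exists>e. heat_at E x t e \<and> M * M - real n * pn x * un n b (x, t) \<le> e"
    and x: "x \<in> closure D" "0 \<le> t" "t < 1"
  shows "un n b (x, t) \<le> E x t"
proof -
  obtain B where B: "\<And>b p. \<bar>un n b p\<bar> \<le> B" using un_bounded by blast
  let ?w = "\<lambda>(b'::bool) x t. un n b (x, t) - E x t"
  have "?w True x t \<le> 0"
  proof (rule parabolic_maximum_principle[where w = ?w and D=D and T=1 and B="B" and L=0])
    show "continuous_on (closure D \<times> {0..<1}) (\<lambda>(x, t). ?w b' x t)" for b' :: bool
      using un_cont'[of "closure D" n b] c by (auto intro!: continuous_intros simp: case_prod_unfold)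
    show "?w b' x t \<le> B" if "x \<in> closure D" "t \<in> {0..<1}" for b' :: bool and x t using B[of b "(x, t)"] lo[OF that] by linarith
    show "?w b' x 0 \<le> 0" if "x \<in> closure D" for b' :: bool and x using init[OF that] by (simp add: un_init)
    show "?w b' x t \<le> 0" if "x \<in> frontier D" "t \<in> {0..<1}" for b' :: bool and x t using lat[OF that] by simp
    show "\<exists>c. heat_at (?w b') x t c \<and> c \<le> 0 * ?w b' x t" if t: "x \<in> D" "t \<in> {0<..<1}" and w: "?w b' x t > 0" for b' :: bool and x t
    proof -
      obtain e where e: "heat_at E x t e" "M * M - real n * pn x * un n b (x, t) \<le> e" using heat[OF t] w by auto
      show ?thesis
      proof (intro exI conjI)
        show "heat_at (?w b') x t ((al b x * F b (un n (\<not> b) (x, t)) - real n * pn x * un n b (x, t)) - e)"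
          using t by (intro heat_at_diff un_heat e) auto
        show "(al b x * F b (un n (\<not> b) (x, t)) - real n * pn x * un n b (x, t)) - e \<le> 0 * ?w b' x t"
          using alF(2)[of b x "un n (\<not> b) (x, t)"] e(2) by simp
      qed
    qed
  qed (use assms in auto)
  then show ?thesis by simp
qed

lemma mm0: "0 \<le> mm" using U00 U0m order_trans by blast

lemma un_upper:
  assumes "0 \<le> t" "t < 1"
  shows "un n b (x, t) \<le> mm + M * M * t"
proof (rule un_le_barrier[where D=UNIV])
  show "continuous_on (closure UNIV \<times> {0..<1}) (\<lambda>(x, t). mm + M * M * t)"
    by (auto intro!: continuous_intros simp: case_prod_unfold)
  show "\<exists>e. heat_at (\<lambda>x t. mm + M * M * t) x t e \<and> M * M - real n * pn x * un n b (x, t) \<le> e" if "t \<in> {0<..<1}" for x t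
    using heat_at_affine[of mm "M * M" x t] pen_nonneg[of t n x b] that by (intro exI[of _ "M * M"]) auto
qed (use assms mm0 M0 U0m in auto)

definition Bd :: real where "Bd = mm + M * M"

lemma Bd0: "0 \<le> Bd" using mm0 M0 by (simp add: Bd_def)

lemma un_Bd:
  assumes "0 \<le> t" "t < 1"
  shows "un n b (x, t) \<le> Bd"
proof -
  have "M * M * t \<le> M * M * 1" using assms M0 by (intro mult_left_mono) auto
  then show ?thesis using un_upper[OF assms, of n b x] by (simp add: Bd_def)
qed

text \<open>At a fixed distance from \<Omega> the solution decays like \<open>1 / n\<close>. Around
  the given point the barrier is a paraboloid, steep enough to reach \<open>Bd\<close> on a small
  sphere, raised by \<open>C / n\<close>; above this height the penalty outweighs the reaction and
  the Laplacian of the paraboloid.\<close>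

lemma un_exterior:
  assumes \<delta>: "0 < \<delta>"
  obtains C where "C \<ge> 0" "\<And>x t n b. \<delta> \<le> infdist x (closure \<Omega>) \<Longrightarrow> 0 \<le> t \<Longrightarrow> t < 1 \<Longrightarrow> 0 < n \<Longrightarrow> un n b (x, t) \<le> C / real n"
proof -
  define \<rho> where "\<rho> = \<delta> / 2"
  have \<rho>: "0 < \<rho>" using \<delta> by (simp add: \<rho>_def)
  define c0 where "c0 = min 1 \<rho>"
  have c0: "0 < c0" using \<rho> by (simp add: c0_def)
  define K where "K = Bd / \<rho>\<^sup>2"
  have K: "0 \<le> K" using Bd0 by (simp add: K_def)
  \<comment> \<open>\<open>c0\<close> bounds the penalty weight from below on the ball, so at height
    \<open>C / n\<close> the penalty is at least \<open>M * M + 2 * DIM('a) * K\<close>.\<close>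
  define C where "C = (M * M + 2 * DIM('a) * K) / c0"
  have C: "0 \<le> C" using M0 K c0 by (simp add: C_def)
  show ?thesis
  proof (rule that[OF C])
    fix x1 :: 'a and t :: real and n :: nat and b
    assume x1: "\<delta> \<le> infdist x1 (closure \<Omega>)" and t: "0 \<le> t" "t < 1" and n: "0 < n"
    have far: "\<rho> \<le> infdist x (closure \<Omega>)" if "x \<in> cball x1 \<rho>" for x
    proof -
      have "infdist x1 (closure \<Omega>) \<le> infdist x (closure \<Omega>) + dist x1 x" by (rule infdist_triangle)
      then show ?thesis using that x1 by (simp add: \<rho>_def)
    qed
    have U: "U0 b x = 0" if "x \<in> cball x1 \<rho>" for x
    proof (rule U0out)
      show "x \<notin> \<Omega>"
      proof
        assume "x \<in> \<Omega>"
        then have "infdist x (closure \<Omega>) = 0" using closure_subset[of \<Omega>] by auto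
        then show False using far[OF that] \<rho> by simp
      qed
    qed
    have n0: "0 \<le> C / real n" using C by simp
    let ?E = "\<lambda>x. K * (norm (x - x1))\<^sup>2 + C / real n"
    have "un n b (x1, t) \<le> ?E x1"
    proof (rule un_le_barrier[where D="ball x1 \<rho>" and E="\<lambda>x t. ?E x"])
      show "continuous_on (closure (ball x1 \<rho>) \<times> {0..<1}) (\<lambda>(x, t). ?E x)"
        by (auto intro!: continuous_intros simp: case_prod_unfold)
      show "0 \<le> ?E x" for x using K n0 by simp
      show "U0 b x \<le> ?E x" if "x \<in> closure (ball x1 \<rho>)" for x
        using U[of x] that \<rho> K n0 by simp
      show "un n b (x, t) \<le> ?E x" if "x \<in> frontier (ball x1 \<rho>)" "t \<in> {0..<1}" for x t
      proof -
        have "norm (x - x1) = \<rho>" using that(1) \<rho> by (simp add: frontier_ball dist_norm norm_minus_commute)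
        then have "K * (norm (x - x1))\<^sup>2 = Bd" using \<rho> by (simp add: K_def)
        then show ?thesis using un_Bd[of t n b x] that(2) n0 by simp
      qed
      show "\<exists>e. heat_at (\<lambda>x t. ?E x) x t e \<and> M * M - real n * pn x * un n b (x, t) \<le> e"
        if x: "x \<in> ball x1 \<rho>" and w: "?E x < un n b (x, t)" for x t
      proof (intro exI conjI)
        show "heat_at (\<lambda>x t. ?E x) x t (K * (- 2 * real DIM('a)) + 0)"
          using heat_at_add[OF heat_at_cmult[OF heat_at_norm_sq] heat_at_affine[of "C / real n" 0]] by simp
        have "C / real n \<le> un n b (x, t)" using w K by (smt (verit) mult_nonneg_nonneg zero_le_power2)
        moreover have "c0 \<le> pn x" using far[of x] x by (auto simp: c0_def)
        ultimately have "c0 * (C / real n) \<le> pn x * un n b (x, t)" using c0 n0 by (intro mult_mono) auto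
        then have "real n * (c0 * (C / real n)) \<le> real n * (pn x * un n b (x, t))" by (intro mult_left_mono) auto
        moreover have "real n * (c0 * (C / real n)) = M * M + 2 * DIM('a) * K" using n c0 by (simp add: C_def)
        ultimately show "M * M - real n * pn x * un n b (x, t) \<le> K * (- 2 * real DIM('a)) + 0"
          by (simp only: mult.assoc of_nat_mult of_nat_numeral) (linarith | simp add: algebra_simps)
      qed
    qed (use \<rho> t in auto)
    then show "un n b (x1, t) \<le> C / real n" by simp
  qed
qed

definition ul :: "bool \<Rightarrow> 'a \<times> real \<Rightarrow> real" where
  "ul b p = (if snd p \<in> {0..<1} then lim (\<lambda>n. un n b p) else 0)"

lemma un_lim:
  assumes "0 \<le> t" "t < 1"
  shows "(\<lambda>n. un n b (x, t)) \<longlonglongrightarrow> ul b (x, t)"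
proof -
  have "decseq (\<lambda>n. un n b (x, t))" by (rule decseq_SucI) (rule un_mono[OF assms])
  then have "convergent (\<lambda>n. un n b (x, t))"
    using decseq_convergent[of "\<lambda>n. un n b (x, t)" 0] un_nonneg[OF assms] unfolding convergent_def by metis
  then show ?thesis using assms by (simp add: ul_def convergent_LIMSEQ_iff)
qed

lemma ul_nonneg: "0 \<le> t \<Longrightarrow> t < 1 \<Longrightarrow> 0 \<le> ul b (x, t)"
  using LIMSEQ_le_const[OF un_lim[of t b x], of 0] un_nonneg by blast

lemma ul_upper: "0 \<le> t \<Longrightarrow> t < 1 \<Longrightarrow> ul b (x, t) \<le> mm + M * M * t"
  using LIMSEQ_le_const2[OF un_lim[of t b x]] un_upper by blast

lemma ul_init: "ul b (x, 0) = U0 b x"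
  using LIMSEQ_unique[OF un_lim[of 0 b x]] by (simp add: un_init)

text \<open>Restricted to the time window, where the bound \<open>Bd\<close> does not depend on
  \<open>n\<close>, so that dominated convergence applies on all of space-time.\<close>

definition vn :: "nat \<Rightarrow> bool \<Rightarrow> 'a \<times> real \<Rightarrow> real" where
  "vn n b p = indicator {0..<1} (snd p) * un n b p"

lemma vn_props: "vn n b \<in> borel_measurable borel" "\<bar>vn n b p\<bar> \<le> Bd" "(\<lambda>n. vn n b p) \<longlonglongrightarrow> ul b p"
proof -
  show "vn n b \<in> borel_measurable borel" unfolding vn_def[abs_def] by measurable
  obtain x t where p: "p = (x, t)" by (cases p)
  show "\<bar>vn n b p\<bar> \<le> Bd" using un_nonneg[of t n b x] un_Bd[of t n b x] Bd0 by (auto simp: vn_def p split: split_indicator)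
  show "(\<lambda>n. vn n b p) \<longlonglongrightarrow> ul b p" using un_lim[of t b x] by (auto simp: vn_def p ul_def split: split_indicator)
qed

lemma ul_measurable [measurable]: "ul b \<in> borel_measurable borel"
  by (rule borel_measurable_LIMSEQ_real[OF vn_props(3) vn_props(1)])

lemma ul_bound: "\<bar>ul b p\<bar> \<le> Bd"
  by (rule LIMSEQ_le_const2[OF tendsto_rabs[OF vn_props(3)]]) (use vn_props(2) in blast)

definition react :: "bool \<Rightarrow> 'a \<times> real \<Rightarrow> real" where
  "react b p = al b (fst p) * F b (ul (\<not> b) p)"

lemma react_measurable [measurable]: "react b \<in> borel_measurable borel"
  unfolding react_def by measurable

lemma react_bound: "\<bar>react b p\<bar> \<le> M * M"
  using alF[of b "fst p" "ul (\<not> b) p"] by (simp add: react_def)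

lemma convol_tendsto:
  assumes k: "integrable lborel k" and m: "\<And>n. f n \<in> borel_measurable borel" "g \<in> borel_measurable borel"
    and B: "\<And>n p. \<bar>f n p\<bar> \<le> B" and l: "\<And>p. (\<lambda>n. f n p) \<longlonglongrightarrow> g p"
  shows "(\<lambda>n. convol k (f n) p) \<longlonglongrightarrow> convol k g p"
  unfolding convol_def
proof (rule integral_dominated_convergence[where w = "\<lambda>q. B * \<bar>k q\<bar>"])
  show "AE q in lborel. (\<lambda>n. k q * f n (p - q)) \<longlonglongrightarrow> k q * g (p - q)" by (intro AE_I2 tendsto_intros l)
  show "AE q in lborel. norm (k q * f n (p - q)) \<le> B * \<bar>k q\<bar>" for n
    by (intro AE_I2) (simp only: real_norm_def, rule abs_mult_le_bound[OF B])
qed (use k m in \<open>auto intro!: borel_measurable_times measurable_compose[OF _ m(1)] measurable_compose[OF _ m(2)]\<close>)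

text \<open>For small \<open>r\<close> the kernels evaluated near a point of
  \<open>\<Omega> \<times> {0<..<1}\<close> only see points of this set, where the penalty vanishes.
  So \<open>n\<close> no longer appears explicitly in the identities, and dominated convergence
  yields those of the limit.\<close>

lemma ul_local_sol: "local_sol (\<Omega> \<times> {0<..<1}) (ul b) (react b)"
  unfolding local_sol_def
proof
  fix p0 assume p0: "p0 \<in> \<Omega> \<times> {0<..<1::real}"
  have "open (\<Omega> \<times> {0<..<1::real})" by (intro open_Times open\<Omega>) auto
  then obtain \<epsilon> where \<epsilon>: "\<epsilon> > 0" "ball p0 \<epsilon> \<subseteq> \<Omega> \<times> {0<..<1}" using p0 open_contains_ball by blast
  obtain r0 where r0: "0 < r0" "\<And>r. 0 < r \<Longrightarrow> r < r0 \<Longrightarrow> 2 * r \<le> 1"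
    "\<And>r q. 0 < r \<Longrightarrow> r < r0 \<Longrightarrow> (q::'a \<times> real) \<in> cap r \<Longrightarrow> norm q < \<epsilon> / 2"
    using cap_small[of "\<epsilon> / 2", where 'a='a] \<epsilon>(1) by (metis half_gt_zero)
  define \<rho> where "\<rho> = min r0 (\<epsilon> / 2)"
  show "\<exists>\<rho>>0. \<forall>r p'. 0 < r \<longrightarrow> r < \<rho> \<longrightarrow> p' \<in> ball p0 \<rho> \<longrightarrow> kernel_id r (ul b) (react b) p'"
  proof (rule exI[of _ \<rho>], intro conjI allI impI)
    show "0 < \<rho>" using r0(1) \<epsilon>(1) by (simp add: \<rho>_def)
    fix r p' assume r: "0 < r" "r < \<rho>" and p': "p' \<in> ball p0 \<rho>"
    obtain x t where xt: "p' = (x, t)" by (cases p')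
    have rr: "2 * r \<le> 1" using r0(2)[of r] r by (simp add: \<rho>_def)
    have near: "p' - q \<in> \<Omega> \<times> {0<..<1}" if "q \<in> cap r" for q
    proof -
      have "dist p0 (p' - q) \<le> dist p0 p' + dist p' (p' - q)" by (rule dist_triangle)
      also have "dist p' (p' - q) = norm q" by (simp add: dist_norm)
      finally have "dist p0 (p' - q) < \<epsilon>" using p' r0(3)[OF r(1) _ that] r by (simp add: \<rho>_def)
      then show ?thesis using \<epsilon>(2) by auto
    qed
    \<comment> \<open>The two extreme times of \<open>cap r\<close>: the lag \<open>2 * r\<close>
      must still land after time 0, the lag 0 before time 1.\<close>
    have "(0, 2 * r) \<in> (cap r :: ('a \<times> real) set)" "(0, 0) \<in> (cap r :: ('a \<times> real) set)" using r by (auto simp: cap_def)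
    from near[OF this(1)] near[OF this(2)] have t: "2 * r < t" "t < 1" by (auto simp: xt)
    define gn where "gn n q = al b (fst q) * F b (vn n (\<not> b) q)" for n q
    have gm: "gn n \<in> borel_measurable borel" for n
    proof -
      note [measurable] = vn_props(1)
      show ?thesis unfolding gn_def[abs_def] by measurable
    qed
    have gB: "\<bar>gn n q\<bar> \<le> M * M" for n q using alF[of b "fst q" "vn n (\<not> b) q"] by (simp add: gn_def)
    have gl: "(\<lambda>n. gn n q) \<longlonglongrightarrow> react b q" for q
    proof -
      have "isCont (F b) (ul (\<not> b) q)" using continuous_F[of UNIV b] by (simp add: continuous_on_eq_continuous_at)
      from isCont_tendsto_compose[OF this vn_props(3)] show ?thesis unfolding gn_def react_def by (intro tendsto_intros)
    qed
    have c1: "convol k (un n b) p' = convol k (vn n b) p'" and c2: "convol k (src (real n) (un n) b) p' = convol k (gn n) p'"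
      if k: "\<And>q. q \<notin> cap r \<Longrightarrow> k q = 0" for k n
    proof -
      have *: "un n b (p' - q) = vn n b (p' - q)" "src (real n) (un n) b (p' - q) = gn n (p' - q)" if "q \<in> cap r" for q
      proof -
        from near[OF that] have q: "fst (p' - q) \<in> \<Omega>" "0 < snd (p' - q)" "snd (p' - q) < 1"
          unfolding mem_Times_iff greaterThanLessThan_iff by blast+
        then have "infdist (fst (p' - q)) (closure \<Omega>) = 0" using closure_subset[of \<Omega>] by auto
        then show "un n b (p' - q) = vn n b (p' - q)" "src (real n) (un n) b (p' - q) = gn n (p' - q)"
          using q by (simp_all add: vn_def src_def gn_def)
      qed
      show "convol k (un n b) p' = convol k (vn n b) p'" "convol k (src (real n) (un n) b) p' = convol k (gn n) p'"
        using * by (auto intro!: convol_cong[OF k])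
    qed
    have id: "kernel_id r (vn n b) (gn n) p'" for n
    proof -
      have "vn n b p' = un n b p'" using t r(1) by (simp add: vn_def xt)
      then show ?thesis
        using un_ident[OF r(1) rr t, of n b x, folded xt] c1[of "kap r" n, OF kap_support(1)[OF r(1)]] c1[of "kap' r" n, OF kap_support(2)[OF r(1)]]
          c2[of "kap r" n, OF kap_support(1)[OF r(1)]] c2[of "kerP r" n, OF kerP_support[OF r(1)]] by simp_all
    qed
    note lims = convol_tendsto[OF kerP_integrable[OF r(1) rr] gm react_measurable gB gl, of p']
      convol_tendsto[OF kap_integrable(1)[OF r(1)] vn_props(1) ul_measurable vn_props(2) vn_props(3), of b p']
      convol_tendsto[OF kap_integrable(2)[OF r(1)] vn_props(1) ul_measurable vn_props(2) vn_props(3), of b p']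
      convol_tendsto[OF kap_integrable(1)[OF r(1)] gm react_measurable gB gl, of p']
    show "ul b p' = convol (kerP r) (react b) p' + convol (kap r) (ul b) p'"
      by (rule LIMSEQ_unique[OF vn_props(3)]) (unfold id[THEN conjunct1], intro tendsto_add lims)
    show "convol (kap' r) (ul b) p' = convol (kap r) (react b) p'"
      by (rule LIMSEQ_unique[OF lims(3)]) (unfold id[THEN conjunct2], rule lims(4))
  qed
qed

end

section \<open>Initial values, boundary values and continuity of the limit\<close>

context dirichlet begin

lemma U0_modulus:
  assumes "0 < \<epsilon>"
  obtains \<rho> where "0 < \<rho>" "\<And>x. norm (x - x0) < \<rho> \<Longrightarrow> \<bar>U0 b x - U0 b x0\<bar> < \<epsilon>"
  using U0c[of b, unfolded continuous_on_iff, rule_format, of x0 \<epsilon>] assms by (auto simp: dist_norm)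

text \<open>A barrier from below, uniform in \<open>n\<close>: it lives on a ball inside \<Omega>,
  where the penalty vanishes. It supplies the lower semicontinuity of the limit at time 0.\<close>

lemma un_initial_lower:
  assumes e: "0 < \<epsilon>" and x0: "x0 \<in> \<Omega>"
  obtains K \<rho> where "0 < \<rho>" "0 \<le> K" "\<And>n x t. x \<in> ball x0 \<rho> \<Longrightarrow> 0 \<le> t \<Longrightarrow> t < 1 \<Longrightarrow>
     U0 b x0 - \<epsilon> - K * ((norm (x - x0))\<^sup>2 + t) \<le> un n b (x, t)"
proof -
  obtain \<rho>0 where \<rho>0: "0 < \<rho>0" "\<And>x. norm (x - x0) < \<rho>0 \<Longrightarrow> \<bar>U0 b x - U0 b x0\<bar> < \<epsilon>" using U0_modulus[OF e] by blast
  obtain \<rho>1 where \<rho>1: "0 < \<rho>1" "ball x0 \<rho>1 \<subseteq> \<Omega>" using open\<Omega> x0 open_contains_ball by blast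
  define \<rho> where "\<rho> = min \<rho>0 \<rho>1 / 2"
  have \<rho>: "0 < \<rho>" "\<rho> < \<rho>0" "\<rho> < \<rho>1" using \<rho>0 \<rho>1 by (auto simp: \<rho>_def)
  \<comment> \<open>Steep enough that \<open>k * (norm (x - x0))\<^sup>2 = 1\<close> on the sphere,
    where it exceeds the initial datum.\<close>
  define k where "k = 1 / \<rho>\<^sup>2"
  \<comment> \<open>\<open>2 * DIM('a) * k\<close> offsets the Laplacian of the paraboloid; the
    additional \<open>k\<close> makes \<open>K\<close> also bound the quadratic coefficient.\<close>
  define K where "K = k * (2 * DIM('a)) + k"
  have k: "0 \<le> k" "k \<le> K" "0 \<le> K" by (auto simp: k_def K_def)
  have inside: "x \<in> \<Omega>" if "x \<in> cball x0 \<rho>" for x using that \<rho> \<rho>1(2) by auto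
  show ?thesis
  proof (rule that[OF \<rho>(1) k(3)])
    fix n x and t :: real assume x: "x \<in> ball x0 \<rho>" and t: "0 \<le> t" "t < 1"
    let ?E = "\<lambda>x t. (U0 b x0 - \<epsilon> + - K * t) - k * (norm (x - x0))\<^sup>2 - un n b (x, t)"
    let ?w = "\<lambda>(b'::bool). ?E"
    have Ele: "?E x t \<le> U0 b x0 - \<epsilon> - k * (norm (x - x0))\<^sup>2 - un n b (x, t)" if "t \<in> {0..<1}" for x t
      using that k by simp
    have "?w True x t \<le> 0"
    proof (rule parabolic_maximum_principle[where w = ?w and D="ball x0 \<rho>" and T=1 and B="1" and L=0])
      show "continuous_on (closure (ball x0 \<rho>) \<times> {0..<1}) (\<lambda>(x, t). ?E x t)"
        using un_cont'[of "closure (ball x0 \<rho>)" n b] by (auto intro!: continuous_intros simp: case_prod_unfold)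
      show "?E x t \<le> 1" if "t \<in> {0..<1}" for x t
      proof -
        have "0 \<le> k * (norm (x - x0))\<^sup>2" using k by simp
        then show ?thesis using Ele[OF that, of x] un_nonneg[of t n b x] that e U01[of b x0] unfolding atLeastLessThan_iff by linarith
      qed
      show "?E x 0 \<le> 0" if "x \<in> closure (ball x0 \<rho>)" for x
        using \<rho>0(2)[of x] that \<rho> mult_nonneg_nonneg[OF k(1), of "(norm (x - x0))\<^sup>2"]
        by (auto simp: un_init dist_norm norm_minus_commute)
      show "?E x t \<le> 0" if "x \<in> frontier (ball x0 \<rho>)" "t \<in> {0..<1}" for x t
      proof -
        have "norm (x - x0) = \<rho>" using that(1) \<rho> by (simp add: frontier_ball dist_norm norm_minus_commute)
        then have "k * (norm (x - x0))\<^sup>2 = 1" using \<rho> by (simp add: k_def)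
        then show ?thesis using Ele[OF that(2), of x] un_nonneg[of t n b x] that(2) e U01[of b x0] by auto
      qed
      show "\<exists>c. heat_at ?E x t c \<and> c \<le> 0 * ?E x t" if "x \<in> ball x0 \<rho>" "t \<in> {0<..<1}" for x t
      proof (intro exI conjI)
        show "heat_at ?E x t ((- K - k * (- 2 * real DIM('a))) - (al b x * F b (un n (\<not> b) (x, t)) - real n * pn x * un n b (x, t)))"
          using that(2) by (intro heat_at_diff heat_at_affine heat_at_cmult heat_at_norm_sq un_heat) auto
        have "infdist x (closure \<Omega>) = 0" using inside[of x] that(1) closure_subset[of \<Omega>] by auto
        then show "(- K - k * (- 2 * real DIM('a))) - (al b x * F b (un n (\<not> b) (x, t)) - real n * pn x * un n b (x, t)) \<le> 0 * ?E x t"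
          using alF(1)[of b x "un n (\<not> b) (x, t)"] k by (simp add: K_def)
      qed
    qed (use t x \<rho> in auto)
    moreover have "k * (norm (x - x0))\<^sup>2 \<le> K * (norm (x - x0))\<^sup>2" using k by (intro mult_right_mono) auto
    ultimately show "U0 b x0 - \<epsilon> - K * ((norm (x - x0))\<^sup>2 + t) \<le> un n b (x, t)" by (simp add: distrib_left)
  qed
qed

lemma ul_frontier:
  assumes p: "p \<in> frontier \<Omega>" and t: "0 \<le> t" "t < 1"
  shows "ul b (p, t) = 0"
proof -
  have "ul b (p, t) \<le> 2 * \<epsilon>" if e: "0 < \<epsilon>" for \<epsilon>
  proof -
    obtain r C \<nu> where r: "0 < r" and C: "0 < C" and \<nu>: "1 \<le> norm \<nu>"
      and graph: "\<And>x. x \<in> closure \<Omega> \<Longrightarrow> x \<in> ball p r \<Longrightarrow> - C * (norm (x - p))\<^sup>2 \<le> (x - p) \<bullet> \<nu>" using ext[OF p] by (metis Int_iff)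
    \<comment> \<open>The heat source of \<open>h\<close> is \<open>2 k |\<nu>|^2 - 4 C N\<close>,
      and this \<open>k\<close> makes it at least 1.\<close>
    define k where "k = 2 * C * DIM('a) + 1"
    have k: "1 \<le> k" using C by (simp add: k_def)
    \<comment> \<open>\<open>r / 2\<close> stays where the paraboloid condition holds; the second
      radius gives \<open>k |l| \<le> 1\<close>, so the concave term cannot outweigh a positive
      \<open>l\<close>; the third makes it at most half of \<open>C q\<close> where \<open>l\<close>
      is negative.\<close>
    define \<rho>2 where "\<rho>2 = min (r / 2) (min (1 / (k * norm \<nu>)) (sqrt (1 / (2 * k * C))))"
    have \<rho>2: "0 < \<rho>2" using r k C \<nu> by (auto simp: \<rho>2_def intro!: divide_pos_pos mult_pos_pos)
    have "\<rho>2\<^sup>2 \<le> (sqrt (1 / (2 * k * C)))\<^sup>2" using \<rho>2 by (intro power_mono) (auto simp: \<rho>2_def)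
    then have kC: "k * C * \<rho>2\<^sup>2 \<le> 1 / 2" using k C by (simp add: divide_simps mult_ac)
    have k\<nu>: "k * norm \<nu> * \<rho>2 \<le> 1"
    proof -
      have "\<rho>2 \<le> 1 / (k * norm \<nu>)" by (simp add: \<rho>2_def)
      moreover have "0 < k * norm \<nu>" using k \<nu> by (intro mult_pos_pos) auto
      ultimately show ?thesis by (simp add: pos_le_divide_eq mult.commute)
    qed
    define q where "q x = (norm (x - p))\<^sup>2" for x
    define l where "l x = (x - p) \<bullet> \<nu>" for x
    define h where "h x = l x + 2 * C * q x - k * (l x)\<^sup>2" for x
    have q0: "0 \<le> q x" for x by (simp add: q_def)
    have hc: "continuous_on S h" for S unfolding h_def l_def q_def by (intro continuous_intros)
    have hge: "C / 2 * q x \<le> h x" if x: "x \<in> closure \<Omega>" "x \<in> cball p \<rho>2" for x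
    proof -
      have d: "norm (x - p) \<le> \<rho>2" using x(2) by (simp add: dist_norm norm_minus_commute)
      have g: "- C * q x \<le> l x" using graph[OF x(1)] d \<rho>2 r unfolding q_def l_def by (auto simp: \<rho>2_def dist_norm norm_minus_commute)
      have "\<bar>l x\<bar> \<le> norm (x - p) * norm \<nu>" unfolding l_def by (rule Cauchy_Schwarz_ineq2)
      also have "\<dots> \<le> \<rho>2 * norm \<nu>" using d by (intro mult_right_mono) auto
      finally have "k * \<bar>l x\<bar> \<le> k * (\<rho>2 * norm \<nu>)" using k by (intro mult_left_mono) auto
      then have l1: "k * \<bar>l x\<bar> \<le> 1" using k\<nu> by (simp add: mult_ac)
      have qq: "0 \<le> C * q x" using C q0 by simp
      show ?thesis
      proof (cases "0 \<le> l x")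
        case True
        have "k * (l x)\<^sup>2 \<le> 1 * l x" using l1 True mult_right_mono[of "k * \<bar>l x\<bar>" 1 "l x"] by (simp add: power2_eq_square mult.assoc)
        then show ?thesis unfolding h_def using qq by simp
      next
        case False
        then have "(l x)\<^sup>2 \<le> (C * q x)\<^sup>2" using g by (intro abs_le_square_iff[THEN iffD1]) auto
        also have "\<dots> = C * q x * (C * q x)" by (simp add: power2_eq_square)
        also have "\<dots> \<le> C * \<rho>2\<^sup>2 * (C * q x)"
          using d C qq unfolding q_def by (intro mult_right_mono mult_left_mono power_mono) auto
        finally have "k * (l x)\<^sup>2 \<le> k * (C * \<rho>2\<^sup>2 * (C * q x))" using k by (intro mult_left_mono) auto
        also have "\<dots> = k * C * \<rho>2\<^sup>2 * (C * q x)" by (simp add: mult_ac)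
        also have "\<dots> \<le> 1 / 2 * (C * q x)" using kC qq by (intro mult_right_mono) auto
        finally show ?thesis unfolding h_def using g by simp
      qed
    qed
    define \<rho> where "\<rho> = \<rho>2 / 2"
    have \<rho>: "0 < \<rho>" using \<rho>2 by (simp add: \<rho>_def)
    have pO: "p \<notin> \<Omega>" "p \<in> closure \<Omega>" using p open\<Omega> by (auto simp: frontier_def interior_open)
    obtain \<rho>0 where \<rho>0: "0 < \<rho>0" "\<And>x. norm (x - p) < \<rho>0 \<Longrightarrow> \<bar>U0 b x - U0 b p\<bar> < \<epsilon>" using U0_modulus[OF e] by blast
    \<comment> \<open>Three demands: dominate the reaction, dominate \<open>Bd\<close> on the sphere
      of radius \<rho>, and dominate the initial datum at distance at least \<rho>0 from
      \<open>p\<close>.\<close>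
    define K where "K = M * M + 2 * Bd / (C * \<rho>\<^sup>2) + 2 / (C * \<rho>0\<^sup>2)"
    have "0 \<le> 2 * Bd / (C * \<rho>\<^sup>2)" "0 \<le> 2 / (C * \<rho>0\<^sup>2)" "0 \<le> M * M" using Bd0 C M0 by auto
    then have K: "M * M \<le> K" "2 * Bd / (C * \<rho>\<^sup>2) \<le> K" "2 / (C * \<rho>0\<^sup>2) \<le> K" "0 \<le> K" by (auto simp: K_def)
    have KB: "Bd \<le> K * (C / 2 * \<rho>\<^sup>2)" "1 \<le> K * (C / 2 * \<rho>0\<^sup>2)"
      using K(2,3) C \<rho> \<rho>0(1) by (simp_all add: pos_divide_le_eq mult_ac)
    \<comment> \<open>The tolerated loss in the lower bound for \<open>h\<close> outside \<Omega>,
      small enough to cost at most \<epsilon> after multiplication by \<open>K\<close>.\<close>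
    define \<omega> where "\<omega> = \<epsilon> / (K + 1)"
    have \<omega>: "0 < \<omega>" "K * \<omega> \<le> \<epsilon>" using K(4) e by (auto simp: \<omega>_def field_simps)
    let ?H = "\<lambda>x. h x - C / 2 * q x"
    have "uniformly_continuous_on (cball p \<rho>2) ?H"
      by (rule compact_uniformly_continuous) (auto intro!: continuous_intros hc simp: q_def)
    then obtain \<delta>0 where \<delta>0: "0 < \<delta>0" "\<And>x y. x \<in> cball p \<rho>2 \<Longrightarrow> y \<in> cball p \<rho>2 \<Longrightarrow> dist y x < \<delta>0 \<Longrightarrow> dist (?H y) (?H x) < \<omega>"
      using \<omega>(1) unfolding uniformly_continuous_on_def by metis
    define \<delta> where "\<delta> = min \<delta>0 \<rho> / 2"
    have \<delta>: "0 < \<delta>" "\<delta> < \<delta>0" "\<delta> < \<rho>" using \<delta>0 \<rho> by (auto simp: \<delta>_def)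
    have Hlow: "C / 2 * q x \<le> h x + \<omega>" if x: "x \<in> cball p \<rho>" "infdist x (closure \<Omega>) \<le> \<delta>" for x
    proof -
      have "closure \<Omega> \<noteq> {}" using ne by simp
      then obtain y where y: "y \<in> closure \<Omega>" "infdist x (closure \<Omega>) = dist x y"
        using infdist_attains_inf[OF closed_closure, of \<Omega> x] by metis
      have "dist p y \<le> dist p x + dist x y" by (rule dist_triangle)
      then have yb: "y \<in> cball p \<rho>2" using x y(2) \<delta> by (simp add: \<rho>_def)
      have "dist (?H y) (?H x) < \<omega>" using \<delta>0(2)[of x y] x y(2) \<delta> yb \<rho> by (simp add: \<rho>_def dist_commute)
      then show ?thesis using hge[OF y(1) yb] by (simp add: dist_real_def)
    qed
    obtain C' where C': "0 \<le> C'" "\<And>x t n b. \<delta> \<le> infdist x (closure \<Omega>) \<Longrightarrow> 0 \<le> t \<Longrightarrow> t < 1 \<Longrightarrow> 0 < n \<Longrightarrow> un n b (x, t) \<le> C' / real n"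
      using un_exterior[OF \<delta>(1)] by metis
    \<comment> \<open>The width \<delta> of the exterior strip comes from uniform continuity. Every
      point of the closure of \<open>D\<close> is so close to the closure of \<Omega> that the lower
      bound for \<open>h\<close> there survives up to \<omega>.\<close>
    define D where "D = {x. infdist x (closure \<Omega>) < \<delta>} \<inter> ball p \<rho>"
    have infc: "continuous_on UNIV (\<lambda>x. infdist x (closure \<Omega>))" by (intro continuous_intros)
    have opD: "open D" unfolding D_def by (intro open_Int open_ball open_Collect_less infc continuous_on_const)
    have "D \<subseteq> {x. infdist x (closure \<Omega>) \<le> \<delta>} \<inter> cball p \<rho>" by (auto simp: D_def)
    moreover have "closed ({x. infdist x (closure \<Omega>) \<le> \<delta>} \<inter> cball p \<rho>)"
      by (intro closed_Int closed_cball closed_Collect_le infc continuous_on_const)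
    ultimately have clD: "closure D \<subseteq> {x. infdist x (closure \<Omega>) \<le> \<delta>} \<inter> cball p \<rho>" by (rule closure_minimal)
    have E0: "C / 2 * q y \<le> h y + \<omega>" if "y \<in> closure D" for y using Hlow clD that by blast
    have E1: "K * (C / 2 * q y) \<le> K * (h y + \<omega>)" if "y \<in> closure D" for y using E0[OF that] K(4) by (rule mult_left_mono)
    have E2: "0 \<le> K * (C / 2 * q y)" for y using K(4) C q0 by simp
    let ?R = "(0 + (2 * C) * (- 2 * real DIM('a))) - k * (- 2 * (norm \<nu>)\<^sup>2)"
    let ?E = "\<lambda>n x. (\<epsilon> + K * \<omega> + C' / real n) + K * h x"
    have "un n b (p, t) \<le> ?E n p" if n: "0 < n" for n
    proof (rule un_le_barrier[where D=D and E="\<lambda>x t. ?E n x"])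
      have Cn: "0 \<le> C' / real n" using C' by simp
      show "continuous_on (closure D \<times> {0..<1}) (\<lambda>(x, t). ?E n x)"
        unfolding case_prod_unfold by (intro continuous_intros continuous_on_compose2[OF hc[of UNIV]]) auto
      show "0 \<le> ?E n y" if "y \<in> closure D" for y
        using E1[OF that] E2[of y] e Cn by (simp add: distrib_left)
      show "U0 b y \<le> ?E n y" if "y \<in> closure D" for y
      proof (cases "norm (y - p) < \<rho>0")
        case True
        then show ?thesis using \<rho>0(2)[OF True] E1[OF that] E2[of y] Cn U0out[OF pO(1), of b] by (simp add: distrib_left)
      next
        case False
        then have "K * (C / 2 * \<rho>0\<^sup>2) \<le> K * (C / 2 * q y)"
          unfolding q_def using \<rho>0(1) C K(4) by (intro mult_left_mono power_mono) auto
        then show ?thesis using E1[OF that] Cn U01[of b y] KB(2) e by (simp add: distrib_left)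
      qed
      show "un n b (y, s) \<le> ?E n y" if y: "y \<in> frontier D" and s: "s \<in> {0..<1}" for y s
      proof -
        have ycl: "y \<in> closure D" and "y \<notin> D" using y opD by (auto simp: frontier_def interior_open)
        then consider "\<delta> \<le> infdist y (closure \<Omega>)" | "norm (y - p) \<ge> \<rho>"
          by (auto simp: D_def dist_norm norm_minus_commute not_less)
        then show ?thesis
        proof cases
          case 1
          then show ?thesis using C'(2)[OF 1, of s n b] n s E1[OF ycl] E2[of y] e by (simp add: distrib_left)
        next
          case 2
          then have "K * (C / 2 * \<rho>\<^sup>2) \<le> K * (C / 2 * q y)"
            unfolding q_def using \<rho> C K(4) by (intro mult_left_mono power_mono) auto
          then show ?thesis using E1[OF ycl] Cn un_Bd[of s n b y] s KB(1) e by (simp add: distrib_left)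
        qed
      qed
      show "\<exists>c. heat_at (\<lambda>x t. ?E n x) y s c \<and> M * M - real n * pn y * un n b (y, s) \<le> c"
        if "s \<in> {0<..<1}" for y s
      proof (intro exI conjI)
        have "heat_at (\<lambda>x t. h x) y s ?R"
          unfolding h_def l_def q_def by (intro heat_at_add heat_at_diff heat_at_cmult heat_at_linear heat_at_linear_sq heat_at_norm_sq)
        from heat_at_add[OF heat_at_affine[of "\<epsilon> + K * \<omega> + C' / real n" 0] heat_at_cmult[OF this, of K]]
        show "heat_at (\<lambda>x t. ?E n x) y s (0 + K * ?R)"
          by simp
        have "2 * k * 1 \<le> 2 * k * (norm \<nu>)\<^sup>2" using k \<nu> by (intro mult_left_mono) auto
        then have "1 \<le> ?R" by (simp add: k_def algebra_simps)
        then have "K * 1 \<le> K * ?R" using K(4) by (rule mult_left_mono)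
        then show "M * M - real n * pn y * un n b (y, s) \<le> 0 + K * ?R"
          using K(1) pen_nonneg[of s n y b] that by simp
      qed
      show "p \<in> closure D" using pO(2) \<rho> \<delta> closure_subset[of D] by (auto simp: D_def)
    qed (use opD t in auto)
    then have ev: "\<forall>\<^sub>F n in sequentially. un n b (p, t) \<le> ?E n p"
      by (intro eventually_mono[OF eventually_gt_at_top[of 0]])
    have "(\<lambda>n. ?E n p) \<longlonglongrightarrow> (\<epsilon> + K * \<omega> + 0) + K * h p"
      by (intro tendsto_intros lim_const_over_n)
    from tendsto_le[OF sequentially_bot this un_lim[OF t] ev] \<omega>(2) show ?thesis by (simp add: h_def l_def q_def)
  qed
  from this[of "e / 2" for e] show ?thesis using ul_nonneg[OF t, of b p] field_le_epsilon[of "ul b (p, t)" 0] by force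
qed

lemma ul_open_cont: "continuous_on (\<Omega> \<times> {0<..<1}) (ul b)"
proof (rule local_sol_continuous[of _ "ul b" "react b"])
  show "loc_bdd (\<Omega> \<times> {0<..<1}) (ul b)" "loc_bdd (\<Omega> \<times> {0<..<1}) (react b)"
    unfolding loc_bdd_def using ul_bound react_bound by (meson zero_less_one)+
qed (auto intro!: open_Times open\<Omega> ul_local_sol)

lemma ul_le_un: "0 \<le> t \<Longrightarrow> t < 1 \<Longrightarrow> ul b (x, t) \<le> un n b (x, t)"
  by (rule decseq_ge[OF _ un_lim]) (auto intro: decseq_SucI un_mono)

text \<open>Upper semicontinuity is automatic for a decreasing limit.\<close>

lemma ul_cont: "continuous_on (closure \<Omega> \<times> {0..<1}) (ul b)"
  unfolding continuous_on_def
proof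
  let ?S = "closure \<Omega> \<times> {0..<1::real}"
  fix p0 assume "p0 \<in> ?S"
  then obtain x0 t0 where p0: "p0 = (x0, t0)" "x0 \<in> closure \<Omega>" "0 \<le> t0" "t0 < 1" by auto
  have tp: "((\<lambda>p. fst p) \<longlongrightarrow> x0) (at p0 within ?S)" "((\<lambda>p. snd p) \<longlongrightarrow> t0) (at p0 within ?S)"
    by (auto intro!: tendsto_eq_intros simp: p0)
  have inS: "\<forall>\<^sub>F p in at p0 within ?S. p \<in> ?S" by (auto simp: eventually_at_filter)
  show "(ul b \<longlongrightarrow> ul b p0) (at p0 within ?S)"
  proof (rule order_tendstoI)
    fix a assume "ul b p0 < a"
    then obtain n where n: "un n b p0 < a"
      using eventually_happens'[OF sequentially_bot order_tendstoD(2)[OF un_lim[OF p0(3,4)]]] p0(1) by blast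
    have "(un n b \<longlongrightarrow> un n b p0) (at p0 within ?S)"
      using continuous_on_subset[OF un_cont[of n b], of ?S] \<open>p0 \<in> ?S\<close> unfolding continuous_on_def by auto
    from order_tendstoD(2)[OF this n] inS show "\<forall>\<^sub>F p in at p0 within ?S. ul b p < a"
      by eventually_elim (auto intro: le_less_trans[OF ul_le_un])
  next
    fix a assume a: "a < ul b p0"
    \<comment> \<open>Lower semicontinuity: on the lateral boundary the limit is 0 and values are
      nonnegative, inside it is continuous as a local solution, and at time 0 the barrier from below
      applies.\<close>
    consider "x0 \<notin> \<Omega>" | "x0 \<in> \<Omega>" "0 < t0" | "x0 \<in> \<Omega>" "t0 = 0" using p0 by linarith
    then show "\<forall>\<^sub>F p in at p0 within ?S. a < ul b p"
    proof cases
      case 1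
      then have "x0 \<in> frontier \<Omega>" using p0 open\<Omega> by (simp add: frontier_def interior_open)
      then have "a < 0" using a ul_frontier[of x0 t0 b] p0 by simp
      then show ?thesis by (intro eventually_mono[OF inS]) (auto intro: less_le_trans[OF _ ul_nonneg])
    next
      case 2
      then have "p0 \<in> \<Omega> \<times> {0<..<1}" using p0 by auto
      moreover have "open (\<Omega> \<times> {0<..<1::real})" by (intro open_Times open\<Omega>) auto
      ultimately have "isCont (ul b) p0" using ul_open_cont[of b] continuous_on_eq_continuous_at by blast
      then have "(ul b \<longlongrightarrow> ul b p0) (at p0 within ?S)" unfolding isCont_def by (rule tendsto_within_subset) simp
      then show ?thesis using a by (rule order_tendstoD)
    next
      case 3
      have p0u: "ul b p0 = U0 b x0" using ul_init p0 3 by simp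
      define e where "e = (U0 b x0 - a) / 2"
      have "0 < e" using a p0u by (simp add: e_def)
      from un_initial_lower[OF this 3(1), of b]
      obtain K \<rho> where K: "0 < \<rho>" "\<And>n x t. x \<in> ball x0 \<rho> \<Longrightarrow> 0 \<le> t \<Longrightarrow> t < 1 \<Longrightarrow>
         U0 b x0 - e - K * ((norm (x - x0))\<^sup>2 + t) \<le> un n b (x, t)" by metis
      have lo: "U0 b x0 - e - K * ((norm (x - x0))\<^sup>2 + t) \<le> ul b (x, t)" if "x \<in> ball x0 \<rho>" "0 \<le> t" "t < 1" for x t
        using LIMSEQ_le_const[OF un_lim[OF that(2,3)]] K(2)[OF that] by blast
      have "((\<lambda>p. U0 b x0 - e - K * ((norm (fst p - x0))\<^sup>2 + snd p)) \<longlongrightarrow> U0 b x0 - e) (at p0 within ?S)"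
        by (rule tendsto_eq_intros tp refl | simp add: 3)+
      moreover have "a < U0 b x0 - e" using a p0u by (simp add: e_def field_simps)
      ultimately have "\<forall>\<^sub>F p in at p0 within ?S. a < U0 b x0 - e - K * ((norm (fst p - x0))\<^sup>2 + snd p)"
        by (rule order_tendstoD(1))
      moreover have "\<forall>\<^sub>F p in at p0 within ?S. fst p \<in> ball x0 \<rho>"
        using tendstoD[OF tp(1) K(1)] by (simp add: dist_commute)
      ultimately show ?thesis using inS
        by eventually_elim (auto intro: less_le_trans[OF _ lo])
    qed
  qed
qed

end

section \<open>Canonical derivatives and gluing of local smoothness\<close>

text \<open>Derivatives as total functions of \<open>w\<close>: local statements with their own
  derivative functions agree on them and can be glued.\<close>

definition pdx :: "'a::euclidean_space \<Rightarrow> ('a \<times> real \<Rightarrow> real) \<Rightarrow> 'a \<times> real \<Rightarrow> real" where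
  "pdx i w p = deriv (\<lambda>h. w (fst p + h *\<^sub>R i, snd p)) 0"

definition pdt :: "('a::euclidean_space \<times> real \<Rightarrow> real) \<Rightarrow> 'a \<times> real \<Rightarrow> real" where
  "pdt w p = deriv (\<lambda>s. w (fst p, s)) (snd p)"

lemma pdx_cong:
  assumes "open G" "p \<in> G" "\<And>q. q \<in> G \<Longrightarrow> w q = v q"
  shows "pdx i w p = pdx i v p"
proof -
  obtain x t where p: "p = (x, t)" by (cases p)
  have "\<forall>\<^sub>F h in nhds 0. w (x + h *\<^sub>R i, t) = v (x + h *\<^sub>R i, t)"
    using eventually_line_in_open(1)[of G x t i] assms p by (auto elim: eventually_mono)
  then show ?thesis unfolding pdx_def p by (simp add: deriv_cong_ev)
qed

abbreviation par_smooth :: "('a::euclidean_space \<times> real) set \<Rightarrow> ('a \<times> real \<Rightarrow> real) \<Rightarrow> bool" where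
  "par_smooth G w \<equiv> par_C2 G w (\<lambda>i. pdx i w) (\<lambda>i j. pdx j (pdx i w))"

lemma par_C2_pdx:
  assumes "par_C2 U w D1 D2" "open U" "p \<in> U" "i \<in> Basis" "j \<in> Basis"
  shows "pdx i w p = D1 i p" "pdx j (pdx i w) p = D2 i j p"
proof -
  have 1: "pdx i w p = D1 i p" if "p \<in> U" for p
    using assms(1,4) that unfolding par_C2_def pdx_def by (cases p) (auto intro!: DERIV_imp_deriv)
  then show "pdx i w p = D1 i p" using assms(3) by simp
  have "pdx j (pdx i w) p = pdx j (D1 i) p" by (rule pdx_cong[OF assms(2,3) 1])
  also have "\<dots> = D2 i j p"
    using assms unfolding par_C2_def pdx_def by (cases p) (auto intro!: DERIV_imp_deriv)
  finally show "pdx j (pdx i w) p = D2 i j p" .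
qed

lemma par_C2_smooth:
  assumes "par_C2 U w D1 D2" "open U"
  shows "par_smooth U w"
proof -
  note E = par_C2_pdx[OF assms]
  have "continuous_on U (pdx i w) \<longleftrightarrow> continuous_on U (D1 i)" if "i \<in> Basis" for i
    by (rule continuous_on_cong) (use E(1) that in auto)
  moreover have "continuous_on U (pdx j (pdx i w)) \<longleftrightarrow> continuous_on U (D2 i j)" if "i \<in> Basis" "j \<in> Basis" for i j
    by (rule continuous_on_cong) (use E(2) that in auto)
  moreover have "((\<lambda>h. pdx i w (x + h *\<^sub>R j, t)) has_real_derivative D2 i j (x, t)) (at 0)"
    if "i \<in> Basis" "j \<in> Basis" "(x, t) \<in> U" for i j x t
  proof -
    have ev: "\<forall>\<^sub>F h in nhds 0. D1 i (x + h *\<^sub>R j, t) = pdx i w (x + h *\<^sub>R j, t)"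
      using eventually_line_in_open(1)[OF assms(2) that(3), of j] by eventually_elim (use E(1) that in auto)
    show ?thesis using assms(1) that DERIV_cong_ev[OF refl ev refl, of "D2 i j (x, t)"] unfolding par_C2_def by auto
  qed
  ultimately show ?thesis using assms(1) E unfolding par_C2_def by auto
qed

lemma par_smooth_glue:
  assumes "open G" "\<And>p. p \<in> G \<Longrightarrow> \<exists>U. open U \<and> p \<in> U \<and> par_smooth U w"
  shows "par_smooth G w"
proof -
  have c: "continuous_on G f" if "\<And>U. open U \<Longrightarrow> par_smooth U w \<Longrightarrow> continuous_on U f" for f :: "'a \<times> real \<Rightarrow> real"
    unfolding continuous_on_eq_continuous_at[OF assms(1)]
    using assms(2) that continuous_on_eq_continuous_at by blast
  show ?thesis
    unfolding par_C2_def by (intro conjI ballI allI impI c; use assms(2) in \<open>unfold par_C2_def, blast\<close>)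
qed

lemma time_C1_glue:
  assumes "open G" "\<And>p. p \<in> G \<Longrightarrow> \<exists>U Dt. open U \<and> p \<in> U \<and> time_C1 U w Dt"
  shows "time_C1 G w (pdt w)"
proof -
  have 1: "pdt w p = Dt p" if "time_C1 U w Dt" "p \<in> U" for U Dt p
    using that unfolding time_C1_def pdt_def by (cases p) (auto intro!: DERIV_imp_deriv)
  have "isCont (pdt w) p" if p: "p \<in> G" for p
  proof -
    obtain U Dt where U: "open U" "p \<in> U" "time_C1 U w Dt" using assms(2)[OF p] by blast
    have "continuous_on U (pdt w) \<longleftrightarrow> continuous_on U Dt" by (rule continuous_on_cong) (auto simp: 1[OF U(3)])
    then have "continuous_on U (pdt w)" using U(3) unfolding time_C1_def by blast
    then show ?thesis using U continuous_on_eq_continuous_at by blast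
  qed
  moreover have "((\<lambda>s. w (x, s)) has_real_derivative pdt w (x, t)) (at t)" if p: "(x, t) \<in> G" for x t
  proof -
    obtain U Dt where U: "(x, t) \<in> U" "time_C1 U w Dt" using assms(2)[OF p] by blast
    then show ?thesis using 1[OF U(2,1)] unfolding time_C1_def by simp
  qed
  ultimately show ?thesis unfolding time_C1_def continuous_on_eq_continuous_at[OF assms(1)] by blast
qed

lemma time_C1_pdt: "open G \<Longrightarrow> time_C1 G w D \<Longrightarrow> p \<in> G \<Longrightarrow> pdt w p = D p"
  unfolding time_C1_def pdt_def by (cases p) (auto intro!: DERIV_imp_deriv)

lemma local_sol_smooth:
  fixes G :: "('a::euclidean_space \<times> real) set"
  assumes G: "open G" "G \<subseteq> UNIV \<times> {0<..<1}" and LS: "local_sol G w H"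
    and m: "w \<in> borel_measurable borel" "H \<in> borel_measurable borel"
    and bd: "loc_bdd G w" "loc_bdd G H"
    and th: "0 < \<theta>" "\<theta> \<le> 1" and Hc: "continuous_on G H" and Hh: "loc_holder \<theta> G H"
  shows "par_smooth G w" "time_C1 G w (pdt w)" "\<And>p. p \<in> G \<Longrightarrow> pdt w p - (\<Sum>i\<in>Basis. pdx i (pdx i w) p) = H p"
proof -
  have 1: "\<exists>U Dt. open U \<and> p \<in> U \<and> par_smooth U w \<and> time_C1 U w Dt \<and> pdt w p - (\<Sum>i\<in>Basis. pdx i (pdx i w) p) = H p" if p: "p \<in> G" for p
    using local_sol_C2_at[OF G LS m bd th Hc Hh p]
  proof (elim exE conjE)
    fix U D1 D2 Dt
    assume U: "open U" "p \<in> U" "par_C2 U w D1 D2" "time_C1 U w Dt" "\<forall>p\<in>U. Dt p - (\<Sum>i\<in>Basis. D2 i i p) = H p"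
    have "(\<Sum>i\<in>Basis. pdx i (pdx i w) p) = (\<Sum>i\<in>Basis. D2 i i p)"
      by (intro sum.cong refl par_C2_pdx(2)[OF U(3,1,2)]) auto
    then have "pdt w p - (\<Sum>i\<in>Basis. pdx i (pdx i w) p) = H p" using U(2,5) time_C1_pdt[OF U(1,4,2)] by simp
    then show ?thesis using U(1,2,4) par_C2_smooth[OF U(3,1)] by (intro exI[of _ U] exI[of _ Dt] conjI)
  qed
  show "par_smooth G w" by (rule par_smooth_glue[OF G(1)], drule 1, elim exE conjE, intro exI conjI)
  show "time_C1 G w (pdt w)" by (rule time_C1_glue[OF G(1)], drule 1, elim exE conjE, intro exI conjI)
  show "\<And>p. p \<in> G \<Longrightarrow> pdt w p - (\<Sum>i\<in>Basis. pdx i (pdx i w) p) = H p" by (drule 1, elim exE conjE)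
qed

section \<open>Differentiating local solutions in time and exchanging mixed derivatives\<close>

text \<open>Here the derivative falls on \<open>f\<close>, so the kernel may be singular; this
  covers \<open>kerP\<close>. Smoothness of \<open>f\<close> is used only at points reached from the
  support of the kernel.\<close>

lemma convol_time_derivative:
  fixes k f f' :: "'a::euclidean_space \<times> real \<Rightarrow> real"
  assumes k: "integrable lborel k" "\<And>q. q \<notin> S \<Longrightarrow> k q = 0" and m: "f \<in> borel_measurable borel" and d: "0 < \<delta>"
    and D: "\<And>q s. q \<in> S \<Longrightarrow> \<bar>s - t\<bar> < \<delta> \<Longrightarrow> ((\<lambda>s. f ((x, s) - q)) has_real_derivative f' ((x, s) - q)) (at s)"
    and B: "\<And>q s. q \<in> S \<Longrightarrow> \<bar>s - t\<bar> < \<delta> \<Longrightarrow> \<bar>f ((x, s) - q)\<bar> \<le> B \<and> \<bar>f' ((x, s) - q)\<bar> \<le> B"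
  shows "((\<lambda>s. convol k f (x, s)) has_real_derivative convol k f' (x, t)) (at t)"
proof -
  have "((\<lambda>h. \<integral>q. k q * f ((x, t + h) - q) \<partial>lborel) has_real_derivative (\<integral>q. k q * f' ((x, t + 0) - q) \<partial>lborel)) (at 0)"
  proof (rule DERIV_integral_dominated[OF d, where g = "\<lambda>q. \<bar>B\<bar> * \<bar>k q\<bar>"])
    fix h :: real assume h: "\<bar>h\<bar> < \<delta>"
    have b: "\<bar>k q * f ((x, t + h) - q)\<bar> \<le> \<bar>B\<bar> * \<bar>k q\<bar>" "\<bar>k q * f' ((x, t + h) - q)\<bar> \<le> \<bar>B\<bar> * \<bar>k q\<bar>" for q
    proof -
      have "k q = 0 \<or> \<bar>f ((x, t + h) - q)\<bar> \<le> \<bar>B\<bar> \<and> \<bar>f' ((x, t + h) - q)\<bar> \<le> \<bar>B\<bar>"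
        using B[of q "t + h"] k(2)[of q] h by fastforce
      then show "\<bar>k q * f ((x, t + h) - q)\<bar> \<le> \<bar>B\<bar> * \<bar>k q\<bar>" "\<bar>k q * f' ((x, t + h) - q)\<bar> \<le> \<bar>B\<bar> * \<bar>k q\<bar>"
        by (cases "k q = 0"; simp add: abs_mult mult.commute[of "\<bar>k q\<bar>"] mult_right_mono)+
    qed
    show "\<bar>k q * f' ((x, t + h) - q)\<bar> \<le> \<bar>B\<bar> * \<bar>k q\<bar>" for q by (rule b)
    show "integrable lborel (\<lambda>q. k q * f ((x, t + h) - q))"
    proof (rule Bochner_Integration.integrable_bound)
      show "integrable lborel (\<lambda>q. \<bar>B\<bar> * \<bar>k q\<bar>)" using k(1) by auto
      have "(\<lambda>q. f ((x, t + h) - q)) \<in> borel_measurable lborel" using m by measurable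
      then show "(\<lambda>q. k q * f ((x, t + h) - q)) \<in> borel_measurable lborel" using k(1) by (intro borel_measurable_times) auto
    qed (use b in auto)
    show "((\<lambda>h. k q * f ((x, t + h) - q)) has_real_derivative k q * f' ((x, t + h) - q)) (at h)" for q
    proof (cases "q \<in> S")
      case True
      from DERIV_cmult[OF DERIV_shift[THEN iffD1, OF D[OF True, of "h + t"]], of "k q"] h show ?thesis
        by (simp add: add.commute)
    qed (simp add: k)
  qed (use k(1) in auto)
  then show ?thesis using DERIV_shift[of "\<lambda>s. convol k f (x, s)" "convol k f' (x, t)" 0 t]
    by (simp add: convol_def add.commute)
qed

text \<open>The representation identities of a local solution can be differentiated in time.\<close>

lemma local_sol_pdt:
  fixes G :: "('a::euclidean_space \<times> real) set"
  assumes G: "open G" and LS: "local_sol G w H"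
    and m: "w \<in> borel_measurable borel" "H \<in> borel_measurable borel"
    and bd: "loc_bdd G w" "loc_bdd G H" and tw: "time_C1 G w w'" and tH: "time_C1 G H H'"
  shows "local_sol G (\<lambda>p. if p \<in> G then w' p else 0) (\<lambda>p. if p \<in> G then H' p else 0)"
  unfolding local_sol_def
proof
  fix p0 assume p0: "p0 \<in> G"
  have bd': "loc_bdd G w'" "loc_bdd G H'" using loc_bdd_continuous[OF G] tw tH unfolding time_C1_def by blast+
  have "\<exists>\<epsilon>>0. \<exists>B. ball p0 \<epsilon> \<subseteq> G \<and> (\<forall>q\<in>ball p0 \<epsilon>. \<bar>w q\<bar> \<le> B \<and> \<bar>H q\<bar> \<le> B \<and> \<bar>w' q\<bar> \<le> B \<and> \<bar>H' q\<bar> \<le> B)"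
  proof -
    obtain e0 where 0: "0 < e0" "ball p0 e0 \<subseteq> G" using G p0 open_contains_ball by blast
    obtain e1 B1 where 1: "0 < e1" "\<forall>q\<in>ball p0 e1. \<bar>w q\<bar> \<le> B1" using bd(1) p0 unfolding loc_bdd_def by blast
    obtain e2 B2 where 2: "0 < e2" "\<forall>q\<in>ball p0 e2. \<bar>H q\<bar> \<le> B2" using bd(2) p0 unfolding loc_bdd_def by blast
    obtain e3 B3 where 3: "0 < e3" "\<forall>q\<in>ball p0 e3. \<bar>w' q\<bar> \<le> B3" using bd'(1) p0 unfolding loc_bdd_def by blast
    obtain e4 B4 where 4: "0 < e4" "\<forall>q\<in>ball p0 e4. \<bar>H' q\<bar> \<le> B4" using bd'(2) p0 unfolding loc_bdd_def by blast
    show ?thesis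
      by (rule exI[of _ "min e0 (min (min e1 e2) (min e3 e4))"], intro conjI exI[of _ "max (max B1 B2) (max B3 B4)"])
        (use 0 1 2 3 4 in \<open>auto simp: le_max_iff_disj\<close>)
  qed
  then obtain \<epsilon> B where e: "0 < \<epsilon>" "ball p0 \<epsilon> \<subseteq> G"
    "\<And>q. q \<in> ball p0 \<epsilon> \<Longrightarrow> \<bar>w q\<bar> \<le> B \<and> \<bar>w' q\<bar> \<le> B" "\<And>q. q \<in> ball p0 \<epsilon> \<Longrightarrow> \<bar>H q\<bar> \<le> B \<and> \<bar>H' q\<bar> \<le> B" by metis
  obtain r0 where r0: "0 < r0" "\<And>r. 0 < r \<Longrightarrow> r < r0 \<Longrightarrow> 2 * r \<le> 1"
    "\<And>r q. 0 < r \<Longrightarrow> r < r0 \<Longrightarrow> (q::'a \<times> real) \<in> cap r \<Longrightarrow> norm q < \<epsilon> / 3"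
    using cap_small[of "\<epsilon> / 3", where 'a='a] e(1) by (metis divide_pos_pos zero_less_numeral)
  obtain \<rho>1 where \<rho>1: "\<rho>1 > 0" "\<And>r p'. 0 < r \<Longrightarrow> r < \<rho>1 \<Longrightarrow> p' \<in> ball p0 \<rho>1 \<Longrightarrow> kernel_id r w H p'"
    using LS p0 unfolding local_sol_def by blast
  define \<rho> where "\<rho> = min (min r0 \<rho>1) (\<epsilon> / 3)"
  define wi where "wi = (\<lambda>p. if p \<in> G then w' p else 0)"
  define Hi where "Hi = (\<lambda>p. if p \<in> G then H' p else 0)"
  have wi: "wi q = w' q" "Hi q = H' q" if "q \<in> ball p0 \<epsilon>" for q using that e(2) by (auto simp: wi_def Hi_def)
  have "\<exists>\<rho>>0. \<forall>r p'. 0 < r \<longrightarrow> r < \<rho> \<longrightarrow> p' \<in> ball p0 \<rho> \<longrightarrow> kernel_id r wi Hi p'"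
  proof (rule exI[of _ \<rho>], intro conjI allI impI)
    show "0 < \<rho>" using r0(1) \<rho>1(1) e(1) by (simp add: \<rho>_def)
    fix r p' assume r: "0 < r" "r < \<rho>" and p': "p' \<in> ball p0 \<rho>"
    obtain x t where xt: "p' = (x, t)" by (cases p')
    have rr: "2 * r \<le> 1" "r < r0" "r < \<rho>1" using r0(2)[of r] r by (auto simp: \<rho>_def)
    \<comment> \<open>A third of \<epsilon> each for the distance of the base point, the shift in
      time and the lag of the kernel.\<close>
    define \<delta> where "\<delta> = min (\<epsilon> / 3) (\<rho> - dist p0 p')"
    have \<delta>: "0 < \<delta>" using p' e(1) by (simp add: \<delta>_def)
    have shift: "dist (x, t) (x, s) = \<bar>s - t\<bar>" for s by (simp add: dist_Pair_Pair dist_real_def)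
    have near: "(x, s) - q \<in> ball p0 \<epsilon>" if "q \<in> cap r" "\<bar>s - t\<bar> < \<delta>" for q s
    proof -
      have "dist p0 ((x, s) - q) \<le> dist p0 (x, t) + dist (x, t) (x, s) + dist (x, s) ((x, s) - q)"
        using dist_triangle[of p0 "(x, s) - q" "(x, s)"] dist_triangle[of p0 "(x, s)" "(x, t)"] by linarith
      also have "dist (x, s) ((x, s) - q) = norm q" by (simp only: dist_norm diff_diff_eq2 add_diff_cancel_left')
      finally show ?thesis using that p' r0(3)[OF r(1) rr(2) that(1)] e(1) unfolding shift xt by (simp add: \<rho>_def \<delta>_def)
    qed
    have Dw: "((\<lambda>s. f ((x, s) - q)) has_real_derivative f' ((x, s) - q)) (at s)"
      if "q \<in> cap r" "\<bar>s - t\<bar> < \<delta>" "time_C1 G f f'" for f f' q s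
    proof -
      have "(x - fst q, s - snd q) \<in> G" using near[OF that(1,2)] e(2) by (cases q) auto
      then have "((\<lambda>s. f (x - fst q, s)) has_real_derivative f' (x - fst q, s - snd q)) (at (s - snd q))"
        using that(3) unfolding time_C1_def by blast
      then show ?thesis using DERIV_shift[of "\<lambda>s. f (x - fst q, s)" _ s "- snd q"] by (cases q) simp
    qed
    have cv: "((\<lambda>s. convol k f (x, s)) has_real_derivative convol k f' (x, t)) (at t)"
      if "integrable lborel k" "\<And>q. q \<notin> cap r \<Longrightarrow> k q = 0" "f \<in> borel_measurable borel" "time_C1 G f f'"
        "\<And>q. q \<in> ball p0 \<epsilon> \<Longrightarrow> \<bar>f q\<bar> \<le> B \<and> \<bar>f' q\<bar> \<le> B" for k f f'
      by (rule convol_time_derivative[OF that(1,2,3) \<delta> Dw[OF _ _ that(4)] that(5)[OF near]])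
    note K = kerP_integrable[OF r(1) rr(1)] kap_integrable[OF r(1)]
    note Ks = kerP_support[OF r(1)] kap_support[OF r(1)]
    have evs: "\<forall>\<^sub>F s in nhds t. (x, s) \<in> ball p0 \<rho>"
      using eventually_line_in_open(2)[OF open_ball] p' xt by blast
    have conv_eq: "convol k Hi p' = convol k H' p'" "convol k wi p' = convol k w' p'" if "\<And>q. q \<notin> cap r \<Longrightarrow> k q = 0" for k
      using near[of _ t] \<delta> unfolding xt by (auto intro!: convol_cong[OF that] wi)
    have pG: "p' \<in> ball p0 \<epsilon>" using p' e(1) by (simp add: \<rho>_def)
    have d1: "((\<lambda>s. w (x, s)) has_real_derivative w' (x, t)) (at t)"
      using tw pG e(2) unfolding time_C1_def xt by blast
    have ev1: "\<forall>\<^sub>F s in nhds t. w (x, s) = convol (kerP r) H (x, s) + convol (kap r) w (x, s)"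
      using evs by eventually_elim (use \<rho>1(2)[OF r(1) rr(3)] in \<open>auto simp: \<rho>_def\<close>)
    have d2: "((\<lambda>s. w (x, s)) has_real_derivative convol (kerP r) H' (x, t) + convol (kap r) w' (x, t)) (at t)"
      unfolding DERIV_cong_ev[OF refl ev1 refl]
      by (intro DERIV_add cv[OF K(1) Ks(1) m(2) tH e(4)] cv[OF K(2) Ks(2) m(1) tw e(3)])
    show "wi p' = convol (kerP r) Hi p' + convol (kap r) wi p'"
      using DERIV_unique[OF d1 d2] wi[OF pG] conv_eq[of "kerP r", OF Ks(1)] conv_eq[of "kap r", OF Ks(2)] unfolding xt by simp
    have ev2: "\<forall>\<^sub>F s in nhds t. convol (kap' r) w (x, s) = convol (kap r) H (x, s)"
      using evs by eventually_elim (use \<rho>1(2)[OF r(1) rr(3)] in \<open>auto simp: \<rho>_def\<close>)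
    have d3: "((\<lambda>s. convol (kap' r) w (x, s)) has_real_derivative convol (kap r) H' (x, t)) (at t)"
      unfolding DERIV_cong_ev[OF refl ev2 refl] by (rule cv[OF K(2) Ks(2) m(2) tH e(4)])
    show "convol (kap' r) wi p' = convol (kap r) Hi p'"
      using DERIV_unique[OF cv[OF K(3) Ks(3) m(1) tw e(3)] d3] conv_eq[of "kap r", OF Ks(2)] conv_eq[of "kap' r", OF Ks(3)] unfolding xt by simp
  qed
  then show "\<exists>\<rho>>0. \<forall>r p'. 0 < r \<longrightarrow> r < \<rho> \<longrightarrow> p' \<in> ball p0 \<rho> \<longrightarrow>
      kernel_id r (\<lambda>p. if p \<in> G then w' p else 0) (\<lambda>p. if p \<in> G then H' p else 0) p'"
    unfolding wi_def Hi_def .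
qed

lemma MVT_between:
  fixes f f' :: "real \<Rightarrow> real"
  assumes D: "\<And>\<xi>. \<bar>\<xi> - a\<bar> \<le> \<bar>b - a\<bar> \<Longrightarrow> (f has_real_derivative f' \<xi>) (at \<xi>)"
  obtains \<xi> where "\<bar>\<xi> - a\<bar> \<le> \<bar>b - a\<bar>" "f b - f a = (b - a) * f' \<xi>"
proof (cases rule: linorder_cases[of a b])
  case less
  then obtain z where "a < z" "z < b" "f b - f a = (b - a) * f' z" using MVT2[of a b f f'] D by (auto simp: abs_if)
  then show ?thesis using less that[of z] by auto
next
  case greater
  then obtain z where "b < z" "z < a" "f a - f b = (a - b) * f' z" using MVT2[of b a f f'] D by (auto simp: abs_if)
  then show ?thesis using greater that[of z] by (auto simp: algebra_simps)
qed (use that[of a] in auto)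

text \<open>Symmetry of the mixed derivative, requiring only one of the two to exist beforehand.\<close>

lemma time_C1_pdx:
  assumes G: "open G" and w: "time_C1 G w v"
    and wx: "\<And>x t. (x, t) \<in> G \<Longrightarrow> ((\<lambda>h. w (x + h *\<^sub>R i, t)) has_real_derivative wi (x, t)) (at 0)"
    and vx: "\<And>x t. (x, t) \<in> G \<Longrightarrow> ((\<lambda>h. v (x + h *\<^sub>R i, t)) has_real_derivative vi (x, t)) (at 0)"
    and vc: "continuous_on G vi"
  shows "time_C1 G wi vi"
  unfolding time_C1_def
proof (intro conjI vc allI impI)
  fix x t assume p: "(x, t) \<in> G"
  have line: "((\<lambda>h. f (x + h *\<^sub>R i, s)) has_real_derivative f' (x + \<xi> *\<^sub>R i, s)) (at \<xi>)"
    if "\<And>x t. (x, t) \<in> G \<Longrightarrow> ((\<lambda>h. f (x + h *\<^sub>R i, t)) has_real_derivative f' (x, t)) (at 0)" "(x + \<xi> *\<^sub>R i, s) \<in> G" for f f' :: "'a \<times> real \<Rightarrow> real" and \<xi> s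
    using that(1)[OF that(2)] DERIV_shift[of "\<lambda>h. f (x + h *\<^sub>R i, s)" "f' (x + \<xi> *\<^sub>R i, s)" 0 \<xi>] by (simp add: scaleR_add_left add_ac)
  show "((\<lambda>s. wi (x, s)) has_real_derivative vi (x, t)) (at t)"
    unfolding has_field_derivative_iff
  proof (rule LIM_I)
    fix \<epsilon> :: real assume e: "0 < \<epsilon>"
    have "isCont vi (x, t)" using vc G p continuous_on_eq_continuous_at by blast
    then obtain \<delta>1 where \<delta>1: "\<delta>1 > 0" "\<And>q. dist q (x, t) < \<delta>1 \<Longrightarrow> dist (vi q) (vi (x, t)) < \<epsilon> / 2"
      using e unfolding continuous_at_eps_delta by (meson half_gt_zero)
    obtain \<delta>2 where \<delta>2: "\<delta>2 > 0" "ball (x, t) \<delta>2 \<subseteq> G" using G p open_contains_ball by blast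
    define \<eta> where "\<eta> = min \<delta>1 \<delta>2 / (2 * (norm i + 1))"
    have ni: "0 < norm i + 1" using norm_ge_zero[of i] by linarith
    have \<eta>: "0 < \<eta>" using \<delta>1 \<delta>2 ni by (simp add: \<eta>_def)
    have box: "dist (x + h *\<^sub>R i, s) (x, t) < min \<delta>1 \<delta>2" if "\<bar>h\<bar> < \<eta>" "\<bar>s - t\<bar> < \<eta>" for h s
    proof -
      have "dist (x + h *\<^sub>R i, s) (x, t) \<le> norm (h *\<^sub>R i) + \<bar>s - t\<bar>"
        using sqrt_sum_squares_le_sum[of "dist (x + h *\<^sub>R i) x" "dist s t"]
        unfolding dist_Pair_Pair by (simp add: dist_norm)
      also have "\<dots> < \<eta> * (norm i + 1) + \<eta> * (norm i + 1)"
      proof (rule add_le_less_mono)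
        show "norm (h *\<^sub>R i) \<le> \<eta> * (norm i + 1)"
          using mult_mono[of "\<bar>h\<bar>" \<eta> "norm i" "norm i + 1"] that(1) \<eta> by simp
        have "0 \<le> \<eta> * norm i" using \<eta> by (intro mult_nonneg_nonneg) auto
        then show "\<bar>s - t\<bar> < \<eta> * (norm i + 1)" using that(2) unfolding distrib_left by linarith
      qed
      also have "\<dots> = min \<delta>1 \<delta>2" using ni by (simp add: \<eta>_def divide_simps del: distrib_left distrib_right)
      finally show ?thesis .
    qed
    have inG: "(x + h *\<^sub>R i, s) \<in> G" if "\<bar>h\<bar> < \<eta>" "\<bar>s - t\<bar> < \<eta>" for h s
      using box[OF that] \<delta>2(2) by (auto simp: dist_commute)
    have near: "\<bar>vi (x + h *\<^sub>R i, s) - vi (x, t)\<bar> \<le> \<epsilon> / 2" if "\<bar>h\<bar> < \<eta>" "\<bar>s - t\<bar> < \<eta>" for h s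
      using \<delta>1(2)[of "(x + h *\<^sub>R i, s)"] box[OF that] by (simp add: dist_real_def)
    \<comment> \<open>The second difference equals \<open>h * (s - t)\<close> times
      \<open>vi\<close> at a nearby point, by the mean value theorem first in time for
      \<open>w\<close> and then along \<open>i\<close> for \<open>v\<close>.\<close>
    have sq: "\<bar>(w (x + h *\<^sub>R i, s) - w (x, s) - (w (x + h *\<^sub>R i, t) - w (x, t))) - h * (s - t) * vi (x, t)\<bar> \<le> \<bar>h\<bar> * \<bar>s - t\<bar> * (\<epsilon> / 2)"
      if h: "\<bar>h\<bar> < \<eta>" and s: "\<bar>s - t\<bar> < \<eta>" for h s
    proof -
      obtain \<sigma> where \<sigma>: "\<bar>\<sigma> - t\<bar> \<le> \<bar>s - t\<bar>"
        "(w (x + h *\<^sub>R i, s) - w (x, s)) - (w (x + h *\<^sub>R i, t) - w (x, t)) = (s - t) * (v (x + h *\<^sub>R i, \<sigma>) - v (x, \<sigma>))"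
      proof (rule MVT_between)
        fix \<sigma> assume "\<bar>\<sigma> - t\<bar> \<le> \<bar>s - t\<bar>"
        then have "(x + h *\<^sub>R i, \<sigma>) \<in> G" "(x, \<sigma>) \<in> G" using inG[of h \<sigma>] inG[of 0 \<sigma>] h s \<eta> by auto
        then show "((\<lambda>s. w (x + h *\<^sub>R i, s) - w (x, s)) has_real_derivative v (x + h *\<^sub>R i, \<sigma>) - v (x, \<sigma>)) (at \<sigma>)"
          using w unfolding time_C1_def by (intro DERIV_diff) auto
      qed
      obtain \<xi> where "\<bar>\<xi> - 0\<bar> \<le> \<bar>h - 0\<bar>" "v (x + h *\<^sub>R i, \<sigma>) - v (x + 0 *\<^sub>R i, \<sigma>) = (h - 0) * vi (x + \<xi> *\<^sub>R i, \<sigma>)"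
        by (rule MVT_between[where a=0 and b=h, OF line[OF vx, of _ \<sigma>]]) (use inG h s \<sigma>(1) in auto)
      then have \<xi>: "\<bar>\<xi>\<bar> \<le> \<bar>h\<bar>" "v (x + h *\<^sub>R i, \<sigma>) - v (x, \<sigma>) = h * vi (x + \<xi> *\<^sub>R i, \<sigma>)" by auto
      have "\<bar>h * (s - t) * (vi (x + \<xi> *\<^sub>R i, \<sigma>) - vi (x, t))\<bar> \<le> \<bar>h\<bar> * \<bar>s - t\<bar> * (\<epsilon> / 2)"
        unfolding abs_mult using near[of \<xi> \<sigma>] \<xi>(1) \<sigma>(1) h s by (intro mult_left_mono) auto
      then show ?thesis unfolding \<sigma>(2) \<xi>(2) by (simp add: algebra_simps)
    qed
    show "\<exists>d>0. \<forall>s. s \<noteq> t \<and> norm (s - t) < d \<longrightarrow> norm ((wi (x, s) - wi (x, t)) / (s - t) - vi (x, t)) < \<epsilon>"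
    proof (intro exI[of _ \<eta>] conjI allI impI \<eta>)
      fix s assume s: "s \<noteq> t \<and> norm (s - t) < \<eta>"
      \<comment> \<open>With \<open>s\<close> fixed, \<open>h\<close> tends to 0 first. This turns
        the second difference into the increment of \<open>wi\<close>, for which no time derivative
        was assumed.\<close>
      let ?Q = "\<lambda>h. ((w (x + h *\<^sub>R i, s) - w (x, s)) / h - (w (x + h *\<^sub>R i, t) - w (x, t)) / h)"
      have "(x, s) \<in> G" using inG[of 0 s] s \<eta> by simp
      from wx[OF this] wx[OF p] have "?Q \<midarrow>0\<rightarrow> wi (x, s) - wi (x, t)"
        unfolding has_field_derivative_iff by (intro tendsto_diff) simp_all
      then have lim: "(\<lambda>h. \<bar>?Q h - (s - t) * vi (x, t)\<bar>) \<midarrow>0\<rightarrow> \<bar>wi (x, s) - wi (x, t) - (s - t) * vi (x, t)\<bar>"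
        by (intro tendsto_rabs tendsto_diff[OF _ tendsto_const])
      have "\<forall>\<^sub>F h in at 0. \<bar>?Q h - (s - t) * vi (x, t)\<bar> \<le> \<bar>s - t\<bar> * (\<epsilon> / 2)"
        unfolding eventually_at
      proof (intro exI[of _ \<eta>] conjI \<eta> ballI impI)
        fix h :: real assume h: "h \<noteq> 0 \<and> dist h 0 < \<eta>"
        have "h * (a / h - b / h - c) = a - b - h * c" for a b c using h by (simp add: field_simps)
        then have eq: "h * (?Q h - (s - t) * vi (x, t)) = (w (x + h *\<^sub>R i, s) - w (x, s) - (w (x + h *\<^sub>R i, t) - w (x, t))) - h * (s - t) * vi (x, t)"
          unfolding mult.assoc .
        have "\<bar>h\<bar> * \<bar>?Q h - (s - t) * vi (x, t)\<bar> \<le> \<bar>h\<bar> * (\<bar>s - t\<bar> * (\<epsilon> / 2))"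
          using sq[of h s] h s unfolding eq[symmetric] abs_mult by (simp add: mult.assoc)
        then show "\<bar>?Q h - (s - t) * vi (x, t)\<bar> \<le> \<bar>s - t\<bar> * (\<epsilon> / 2)" using h by simp
      qed
      then have "\<bar>wi (x, s) - wi (x, t) - (s - t) * vi (x, t)\<bar> \<le> \<bar>s - t\<bar> * (\<epsilon> / 2)"
        by (intro tendsto_upperbound[OF lim]) auto
      moreover have "\<bar>s - t\<bar> * (\<epsilon> / 2) < \<bar>s - t\<bar> * \<epsilon>" using s e by simp
      moreover have "wi (x, s) - wi (x, t) - (s - t) * vi (x, t) = (s - t) * ((wi (x, s) - wi (x, t)) / (s - t) - vi (x, t))"
        using s by (simp add: field_simps)
      ultimately have "\<bar>s - t\<bar> * \<bar>(wi (x, s) - wi (x, t)) / (s - t) - vi (x, t)\<bar> < \<bar>s - t\<bar> * \<epsilon>"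
        unfolding abs_mult[symmetric] by (metis le_less_trans)
      then show "norm ((wi (x, s) - wi (x, t)) / (s - t) - vi (x, t)) < \<epsilon>" using s by simp
    qed
  qed
qed

section \<open>From line derivatives to Frechet derivatives and the regularity classes of the
  statement\<close>

lemma has_derivative_of_continuous_partials:
  fixes f :: "'a::euclidean_space \<Rightarrow> real"
  assumes S: "open S" and d: "\<And>x i. x \<in> S \<Longrightarrow> i \<in> Basis \<Longrightarrow> ((\<lambda>h. f (x + h *\<^sub>R i)) has_real_derivative D i x) (at 0)"
    and c: "\<And>i. i \<in> Basis \<Longrightarrow> continuous_on S (D i)" and x: "x \<in> S"
  shows "(f has_derivative (\<lambda>h. \<Sum>i\<in>Basis. (h \<bullet> i) * D i x)) (at x)"
proof -
  \<comment> \<open>The projection onto the span of \<open>B\<close>. The increment of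
    \<open>f\<close> is built up one coordinate at a time by induction on \<open>B\<close>, each
    step being a mean value argument along a coordinate line.\<close>
  define P where "P B h = (\<Sum>i\<in>B. (h \<bullet> i) *\<^sub>R i)" for B and h :: 'a
  have P: "norm (P B h) \<le> DIM('a) * norm h" if "B \<subseteq> Basis" for B and h :: 'a
  proof -
    have "norm (P B h) \<le> (\<Sum>i\<in>B. norm h)"
      unfolding P_def by (rule order_trans[OF norm_sum], rule sum_mono) (use that Basis_le_norm in \<open>auto simp: subset_iff\<close>)
    also have "\<dots> = card B * norm h" by simp
    also have "\<dots> \<le> DIM('a) * norm h" using that by (intro mult_right_mono) (auto intro: card_mono)
    finally show ?thesis .
  qed
  have main: "\<forall>e>0. \<exists>\<delta>>0. \<forall>h. norm h < \<delta> \<longrightarrow> \<bar>f (x + P B h) - f x - (\<Sum>i\<in>B. (h \<bullet> i) * D i x)\<bar> \<le> e * norm h"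
    if "finite B" "B \<subseteq> Basis" for B
    using that
  proof (induction B rule: finite_induct)
    case empty
    show ?case by (auto simp: P_def intro: exI[of _ 1])
  next
    case (insert i B)
    then have i: "i \<in> Basis" "B \<subseteq> Basis" by auto
    show ?case
    proof (intro allI impI)
      fix e :: real assume e: "0 < e"
      obtain \<delta>1 where 1: "0 < \<delta>1" "\<And>h. norm h < \<delta>1 \<Longrightarrow> \<bar>f (x + P B h) - f x - (\<Sum>i\<in>B. (h \<bullet> i) * D i x)\<bar> \<le> e / 2 * norm h"
        using insert.IH[OF i(2)] e by (metis half_gt_zero)
      have "isCont (D i) x" using c[OF i(1)] S x continuous_on_eq_continuous_at by blast
      then obtain \<delta>2 where 2: "0 < \<delta>2" "\<And>y. dist y x < \<delta>2 \<Longrightarrow> dist (D i y) (D i x) < e / 2"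
        using e unfolding continuous_at_eps_delta by (meson half_gt_zero)
      obtain \<delta>3 where 3: "0 < \<delta>3" "ball x \<delta>3 \<subseteq> S" using S x open_contains_ball by blast
      let ?d = "min \<delta>1 (min \<delta>2 \<delta>3 / (DIM('a) + 1))"
      show "\<exists>\<delta>>0. \<forall>h. norm h < \<delta> \<longrightarrow> \<bar>f (x + P (insert i B) h) - f x - (\<Sum>i\<in>insert i B. (h \<bullet> i) * D i x)\<bar> \<le> e * norm h"
      proof (intro exI[of _ ?d] conjI allI impI)
        show "0 < ?d" using 1 2 3 by auto
        fix h :: 'a assume h: "norm h < ?d"
        define y where "y = x + P B h"
        have hi: "\<bar>h \<bullet> i\<bar> \<le> norm h" using i(1) by (rule Basis_le_norm)
        have near: "dist (y + \<xi> *\<^sub>R i) x < min \<delta>2 \<delta>3" if "\<bar>\<xi>\<bar> \<le> \<bar>h \<bullet> i\<bar>" for \<xi>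
        proof -
          have "dist (y + \<xi> *\<^sub>R i) x = norm (P B h + \<xi> *\<^sub>R i)" by (simp add: y_def dist_norm algebra_simps)
          also have "\<dots> \<le> norm (P B h) + norm (\<xi> *\<^sub>R i)" by (rule norm_triangle_ineq)
          also have "\<dots> \<le> DIM('a) * norm h + norm h" using P[OF i(2), of h] i that hi by (intro add_mono) auto
          also have "\<dots> = (DIM('a) + 1) * norm h" by (simp add: algebra_simps)
          also have "\<dots> < min \<delta>2 \<delta>3" using h by (simp add: pos_less_divide_eq mult.commute)
          finally show ?thesis .
        qed
        have D: "((\<lambda>h. f (y + h *\<^sub>R i)) has_real_derivative D i (y + \<xi> *\<^sub>R i)) (at \<xi>)" if "\<bar>\<xi>\<bar> \<le> \<bar>h \<bullet> i\<bar>" for \<xi>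
        proof -
          have "y + \<xi> *\<^sub>R i \<in> S" using near[OF that] 3(2) by (auto simp: dist_commute)
          from d[OF this i(1)] show ?thesis
            using DERIV_shift[of "\<lambda>h. f (y + h *\<^sub>R i)" _ 0 \<xi>] by (simp add: scaleR_add_left add_ac)
        qed
        obtain \<xi> where "\<bar>\<xi> - 0\<bar> \<le> \<bar>h \<bullet> i - 0\<bar>" "f (y + (h \<bullet> i) *\<^sub>R i) - f (y + 0 *\<^sub>R i) = (h \<bullet> i - 0) * D i (y + \<xi> *\<^sub>R i)"
          by (rule MVT_between[where a=0 and b="h \<bullet> i", OF D]) auto
        then have \<xi>: "\<bar>\<xi>\<bar> \<le> \<bar>h \<bullet> i\<bar>" "f (y + (h \<bullet> i) *\<^sub>R i) - f y = (h \<bullet> i) * D i (y + \<xi> *\<^sub>R i)" by auto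
        have "\<bar>D i (y + \<xi> *\<^sub>R i) - D i x\<bar> \<le> e / 2" using 2(2)[of "y + \<xi> *\<^sub>R i"] near[OF \<xi>(1)] by (simp add: dist_real_def)
        then have "\<bar>h \<bullet> i\<bar> * \<bar>D i (y + \<xi> *\<^sub>R i) - D i x\<bar> \<le> norm h * (e / 2)" using hi by (intro mult_mono) auto
        then have "\<bar>f (y + (h \<bullet> i) *\<^sub>R i) - f y - (h \<bullet> i) * D i x\<bar> \<le> e / 2 * norm h"
          unfolding \<xi>(2) right_diff_distrib[symmetric] abs_mult by (simp add: mult.commute)
        moreover have "f (x + P (insert i B) h) = f (y + (h \<bullet> i) *\<^sub>R i)" using insert by (simp add: P_def y_def add_ac)
        moreover have "\<bar>f y - f x - (\<Sum>i\<in>B. (h \<bullet> i) * D i x)\<bar> \<le> e / 2 * norm h" using 1(2)[of h] h by (simp add: y_def)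
        moreover have "(\<Sum>i\<in>insert i B. (h \<bullet> i) * D i x) = (h \<bullet> i) * D i x + (\<Sum>i\<in>B. (h \<bullet> i) * D i x)" using insert by simp
        ultimately show "\<bar>f (x + P (insert i B) h) - f x - (\<Sum>i\<in>insert i B. (h \<bullet> i) * D i x)\<bar> \<le> e * norm h" by linarith
      qed
    qed
  qed
  show ?thesis
    unfolding has_derivative_at_alt
  proof (intro conjI allI impI)
    show "bounded_linear (\<lambda>h. \<Sum>i\<in>Basis. (h \<bullet> i) * D i x)"
      by (intro bounded_linear_sum bounded_linear_mult_const bounded_linear_inner_left)
    fix e :: real assume "0 < e"
    then obtain \<delta> where \<delta>: "0 < \<delta>" "\<And>h. norm h < \<delta> \<Longrightarrow> \<bar>f (x + P Basis h) - f x - (\<Sum>i\<in>Basis. (h \<bullet> i) * D i x)\<bar> \<le> e * norm h"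
      using main[OF finite_Basis] by blast
    have "P Basis h = h" for h by (simp add: P_def euclidean_representation)
    then show "\<exists>\<delta>>0. \<forall>y. norm (y - x) < \<delta> \<longrightarrow> norm (f y - f x - (\<Sum>i\<in>Basis. ((y - x) \<bullet> i) * D i x)) \<le> e * norm (y - x)"
      using \<delta>(1) \<delta>(2)[of "_ - x"] by (intro exI[of _ \<delta>]) simp
  qed
qed

lemma partials_Cons: "partials (i # is) f = partial i (partials is f)"
  by (simp add: partials_def)

lemma partials_Nil: "partials [] f = f"
  by (simp add: partials_def)

lemma partial_eqI: "(f has_derivative f') (at x) \<Longrightarrow> partial i f x = f' i"
  unfolding partial_def by (simp add: frechet_derivative_at[symmetric])

text \<open>Multi-index form of spatial smoothness with joint continuity in space-time; joint
  continuity is what later gives convergence uniform on compact sets as time varies.\<close>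

definition par_Ck :: "nat \<Rightarrow> ('a::euclidean_space \<times> real) set \<Rightarrow> ('a \<times> real \<Rightarrow> real) \<Rightarrow> bool" where
  "par_Ck k G w \<longleftrightarrow> (\<forall>is\<in>multi_indices k. continuous_on G (foldr pdx is w) \<and>
     (length is < k \<longrightarrow> (\<forall>i\<in>Basis. \<forall>x t. (x, t) \<in> G \<longrightarrow>
        ((\<lambda>h. foldr pdx is w (x + h *\<^sub>R i, t)) has_real_derivative foldr pdx (i # is) w (x, t)) (at 0))))"

lemma multi_indices_2: "multi_indices 2 = {[]} \<union> {[i] | i. i \<in> Basis} \<union> {[i, j] | i j. i \<in> Basis \<and> j \<in> Basis}"
proof -
  have "is \<in> {[]} \<union> {[i] | i. i \<in> Basis} \<union> {[i, j] | i j. i \<in> Basis \<and> j \<in> Basis}"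
    if "set is \<subseteq> Basis" "length is \<le> 2" for "is" :: "'a list"
    using that by (cases "is"; cases "tl is") auto
  then show ?thesis unfolding multi_indices_def by auto
qed

lemma par_smooth_Ck:
  assumes "par_smooth G w"
  shows "par_Ck 2 G w"
  using assms unfolding par_Ck_def par_C2_def multi_indices_2 by auto

text \<open>Induction on the multi-index: continuity of the line derivatives upgrades them to a
  Frechet derivative of the slice, whose value on a basis vector is the next
  \<open>pdx\<close>.\<close>

lemma par_Ck_partials:
  fixes G :: "('a::euclidean_space \<times> real) set"
  assumes G: "open G" and w: "par_Ck k G w" and "is \<in> multi_indices k" "(x, t) \<in> G"
  shows "partials is (\<lambda>y. w (y, t)) x = foldr pdx is w (x, t)"
    and "length is < k \<Longrightarrow> (partials is (\<lambda>y. w (y, t)) has_derivative (\<lambda>h. \<Sum>i\<in>Basis. (h \<bullet> i) * foldr pdx (i # is) w (x, t))) (at x)"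
proof -
  have slice: "open {y. (y, t) \<in> G}" for t
  proof -
    have "open ((\<lambda>y. (y, t)) -` G)" by (intro open_vimage[OF G] continuous_intros)
    then show ?thesis by (simp add: vimage_def)
  qed
  have der: "(partials is (\<lambda>y. w (y, t)) has_derivative (\<lambda>h. \<Sum>i\<in>Basis. (h \<bullet> i) * foldr pdx (i # is) w (x, t))) (at x)"
    if eq: "\<And>y. (y, t) \<in> G \<Longrightarrow> partials is (\<lambda>y. w (y, t)) y = foldr pdx is w (y, t)" and "is": "is \<in> multi_indices k" "length is < k"
      and x: "(x, t) \<in> G" for "is" x t
  proof (rule has_derivative_transform_within_open[where s="{y. (y, t) \<in> G}"])
    show "((\<lambda>y. foldr pdx is w (y, t)) has_derivative (\<lambda>h. \<Sum>i\<in>Basis. (h \<bullet> i) * foldr pdx (i # is) w (x, t))) (at x)"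
    proof (rule has_derivative_of_continuous_partials[OF slice, of t])
      fix i :: 'a assume i: "i \<in> Basis"
      show "((\<lambda>h. foldr pdx is w (y + h *\<^sub>R i, t)) has_real_derivative foldr pdx (i # is) w (y, t)) (at 0)" if "y \<in> {y. (y, t) \<in> G}" for y
        using w "is" i that unfolding par_Ck_def by auto
      have "i # is \<in> multi_indices k" using "is" i by (auto simp: multi_indices_def)
      then have "continuous_on G (foldr pdx (i # is) w)" using w unfolding par_Ck_def by auto
      then show "continuous_on {y. (y, t) \<in> G} (\<lambda>y. foldr pdx (i # is) w (y, t))"
        by (rule continuous_on_compose2) (auto intro!: continuous_intros)
    qed (use x in auto)
  qed (use slice x eq in auto)
  have E: "partials is (\<lambda>y. w (y, t)) x = foldr pdx is w (x, t)" if "is \<in> multi_indices k" "(x, t) \<in> G" for "is" x t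
    using that
  proof (induction "is" arbitrary: x)
    case Nil
    then show ?case by (simp add: partials_Nil)
  next
    case (Cons i "is")
    then have "is": "is \<in> multi_indices k" "length is < k" "i \<in> Basis" by (auto simp: multi_indices_def)
    have "partials (i # is) (\<lambda>y. w (y, t)) x = (\<Sum>j\<in>Basis. (i \<bullet> j) * foldr pdx (j # is) w (x, t))"
      unfolding partials_Cons by (rule partial_eqI[OF der[OF Cons.IH "is"(1,2) Cons.prems(2)]]) (rule "is"(1))
    also have "\<dots> = (\<Sum>j\<in>Basis. if j = i then foldr pdx (i # is) w (x, t) else 0)"
      using "is"(3) by (intro sum.cong) (auto simp: inner_Basis)
    finally show ?case using "is"(3) by simp
  qed
  show "partials is (\<lambda>y. w (y, t)) x = foldr pdx is w (x, t)" by (rule E) fact+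
  show "length is < k \<Longrightarrow> (partials is (\<lambda>y. w (y, t)) has_derivative (\<lambda>h. \<Sum>i\<in>Basis. (h \<bullet> i) * foldr pdx (i # is) w (x, t))) (at x)"
    using der[of t "is" x, OF E[OF assms(3)] assms(3) _ assms(4)] by blast
qed

lemma par_Ck_slice:
  fixes G :: "('a::euclidean_space \<times> real) set"
  assumes G: "open G" and w: "par_Ck k G w" and S: "\<And>x. x \<in> S \<Longrightarrow> (x, t) \<in> G"
  shows "Ck_on k S (\<lambda>x. w (x, t))"
  unfolding Ck_on_def
proof (intro ballI conjI impI)
  fix "is" :: "'a list" assume "is": "is \<in> multi_indices k"
  have "continuous_on G (foldr pdx is w)" using w "is" unfolding par_Ck_def by blast
  then have "continuous_on S (\<lambda>x. foldr pdx is w (x, t))"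
    by (rule continuous_on_compose2) (auto intro!: continuous_intros S)
  then show "continuous_on S (partials is (\<lambda>x. w (x, t)))"
    by (rule continuous_on_cong[THEN iffD2, OF refl, rotated]) (rule par_Ck_partials(1)[OF G w "is" S])
  show "partials is (\<lambda>x. w (x, t)) differentiable at x" if "length is < k" "x \<in> S" for x
    using par_Ck_partials(2)[OF G w "is" S[OF that(2)] that(1)] unfolding differentiable_def by blast
qed

lemma C21_onI:
  assumes \<Omega>: "open \<Omega>" and w: "par_smooth (\<Omega> \<times> {0<..<T}) w" "time_C1 (\<Omega> \<times> {0<..<T}) w (pdt w)"
  shows "C21_on \<Omega> T (\<lambda>x t. w (x, t))"
proof -
  let ?G = "\<Omega> \<times> {0<..<T}"
  have G: "open ?G" by (intro open_Times \<Omega>) auto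
  note k = par_smooth_Ck[OF w(1)]
  have dt: "((\<lambda>s. w (x, s)) has_real_derivative pdt w (x, t)) (at t)" if "x \<in> \<Omega>" "t \<in> {0<..<T}" for x t
    using w(2) that unfolding time_C1_def by auto
  show ?thesis
    unfolding C21_on_def
  proof (intro conjI ballI)
    show "Ck_on 2 \<Omega> (\<lambda>x. w (x, t))" if "t \<in> {0<..<T}" for t
      by (rule par_Ck_slice[OF G k]) (use that in auto)
    show "continuous_on ?G (\<lambda>(x, t). partials is (\<lambda>y. w (y, t)) x)" if "is": "is \<in> multi_indices 2" for "is"
    proof -
      have "continuous_on ?G (foldr pdx is w)" using k "is" unfolding par_Ck_def by blast
      then show ?thesis
        by (rule continuous_on_cong[THEN iffD2, OF refl, rotated]) (auto intro!: par_Ck_partials(1)[OF G k "is"])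
    qed
    show "(\<lambda>s. w (x, s)) field_differentiable at t" if "x \<in> \<Omega>" "t \<in> {0<..<T}" for x t
      using dt[OF that] unfolding field_differentiable_def by blast
    show "continuous_on ?G (\<lambda>(x, t). deriv (\<lambda>s. w (x, s)) t)"
      using w(2) unfolding time_C1_def pdt_def case_prod_unfold by blast
  qed
qed

lemma laplacian_slice:
  assumes G: "open G" and w: "par_smooth G w" and x: "(x, t) \<in> G"
  shows "laplacian (\<lambda>y. w (y, t)) x = (\<Sum>i\<in>Basis. pdx i (pdx i w) (x, t))"
  unfolding laplacian_def
  by (intro sum.cong refl, subst par_Ck_partials(1)[OF G par_smooth_Ck[OF w] _ x]) (auto simp: multi_indices_2)

lemma Ck_on_has_derivative:
  assumes "Ck_on k S f" "is \<in> multi_indices k" "length is < k" "x \<in> S"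
  shows "(partials is f has_derivative frechet_derivative (partials is f) (at x)) (at x)"
  using assms unfolding Ck_on_def frechet_derivative_works[symmetric] by blast

lemma partials_Pair:
  assumes S: "open S" and f: "Ck_on k S f" and g: "Ck_on k S g" and "is \<in> multi_indices k" "x \<in> S"
  shows "partials is (\<lambda>x. (f x, g x)) x = (partials is f x, partials is g x)"
  using assms(4,5)
proof (induction "is" arbitrary: x)
  case Nil
  then show ?case by (simp add: partials_Nil)
next
  case (Cons i "is")
  then have "is": "is \<in> multi_indices k" "length is < k" by (auto simp: multi_indices_def)
  have "(partials is (\<lambda>x. (f x, g x)) has_derivative
      (\<lambda>h. (frechet_derivative (partials is f) (at x) h, frechet_derivative (partials is g) (at x) h))) (at x)"
    by (rule has_derivative_transform_within_open[OF has_derivative_Pair[OF Ck_on_has_derivative[OF f "is"] Ck_on_has_derivative[OF g "is"]] S])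
      (use Cons "is" in auto)
  from partial_eqI[OF this] show ?case by (simp add: partials_Cons partial_def)
qed

lemma Ck_on_Pair:
  assumes S: "open S" and f: "Ck_on k S f" and g: "Ck_on k S g"
  shows "Ck_on k S (\<lambda>x. (f x, g x))"
  unfolding Ck_on_def
proof (intro ballI conjI impI)
  fix "is" :: "'a list" assume "is": "is \<in> multi_indices k"
  note E = partials_Pair[OF S f g "is"]
  have "continuous_on S (\<lambda>x. (partials is f x, partials is g x))"
    using f g "is" unfolding Ck_on_def by (intro continuous_on_Pair) auto
  then show "continuous_on S (partials is (\<lambda>x. (f x, g x)))"
    by (rule continuous_on_cong[THEN iffD2, OF refl, rotated]) (rule E)
  show "partials is (\<lambda>x. (f x, g x)) differentiable at x" if "length is < k" "x \<in> S" for x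
    using has_derivative_transform_within_open[OF has_derivative_Pair[OF Ck_on_has_derivative[OF f "is" that] Ck_on_has_derivative[OF g "is" that]] S that(2), of "partials is (\<lambda>x. (f x, g x))"]
      E unfolding differentiable_def by auto
qed

lemma partials_quotient:
  assumes S: "open S" and f: "Ck_on k S f" and g: "Ck_on k S g" and "is \<in> multi_indices k" "x \<in> S"
  shows "partials is (\<lambda>x. (f x - g x) /\<^sub>R c) x = (partials is f x - partials is g x) /\<^sub>R c"
  using assms(4,5)
proof (induction "is" arbitrary: x)
  case Nil
  then show ?case by (simp add: partials_Nil)
next
  case (Cons i "is")
  then have "is": "is \<in> multi_indices k" "length is < k" by (auto simp: multi_indices_def)
  have "(partials is (\<lambda>x. (f x - g x) /\<^sub>R c) has_derivative
      (\<lambda>h. (frechet_derivative (partials is f) (at x) h - frechet_derivative (partials is g) (at x) h) /\<^sub>R c)) (at x)"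
    by (rule has_derivative_transform_within_open[OF has_derivative_scaleR_right[OF has_derivative_diff[OF Ck_on_has_derivative[OF f "is"] Ck_on_has_derivative[OF g "is"]]] S])
      (use Cons "is" in auto)
  from partial_eqI[OF this] show ?case by (simp add: partials_Cons partial_def)
qed

lemma uniform_limit_slice:
  fixes Q :: "'a::euclidean_space \<times> real \<Rightarrow> real"
  assumes Q: "continuous_on (\<Omega> \<times> I) Q" and I: "open I" "t \<in> I" and K: "compact K" "K \<subseteq> \<Omega>"
  shows "uniform_limit K (\<lambda>s x. Q (x, s)) (\<lambda>x. Q (x, t)) (at t)"
proof (rule uniform_limitI)
  fix e :: real assume e: "0 < e"
  obtain r where r: "0 < r" "cball t r \<subseteq> I" using I open_contains_cball by blast
  have "uniformly_continuous_on (K \<times> cball t r) Q"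
    by (intro compact_uniformly_continuous compact_Times K compact_cball continuous_on_subset[OF Q]) (use r K in auto)
  then obtain d where d: "0 < d" "\<And>p q. p \<in> K \<times> cball t r \<Longrightarrow> q \<in> K \<times> cball t r \<Longrightarrow> dist q p < d \<Longrightarrow> dist (Q q) (Q p) < e"
    using e unfolding uniformly_continuous_on_def by metis
  have "\<forall>\<^sub>F s in at t. dist s t < min d r" unfolding eventually_at using d(1) r(1) by (intro exI[of _ "min d r"]) auto
  then show "\<forall>\<^sub>F s in at t. \<forall>x\<in>K. dist (Q (x, s)) (Q (x, t)) < e"
  proof eventually_elim
    case (elim s)
    show ?case using elim r(1) by (intro ballI d(2)) (auto simp: dist_Pair_Pair dist_commute)
  qed
qed

text \<open>The difference quotient is the value of \<open>Q\<close> at an intermediate time, so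
  uniformity on \<open>K\<close> is inherited from \<open>uniform_limit_slice\<close>.\<close>

lemma uniform_limit_time_quotient:
  fixes P :: "'a::euclidean_space \<times> real \<Rightarrow> real"
  assumes P: "time_C1 (\<Omega> \<times> I) P Q" and I: "open I" "t \<in> I" and K: "compact K" "K \<subseteq> \<Omega>"
  shows "uniform_limit K (\<lambda>s x. (P (x, s) - P (x, t)) / (s - t)) (\<lambda>x. Q (x, t)) (at t)"
proof (rule uniform_limitI)
  fix e :: real assume e: "0 < e"
  have "continuous_on (\<Omega> \<times> I) Q" using P unfolding time_C1_def by blast
  from uniform_limitD[OF uniform_limit_slice[OF this I K] e]
  obtain d where d: "0 < d" "\<And>s x. s \<noteq> t \<Longrightarrow> dist s t < d \<Longrightarrow> x \<in> K \<Longrightarrow> dist (Q (x, s)) (Q (x, t)) < e"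
    unfolding eventually_at by auto
  obtain r where r: "0 < r" "ball t r \<subseteq> I" using I open_contains_ball by blast
  show "\<forall>\<^sub>F s in at t. \<forall>x\<in>K. dist ((P (x, s) - P (x, t)) / (s - t)) (Q (x, t)) < e"
    unfolding eventually_at
  proof (intro exI[of _ "min d r"] conjI ballI impI)
    fix s x assume s: "s \<noteq> t \<and> dist s t < min d r" and x: "x \<in> K"
    have D: "((\<lambda>s. P (x, s)) has_real_derivative Q (x, z)) (at z)" if "\<bar>z - t\<bar> \<le> \<bar>s - t\<bar>" for z
    proof -
      have "z \<in> ball t r" using that s by (auto simp: dist_real_def)
      then have "(x, z) \<in> \<Omega> \<times> I" using r(2) K(2) x by blast
      then show ?thesis using P unfolding time_C1_def by blast
    qed
    obtain z where z: "\<bar>z - t\<bar> \<le> \<bar>s - t\<bar>" "P (x, s) - P (x, t) = (s - t) * Q (x, z)"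
      by (rule MVT_between[OF D])
    then have "(P (x, s) - P (x, t)) / (s - t) = Q (x, z)" using s by simp
    moreover have "dist (Q (x, z)) (Q (x, t)) < e" using d(2)[of z x] z(1) s x e by (cases "z = t") (auto simp: dist_real_def)
    ultimately show "dist ((P (x, s) - P (x, t)) / (s - t)) (Q (x, t)) < e" by simp
  qed (use d(1) r(1) in auto)
qed

lemma uniform_limit_Pair_real:
  fixes f g :: "'c \<Rightarrow> 'a \<Rightarrow> real"
  assumes "uniform_limit K f a F" "uniform_limit K g b F"
  shows "uniform_limit K (\<lambda>s x. (f s x, g s x)) (\<lambda>x. (a x, b x)) F"
proof (rule uniform_limitI)
  fix e :: real assume "0 < e"
  then have e: "0 < e / 2" by simp
  show "\<forall>\<^sub>F s in F. \<forall>x\<in>K. dist (f s x, g s x) (a x, b x) < e"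
    using uniform_limitD[OF assms(1) e] uniform_limitD[OF assms(2) e]
  proof eventually_elim
    case (elim s)
    show ?case
    proof
      fix x assume "x \<in> K"
      then have "dist (f s x) (a x) < e / 2" "dist (g s x) (b x) < e / 2" using elim by auto
      moreover have "dist (f s x, g s x) (a x, b x) \<le> dist (f s x) (a x) + dist (g s x) (b x)"
        unfolding dist_Pair_Pair by (rule sqrt_sum_squares_le_sum) auto
      ultimately show "dist (f s x, g s x) (a x, b x) < e" by linarith
    qed
  qed
qed

text \<open>Time differentiation passes through one space derivative after another by
  \<open>time_C1_pdx\<close>.\<close>

lemma time_C1_foldr_pdx:
  assumes G: "open G" and w: "time_C1 G w v" and k: "par_Ck k G w" "par_Ck k G v" and "is": "is \<in> multi_indices k"
  shows "time_C1 G (foldr pdx is w) (foldr pdx is v)"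
  using "is"
proof (induction "is")
  case Nil
  show ?case using w by simp
next
  case (Cons i "is")
  then have "is": "is \<in> multi_indices k" "length is < k" "i \<in> Basis" by (auto simp: multi_indices_def)
  have "time_C1 G (foldr pdx (i # is) w) (foldr pdx (i # is) v)"
  proof (rule time_C1_pdx[OF G Cons.IH[OF "is"(1)], of i])
    show "continuous_on G (foldr pdx (i # is) v)" using k(2) Cons.prems unfolding par_Ck_def by blast
  qed (use k "is" in \<open>auto simp: par_Ck_def\<close>)
  then show ?case .
qed

lemma C1_curve_in_C2_I:
  fixes \<Omega> :: "'a::euclidean_space set"
  assumes \<Omega>: "open \<Omega>" and u: "par_smooth (\<Omega> \<times> {0<..<T}) u" "time_C1 (\<Omega> \<times> {0<..<T}) u u'" "par_smooth (\<Omega> \<times> {0<..<T}) u'"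
    and v: "par_smooth (\<Omega> \<times> {0<..<T}) v" "time_C1 (\<Omega> \<times> {0<..<T}) v v'" "par_smooth (\<Omega> \<times> {0<..<T}) v'"
  shows "C1_curve_in_Ck {0<..<T} 2 \<Omega> (\<lambda>t x. (u (x, t), v (x, t)))"
proof -
  let ?G = "\<Omega> \<times> {0<..<T}"
  have G: "open ?G" by (intro open_Times \<Omega>) auto
  note k = par_smooth_Ck[OF u(1)] par_smooth_Ck[OF u(3)] par_smooth_Ck[OF v(1)] par_smooth_Ck[OF v(3)]
  have C: "Ck_on 2 \<Omega> (\<lambda>x. w (x, t))" if "par_Ck 2 ?G w" "t \<in> {0<..<T}" for w t
    by (rule par_Ck_slice[OF G that(1)]) (use that(2) in auto)
  have CP: "Ck_on 2 \<Omega> (\<lambda>x. (u (x, t), v (x, t)))" if "t \<in> {0<..<T}" for t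
    by (intro Ck_on_Pair \<Omega> C k that)
  have P: "partials is (\<lambda>x. (w (x, t), z (x, t))) x = (foldr pdx is w (x, t), foldr pdx is z (x, t))"
    if "par_Ck 2 ?G w" "par_Ck 2 ?G z" "t \<in> {0<..<T}" "is \<in> multi_indices 2" "x \<in> \<Omega>" for w z t "is" x
    using partials_Pair[OF \<Omega> C[OF that(1,3)] C[OF that(2,3)] that(4,5)] par_Ck_partials(1)[OF G that(1,4), of x t] par_Ck_partials(1)[OF G that(2,4), of x t] that
    by simp
  show ?thesis
    unfolding C1_curve_in_Ck_def
  proof (intro conjI ballI exI[of _ "\<lambda>t x. (u' (x, t), v' (x, t))"])
    fix t assume t: "t \<in> {0<..<T}"
    have at: "at t within {0<..<T} = at t" using t by (intro at_within_open) auto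
    have ev: "\<forall>\<^sub>F s in at t. s \<in> {0<..<T}" using t eventually_at_in_open'[of "{0<..<T}" t] by auto
    show "Ck_on 2 \<Omega> (\<lambda>x. (u (x, t), v (x, t)))" "Ck_on 2 \<Omega> (\<lambda>x. (u' (x, t), v' (x, t)))"
      by (intro Ck_on_Pair \<Omega> C k t)+
    show "Ck_tendsto 2 \<Omega> (\<lambda>s x. ((u (x, s), v (x, s)) - (u (x, t), v (x, t))) /\<^sub>R (s - t)) (\<lambda>x. (u' (x, t), v' (x, t))) (at t within {0<..<T})"
      unfolding Ck_tendsto_def at
    proof (intro allI impI ballI)
      fix K :: "'a set" and "is" :: "'a list" assume K: "compact K" "K \<subseteq> \<Omega>" and "is": "is \<in> multi_indices 2"
      show "uniform_limit K (\<lambda>s. partials is (\<lambda>x. ((u (x, s), v (x, s)) - (u (x, t), v (x, t))) /\<^sub>R (s - t))) (partials is (\<lambda>x. (u' (x, t), v' (x, t)))) (at t)"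
      proof (rule uniform_limit_cong[THEN iffD2])
        show "\<forall>\<^sub>F s in at t. \<forall>x\<in>K. partials is (\<lambda>x. ((u (x, s), v (x, s)) - (u (x, t), v (x, t))) /\<^sub>R (s - t)) x =
          ((foldr pdx is u (x, s) - foldr pdx is u (x, t)) / (s - t), (foldr pdx is v (x, s) - foldr pdx is v (x, t)) / (s - t))"
          using ev
        proof eventually_elim
          case (elim s)
          show ?case
          proof
            fix x assume "x \<in> K"
            then have x: "x \<in> \<Omega>" using K by auto
            show "partials is (\<lambda>x. ((u (x, s), v (x, s)) - (u (x, t), v (x, t))) /\<^sub>R (s - t)) x =
              ((foldr pdx is u (x, s) - foldr pdx is u (x, t)) / (s - t), (foldr pdx is v (x, s) - foldr pdx is v (x, t)) / (s - t))"
              unfolding partials_quotient[OF \<Omega> CP[OF elim] CP[OF t] "is" x] P[OF k(1,3) elim "is" x] P[OF k(1,3) t "is" x]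
              by (simp add: divide_inverse mult.commute)
          qed
        qed
        show "partials is (\<lambda>x. (u' (x, t), v' (x, t))) x = (foldr pdx is u' (x, t), foldr pdx is v' (x, t))" if "x \<in> K" for x
          using P[OF k(2,4) t "is"] K that by auto
        show "uniform_limit K (\<lambda>s x. ((foldr pdx is u (x, s) - foldr pdx is u (x, t)) / (s - t), (foldr pdx is v (x, s) - foldr pdx is v (x, t)) / (s - t)))
          (\<lambda>x. (foldr pdx is u' (x, t), foldr pdx is v' (x, t))) (at t)"
          by (intro uniform_limit_Pair_real uniform_limit_time_quotient[OF time_C1_foldr_pdx[OF G u(2) k(1,2) "is"]]
              uniform_limit_time_quotient[OF time_C1_foldr_pdx[OF G v(2) k(3,4) "is"]] K t open_greaterThanLessThan)
      qed
    qed
    show "Ck_tendsto 2 \<Omega> (\<lambda>t x. (u' (x, t), v' (x, t))) (\<lambda>x. (u' (x, t), v' (x, t))) (at t within {0<..<T})"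
      unfolding Ck_tendsto_def at
    proof (intro allI impI ballI)
      fix K :: "'a set" and "is" :: "'a list" assume K: "compact K" "K \<subseteq> \<Omega>" and "is": "is \<in> multi_indices 2"
      have c: "continuous_on ?G (foldr pdx is u')" "continuous_on ?G (foldr pdx is v')" using k "is" unfolding par_Ck_def by blast+
      show "uniform_limit K (\<lambda>s. partials is (\<lambda>x. (u' (x, s), v' (x, s)))) (partials is (\<lambda>x. (u' (x, t), v' (x, t)))) (at t)"
      proof (rule uniform_limit_cong[THEN iffD2])
        show "\<forall>\<^sub>F s in at t. \<forall>x\<in>K. partials is (\<lambda>x. (u' (x, s), v' (x, s))) x = (foldr pdx is u' (x, s), foldr pdx is v' (x, s))"
          using ev by eventually_elim (use P[OF k(2,4) _ "is"] K in auto)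
        show "partials is (\<lambda>x. (u' (x, t), v' (x, t))) x = (foldr pdx is u' (x, t), foldr pdx is v' (x, t))" if "x \<in> K" for x
          using P[OF k(2,4) t "is"] K that by auto
        show "uniform_limit K (\<lambda>s x. (foldr pdx is u' (x, s), foldr pdx is v' (x, s))) (\<lambda>x. (foldr pdx is u' (x, t), foldr pdx is v' (x, t))) (at t)"
          by (intro uniform_limit_Pair_real uniform_limit_slice[OF c(1)] uniform_limit_slice[OF c(2)] K t open_greaterThanLessThan)
      qed
    qed
  qed
qed

section \<open>Smoothness of the limit and of its time derivative\<close>

text \<open>Up to time \<open>T\<close> the bound \<open>mm + M * M * t\<close> keeps the limit in
  \<open>[0, c]\<close>. The truncated nonlinearity has a kink at \<open>c\<close>, so its
  derivative \<open>dF\<close> is taken within this interval only.\<close>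

locale dirichlet_smooth = dirichlet al U0 F M A L \<theta> \<Omega> mm
  for al U0 :: "bool \<Rightarrow> 'a::euclidean_space \<Rightarrow> real" and F M A L \<theta> and \<Omega> :: "'a set" and mm +
  fixes T c L' :: real and dF :: "bool \<Rightarrow> real \<Rightarrow> real"
  assumes T: "0 < T" "T \<le> 1" and Tc: "mm + M * M * T \<le> c"
    and dF: "\<And>b s. s \<in> {0..c} \<Longrightarrow> (F b has_real_derivative dF b s) (at s within {0..c})"
    and dFL: "\<And>b s s'. s \<in> {0..c} \<Longrightarrow> s' \<in> {0..c} \<Longrightarrow> \<bar>dF b s - dF b s'\<bar> \<le> L' * \<bar>s - s'\<bar>" and L'0: "0 \<le> L'"
begin

abbreviation (input) GT where "GT \<equiv> \<Omega> \<times> {0<..<T}"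

lemma GT: "open GT" "GT \<subseteq> UNIV \<times> {0<..<1}" "GT \<subseteq> \<Omega> \<times> {0<..<1}" "GT \<subseteq> closure \<Omega> \<times> {0..<1}"
  using T closure_subset[of \<Omega>] by (auto intro!: open_Times open\<Omega>)

lemma ul_c: "0 \<le> t \<Longrightarrow> t < T \<Longrightarrow> ul b (x, t) \<in> {0..c}"
proof -
  assume t: "0 \<le> t" "t < T"
  have "M * M * t \<le> M * M * T" using t M0 by (intro mult_left_mono) auto
  then show ?thesis using ul_nonneg[of t b x] ul_upper[of t b x] t T Tc by auto
qed

lemma ul_GT:
  shows "local_sol GT (ul b) (react b)" "continuous_on GT (ul b)" "loc_bdd GT (ul b)" "loc_bdd GT (react b)"
    "loc_holder \<theta> GT (ul b)" "continuous_on GT (react b)" "loc_holder \<theta> GT (react b)"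
proof -
  show 1: "local_sol GT (ul b) (react b)" for b
    using ul_local_sol[of b] GT(3) unfolding local_sol_def by blast
  show 2: "continuous_on GT (ul b)" for b by (rule continuous_on_subset[OF ul_cont GT(4)])
  show 3: "loc_bdd GT (ul b)" for b by (rule loc_bdd_continuous[OF GT(1) 2])
  show 4: "loc_bdd GT (react b)" unfolding loc_bdd_def using react_bound by (meson zero_less_one)
  have 4: "loc_bdd GT (react b)" for b unfolding loc_bdd_def using react_bound by (meson zero_less_one)
  show 5: "loc_holder \<theta> GT (ul b)" for b
    by (rule local_sol_holder[OF GT(1,2) 1[of b] ul_measurable react_measurable 3 4 th])
  have al: "continuous_on GT (\<lambda>p. al b (fst p))"
    by (rule continuous_on_compose2[OF continuous_al]) (auto intro!: continuous_intros)
  have Fc: "continuous_on GT (\<lambda>p. F b (ul (\<not> b) p))"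
    by (rule continuous_on_compose2[OF continuous_F[of UNIV] 2]) auto
  show "continuous_on GT (react b)" unfolding react_def by (intro continuous_on_mult al Fc)
  have "loc_holder \<theta> GT (\<lambda>p. F b (ul (\<not> b) p))" by (rule loc_holder_comp[OF 5 _ GT(1) L0]) (rule FL)
  then show "loc_holder \<theta> GT (react b)"
    unfolding react_def by (intro loc_holder_mult loc_holder_space[OF alh] loc_bdd_continuous[OF GT(1)] al Fc)
qed

lemma ul_smooth: "par_smooth GT (ul b)" "time_C1 GT (ul b) (pdt (ul b))"
  "p \<in> GT \<Longrightarrow> pdt (ul b) p - (\<Sum>i\<in>Basis. pdx i (pdx i (ul b)) p) = react b p"
  by (rule local_sol_smooth[OF GT(1,2) ul_GT(1) ul_measurable react_measurable ul_GT(3,4) th ul_GT(6,7)]; assumption?)+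

definition react' :: "bool \<Rightarrow> 'a \<times> real \<Rightarrow> real" where
  "react' b p = al b (fst p) * (dF b (ul (\<not> b) p) * pdt (ul (\<not> b)) p)"

lemma dF_ul_cont: "continuous_on GT (\<lambda>p. dF b (ul (\<not> b) p))"
proof (rule continuous_on_compose2[OF _ ul_GT(2)])
  have "L'-lipschitz_on {0..c} (dF b)" by (rule lipschitz_onI) (use dFL L'0 in \<open>auto simp: dist_real_def\<close>)
  then show "continuous_on {0..c} (dF b)" by (rule lipschitz_on_continuous_on)
  show "ul (\<not> b) ` GT \<subseteq> {0..c}" using ul_c[of _ "\<not> b"] by auto
qed

lemma pdt_cont: "continuous_on GT (pdt (ul b))" using ul_smooth(2) unfolding time_C1_def by blast

lemma al_cont: "continuous_on S (\<lambda>p. al b (fst p))"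
  by (rule continuous_on_compose2[OF continuous_al]) (auto intro!: continuous_intros)

lemma react'_cont: "continuous_on GT (react' b)"
  unfolding react'_def by (intro continuous_on_mult al_cont dF_ul_cont pdt_cont)

lemma react_time: "time_C1 GT (react b) (react' b)"
  unfolding time_C1_def
proof (intro conjI allI impI react'_cont)
  fix x t assume p: "(x, t) \<in> GT"
  have u: "((\<lambda>s. ul (\<not> b) (x, s)) has_real_derivative pdt (ul (\<not> b)) (x, t)) (at t within {0<..<T})"
    using ul_smooth(2)[of "\<not> b"] p unfolding time_C1_def by (blast intro: has_field_derivative_at_within)
  \<comment> \<open>The derivative of \<open>F b\<close> is one-sided at the ends of
    \<open>{0..c}\<close>; the chain rule is therefore applied along the image of the time path,
    which stays inside.\<close>
  have "(F b has_real_derivative dF b (ul (\<not> b) (x, t))) (at (ul (\<not> b) (x, t)) within (\<lambda>s. ul (\<not> b) (x, s)) ` {0<..<T})"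
    by (rule DERIV_subset[OF dF]) (use ul_c[of _ "\<not> b" x] p in auto)
  from DERIV_cmult[OF DERIV_image_chain[OF this u], of "al b x"]
  have "((\<lambda>s. al b x * F b (ul (\<not> b) (x, s))) has_real_derivative al b x * (dF b (ul (\<not> b) (x, t)) * pdt (ul (\<not> b)) (x, t))) (at t within {0<..<T})"
    by (simp add: o_def)
  moreover have "at t within {0<..<T} = at t" using p by (intro at_within_open) auto
  ultimately show "((\<lambda>s. react b (x, s)) has_real_derivative react' b (x, t)) (at t)" by (simp add: react_def react'_def)
qed

text \<open>Set to 0 off the domain so that it is Borel measurable on the whole of space-time, as
  the convolutions require.\<close>

definition ut :: "bool \<Rightarrow> 'a \<times> real \<Rightarrow> real" where "ut b p = (if p \<in> GT then pdt (ul b) p else 0)"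

text \<open>The bootstrap is run a second time: \<open>ut\<close> is a local solution with bounded
  source, hence locally Hoelder continuous in space. The source is \<alpha> times \<open>dF\<close>
  of the solution times the other component of \<open>ut\<close>, so it is Hoelder continuous too,
  and second space derivatives of \<open>ut\<close> follow.\<close>

lemma ut_smooth: "time_C1 GT (ul b) (ut b)" "par_smooth GT (ut b)"
proof -
  have cont_ut: "continuous_on GT (ut b)" for b
    using continuous_on_cong[OF refl, of GT "ut b" "pdt (ul b)"] pdt_cont[of b] by (simp add: ut_def)
  then show "time_C1 GT (ul b) (ut b)" using ul_smooth(2)[of b] unfolding time_C1_def by (auto simp: ut_def)
  define R where "R b p = (if p \<in> GT then react' b p else 0)" for b p
  have R: "continuous_on GT (R b)" for b
    using continuous_on_cong[OF refl, of GT "R b" "react' b"] react'_cont[of b] by (simp add: R_def)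
  have LS: "local_sol GT (ut b) (R b)" for b
    unfolding ut_def[abs_def] R_def[abs_def]
    by (rule local_sol_pdt[OF GT(1) ul_GT(1) ul_measurable react_measurable ul_GT(3,4) ul_smooth(2) react_time])
  have m: "ut b \<in> borel_measurable borel" "R b \<in> borel_measurable borel" for b
    unfolding ut_def[abs_def] R_def[abs_def]
    by (intro borel_measurable_continuous_on_if pdt_cont react'_cont continuous_on_const borel_open GT(1))+
  note bd = loc_bdd_continuous[OF GT(1) cont_ut] loc_bdd_continuous[OF GT(1) R]
  have uh: "loc_holder \<theta> GT (ut b)" for b
    by (rule local_sol_holder[OF GT(1,2) LS[of b] m bd th])
  have "loc_holder \<theta> GT (\<lambda>p. dF b (ul (\<not> b) p))" for b
  proof (rule loc_holder_comp[OF ul_GT(5) _ GT(1) L'0])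
    fix p q assume "p \<in> GT" "q \<in> GT"
    then show "\<bar>dF b (ul (\<not> b) p) - dF b (ul (\<not> b) q)\<bar> \<le> L' * \<bar>ul (\<not> b) p - ul (\<not> b) q\<bar>"
      using ul_c[of "snd p" "\<not> b" "fst p"] ul_c[of "snd q" "\<not> b" "fst q"] by (intro dFL) auto
  qed
  then have "loc_holder \<theta> GT (\<lambda>p. al b (fst p) * (dF b (ul (\<not> b) p) * ut (\<not> b) p))"
    by (intro loc_holder_mult loc_holder_space[OF alh] uh loc_bdd_continuous[OF GT(1)] continuous_on_mult al_cont dF_ul_cont cont_ut)
  then have Rh: "loc_holder \<theta> GT (R b)"
    by (rule loc_holder_cong[OF _ GT(1)]) (auto simp: R_def react'_def ut_def)
  show "par_smooth GT (ut b)"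
    by (rule local_sol_smooth[OF GT(1,2) LS m bd th R Rh])
qed

lemma ul_C21: "C21_on \<Omega> T (\<lambda>x t. ul b (x, t))"
  by (rule C21_onI[OF open\<Omega> ul_smooth(1,2)])

lemma ul_equation:
  assumes "x \<in> \<Omega>" "t \<in> {0<..<T}"
  shows "deriv (\<lambda>s. ul b (x, s)) t - laplacian (\<lambda>y. ul b (y, t)) x = al b x * F b (ul (\<not> b) (x, t))"
  using ul_smooth(3)[of "(x, t)" b] laplacian_slice[OF GT(1) ul_smooth(1), of x t b] assms
  by (simp add: pdt_def react_def)

lemma ul_C1_curve: "C1_curve_in_Ck {0<..<T} 2 \<Omega> (\<lambda>t x. (ul b (x, t), ul b' (x, t)))"
  by (rule C1_curve_in_C2_I[OF open\<Omega> ul_smooth(1) ut_smooth ul_smooth(1) ut_smooth])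

end

section \<open>Exterior paraboloids, extension of the coefficients, and local Lipschitz
  bounds\<close>

lemma differentiable_lipschitz_at:
  fixes f :: "'a::real_normed_vector \<Rightarrow> real"
  assumes "f differentiable (at x)"
  shows "\<exists>r>0. \<exists>K\<ge>0. \<forall>y\<in>ball x r. \<bar>f y - f x\<bar> \<le> K * norm (y - x)"
proof -
  obtain f' where f': "(f has_derivative f') (at x)" using assms unfolding differentiable_def by blast
  then obtain r where r: "r > 0" "\<And>y. norm (y - x) < r \<Longrightarrow> norm (f y - f x - f' (y - x)) \<le> 1 * norm (y - x)"
    and bl: "bounded_linear f'"
    unfolding has_derivative_at_alt by (meson zero_less_one)
  obtain K where K: "0 \<le> K" "\<And>z. norm (f' z) \<le> norm z * K" using bounded_linear.nonneg_bounded[OF bl] by blast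
  have "\<bar>f y - f x\<bar> \<le> (1 + K) * norm (y - x)" if "y \<in> ball x r" for y
    using r(2)[of y] K(2)[of "y - x"] that by (auto simp: dist_norm norm_minus_commute algebra_simps)
  then show ?thesis using r(1) K(1) by (intro exI[of _ r] conjI exI[of _ "1 + K"]) auto
qed

text \<open>A quadratic Taylor bound at one point: the first partials are differentiable at
  \<open>q\<close>, hence Lipschitz relative to their values there, and the mean value theorem on
  the segment from \<open>q\<close> does the rest.\<close>

lemma Ck_on_quadratic:
  fixes \<gamma> :: "'a::euclidean_space \<Rightarrow> real"
  assumes g: "Ck_on 2 UNIV \<gamma>"
  obtains r C a where "0 < r" "0 < C" "\<And>z. norm z < r \<Longrightarrow> \<bar>\<gamma> (q + z) - \<gamma> q - a \<bullet> z\<bar> \<le> C * (norm z)\<^sup>2"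
proof -
  have lin: "(\<gamma> has_derivative (\<lambda>z. \<Sum>i\<in>Basis. (z \<bullet> i) * partial i \<gamma> y)) (at y)" for y
  proof -
    have d: "(\<gamma> has_derivative frechet_derivative \<gamma> (at y)) (at y)"
      using Ck_on_has_derivative[OF g, of "[]" y] by (simp add: multi_indices_def partials_Nil)
    then have "linear (frechet_derivative \<gamma> (at y))" by (simp add: has_derivative_linear)
    then have "frechet_derivative \<gamma> (at y) z = (\<Sum>i\<in>Basis. (z \<bullet> i) * partial i \<gamma> y)" for z
      unfolding partial_def by (subst euclidean_representation[of z, symmetric]) (simp add: linear_sum linear_scale o_def)
    then have "frechet_derivative \<gamma> (at y) = (\<lambda>z. \<Sum>i\<in>Basis. (z \<bullet> i) * partial i \<gamma> y)" by (rule ext)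
    then show ?thesis using d by simp
  qed
  have "\<exists>r>0. \<exists>K\<ge>0. \<forall>y\<in>ball q r. \<bar>partial i \<gamma> y - partial i \<gamma> q\<bar> \<le> K * norm (y - q)" if "i \<in> Basis" for i
  proof (rule differentiable_lipschitz_at)
    have "[i] \<in> multi_indices 2" using that by (simp add: multi_indices_def)
    then have "partials [i] \<gamma> differentiable at q" using g unfolding Ck_on_def by fastforce
    then show "partial i \<gamma> differentiable at q" by (simp add: partials_def)
  qed
  then obtain R K where RK: "\<And>i. i \<in> Basis \<Longrightarrow> 0 < R i" "\<And>i. i \<in> Basis \<Longrightarrow> 0 \<le> K i"
    "\<And>i y. i \<in> Basis \<Longrightarrow> y \<in> ball q (R i) \<Longrightarrow> \<bar>partial i \<gamma> y - partial i \<gamma> q\<bar> \<le> K i * norm (y - q)" by metis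
  define r where "r = Min (R ` Basis)"
  define C where "C = (\<Sum>i\<in>(Basis::'a set). K i) + 1"
  define a where "a = (\<Sum>i\<in>Basis. partial i \<gamma> q *\<^sub>R i)"
  have r: "0 < r" "\<And>i. i \<in> Basis \<Longrightarrow> r \<le> R i" using RK(1) by (auto simp: r_def)
  have K0: "0 \<le> (\<Sum>i\<in>(Basis::'a set). K i)" using RK(2) by (intro sum_nonneg)
  show ?thesis
  proof (rule that[OF r(1), of C a])
    show "0 < C" using K0 by (simp add: C_def)
    fix z :: 'a assume z: "norm z < r"
    have "\<exists>\<xi>. 0 < \<xi> \<and> \<xi> < 1 \<and> \<gamma> (q + 1 *\<^sub>R z) - \<gamma> (q + 0 *\<^sub>R z) = (1 - 0) * (\<Sum>i\<in>Basis. (z \<bullet> i) * partial i \<gamma> (q + \<xi> *\<^sub>R z))"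
    proof (rule MVT2)
      fix s :: real
      have "((\<lambda>s. q + s *\<^sub>R z) has_derivative (\<lambda>h. h *\<^sub>R z)) (at s)" by (auto intro!: derivative_eq_intros)
      from diff_chain_at[OF this lin] have "((\<lambda>s. \<gamma> (q + s *\<^sub>R z)) has_derivative (\<lambda>h. \<Sum>i\<in>Basis. ((h *\<^sub>R z) \<bullet> i) * partial i \<gamma> (q + s *\<^sub>R z))) (at s)"
        by (simp add: o_def)
      then show "((\<lambda>s. \<gamma> (q + s *\<^sub>R z)) has_real_derivative (\<Sum>i\<in>Basis. (z \<bullet> i) * partial i \<gamma> (q + s *\<^sub>R z))) (at s)"
        by (rule has_derivative_imp_has_field_derivative) (simp add: sum_distrib_left mult_ac)
    qed simp
    then obtain \<xi> where \<xi>: "0 < \<xi>" "\<xi> < 1" "\<gamma> (q + z) - \<gamma> q = (\<Sum>i\<in>Basis. (z \<bullet> i) * partial i \<gamma> (q + \<xi> *\<^sub>R z))" by auto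
    have \<xi>z: "norm (\<xi> *\<^sub>R z) \<le> norm z" using \<xi> by (simp add: mult_left_le_one_le)
    have "\<gamma> (q + z) - \<gamma> q - a \<bullet> z = (\<Sum>i\<in>Basis. (z \<bullet> i) * (partial i \<gamma> (q + \<xi> *\<^sub>R z) - partial i \<gamma> q))"
      unfolding \<xi>(3) a_def by (simp add: inner_sum_right inner_commute[of _ z] right_diff_distrib sum_subtractf mult.commute)
    then have "\<bar>\<gamma> (q + z) - \<gamma> q - a \<bullet> z\<bar> \<le> (\<Sum>i\<in>Basis. \<bar>(z \<bullet> i) * (partial i \<gamma> (q + \<xi> *\<^sub>R z) - partial i \<gamma> q)\<bar>)"
      by (simp only: sum_abs)
    also have "\<dots> \<le> (\<Sum>i\<in>(Basis::'a set). norm z * (K i * norm z))"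
    proof (rule sum_mono)
      fix i :: 'a assume i: "i \<in> Basis"
      have "q + \<xi> *\<^sub>R z \<in> ball q (R i)" using \<xi>z z r(2)[OF i] by (simp add: dist_norm)
      from RK(3)[OF i this] have "\<bar>partial i \<gamma> (q + \<xi> *\<^sub>R z) - partial i \<gamma> q\<bar> \<le> K i * norm (\<xi> *\<^sub>R z)" by simp
      also have "\<dots> \<le> K i * norm z" using \<xi>z RK(2)[OF i] by (intro mult_left_mono)
      finally show "\<bar>(z \<bullet> i) * (partial i \<gamma> (q + \<xi> *\<^sub>R z) - partial i \<gamma> q)\<bar> \<le> norm z * (K i * norm z)"
        unfolding abs_mult using Basis_le_norm[OF i] by (intro mult_mono) auto
    qed
    also have "\<dots> = (\<Sum>i\<in>(Basis::'a set). K i) * (norm z)\<^sup>2"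
      unfolding sum_distrib_right by (intro sum.cong) (simp_all add: power2_eq_square)
    also have "\<dots> \<le> C * (norm z)\<^sup>2" unfolding C_def by (intro mult_right_mono) auto
    finally show "\<bar>\<gamma> (q + z) - \<gamma> q - a \<bullet> z\<bar> \<le> C * (norm z)\<^sup>2" .
  qed
qed

text \<open>An exterior paraboloid touches the closure of \<open>\<Omega>\<close> at \<open>p\<close>; \<open>\<nu>\<close> is a (non-normalised) inner normal.\<close>

lemma smooth_boundary_paraboloid:
  fixes \<Omega> :: "'a::euclidean_space set"
  assumes \<Omega>: "open \<Omega>" and sm: "smooth_boundary \<Omega>" and p: "p \<in> frontier \<Omega>"
  shows "\<exists>r>0. \<exists>C>0. \<exists>\<nu>. 1 \<le> norm \<nu> \<and> (\<forall>x\<in>closure \<Omega> \<inter> ball p r. - C * (norm (x - p))\<^sup>2 \<le> (x - p) \<bullet> \<nu>)"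
proof -
  obtain r e and \<gamma> :: "'a \<Rightarrow> real" where r: "r > 0" and e: "norm e = 1" and g: "Ck_on 2 UNIV \<gamma>"
    and gr: "\<Omega> \<inter> ball p r = {x \<in> ball p r. \<gamma> (x - (x \<bullet> e) *\<^sub>R e) < x \<bullet> e}"
    using bspec[OF sm[unfolded smooth_boundary_def] p] by blast
  define \<pi> where "\<pi> x = x - (x \<bullet> e) *\<^sub>R e" for x
  define h where "h x = x \<bullet> e - \<gamma> (\<pi> x)" for x
  have "[] \<in> multi_indices 2" by (simp add: multi_indices_def)
  then have "continuous_on UNIV (partials [] \<gamma>)" using g unfolding Ck_on_def by blast
  then have "continuous_on UNIV \<gamma>" by (simp add: partials_Nil)
  moreover have "continuous_on UNIV \<pi>" unfolding \<pi>_def by (intro continuous_intros)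
  ultimately have "continuous_on UNIV (\<lambda>x. \<gamma> (\<pi> x))" by (rule continuous_on_compose2) auto
  then have hc: "continuous_on UNIV h" unfolding h_def by (intro continuous_intros)
  have h0: "0 \<le> h x" if "x \<in> closure \<Omega>" "x \<in> ball p r" for x
  proof -
    have "x \<in> closure (\<Omega> \<inter> ball p r)" using that open_Int_closure_subset[OF open_ball, of p r \<Omega>] by (auto simp: Int_commute)
    moreover have "closure (\<Omega> \<inter> ball p r) \<subseteq> {x. 0 \<le> h x}"
    proof (rule closure_minimal)
      show "closed {x. 0 \<le> h x}" by (intro closed_Collect_le continuous_on_const hc)
      show "\<Omega> \<inter> ball p r \<subseteq> {x. 0 \<le> h x}" unfolding gr h_def \<pi>_def by auto
    qed
    ultimately show ?thesis by blast
  qed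
  have pc: "p \<notin> \<Omega>" "p \<in> closure \<Omega>" using p \<Omega> by (auto simp: frontier_def interior_open)
  have pb: "p \<in> ball p r" using r by simp
  have "p \<notin> {x \<in> ball p r. \<gamma> (x - (x \<bullet> e) *\<^sub>R e) < x \<bullet> e}" unfolding gr[symmetric] using pc(1) by blast
  then have "h p \<le> 0" using pb by (simp add: h_def \<pi>_def)
  then have hp: "h p = 0" using h0[OF pc(2) pb] by simp
  obtain r' C a where C: "0 < r'" "0 < C" "\<And>z. norm z < r' \<Longrightarrow> \<bar>\<gamma> (\<pi> p + z) - \<gamma> (\<pi> p) - a \<bullet> z\<bar> \<le> C * (norm z)\<^sup>2"
    using Ck_on_quadratic[OF g, of "\<pi> p"] by metis
  \<comment> \<open>The gradient at \<open>p\<close> of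
    \<open>h x = x \<bullet> e - \<gamma> (\<pi> x)\<close>: the vector \<open>a\<close> enters
    through its part orthogonal to \<open>e\<close>. Hence \<open>\<nu> \<bullet> e = 1\<close> and
    the norm is at least 1.\<close>
  define \<nu> where "\<nu> = e - (a - (a \<bullet> e) *\<^sub>R e)"
  have ee: "e \<bullet> e = 1" using e by (simp add: dot_square_norm)
  have "\<nu> \<bullet> e = 1" by (simp add: \<nu>_def inner_diff_left ee)
  then have \<nu>: "1 \<le> norm \<nu>" using norm_cauchy_schwarz[of \<nu> e] e by simp
  \<comment> \<open>The factor 4 comes from \<open>norm z \<le> 2 * norm (x - p)\<close>,
    squared.\<close>
  have "- (4 * C) * (norm (x - p))\<^sup>2 \<le> (x - p) \<bullet> \<nu>" if x: "x \<in> closure \<Omega>" "x \<in> ball p (min r (r' / 2))" for x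
  proof -
    define z where "z = \<pi> x - \<pi> p"
    have z: "z = (x - p) - ((x - p) \<bullet> e) *\<^sub>R e" by (simp add: z_def \<pi>_def inner_diff_left algebra_simps)
    have "norm z \<le> norm (x - p) + \<bar>(x - p) \<bullet> e\<bar>" unfolding z by (rule order_trans[OF norm_triangle_ineq4]) (simp add: e)
    also have "\<bar>(x - p) \<bullet> e\<bar> \<le> norm (x - p)" using Cauchy_Schwarz_ineq2[of "x - p" e] e by simp
    finally have nz: "norm z \<le> 2 * norm (x - p)" by simp
    have "norm z < r'" using nz x(2) by (simp add: dist_norm norm_minus_commute)
    from C(3)[OF this] have "a \<bullet> z - C * (norm z)\<^sup>2 \<le> \<gamma> (\<pi> x) - \<gamma> (\<pi> p)" by (simp add: z_def)
    moreover have "\<gamma> (\<pi> x) - \<gamma> (\<pi> p) \<le> (x - p) \<bullet> e" using h0[OF x(1)] x(2) hp by (simp add: h_def inner_diff_left)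
    moreover have "(x - p) \<bullet> \<nu> = (x - p) \<bullet> e - a \<bullet> z"
      unfolding z \<nu>_def by (simp add: inner_diff_right inner_commute algebra_simps)
    moreover have "(norm z)\<^sup>2 \<le> (2 * norm (x - p))\<^sup>2" using nz by (intro power_mono) auto
    then have "C * (norm z)\<^sup>2 \<le> C * (4 * (norm (x - p))\<^sup>2)" using C(2) by (simp add: power_mult_distrib)
    ultimately show ?thesis by (simp add: mult_ac)
  qed
  then show ?thesis using C r \<nu> by (intro exI[of _ "min r (r' / 2)"] exI[of _ "4 * C"] exI[of _ \<nu>] conjI) auto
qed

text \<open>A fraction in \<open>[0, 1]\<close> is at most its power with exponent \<theta>; apply
  this to the two shares of \<open>s + t\<close>, which sum to 1. It makes
  \<open>norm (x - y) powr \<theta>\<close> obey the triangle inequality.\<close>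

lemma powr_subadditive:
  fixes s t \<theta> :: real
  assumes "0 \<le> s" "0 \<le> t" "0 < \<theta>" "\<theta> \<le> 1"
  shows "(s + t) powr \<theta> \<le> s powr \<theta> + t powr \<theta>"
proof (cases "s + t = 0")
  case False
  have 1: "a / (s + t) \<le> a powr \<theta> / (s + t) powr \<theta>" if "0 \<le> a" "a \<le> s + t" for a
  proof -
    have "a / (s + t) \<le> (a / (s + t)) powr \<theta>"
      using that False assms powr_mono'[of \<theta> 1 "a / (s + t)"] by (cases "a = 0") auto
    then show ?thesis using that False assms by (simp add: powr_divide)
  qed
  have "1 = s / (s + t) + t / (s + t)" using False by (simp add: add_divide_distrib[symmetric])
  also have "\<dots> \<le> (s powr \<theta> + t powr \<theta>) / (s + t) powr \<theta>"
    unfolding add_divide_distrib using 1[of s] 1[of t] assms by (intro add_mono) auto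
  finally show ?thesis using False assms by (simp add: pos_le_divide_eq)
qed (use assms in \<open>simp add: add_nonneg_eq_0_iff\<close>)

text \<open>McShane's extension by an infimum, capped at an upper bound of \<open>a\<close>. The
  exponent may be lowered on the bounded set, so that two coefficients can share one.\<close>

lemma holder_extension:
  fixes a :: "'a::euclidean_space \<Rightarrow> real"
  assumes h: "\<And>x y. x \<in> S \<Longrightarrow> y \<in> S \<Longrightarrow> \<bar>a x - a y\<bar> \<le> C * dist x y powr \<theta>0" and S: "bounded S" "S \<noteq> {}"
    and pos: "\<And>x. x \<in> S \<Longrightarrow> 0 \<le> a x" and th: "0 < \<theta>" "\<theta> \<le> \<theta>0" "\<theta> \<le> 1"
  shows "\<exists>a' A M. (\<forall>x\<in>S. a' x = a x) \<and> (\<forall>x. 0 \<le> a' x \<and> a' x \<le> M) \<and> (\<forall>x y. \<bar>a' x - a' y\<bar> \<le> A * norm (x - y) powr \<theta>)"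
proof -
  obtain d where d: "0 < d" "\<And>x y. x \<in> S \<Longrightarrow> y \<in> S \<Longrightarrow> dist x y \<le> d"
    using S(1) unfolding bounded_two_points by (metis dual_order.trans linorder_not_less zero_less_one nle_le)
  \<comment> \<open>The power of the diameter bound \<open>d\<close> converts the exponent \<theta>0
    into the smaller \<theta>.\<close>
  define A where "A = \<bar>C\<bar> * d powr (\<theta>0 - \<theta>)"
  have A0: "0 \<le> A" by (simp add: A_def)
  have hA: "\<bar>a x - a y\<bar> \<le> A * norm (x - y) powr \<theta>" if "x \<in> S" "y \<in> S" for x y
  proof -
    have "dist x y powr \<theta>0 = dist x y powr (\<theta>0 - \<theta>) * dist x y powr \<theta>" using th by (simp flip: powr_add)
    also have "\<dots> \<le> d powr (\<theta>0 - \<theta>) * dist x y powr \<theta>" using d(2)[OF that] th by (intro mult_right_mono powr_mono2) auto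
    finally have "\<bar>C\<bar> * dist x y powr \<theta>0 \<le> A * dist x y powr \<theta>" unfolding A_def mult.assoc by (rule mult_left_mono) simp
    moreover have "C * dist x y powr \<theta>0 \<le> \<bar>C\<bar> * dist x y powr \<theta>0" by (intro mult_right_mono) auto
    ultimately show ?thesis using h[OF that] by (simp add: dist_norm)
  qed
  obtain x1 where x1: "x1 \<in> S" using S(2) by blast
  define M where "M = a x1 + A * d powr \<theta>"
  have aM: "a x \<le> M" if "x \<in> S" for x
  proof -
    have "A * norm (x - x1) powr \<theta> \<le> A * d powr \<theta>" using d(2)[OF that x1] th A0 by (intro mult_left_mono powr_mono2) (auto simp: dist_norm)
    then show ?thesis using hA[OF that x1] by (simp add: M_def)
  qed
  have M0: "0 \<le> M" using aM[OF x1] pos[OF x1] by simp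
  define m where "m x = (INF y\<in>S. a y + A * norm (x - y) powr \<theta>)" for x
  have bb: "bdd_below ((\<lambda>y. a y + A * norm (x - y) powr \<theta>) ` S)" for x
    using pos A0 by (intro bdd_belowI2[of _ 0]) (simp add: add_nonneg_nonneg)
  have m0: "0 \<le> m x" for x unfolding m_def by (rule cINF_greatest[OF S(2)]) (simp add: pos A0 add_nonneg_nonneg)
  have mS: "m x = a x" if "x \<in> S" for x
  proof (rule antisym)
    show "m x \<le> a x" unfolding m_def using cINF_lower[OF bb that, of x] th by simp
    show "a x \<le> m x" unfolding m_def
    proof (rule cINF_greatest[OF S(2)])
      fix y assume "y \<in> S"
      from hA[OF that this] show "a x \<le> a y + A * norm (x - y) powr \<theta>" by linarith
    qed
  qed
  have mle: "m x \<le> m x' + A * norm (x - x') powr \<theta>" for x x'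
  proof -
    have "m x - A * norm (x - x') powr \<theta> \<le> m x'"
      unfolding m_def[of x']
    proof (rule cINF_greatest[OF S(2)])
      fix y assume y: "y \<in> S"
      have "norm (x - y) powr \<theta> \<le> (norm (x - x') + norm (x' - y)) powr \<theta>"
        using th norm_triangle_ineq[of "x - x'" "x' - y"] by (intro powr_mono2) auto
      also have "\<dots> \<le> norm (x - x') powr \<theta> + norm (x' - y) powr \<theta>" using th by (intro powr_subadditive) auto
      finally have "A * norm (x - y) powr \<theta> \<le> A * norm (x - x') powr \<theta> + A * norm (x' - y) powr \<theta>"
        unfolding distrib_left[symmetric] using A0 by (rule mult_left_mono)
      moreover have "m x \<le> a y + A * norm (x - y) powr \<theta>" unfolding m_def by (rule cINF_lower[OF bb y])
      ultimately show "m x - A * norm (x - x') powr \<theta> \<le> a y + A * norm (x' - y) powr \<theta>" by linarith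
    qed
    then show ?thesis by simp
  qed
  show ?thesis
  proof (rule exI[of _ "\<lambda>x. min M (m x)"], rule exI[of _ A], rule exI[of _ M], intro conjI ballI allI)
    show "min M (m x) = a x" if "x \<in> S" for x using mS[OF that] aM[OF that] by simp
    show "0 \<le> min M (m x)" "min M (m x) \<le> M" for x using m0 M0 by auto
    show "\<bar>min M (m x) - min M (m y)\<bar> \<le> A * norm (x - y) powr \<theta>" for x y
      using mle[of x y] mle[of y x] unfolding norm_minus_commute[of y x] by (auto simp: min_def abs_le_iff)
  qed
qed

lemma C2_interval_lipschitz:
  assumes f: "C2_interval {0..<1} f" and c: "c < 1"
  obtains f' L L' where "0 \<le> L" "0 \<le> L'" "\<And>s. s \<in> {0..c} \<Longrightarrow> (f has_real_derivative f' s) (at s within {0..c})"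
    "\<And>s s'. s \<in> {0..c} \<Longrightarrow> s' \<in> {0..c} \<Longrightarrow> \<bar>f s - f s'\<bar> \<le> L * \<bar>s - s'\<bar>"
    "\<And>s s'. s \<in> {0..c} \<Longrightarrow> s' \<in> {0..c} \<Longrightarrow> \<bar>f' s - f' s'\<bar> \<le> L' * \<bar>s - s'\<bar>"
proof -
  obtain f' f'' where D: "\<And>s. s \<in> {0..<1} \<Longrightarrow> (f has_real_derivative f' s) (at s within {0..<1})"
    "\<And>s. s \<in> {0..<1} \<Longrightarrow> (f' has_real_derivative f'' s) (at s within {0..<1})" "continuous_on {0..<1} f''"
    using f unfolding C2_interval_def by blast
  have sub: "{0..c} \<subseteq> {0..<1}" using c by auto
  have D': "(f has_real_derivative f' s) (at s within {0..c})" "(f' has_real_derivative f'' s) (at s within {0..c})" if "s \<in> {0..c}" for s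
    using DERIV_subset[OF D(1) sub] DERIV_subset[OF D(2) sub] that sub by blast+
  have bnd: "\<exists>B. \<forall>s\<in>{0..c}. norm (h s) \<le> B" if "continuous_on {0..c} h" for h :: "real \<Rightarrow> real"
    using compact_imp_bounded[OF compact_continuous_image[OF that compact_Icc]] unfolding bounded_iff by auto
  have "continuous_on {0..c} f'" using D'(2) by (rule DERIV_continuous_on)
  then obtain B where B: "\<And>s. s \<in> {0..c} \<Longrightarrow> norm (f' s) \<le> B"
    using bnd by blast
  have "continuous_on {0..c} f''" using D(3) sub by (rule continuous_on_subset)
  then obtain B' where B': "\<And>s. s \<in> {0..c} \<Longrightarrow> norm (f'' s) \<le> B'"
    using bnd by blast
  show ?thesis
  proof (rule that[of "max 0 B" "max 0 B'" f'])
    fix s s' assume s: "s \<in> {0..c}" "s' \<in> {0..c}"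
    show "\<bar>f s - f s'\<bar> \<le> max 0 B * \<bar>s - s'\<bar>"
      using field_differentiable_bound[of "{0..c}" f f' "max 0 B", OF _ D'(1) _ s] B by (auto simp: le_max_iff_disj)
    show "\<bar>f' s - f' s'\<bar> \<le> max 0 B' * \<bar>s - s'\<bar>"
      using field_differentiable_bound[of "{0..c}" f' f'' "max 0 B'", OF _ D'(2) _ s] B' by (auto simp: le_max_iff_disj)
  qed (use D' in auto)
qed

section \<open>Comparison of classical solutions\<close>

lemma C21_heat_at:
  fixes \<Omega> :: "'a::euclidean_space set"
  assumes \<Omega>: "open \<Omega>" and u: "C21_on \<Omega> T u" and x: "x \<in> \<Omega>" and t: "t \<in> {0<..<T}"
  shows "heat_at u x t (deriv (\<lambda>s. u x s) t - laplacian (\<lambda>y. u y t) x)"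
  unfolding heat_at_def
proof (intro exI[of _ "deriv (\<lambda>s. u x s) t"] exI[of _ "\<lambda>i. partials [i, i] (\<lambda>y. u y t) x"]
    exI[of _ "\<lambda>i s. partial i (\<lambda>y. u y t) (x + s *\<^sub>R i)"] conjI ballI)
  show "((\<lambda>s. u x s) has_real_derivative deriv (\<lambda>s. u x s) t) (at t)"
    using u x t unfolding C21_on_def by (blast intro: field_differentiable_derivI)
  have k: "Ck_on 2 \<Omega> (\<lambda>y. u y t)" using u t unfolding C21_on_def by blast
  have line: "((\<lambda>r. partials is (\<lambda>y. u y t) (x + r *\<^sub>R i)) has_real_derivative partials (i # is) (\<lambda>y. u y t) (x + s *\<^sub>R i)) (at s)"
    if "is \<in> multi_indices 2" "length is < 2" "x + s *\<^sub>R i \<in> \<Omega>" for "is" i s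
  proof -
    note d = Ck_on_has_derivative[OF k that]
    have "((\<lambda>r. x + r *\<^sub>R i) has_derivative (\<lambda>h. h *\<^sub>R i)) (at s)" by (auto intro!: derivative_eq_intros)
    from diff_chain_at[OF this d, unfolded o_def] show ?thesis
      by (rule has_derivative_imp_has_field_derivative)
        (simp add: partials_Cons partial_def linear_scale[OF has_derivative_linear[OF d]])
  qed
  fix i :: 'a assume i: "i \<in> Basis"
  have "((\<lambda>s. x + s *\<^sub>R i) \<longlongrightarrow> x + 0 *\<^sub>R i) (nhds 0)" by (intro tendsto_intros filterlim_ident)
  then have "\<forall>\<^sub>F s in nhds 0. x + s *\<^sub>R i \<in> \<Omega>" using topological_tendstoD[OF _ \<Omega>] x by fastforce
  then show "\<forall>\<^sub>F s in nhds 0. ((\<lambda>r. u (x + r *\<^sub>R i) t) has_real_derivative partial i (\<lambda>y. u y t) (x + s *\<^sub>R i)) (at s)"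
    by eventually_elim (use line[of "[]"] in \<open>auto simp: multi_indices_def partials_def\<close>)
  show "((\<lambda>s. partial i (\<lambda>y. u y t) (x + s *\<^sub>R i)) has_real_derivative partials [i, i] (\<lambda>y. u y t) x) (at 0)"
    using line[of "[i]" 0 i] i x by (auto simp: multi_indices_def partials_def)
qed (simp add: laplacian_def)

lemma compact_values_lt_1:
  fixes u :: "'a::euclidean_space \<Rightarrow> real \<Rightarrow> real"
  assumes S: "compact S" and c: "continuous_on (S \<times> {0..<T}) (\<lambda>(x, t). u x t)"
    and r: "\<And>x t. x \<in> S \<Longrightarrow> t \<in> {0..<T} \<Longrightarrow> u x t < 1" and t: "T' < T"
  shows "\<exists>c. 0 < c \<and> c < 1 \<and> (\<forall>x\<in>S. \<forall>t\<in>{0..<T'}. u x t \<le> c)"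
proof (cases "S \<times> {0..T'} = {}")
  case False
  have "compact (S \<times> {0..T'})" by (intro compact_Times S compact_Icc)
  moreover have "continuous_on (S \<times> {0..T'}) (\<lambda>(x, t). u x t)" by (rule continuous_on_subset[OF c]) (use t in auto)
  ultimately obtain q where q: "q \<in> S \<times> {0..T'}" "\<And>p. p \<in> S \<times> {0..T'} \<Longrightarrow> (\<lambda>(x, t). u x t) p \<le> (\<lambda>(x, t). u x t) q"
    using continuous_attains_sup[OF _ False] by metis
  have "(\<lambda>(x, t). u x t) q < 1" using r q(1) t by auto
  then show ?thesis using q(2) by (intro exI[of _ "max (1 / 2) ((\<lambda>(x, t). u x t) q)"]) (auto simp: le_max_iff_disj)
qed (auto intro!: exI[of _ "1 / 2"])

text \<open>The nonlinearities need not be Lipschitz up to 1. On a shorter time interval compactness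
  keeps both solutions below some \<open>c < 1\<close>, and there the maximum principle for the
  cooperative system applies.\<close>

lemma classical_comparison:
  fixes u u' :: "bool \<Rightarrow> 'a::euclidean_space \<Rightarrow> real \<Rightarrow> real"
  assumes \<Omega>: "open \<Omega>" "bounded \<Omega>"
    and C: "\<And>b. C21_on \<Omega> T (u b)" "\<And>b. C21_on \<Omega> T (u' b)"
    and cont: "\<And>b. continuous_on (closure \<Omega> \<times> {0..<T}) (\<lambda>(x, t). u b x t)" "\<And>b. continuous_on (closure \<Omega> \<times> {0..<T}) (\<lambda>(x, t). u' b x t)"
    and range: "\<And>b x t. x \<in> closure \<Omega> \<Longrightarrow> t \<in> {0..<T} \<Longrightarrow> u b x t \<in> {0..<1} \<and> u' b x t \<in> {0..<1}"
    and eq: "\<And>b x t. x \<in> \<Omega> \<Longrightarrow> t \<in> {0<..<T} \<Longrightarrow>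
      deriv (\<lambda>s. u b x s) t - laplacian (\<lambda>y. u b y t) x = al b x * f b (u (\<not> b) x t) \<and>
      deriv (\<lambda>s. u' b x s) t - laplacian (\<lambda>y. u' b y t) x = al b x * f b (u' (\<not> b) x t)"
    and lat: "\<And>b x t. x \<in> frontier \<Omega> \<Longrightarrow> t \<in> {0<..<T} \<Longrightarrow> u b x t = u' b x t"
    and init: "\<And>b x. x \<in> \<Omega> \<Longrightarrow> u b x 0 = u' b x 0"
    and al: "\<And>b x. x \<in> \<Omega> \<Longrightarrow> 0 \<le> al b x \<and> al b x \<le> M"
    and mono: "\<And>b. strict_mono_on {0..<1} (f b)"
    and lip: "\<And>b c. c < 1 \<Longrightarrow> \<exists>K\<ge>0. \<forall>s\<in>{0..c}. \<forall>s'\<in>{0..c}. \<bar>f b s - f b s'\<bar> \<le> K * \<bar>s - s'\<bar>"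
    and x: "x \<in> closure \<Omega>" "t \<in> {0..<T}"
  shows "u b x t \<le> u' b x t"
proof -
  \<comment> \<open>Halfway between the time in question and \<open>T\<close>, so that the closed
    interval up to \<open>T'\<close> lies in the common domain.\<close>
  define T' where "T' = (t + T) / 2"
  have T': "t < T'" "T' < T" "0 < T'" using x(2) by (auto simp: T'_def)
  have cs: "compact (closure \<Omega>)" using \<Omega>(2) by (simp add: compact_closure)
  have "\<exists>c<1. \<forall>b. \<forall>x\<in>closure \<Omega>. \<forall>t\<in>{0..<T'}. u b x t \<le> c \<and> u' b x t \<le> c"
  proof -
    have "\<exists>c. 0 < c \<and> c < 1 \<and> (\<forall>x\<in>closure \<Omega>. \<forall>t\<in>{0..<T'}. u b x t \<le> c)" "\<exists>c. 0 < c \<and> c < 1 \<and> (\<forall>x\<in>closure \<Omega>. \<forall>t\<in>{0..<T'}. u' b x t \<le> c)" for b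
      by (rule compact_values_lt_1[OF cs cont(1) _ T'(2)], use range in auto)
        (rule compact_values_lt_1[OF cs cont(2) _ T'(2)], use range in auto)
    then obtain c1 c2 where c: "\<And>b. c1 b < (1::real)" "\<And>b. c2 b < (1::real)" "\<And>b x t. x \<in> closure \<Omega> \<Longrightarrow> t \<in> {0..<T'} \<Longrightarrow> u b x t \<le> c1 b"
      "\<And>b x t. x \<in> closure \<Omega> \<Longrightarrow> t \<in> {0..<T'} \<Longrightarrow> u' b x t \<le> c2 b" by metis
    let ?m = "max (max (c1 True) (c1 False)) (max (c2 True) (c2 False))"
    have m: "c1 b \<le> ?m" "c2 b \<le> ?m" for b by (cases b; simp)+
    show ?thesis
    proof (intro exI[of _ ?m] conjI allI ballI)
      show "?m < 1" using c(1,2) by simp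
      show "u b x t \<le> ?m" "u' b x t \<le> ?m" if "x \<in> closure \<Omega>" "t \<in> {0..<T'}" for b x t
        by (rule order_trans[OF c(3)[OF that] m(1)], rule order_trans[OF c(4)[OF that] m(2)])
    qed
  qed
  then obtain c where c: "c < 1" "\<And>b x t. x \<in> closure \<Omega> \<Longrightarrow> t \<in> {0..<T'} \<Longrightarrow> u b x t \<le> c \<and> u' b x t \<le> c" by blast
  obtain K where K: "\<And>b. 0 \<le> K b" "\<And>b s s'. s \<in> {0..c} \<Longrightarrow> s' \<in> {0..c} \<Longrightarrow> \<bar>f b s - f b s'\<bar> \<le> K b * \<bar>s - s'\<bar>" using lip[OF c(1)] by metis
  define L where "L = max (K True) (K False)"
  have L: "K b \<le> L" "0 \<le> L" for b using K(1)[of True] by (cases b; simp add: L_def)+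
  have M: "0 \<le> M" if "x \<in> \<Omega>" for x using al[OF that] order_trans by blast
  \<comment> \<open>The initial values are prescribed in \<Omega> only; continuity carries them to
    the closure.\<close>
  have t0: "u b x 0 = u' b x 0" if "x \<in> closure \<Omega>" for b x
  proof -
    have l: "continuous_on (closure \<Omega>) (\<lambda>x. (x, 0::real))" "(\<lambda>x. (x, 0)) ` closure \<Omega> \<subseteq> closure \<Omega> \<times> {0..<T}"
      using x(2) by (auto intro!: continuous_intros)
    have "continuous_on (closure \<Omega>) (\<lambda>x. u b x 0 - u' b x 0)"
      using continuous_on_compose2[OF cont(1)[of b] l] continuous_on_compose2[OF cont(2)[of b] l] by (simp add: continuous_on_diff)
    then have "u b x 0 - u' b x 0 = 0" by (rule continuous_constant_on_closure) (use init that in auto)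
    then show ?thesis by simp
  qed
  have "u b x t - u' b x t \<le> 0"
  proof (rule parabolic_maximum_principle[where w = "\<lambda>b x t. u b x t - u' b x t" and D = \<Omega> and T = T' and B = 1 and L = "M * L"])
    show "continuous_on (closure \<Omega> \<times> {0..<T'}) (\<lambda>(x, t). u b x t - u' b x t)" for b
    proof -
      have "continuous_on (closure \<Omega> \<times> {0..<T'}) (\<lambda>(x, t). u b x t)" "continuous_on (closure \<Omega> \<times> {0..<T'}) (\<lambda>(x, t). u' b x t)"
        by (rule continuous_on_subset[OF cont(1)] continuous_on_subset[OF cont(2)], use T' in force)+
      then show ?thesis unfolding case_prod_unfold by (rule continuous_on_diff)
    qed
    show "u b x t - u' b x t \<le> 1" if "x \<in> closure \<Omega>" "t \<in> {0..<T'}" for b x t using range[of x t b] that T' by auto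
    show "u b x 0 - u' b x 0 \<le> 0" if "x \<in> closure \<Omega>" for b x using t0[OF that] by simp
    show "u b x t - u' b x t \<le> 0" if "x \<in> frontier \<Omega>" "t \<in> {0..<T'}" for b x t
      using t0[of x b] lat[of x t b] that T' by (cases "t = 0") (auto simp: frontier_def)
    show "\<exists>c. heat_at (\<lambda>x t. u b x t - u' b x t) x t c \<and> c \<le> M * L * (u b x t - u' b x t)"
      if x: "x \<in> \<Omega>" and t: "t \<in> {0<..<T'}" and w: "u b x t - u' b x t > 0" "u (\<not> b) x t - u' (\<not> b) x t \<le> u b x t - u' b x t" for b x t
    proof (intro exI conjI)
      have tT: "t \<in> {0<..<T}" "t \<in> {0..<T'}" "t \<in> {0..<T}" using t T' by auto
      have xc: "x \<in> closure \<Omega>" using x closure_subset by blast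
      show "heat_at (\<lambda>x t. u b x t - u' b x t) x t (al b x * f b (u (\<not> b) x t) - al b x * f b (u' (\<not> b) x t))"
      proof (rule heat_at_diff)
        have e: "deriv (\<lambda>s. u b x s) t - laplacian (\<lambda>y. u b y t) x = al b x * f b (u (\<not> b) x t)"
          "deriv (\<lambda>s. u' b x s) t - laplacian (\<lambda>y. u' b y t) x = al b x * f b (u' (\<not> b) x t)"
          using eq[OF x tT(1)] by blast+
        show "heat_at (u b) x t (al b x * f b (u (\<not> b) x t))" "heat_at (u' b) x t (al b x * f b (u' (\<not> b) x t))"
          using C21_heat_at[OF \<Omega>(1) C(1) x tT(1)] C21_heat_at[OF \<Omega>(1) C(2) x tT(1)] unfolding e[symmetric] by blast+
      qed
      have r: "u (\<not> b) x t \<in> {0..c}" "u' (\<not> b) x t \<in> {0..c}" using c(2)[OF xc tT(2), of "\<not> b"] range[OF xc tT(3), of "\<not> b"] by auto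
      show "al b x * f b (u (\<not> b) x t) - al b x * f b (u' (\<not> b) x t) \<le> M * L * (u b x t - u' b x t)"
      proof (rule reaction_increment[OF _ _ L(2) w])
        show "f b (u (\<not> b) x t) \<le> f b (u' (\<not> b) x t)" if "u (\<not> b) x t \<le> u' (\<not> b) x t"
          using r c(1) that by (intro monotone_onD[OF strict_mono_on_imp_mono_on[OF mono]]) auto
        show "\<bar>f b (u (\<not> b) x t) - f b (u' (\<not> b) x t)\<bar> \<le> L * \<bar>u (\<not> b) x t - u' (\<not> b) x t\<bar>"
          using K(2)[OF r, of b] mult_right_mono[OF L(1)[of b], of "\<bar>u (\<not> b) x t - u' (\<not> b) x t\<bar>"] by linarith
      qed (use al[OF x] in auto)
    qed
  qed (use \<Omega> x T' in auto)
  then show ?thesis by simp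
qed

lemma classical_solution_le:
  assumes \<Omega>: "open \<Omega>" "bounded \<Omega>"
    and s: "classical_solution \<Omega> \<alpha> \<beta> f g lam \<mu> u0 v0 T u v" "classical_solution \<Omega> \<alpha> \<beta> f g lam \<mu> u0 v0 T u' v'"
    and al: "\<And>x. x \<in> \<Omega> \<Longrightarrow> 0 \<le> lam * \<alpha> x \<and> lam * \<alpha> x \<le> M" "\<And>x. x \<in> \<Omega> \<Longrightarrow> 0 \<le> \<mu> * \<beta> x \<and> \<mu> * \<beta> x \<le> M"
    and f: "C2_interval {0..<1} f" "strict_mono_on {0..<1} f" and g: "C2_interval {0..<1} g" "strict_mono_on {0..<1} g"
    and x: "x \<in> closure \<Omega>" "t \<in> {0..<T}"
  shows "u x t \<le> u' x t" "v x t \<le> v' x t"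
proof -
  have "(if b then u else v) x t \<le> (if b then u' else v') x t" for b
  proof (rule classical_comparison[OF \<Omega>, where u = "\<lambda>b. if b then u else v" and u' = "\<lambda>b. if b then u' else v'" and al = "\<lambda>b x. if b then lam * \<alpha> x else \<mu> * \<beta> x" and f = "\<lambda>b. if b then f else g" and M = M])
    fix b and c :: real assume c: "c < 1"
    show "\<exists>K\<ge>0. \<forall>s\<in>{0..c}. \<forall>s'\<in>{0..c}. \<bar>(if b then f else g) s - (if b then f else g) s'\<bar> \<le> K * \<bar>s - s'\<bar>"
    proof (cases b)
      case True
      show ?thesis by (rule C2_interval_lipschitz[OF f(1) c]) (use True in auto)
    next
      case False
      show ?thesis by (rule C2_interval_lipschitz[OF g(1) c]) (use False in auto)
    qed
  next
    note s = s[unfolded classical_solution_def]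
    fix b
    show "C21_on \<Omega> T (if b then u else v)" "C21_on \<Omega> T (if b then u' else v')" using s by simp_all
    show "continuous_on (closure \<Omega> \<times> {0..<T}) (\<lambda>(x, t). (if b then u else v) x t)"
      "continuous_on (closure \<Omega> \<times> {0..<T}) (\<lambda>(x, t). (if b then u' else v') x t)" using s by (cases b; simp)+
    show "(if b then u else v) x t \<in> {0..<1} \<and> (if b then u' else v') x t \<in> {0..<1}" if "x \<in> closure \<Omega>" "t \<in> {0..<T}" for x t
      using s that by (cases b) simp_all
    show "deriv (\<lambda>s. (if b then u else v) x s) t - laplacian (\<lambda>y. (if b then u else v) y t) x =
        (if b then lam * \<alpha> x else \<mu> * \<beta> x) * (if b then f else g) ((if \<not> b then u else v) x t) \<and>
      deriv (\<lambda>s. (if b then u' else v') x s) t - laplacian (\<lambda>y. (if b then u' else v') y t) x =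
        (if b then lam * \<alpha> x else \<mu> * \<beta> x) * (if b then f else g) ((if \<not> b then u' else v') x t)"
      if "x \<in> \<Omega>" "t \<in> {0<..<T}" for x t
      using s that by (cases b) simp_all
    show "(if b then u else v) x t = (if b then u' else v') x t" if "x \<in> frontier \<Omega>" "t \<in> {0<..<T}" for x t
      using s that by (cases b) simp_all
    show "(if b then u else v) x 0 = (if b then u' else v') x 0" if "x \<in> \<Omega>" for x
      using s that by (cases b) simp_all
    show "0 \<le> (if b then lam * \<alpha> x else \<mu> * \<beta> x) \<and> (if b then lam * \<alpha> x else \<mu> * \<beta> x) \<le> M" if "x \<in> \<Omega>" for x
      using al[OF that] by simp
    show "strict_mono_on {0..<1} (if b then f else g)" using f(2) g(2) by simp
  qed (rule x)+
  from this[of True] this[of False] show "u x t \<le> u' x t" "v x t \<le> v' x t" by simp_all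
qed

section \<open>Truncation of the nonlinearities and assembly of the solution\<close>

lemma zero_extension_continuous:
  assumes "open \<Omega>" "continuous_on (closure \<Omega>) w" "\<forall>x\<in>frontier \<Omega>. w x = (0::real)"
  shows "continuous_on UNIV (\<lambda>x. if x \<in> \<Omega> then w x else 0)"
proof -
  have "continuous_on (closure \<Omega> \<union> - \<Omega>) (\<lambda>x. if x \<in> \<Omega> then w x else 0)"
    by (rule continuous_on_cases) (use assms in \<open>auto simp: frontier_def interior_open\<close>)
  moreover have "closure \<Omega> \<union> - \<Omega> = UNIV" using closure_subset[of \<Omega>] by auto
  ultimately show ?thesis by simp
qed

lemma sup_lt_1:
  assumes "compact S" "S \<noteq> {}" "continuous_on S w" "\<forall>x\<in>S. 0 \<le> w x \<and> w x < (1::real)"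
  shows "\<exists>m. 0 \<le> m \<and> m < 1 \<and> (\<forall>x\<in>S. w x \<le> m)"
  using continuous_attains_sup[OF assms(1,2,3)] assms(4) by blast

text \<open>Composition with the clamp onto \<open>[0, c]\<close>, which is monotone and has
  Lipschitz constant 1. The derivative is claimed within the interval only, where the clamp is the
  identity.\<close>

lemma truncation:
  assumes f: "C2_interval {0..<1} f" "\<forall>s\<in>{0..<1}. 0 < f s" "strict_mono_on {0..<1} f" and c: "0 < c" "c < (1::real)"
  shows "\<exists>F dF L L'. (\<forall>s\<in>{0..c}. F s = f s) \<and> (\<forall>s. 0 \<le> F s \<and> F s \<le> f c) \<and> (\<forall>s s'. \<bar>F s - F s'\<bar> \<le> L * \<bar>s - s'\<bar>) \<and>
    (\<forall>s s'. s \<le> s' \<longrightarrow> F s \<le> F s') \<and> (\<forall>s\<in>{0..c}. (F has_real_derivative dF s) (at s within {0..c})) \<and>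
    0 \<le> L' \<and> (\<forall>s\<in>{0..c}. \<forall>s'\<in>{0..c}. \<bar>dF s - dF s'\<bar> \<le> L' * \<bar>s - s'\<bar>)"
proof (rule C2_interval_lipschitz[OF f(1) c(2)])
  fix f' L L' assume L: "0 \<le> L" "0 \<le> L'" and d: "\<And>s. s \<in> {0..c} \<Longrightarrow> (f has_real_derivative f' s) (at s within {0..c})"
    and lip: "\<And>s s'. s \<in> {0..c} \<Longrightarrow> s' \<in> {0..c} \<Longrightarrow> \<bar>f s - f s'\<bar> \<le> L * \<bar>s - s'\<bar>"
    "\<And>s s'. s \<in> {0..c} \<Longrightarrow> s' \<in> {0..c} \<Longrightarrow> \<bar>f' s - f' s'\<bar> \<le> L' * \<bar>s - s'\<bar>"
  define k where "k s = max 0 (min c s)" for s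
  have k: "k s \<in> {0..c}" "s \<in> {0..c} \<Longrightarrow> k s = s" "\<bar>k s - k s'\<bar> \<le> \<bar>s - s'\<bar>" "s \<le> s' \<Longrightarrow> k s \<le> k s'" for s s'
    using c by (auto simp: k_def min_def max_def)
  have mono: "f s \<le> f s'" if "s \<in> {0..c}" "s' \<in> {0..c}" "s \<le> s'" for s s'
    using monotone_onD[OF strict_mono_on_imp_mono_on[OF f(3)] _ _ that(3)] that c by auto
  show ?thesis
  proof (rule exI[of _ "\<lambda>s. f (k s)"], rule exI[of _ f'], rule exI[of _ L], rule exI[of _ L'], intro conjI ballI allI impI L)
    show "f (k s) = f s" if "s \<in> {0..c}" for s using k(2)[OF that] by simp
    show "0 \<le> f (k s)" "f (k s) \<le> f c" for s using f(2) k(1)[of s] c mono[of "k s" c] by (auto intro: less_imp_le)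
    show "\<bar>f (k s) - f (k s')\<bar> \<le> L * \<bar>s - s'\<bar>" for s s'
      using lip(1)[OF k(1) k(1), of s s'] mult_left_mono[OF k(3)[of s s'] L(1)] by linarith
    show "f (k s) \<le> f (k s')" if "s \<le> s'" for s s' by (intro mono k that)
    show "((\<lambda>s. f (k s)) has_real_derivative f' s) (at s within {0..c})" if "s \<in> {0..c}" for s
      by (rule has_field_derivative_transform_within[OF d[OF that] zero_less_one that]) (simp add: k(2))
  qed (use lip in auto)
qed

theorem theoremB:
  fixes \<Omega> :: "'a::euclidean_space set"
    and \<alpha> \<beta> u0 v0 :: "'a \<Rightarrow> real"
    and f g :: "real \<Rightarrow> real"
    and lam \<mu> :: real
  assumes "smooth_bounded_domain \<Omega>"
    and "holder_continuous_on (closure \<Omega>) \<alpha>" "\<forall>x\<in>closure \<Omega>. 0 \<le> \<alpha> x" "\<exists>x\<in>closure \<Omega>. \<alpha> x \<noteq> 0"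
    and "holder_continuous_on (closure \<Omega>) \<beta>" "\<forall>x\<in>closure \<Omega>. 0 \<le> \<beta> x" "\<exists>x\<in>closure \<Omega>. \<beta> x \<noteq> 0"
    and "C2_interval {0..<1} f" "\<forall>s\<in>{0..<1}. 0 < f s"
        "strict_mono_on {0..<1} f" "strictly_convex_on {0..<1} f" "filterlim f at_top (at_left 1)"
    and "C2_interval {0..<1} g" "\<forall>s\<in>{0..<1}. 0 < g s"
        "strict_mono_on {0..<1} g" "strictly_convex_on {0..<1} g" "filterlim g at_top (at_left 1)"
    and "Ck_closure 2 \<Omega> u0" "\<forall>x\<in>closure \<Omega>. 0 \<le> u0 x \<and> u0 x < 1" "\<forall>x\<in>frontier \<Omega>. u0 x = 0"
    and "Ck_closure 2 \<Omega> v0" "\<forall>x\<in>closure \<Omega>. 0 \<le> v0 x \<and> v0 x < 1" "\<forall>x\<in>frontier \<Omega>. v0 x = 0"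
    and "0 < lam" "0 < \<mu>"
  shows "\<exists>T>0. \<exists>u v.
     classical_solution \<Omega> \<alpha> \<beta> f g lam \<mu> u0 v0 T u v \<and>
     (\<forall>u' v'. classical_solution \<Omega> \<alpha> \<beta> f g lam \<mu> u0 v0 T u' v' \<longrightarrow>
        (\<forall>x\<in>closure \<Omega>. \<forall>t\<in>{0..<T}. u' x t = u x t \<and> v' x t = v x t)) \<and>
     C1_curve_in_Ck {0<..<T} 2 \<Omega> (\<lambda>t x. (u x t, v x t))"
proof -
  note fh = assms(8-10) and gh = assms(13-15)
  have \<Omega>: "open \<Omega>" "bounded \<Omega>" "\<Omega> \<noteq> {}" "smooth_boundary \<Omega>" using assms(1) unfolding smooth_bounded_domain_def by auto
  have cl: "bounded (closure \<Omega>)" "closure \<Omega> \<noteq> {}" "compact (closure \<Omega>)"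
    using \<Omega> closure_subset[of \<Omega>] by (auto simp: bounded_closure compact_closure)
  have sub: "x \<in> closure \<Omega>" if "x \<in> \<Omega>" for x using that closure_subset by blast
  have frsub: "x \<in> closure \<Omega>" if "x \<in> frontier \<Omega>" for x using that by (simp add: frontier_def)

  obtain \<theta>1 C1 where h1: "0 < \<theta>1" "\<theta>1 \<le> 1" "\<And>x y. x \<in> closure \<Omega> \<Longrightarrow> y \<in> closure \<Omega> \<Longrightarrow> \<bar>\<alpha> x - \<alpha> y\<bar> \<le> C1 * dist x y powr \<theta>1"
    using assms(2) unfolding holder_continuous_on_def by blast
  obtain \<theta>2 C2 where h2: "0 < \<theta>2" "\<theta>2 \<le> 1" "\<And>x y. x \<in> closure \<Omega> \<Longrightarrow> y \<in> closure \<Omega> \<Longrightarrow> \<bar>\<beta> x - \<beta> y\<bar> \<le> C2 * dist x y powr \<theta>2"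
    using assms(5) unfolding holder_continuous_on_def by blast
  \<comment> \<open>Both coefficients are extended with one common exponent.\<close>
  define \<theta> where "\<theta> = min \<theta>1 \<theta>2"
  have th: "0 < \<theta>" "\<theta> \<le> \<theta>1" "\<theta> \<le> \<theta>2" "\<theta> \<le> 1" using h1 h2 by (auto simp: \<theta>_def)
  have scale: "\<bar>k * a - k * b\<bar> \<le> (k * C) * d" if "0 < k" "\<bar>a - b\<bar> \<le> C * d" for k a b C d :: real
    using mult_left_mono[OF that(2), of k] that(1) by (simp add: abs_mult mult.assoc flip: right_diff_distrib)
  have nn: "0 \<le> lam * \<alpha> x" "0 \<le> \<mu> * \<beta> x" if "x \<in> closure \<Omega>" for x using assms(3,6,24,25) that by simp_all
  obtain a1 A1 M1 where a1: "\<And>x. x \<in> closure \<Omega> \<Longrightarrow> a1 x = lam * \<alpha> x" "\<And>x. 0 \<le> a1 x" "\<And>x. a1 x \<le> M1"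
    "\<And>x y. \<bar>a1 x - a1 y\<bar> \<le> A1 * norm (x - y) powr \<theta>"
    using holder_extension[of "closure \<Omega>" "\<lambda>x. lam * \<alpha> x" "lam * C1" \<theta>1 \<theta>, OF scale[OF assms(24) h1(3)] cl(1,2) nn(1) th(1,2,4)] by metis
  obtain a2 A2 M2 where a2: "\<And>x. x \<in> closure \<Omega> \<Longrightarrow> a2 x = \<mu> * \<beta> x" "\<And>x. 0 \<le> a2 x" "\<And>x. a2 x \<le> M2"
    "\<And>x y. \<bar>a2 x - a2 y\<bar> \<le> A2 * norm (x - y) powr \<theta>"
    using holder_extension[of "closure \<Omega>" "\<lambda>x. \<mu> * \<beta> x" "\<mu> * C2" \<theta>2 \<theta>, OF scale[OF assms(25) h2(3)] cl(1,2) nn(2) th(1,3,4)] by metis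

  have cu: "continuous_on (closure \<Omega>) u0" and cv: "continuous_on (closure \<Omega>) v0" using assms(18,21) unfolding Ck_closure_def by auto
  obtain m1 where m1: "0 \<le> m1" "m1 < 1" "\<And>x. x \<in> closure \<Omega> \<Longrightarrow> u0 x \<le> m1" using sup_lt_1[OF cl(3,2) cu assms(19)] by blast
  obtain m2 where m2: "0 \<le> m2" "m2 < 1" "\<And>x. x \<in> closure \<Omega> \<Longrightarrow> v0 x \<le> m2" using sup_lt_1[OF cl(3,2) cv assms(22)] by blast
  define mm where "mm = max m1 m2"
  \<comment> \<open>Midway between the maximum of the data and the singular value 1, leaving room
    for growth during a short time.\<close>
  define c where "c = (1 + mm) / 2"
  have mm: "0 \<le> mm" "mm < 1" "0 < c" "c < 1" "mm < c" using m1 m2 by (auto simp: mm_def c_def)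

  obtain F dF L1 L1' where F: "\<And>s. s \<in> {0..c} \<Longrightarrow> F s = f s" "\<And>s. 0 \<le> F s" "\<And>s. F s \<le> f c" "\<And>s s'. \<bar>F s - F s'\<bar> \<le> L1 * \<bar>s - s'\<bar>"
    "\<And>s s'. s \<le> s' \<Longrightarrow> F s \<le> F s'" "\<And>s. s \<in> {0..c} \<Longrightarrow> (F has_real_derivative dF s) (at s within {0..c})" "0 \<le> L1'"
    "\<And>s s'. s \<in> {0..c} \<Longrightarrow> s' \<in> {0..c} \<Longrightarrow> \<bar>dF s - dF s'\<bar> \<le> L1' * \<bar>s - s'\<bar>"
    using truncation[OF fh mm(3,4)] by metis
  obtain G dG L2 L2' where G: "\<And>s. s \<in> {0..c} \<Longrightarrow> G s = g s" "\<And>s. 0 \<le> G s" "\<And>s. G s \<le> g c" "\<And>s s'. \<bar>G s - G s'\<bar> \<le> L2 * \<bar>s - s'\<bar>"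
    "\<And>s s'. s \<le> s' \<Longrightarrow> G s \<le> G s'" "\<And>s. s \<in> {0..c} \<Longrightarrow> (G has_real_derivative dG s) (at s within {0..c})" "0 \<le> L2'"
    "\<And>s s'. s \<in> {0..c} \<Longrightarrow> s' \<in> {0..c} \<Longrightarrow> \<bar>dG s - dG s'\<bar> \<le> L2' * \<bar>s - s'\<bar>"
    using truncation[OF gh mm(3,4)] by metis

  \<comment> \<open>One constant bounds coefficients and truncated nonlinearities, so each reaction
    term is at most \<open>M * M\<close>.\<close>
  define M where "M = max (max M1 M2) (max (f c) (g c))"
  have M: "M1 \<le> M" "M2 \<le> M" "f c \<le> M" "g c \<le> M" by (auto simp: M_def)
  \<comment> \<open>The time within which growth at the rate \<open>M * M\<close> stays within
    \<open>c - mm\<close>; the summand 1 keeps the denominator positive, and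
    \<open>T \<le> 1\<close> fits the window of the cut kernel.\<close>
  define T where "T = min 1 ((c - mm) / (M * M + 1))"
  have MM: "0 < M * M + 1" using zero_le_square[of M] by linarith
  have T: "0 < T" "T \<le> 1" using mm(5) MM by (auto simp: T_def)
  have "(M * M + 1) * T \<le> c - mm"
    using MM mult_left_mono[of T "(c - mm) / (M * M + 1)" "M * M + 1"] by (simp add: T_def)
  then have Tc: "mm + M * M * T \<le> c" using T by (simp add: distrib_right)
  have le: "0 \<le> r \<longrightarrow> B * r \<le> max B B' * r \<and> B' * r \<le> max B B' * r" for B B' r :: real by (auto intro: mult_right_mono)

  define al where "al b = (if b then a1 else a2)" for b
  \<comment> \<open>The extension by 0 is continuous because the data vanish on the
    boundary.\<close>
  define U0 where "U0 b x = (if x \<in> \<Omega> then (if b then u0 else v0) x else 0)" for b x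
  define FF where "FF b = (if b then F else G)" for b
  define dFF where "dFF b = (if b then dF else dG)" for b
  interpret D: dirichlet_smooth al U0 FF M "max A1 A2" "max L1 L2" \<theta> \<Omega> mm T c "max L1' L2'" dFF
  proof
    show "al b x \<le> M" "0 \<le> al b x" for b x using a1(2,3)[of x] a2(2,3)[of x] M by (auto simp: al_def intro: order_trans)
    show "\<bar>al b x - al b x'\<bar> \<le> max A1 A2 * norm (x - x') powr \<theta>" for b x x'
      using a1(4)[of x x'] a2(4)[of x x'] le[of "norm (x - x') powr \<theta>" A1 A2] by (cases b) (simp_all add: al_def)
    show "0 \<le> FF b s" "FF b s \<le> M" for b s using F(2,3)[of s] G(2,3)[of s] M by (auto simp: FF_def intro: order_trans)
    show "\<bar>FF b s - FF b s'\<bar> \<le> max L1 L2 * \<bar>s - s'\<bar>" for b s s'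
      using F(4)[of s s'] G(4)[of s s'] le[of "\<bar>s - s'\<bar>" L1 L2] by (cases b) (simp_all add: FF_def)
    show "s \<le> s' \<Longrightarrow> FF b s \<le> FF b s'" for b s s' using F(5) G(5) by (auto simp: FF_def)
    show "continuous_on UNIV (U0 b)" for b
      unfolding U0_def using zero_extension_continuous[OF \<Omega>(1) cu assms(20)] zero_extension_continuous[OF \<Omega>(1) cv assms(23)] by (cases b) auto
    show "0 \<le> U0 b x" "U0 b x \<le> mm" "U0 b x \<le> 1" for b x
      using assms(19,22) m1(3)[of x] m2(3)[of x] sub[of x] mm by (auto simp: U0_def mm_def le_max_iff_disj intro: less_imp_le)
    show "x \<notin> \<Omega> \<Longrightarrow> U0 b x = 0" for b x by (simp add: U0_def)
    show "\<exists>r>0. \<exists>C>0. \<exists>\<nu>. 1 \<le> norm \<nu> \<and> (\<forall>x\<in>closure \<Omega> \<inter> ball p r. - C * (norm (x - p))\<^sup>2 \<le> (x - p) \<bullet> \<nu>)" if "p \<in> frontier \<Omega>" for p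
      by (rule smooth_boundary_paraboloid[OF \<Omega>(1,4) that])
    show "\<bar>min 1 (infdist x (closure \<Omega>)) - min 1 (infdist x' (closure \<Omega>))\<bar> \<le> norm (x - x')" for x x'
      using infdist_triangle_abs[of x "closure \<Omega>" x'] by (auto simp: dist_norm)
    show "s \<in> {0..c} \<Longrightarrow> (FF b has_real_derivative dFF b s) (at s within {0..c})" for b s using F(6) G(6) by (simp add: FF_def dFF_def)
    show "\<bar>dFF b s - dFF b s'\<bar> \<le> max L1' L2' * \<bar>s - s'\<bar>" if "s \<in> {0..c}" "s' \<in> {0..c}" for b s s'
      using F(8)[OF that] G(8)[OF that] le[of "\<bar>s - s'\<bar>" L1' L2'] by (cases b) (simp_all add: dFF_def)
    show "0 \<le> max L1' L2'" using F(7) by simp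
  qed (use th T Tc \<Omega> in \<open>auto simp: infdist_nonneg\<close>)

  define u where "u x t = D.ul True (x, t)" for x t
  define v where "v x t = D.ul False (x, t)" for x t
  have range: "u x t \<in> {0..c}" "v x t \<in> {0..c}" if "t \<in> {0..<T}" for x t
    using D.ul_c[of t True x] D.ul_c[of t False x] that by (auto simp: u_def v_def)
  have sol: "classical_solution \<Omega> \<alpha> \<beta> f g lam \<mu> u0 v0 T u v"
    unfolding classical_solution_def
  proof (intro conjI ballI)
    show "C21_on \<Omega> T u" "C21_on \<Omega> T v" using D.ul_C21 by (simp_all add: u_def[abs_def] v_def[abs_def])
    have "continuous_on (closure \<Omega> \<times> {0..<T}) (D.ul b)" for b
      by (rule continuous_on_subset[OF D.ul_cont]) (use T in auto)
    from this[of True] this[of False]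
    show "continuous_on (closure \<Omega> \<times> {0..<T}) (\<lambda>(x, t). u x t)" "continuous_on (closure \<Omega> \<times> {0..<T}) (\<lambda>(x, t). v x t)"
      by (simp_all add: u_def v_def case_prod_unfold)
    show "u x t \<in> {0..<1}" "v x t \<in> {0..<1}" if "t \<in> {0..<T}" for x t using range[OF that, of x] mm(4) by auto
    show "deriv (\<lambda>s. u x s) t - laplacian (\<lambda>y. u y t) x = lam * \<alpha> x * f (v x t)"
      "deriv (\<lambda>s. v x s) t - laplacian (\<lambda>y. v y t) x = \<mu> * \<beta> x * g (u x t)" if "x \<in> \<Omega>" "t \<in> {0<..<T}" for x t
      using D.ul_equation[OF that, of True] D.ul_equation[OF that, of False] range[of t x] that F(1) G(1) a1(1)[OF sub] a2(1)[OF sub]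
      by (simp_all add: u_def v_def al_def FF_def)
    show "u x t = 0" "v x t = 0" if "x \<in> frontier \<Omega>" "t \<in> {0<..<T}" for x t
      using D.ul_frontier[OF that(1), of t] that(2) T by (simp_all add: u_def v_def)
    show "u x 0 = u0 x" "v x 0 = v0 x" if "x \<in> \<Omega>" for x using that by (simp_all add: u_def v_def D.ul_init U0_def)
  qed
  have al: "0 \<le> lam * \<alpha> x \<and> lam * \<alpha> x \<le> M" "0 \<le> \<mu> * \<beta> x \<and> \<mu> * \<beta> x \<le> M" if "x \<in> \<Omega>" for x
    using a1(2,3)[of x] a2(2,3)[of x] a1(1)[OF sub[OF that]] a2(1)[OF sub[OF that]] M by auto
  \<comment> \<open>Comparison is stated for an arbitrary pair of solutions, so that exchanging the
    two gives uniqueness.\<close>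
  have le: "u1 x t \<le> u2 x t" "v1 x t \<le> v2 x t"
    if "classical_solution \<Omega> \<alpha> \<beta> f g lam \<mu> u0 v0 T u1 v1" "classical_solution \<Omega> \<alpha> \<beta> f g lam \<mu> u0 v0 T u2 v2" "x \<in> closure \<Omega>" "t \<in> {0..<T}"
    for u1 v1 u2 v2 x t
    by (rule classical_solution_le[OF \<Omega>(1,2) that(1,2) _ _ fh(1,3) gh(1,3) that(3,4)]; rule al; assumption)+
  have "u' x t = u x t \<and> v' x t = v x t"
    if "classical_solution \<Omega> \<alpha> \<beta> f g lam \<mu> u0 v0 T u' v'" "x \<in> closure \<Omega>" "t \<in> {0..<T}" for u' v' x t
    using le[OF sol that] le[OF that(1) sol that(2,3)] by (auto intro: antisym)
  moreover have "C1_curve_in_Ck {0<..<T} 2 \<Omega> (\<lambda>t x. (u x t, v x t))"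
    using D.ul_C1_curve[of True False] by (simp add: u_def v_def)
  ultimately show ?thesis using T(1) sol by blast
qed

end
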